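(* Let $n\ge 1$, let $\theta(T)=\sum_{\mathbf n\in\mathbb Z^n}e^{\pi i\,\mathbf n^tT\mathbf n}$ be the Riemann Thetanullwert on the Siegel upper half plane $\mathfrak H_n$, and regard it as a superfunction on $S\mathfrak H_n$ independent of the odd variables $\xi_1,\dots,\xi_n$. Fix a choice of $\sqrt{-4\pi i}$. Consider the system of equations on a superfunction $\Phi$: $$\mathbb D\Phi=0,\qquad e^{\sqrt{-4\pi i}\,D^{(1/2)}_{p_\nu}}\Phi=\Phi,\qquad e^{\sqrt{-4\pi i}\,D^{(1/2)}_{q_\nu}}\Phi=\Phi,\qquad \nu=1,\dots,n.$$ (a) $\theta$ is a solution of this system. (b) Any holomorphic superfunction $\Phi$ defined over a nonempty connected open subset $U\subset\mathfrak H_n$ (i.e. $\Phi\in\mathcal O(U)\otimes\Lambda[\xi_1,\dots,\xi_n]$) and satisfying this system is a constant multiple of $\theta$ on $U$.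
   Context: $\mathfrak H_n$ is the set of complex symmetric $n\times n$ matrices $v=\|v_{ij}\|$ with positive definite imaginary part. The super Siegel plane $S\mathfrak H_n$ is the complex supermanifold with underlying manifold $\mathfrak H_n$ and structure sheaf $\mathcal O_{\mathfrak H_n}\otimes_{\mathbb C}\Lambda[\xi_1,\dots,\xi_n]$, the $\xi_i$ being odd. A function of $T$ alone is regarded as a function of $v$, i.e. $\theta(v)=\sum_{\mathbf n}e^{\pi i\,\mathbf n^tv\mathbf n}$. Put $\partial_{ij}=\partial_{ji}=\frac12\left(\frac{\partial}{\partial v_{ij}}+\frac{\partial}{\partial v_{ji}}\right)$, which means: $\partial_{ii}=\partial/\partial v_{ii}$, and for $i\ne j$, $\partial_{ij}=\frac12\,\partial/\partial v_{ij}$ in the independent coordinates $(v_{ij})_{i\le j}$. The spinor derivatives are $D_i=\frac{\partial}{\partial\xi_i}-\sum_{j}\xi_j\partial_{ij}$ (with left derivatives in $\xi$). Put $t_{ij}=v_{ij}-\frac12\xi_i\xi_j$, so that $t_{ij}-t_{ji}+\xi_i\xi_j=0$. Superforms of weight $1/2$ are represented by superfunctions on (opens of) $S\mathfrak H_n$; on them the odd generators $p_i,q_i$ ($i=1,\dots,n$) of the Lie superalgebra $\mathfrak{osp}(1|2n)$ act by $$D^{(1/2)}_{p_i}=D_i,\qquad D^{(1/2)}_{q_i}=\sum_{j=1}^n t_{ji}D_j-\tfrac12\xi_i .$$ $\mathbb D\Phi=0$ means $\mathbb D_{ij}\Phi:=(D_iD_j-D_jD_i)\Phi=0$ for all $i<j$.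 For $c\in\mathbb C$ and $D=D^{(1/2)}_{p_i}$ or $D^{(1/2)}_{q_i}$, the exponential $e^{cD}=\sum_{k\ge0}c^kD^k/k!$ is a differential operator of infinite order: the series converges when applied to any holomorphic superfunction over any open set and gives a holomorphic superfunction over the same open set. *)

theory Defs
  imports "HOL-Analysis.Analysis"
begin

text \<open>
  The size \<open>n \<ge> 1\<close> is the cardinality of a finite index type \<open>'n\<close>; its linear order
  fixes the order of the factors in the odd monomials. The synonym spells out
  \<open>complex^'n^'n\<close>, whose syntax would restrict \<open>'n\<close> to the sort \<open>finite\<close>.
\<close>

type_synonym 'n cmatrix = "((complex, 'n) vec, 'n) vec"

definition siegel_space :: "'n::finite cmatrix set" where
  "siegel_space = {v. transpose v = v \<and>
     (\<forall>x::real^'n. x \<noteq> 0 \<longrightarrow> x \<bullet> ((\<chi> i j. Im (v $ i $ j)) *v x) > 0)}"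

text \<open>
  Holomorphy of a function on a relatively open subset of the space of symmetric matrices:
  existence of a complex-linear Frechet derivative at every point. Only the values on the
  subset matter, as the derivative is taken within it.
\<close>

definition sym_holomorphic_on ::
    "('n::finite cmatrix \<Rightarrow> complex) \<Rightarrow> 'n cmatrix set \<Rightarrow> bool" where
  "sym_holomorphic_on f U \<longleftrightarrow>
     (\<forall>v\<in>U. \<exists>f'. (f has_derivative f') (at v within U) \<and>
        (\<forall>a w. f' (\<chi> i j. a * w $ i $ j) = a * f' w))"

text \<open>
  Partial derivative with respect to the independent coordinate \<open>v\<^sub>i\<^sub>j = v\<^sub>j\<^sub>i\<close> of a
  symmetric matrix: for \<open>i \<noteq> j\<close> both entries are varied simultaneously.
\<close>

definition coord_deriv ::
    "'n::finite \<Rightarrow> 'n \<Rightarrow> ('n cmatrix \<Rightarrow> complex) \<Rightarrow> 'n cmatrix \<Rightarrow> complex" where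
  "coord_deriv i j f v =
     deriv (\<lambda>z. f (\<chi> k l. v $ k $ l + (if {k, l} = {i, j} then z else 0))) 0"

definition sym_deriv ::
    "'n::finite \<Rightarrow> 'n \<Rightarrow> ('n cmatrix \<Rightarrow> complex) \<Rightarrow> 'n cmatrix \<Rightarrow> complex" where
  "sym_deriv i j f v = (if i = j then 1 else 1 / 2) * coord_deriv i j f v"

text \<open>
  A superfunction \<open>\<Phi> = (\<Sum>I. \<Phi>\<^sub>I \<xi>\<^sub>I)\<close>, where \<open>\<xi>\<^sub>I\<close> is the product of the \<open>\<xi>\<^sub>i\<close> with
  \<open>i \<in> I\<close> in increasing order, is given by its coefficient functions \<open>\<Phi> I\<close>.
\<close>

type_synonym 'n superfun = "'n set \<Rightarrow> 'n cmatrix \<Rightarrow> complex"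

definition super_holomorphic_on :: "'n::finite superfun \<Rightarrow> 'n cmatrix set \<Rightarrow> bool" where
  "super_holomorphic_on \<Phi> U \<longleftrightarrow> (\<forall>I. sym_holomorphic_on (\<Phi> I) U)"

definition super_of :: "('n::finite cmatrix \<Rightarrow> complex) \<Rightarrow> 'n superfun" where
  "super_of f = (\<lambda>I v. if I = {} then f v else 0)"

definition xi :: "'n::finite \<Rightarrow> 'n superfun" where
  "xi i = (\<lambda>I v. if I = {i} then 1 else 0)"

text \<open>The sign in \<open>\<xi>\<^sub>J \<xi>\<^sub>K = \<plusminus> \<xi>\<^bsub>J \<union> K\<^esub>\<close> for disjoint \<open>J\<close>, \<open>K\<close>.\<close>

definition reorder_sign :: "'n::{finite,linorder} set \<Rightarrow> 'n set \<Rightarrow> complex" where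
  "reorder_sign J K = (- 1) ^ card {(j, k). j \<in> J \<and> k \<in> K \<and> k < j}"

definition super_mult ::
    "'n::{finite,linorder} superfun \<Rightarrow> 'n superfun \<Rightarrow> 'n superfun" (infixl "\<odot>" 70) where
  "(\<Phi> \<odot> \<Psi>) = (\<lambda>I v. \<Sum>J\<in>Pow I. reorder_sign J (I - J) * \<Phi> J v * \<Psi> (I - J) v)"

text \<open>
  The left derivative with respect to \<open>\<xi>\<^sub>i\<close>; the coefficient at \<open>I\<close> comes from
  \<open>\<xi>\<^bsub>I \<union> {i}\<^esub> = reorder_sign {i} I \<cdot> \<xi>\<^sub>i \<xi>\<^sub>I\<close>.
\<close>

definition odd_deriv :: "'n::{finite,linorder} \<Rightarrow> 'n superfun \<Rightarrow> 'n superfun" where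
  "odd_deriv i \<Phi> = (\<lambda>I v. if i \<in> I then 0 else reorder_sign {i} I * \<Phi> (insert i I) v)"

definition even_deriv :: "'n::finite \<Rightarrow> 'n \<Rightarrow> 'n superfun \<Rightarrow> 'n superfun" where
  "even_deriv i j \<Phi> = (\<lambda>I. sym_deriv i j (\<Phi> I))"

definition spinor_deriv :: "'n::{finite,linorder} \<Rightarrow> 'n superfun \<Rightarrow> 'n superfun" where
  "spinor_deriv i \<Phi> =
     (\<lambda>I v. odd_deriv i \<Phi> I v - (\<Sum>j\<in>UNIV. (xi j \<odot> even_deriv i j \<Phi>) I v))"

definition t_coord :: "'n::{finite,linorder} \<Rightarrow> 'n \<Rightarrow> 'n superfun" where
  "t_coord i j =
     (\<lambda>I v. super_of (\<lambda>v. v $ i $ j) I v - 1 / 2 * (xi i \<odot> xi j) I v)"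

definition D_p :: "'n::{finite,linorder} \<Rightarrow> 'n superfun \<Rightarrow> 'n superfun" where
  "D_p i \<Phi> = spinor_deriv i \<Phi>"

definition D_q :: "'n::{finite,linorder} \<Rightarrow> 'n superfun \<Rightarrow> 'n superfun" where
  "D_q i \<Phi> =
     (\<lambda>I v. (\<Sum>j\<in>UNIV. (t_coord j i \<odot> spinor_deriv j \<Phi>) I v) - 1 / 2 * (xi i \<odot> \<Phi>) I v)"

definition DD :: "'n::{finite,linorder} \<Rightarrow> 'n \<Rightarrow> 'n superfun \<Rightarrow> 'n superfun" where
  "DD i j \<Phi> = (\<lambda>I v. spinor_deriv i (spinor_deriv j \<Phi>) I v
                    - spinor_deriv j (spinor_deriv i \<Phi>) I v)"

text \<open>
  \<open>exp_maps_to c D \<Phi> \<Psi> U\<close> expresses \<open>e\<^bsup>cD\<^esup> \<Phi> = \<Psi>\<close> over \<open>U\<close>: the exponential series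
  applied to \<open>\<Phi>\<close> converges to \<open>\<Psi>\<close> at every point of \<open>U\<close>, coefficientwise in \<open>\<xi>\<close>.
\<close>

definition exp_maps_to ::
    "complex \<Rightarrow> ('n::finite superfun \<Rightarrow> 'n superfun) \<Rightarrow> 'n superfun \<Rightarrow> 'n superfun \<Rightarrow>
     'n cmatrix set \<Rightarrow> bool" where
  "exp_maps_to c D \<Phi> \<Psi> U \<longleftrightarrow>
     (\<forall>v\<in>U. \<forall>I. (\<lambda>k. c ^ k * (D ^^ k) \<Phi> I v / fact k) sums \<Psi> I v)"

definition theta_system ::
    "complex \<Rightarrow> 'n cmatrix set \<Rightarrow> 'n::{finite,linorder} superfun \<Rightarrow> bool" where
  "theta_system c U \<Phi> \<longleftrightarrow>
     (\<forall>i j. i < j \<longrightarrow> (\<forall>v\<in>U. \<forall>I. DD i j \<Phi> I v = 0)) \<and>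
     (\<forall>\<nu>. exp_maps_to c (D_p \<nu>) \<Phi> \<Phi> U) \<and>
     (\<forall>\<nu>. exp_maps_to c (D_q \<nu>) \<Phi> \<Phi> U)"

definition riemann_theta :: "'n::finite cmatrix \<Rightarrow> complex" where
  "riemann_theta v = (\<Sum>\<^sub>\<infinity>m::int^'n.
     exp (of_real pi * \<i> * (\<Sum>i\<in>UNIV. \<Sum>j\<in>UNIV. of_int (m $ i) * v $ i $ j * of_int (m $ j))))"

end

theory Submission
  imports Defs "HOL-Complex_Analysis.Complex_Analysis"
begin

text \<open>
  If \<open>\<DD>\<Phi> = 0\<close>, the anticommutation relations of the \<open>D\<^sub>i\<close> give \<open>D\<^sub>iD\<^sub>j\<Phi> = -\<partial>\<^sub>i\<^sub>j\<Phi>\<close>, and the body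
  \<open>F(y, v)\<close> of \<open>exp (c \<Sum>\<^sub>j y\<^sub>jD\<^sub>j) \<Phi>\<close> is entire in \<open>y\<close> and solves the heat equation
  \<open>\<partial>\<^sup>2F/\<partial>y\<^sub>i\<partial>y\<^sub>j = 4\<pi>i \<partial>\<^sub>i\<^sub>jF\<close>. The equation for \<open>p\<^sub>i\<close> says that \<open>F\<close> is periodic under \<open>y \<mapsto> y + e\<^sub>i\<close>.
  The equation for \<open>q\<^sub>i\<close>, propagated in \<open>y\<close> by uniqueness for the heat equation, says that
  \<open>exp (\<pi>iv\<^sub>i\<^sub>i + 2\<pi>iy\<^sub>i) F(y + ve\<^sub>i, v) = F(y, v)\<close>. Such an \<open>F\<close> is determined by its zeroth Fourier
  coefficient, which by the heat equation does not depend on \<open>v\<close>; and \<open>F\<close> determines \<open>\<Phi>\<close>.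
  Conversely, the theta series with characteristics \<open>(\<sigma>, u)\<close> are the bodies of a family of
  superfunctions on which \<open>cD\<close> for \<open>p\<^sub>i\<close> and \<open>q\<^sub>i\<close> acts at \<open>\<sigma> = 0\<close> and at \<open>u = 0\<close> as differentiation in
  \<open>u\<^sub>i\<close> and, up to sign, in \<open>\<sigma>\<^sub>i\<close>. By Taylor's formula the exponentials shift a characteristic by a
  period, which fixes \<open>\<theta>\<close>.
\<close>

text \<open>On solutions of the equation \<open>DD\<close> the odd generators behave like a
  Heisenberg algebra: the D_i commute with each other, and D_j commutes with the operator of q_i up
  to the scalar -1/2 when i = j. As c^2 = -4 pi i, the product of c^2 and -1/2 is 2 pi i, so that
  formally the exponentials for p and q commute, and reordering them yields exactly the Gaussian
  factor of theta. The analytic obstacle is that the superfunction lives over U only, while F has to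
  be entire in y. The square of the operator sum of y_j D_j is minus the derivative in the direction
  of the matrix y y^t. Applying it 2m times therefore costs only m derivatives, hence a factor of
  size m!, against the (2m)! of the exponential series. The equations for p_i and q_i give
  information at y = 0 only. The heat equation is of second order in y, so both F and its first
  y-derivatives are needed there: the body of each equation supplies the former, its components at
  single odd variables the latter.\<close>

section \<open>Complex normed spaces, holomorphic functions and directional derivatives\<close>

class cspace = real_normed_vector +
  fixes cscale :: "complex \<Rightarrow> 'a \<Rightarrow> 'a" (infixr "*\<^sub>C" 75)
  assumes cscale_add_right: "a *\<^sub>C (x + y) = a *\<^sub>C x + a *\<^sub>C y"
    and cscale_add_left: "(a + b) *\<^sub>C x = a *\<^sub>C x + b *\<^sub>C x"
    and cscale_cscale [simp]: "a *\<^sub>C b *\<^sub>C x = (a * b) *\<^sub>C x"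
    and cscale_of_real: "of_real r *\<^sub>C x = r *\<^sub>R x"
    and norm_cscale [simp]: "norm (a *\<^sub>C x) = cmod a * norm x"

instantiation complex :: cspace
begin
definition cscale_complex :: "complex \<Rightarrow> complex \<Rightarrow> complex" where
  "cscale_complex a x = a * x"
instance
  by standard (simp_all add: cscale_complex_def algebra_simps norm_mult scaleR_conv_of_real)
end

instantiation prod :: (cspace, cspace) cspace
begin
definition cscale_prod :: "complex \<Rightarrow> 'a \<times> 'b \<Rightarrow> 'a \<times> 'b" where
  "cscale_prod a x = (a *\<^sub>C fst x, a *\<^sub>C snd x)"
instance
proof
  fix a :: complex and x :: "'a \<times> 'b"
  have "(cmod a * norm (fst x))\<^sup>2 + (cmod a * norm (snd x))\<^sup>2 =
      (cmod a)\<^sup>2 * ((norm (fst x))\<^sup>2 + (norm (snd x))\<^sup>2)"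
    by (simp add: algebra_simps power_mult_distrib)
  then show "norm (a *\<^sub>C x) = cmod a * norm x"
    by (simp add: norm_prod_def cscale_prod_def real_sqrt_mult)
qed (simp_all add: cscale_prod_def cscale_add_right cscale_add_left cscale_of_real prod_eq_iff)
end

instantiation vec :: (cspace, finite) cspace
begin
definition cscale_vec :: "complex \<Rightarrow> ('a, 'b) vec \<Rightarrow> ('a, 'b) vec" where
  "cscale_vec a x = (\<chi> i. a *\<^sub>C x $ i)"
instance
  by standard (simp_all add: cscale_vec_def cscale_add_right cscale_add_left cscale_of_real
      vec_eq_iff norm_vec_def L2_set_right_distrib)
end

lemma cscale_fst [simp]: "fst (a *\<^sub>C x) = a *\<^sub>C fst x"
  and cscale_snd [simp]: "snd (a *\<^sub>C x) = a *\<^sub>C snd x"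
  by (simp_all add: cscale_prod_def)

lemma cscale_Pair: "a *\<^sub>C (x, y) = (a *\<^sub>C x, a *\<^sub>C y)"
  by (simp add: cscale_prod_def)

lemma cscale_nth [simp]: "(a *\<^sub>C x) $ i = a *\<^sub>C x $ i"
  by (simp add: cscale_vec_def)

lemma cscale_mult [simp]: "a *\<^sub>C x = a * x" for x :: complex
  by (simp add: cscale_complex_def)

lemma cscale_zero_left [simp]: "0 *\<^sub>C x = 0" for x :: "'a::cspace"
  by (metis cscale_of_real of_real_0 scaleR_zero_left)

lemma cscale_one [simp]: "1 *\<^sub>C x = x" for x :: "'a::cspace"
  by (metis cscale_of_real of_real_1 scaleR_one)

lemma cscale_zero_right [simp]: "a *\<^sub>C 0 = (0 :: 'a::cspace)"
  by (metis add_cancel_right_right cscale_add_right)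

lemma bounded_linear_cscale_left: "bounded_linear (\<lambda>z. z *\<^sub>C x)" for x :: "'a::cspace"
proof (rule bounded_linear_intro[where K = "norm x"])
  fix r :: real and z :: complex
  show "(r *\<^sub>R z) *\<^sub>C x = r *\<^sub>R z *\<^sub>C x"
    by (metis cscale_cscale cscale_of_real scaleR_conv_of_real)
qed (simp_all add: cscale_add_left)

lemmas continuous_on_cscale_left [continuous_intros] =
  bounded_linear.continuous_on[OF bounded_linear_cscale_left]

text \<open>The derivative is taken in the whole space and not within \<open>S\<close>, so that it
  is unique and every complex direction can be probed. The class \<open>cspace\<close> lets one
  notion serve numbers, vectors, matrices and tuples of them.\<close>

definition holo :: "('a::cspace \<Rightarrow> complex) \<Rightarrow> 'a set \<Rightarrow> bool" where
  "holo f S \<longleftrightarrow> (\<forall>x\<in>S. \<exists>f'. (f has_derivative f') (at x) \<and> (\<forall>a w. f' (a *\<^sub>C w) = a * f' w))"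

text \<open>Being a one-variable derivative on a complex line, this is defined for every function,
  so that it can be iterated freely.\<close>

definition dd :: "'a::cspace \<Rightarrow> ('a \<Rightarrow> complex) \<Rightarrow> 'a \<Rightarrow> complex" where
  "dd w f x = deriv (\<lambda>z. f (x + z *\<^sub>C w)) 0"

lemma holo_subset: "holo f S \<Longrightarrow> T \<subseteq> S \<Longrightarrow> holo f T"
  by (auto simp: holo_def)

lemma holo_local:
  assumes "\<And>x. x \<in> S \<Longrightarrow> \<exists>T. x \<in> T \<and> holo f T"
  shows "holo f S"
  using assms unfolding holo_def by blast

lemma has_derivative_dd:
  assumes "(f has_derivative f') (at x)" "\<And>a w. f' (a *\<^sub>C w) = a * f' w"
  shows "((\<lambda>z. f (x + z *\<^sub>C w)) has_field_derivative f' w) (at 0)" "dd w f x = f' w"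
proof -
  have "((\<lambda>z. x + z *\<^sub>C w) has_derivative (\<lambda>z. z *\<^sub>C w)) (at 0)"
    using bounded_linear_imp_has_derivative[OF bounded_linear_cscale_left[of w], of "at 0"]
    by (auto intro!: derivative_eq_intros)
  then have "((\<lambda>z. f (x + z *\<^sub>C w)) has_derivative (\<lambda>z. f' (z *\<^sub>C w))) (at 0)"
    by (rule has_derivative_compose) (use assms in simp)
  then show *: "((\<lambda>z. f (x + z *\<^sub>C w)) has_field_derivative f' w) (at 0)"
    by (rule has_derivative_imp_has_field_derivative) (simp add: assms mult.commute)
  show "dd w f x = f' w"
    unfolding dd_def by (rule DERIV_imp_deriv[OF *])
qed

lemma holo_has_derivative:
  assumes "holo f S" "x \<in> S"
  shows "(f has_derivative (\<lambda>w. dd w f x)) (at x)"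
proof -
  obtain f' where f': "(f has_derivative f') (at x)" "\<And>a w. f' (a *\<^sub>C w) = a * f' w"
    using assms by (auto simp: holo_def)
  have "(\<lambda>w. dd w f x) = f'" using has_derivative_dd(2)[OF f'] by auto
  then show ?thesis using f' by simp
qed

lemma dd_cscale: assumes "holo f S" "x \<in> S" shows "dd (a *\<^sub>C w) f x = a * dd w f x"
proof -
  obtain f' where f': "(f has_derivative f') (at x)" "\<And>a w. f' (a *\<^sub>C w) = a * f' w"
    using assms by (auto simp: holo_def)
  show ?thesis using has_derivative_dd(2)[OF f'] f'(2) by simp
qed

lemma dd_linear: assumes "holo f S" "x \<in> S" shows "linear (\<lambda>w. dd w f x)"
  using holo_has_derivative[OF assms] by (rule has_derivative_linear)

lemma dd_add: "holo f S \<Longrightarrow> x \<in> S \<Longrightarrow> dd (w + w') f x = dd w f x + dd w' f x"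
  using dd_linear linear_add by blast

lemma dd_sum: "holo f S \<Longrightarrow> x \<in> S \<Longrightarrow> dd (\<Sum>i\<in>A. g i) f x = (\<Sum>i\<in>A. dd (g i) f x)"
  using linear_sum[OF dd_linear] by blast

lemma holo_field_derivative:
  assumes "holo f S" "p + z *\<^sub>C w \<in> S"
  shows "((\<lambda>z. f (p + z *\<^sub>C w)) has_field_derivative dd w f (p + z *\<^sub>C w)) (at z)"
proof -
  obtain f' where f': "(f has_derivative f') (at (p + z *\<^sub>C w))" "\<And>a w. f' (a *\<^sub>C w) = a * f' w"
    using assms by (auto simp: holo_def)
  have "((\<lambda>h. f ((p + z *\<^sub>C w) + h *\<^sub>C w)) has_field_derivative f' w) (at 0)"
    using has_derivative_dd(1)[OF f'] .
  then have "((\<lambda>h. f (p + h *\<^sub>C w)) has_field_derivative f' w) (at (0 + z))"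
    unfolding DERIV_shift by (simp add: cscale_add_left algebra_simps)
  then show ?thesis using has_derivative_dd(2)[OF f'] by simp
qed

lemma dd_unique:
  assumes "((\<lambda>z. f (x + z *\<^sub>C w)) has_field_derivative D) (at 0)"
  shows "dd w f x = D"
  using assms unfolding dd_def by (rule DERIV_imp_deriv)

lemma holo_continuous_on: "holo f S \<Longrightarrow> continuous_on S f"
  by (meson has_derivative_at_withinI holo_has_derivative has_derivative_continuous_on)

lemma open_line:
  assumes "open S" shows "open {z. p + z *\<^sub>C w \<in> S}"
proof -
  have "open ((\<lambda>z. p + z *\<^sub>C w) -` S)"
    by (rule open_vimage[OF assms]) (intro continuous_intros)
  then show ?thesis by (simp add: vimage_def)
qed

lemma holo_holomorphic_line:
  assumes "holo f S" "\<And>z. z \<in> T \<Longrightarrow> p + z *\<^sub>C w \<in> S"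
  shows "(\<lambda>z. f (p + z *\<^sub>C w)) holomorphic_on T"
proof (rule holomorphic_onI)
  fix z assume "z \<in> T"
  then show "(\<lambda>z. f (p + z *\<^sub>C w)) field_differentiable at z within T"
    using holo_field_derivative[OF assms(1) assms(2)] field_differentiable_def
      field_differentiable_at_within by blast
qed

lemma dd_cong_open:
  assumes "open S" "x \<in> S" "\<And>y. y \<in> S \<Longrightarrow> f y = g y"
  shows "dd w f x = dd w g x"
proof -
  have "\<forall>\<^sub>F z in nhds 0. z \<in> {z. x + z *\<^sub>C w \<in> S}"
    by (rule eventually_nhds_in_open[OF open_line[OF assms(1)]]) (use assms in auto)
  then have "\<forall>\<^sub>F z in nhds 0. f (x + z *\<^sub>C w) = g (x + z *\<^sub>C w)"
    by eventually_elim (use assms in auto)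
  then show ?thesis unfolding dd_def by (rule deriv_cong_ev) simp
qed

lemma holo_cong_open:
  assumes "open S" "\<And>y. y \<in> S \<Longrightarrow> f y = g y" "holo f S"
  shows "holo g S"
  unfolding holo_def
proof
  fix x assume x: "x \<in> S"
  then obtain f' where f': "(f has_derivative f') (at x)" "\<forall>a w. f' (a *\<^sub>C w) = a * f' w"
    using assms(3) by (auto simp: holo_def)
  have "(g has_derivative f') (at x)"
    using f'(1) by (rule has_derivative_transform_within_open[OF _ assms(1) x]) (use assms in auto)
  then show "\<exists>f'. (g has_derivative f') (at x) \<and> (\<forall>a w. f' (a *\<^sub>C w) = a * f' w)"
    using f'(2) by blast
qed

subsection \<open>Algebra of holomorphic functions\<close>

lemma holo_const [simp]: "holo (\<lambda>_. k) S"
  unfolding holo_def by (auto intro!: exI[of _ "\<lambda>_. 0"])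

lemma dd_const [simp]: "dd w (\<lambda>_. k) x = 0"
  by (simp add: dd_def)

lemma holo_linear:
  assumes "bounded_linear f" "\<And>a w. f (a *\<^sub>C w) = a * f w"
  shows "holo f S"
  unfolding holo_def using bounded_linear_imp_has_derivative[OF assms(1)] assms(2) by blast

lemma dd_linear_fun:
  assumes "bounded_linear f" "\<And>a w. f (a *\<^sub>C w) = a * f w"
  shows "dd w f x = f w"
  using has_derivative_dd(2)[OF bounded_linear_imp_has_derivative[OF assms(1)] assms(2)] .

lemma holo_add: "holo f S \<Longrightarrow> holo g S \<Longrightarrow> holo (\<lambda>x. f x + g x) S"
  and holo_mult: "holo f S \<Longrightarrow> holo g S \<Longrightarrow> holo (\<lambda>x. f x * g x) S"
proof -
  assume fg: "holo f S" "holo g S"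
  show "holo (\<lambda>x. f x + g x) S" unfolding holo_def
  proof
    fix x assume "x \<in> S"
    then obtain f' g' where *: "(f has_derivative f') (at x)" "\<forall>a w. f' (a *\<^sub>C w) = a * f' w"
      "(g has_derivative g') (at x)" "\<forall>a w. g' (a *\<^sub>C w) = a * g' w"
      using fg by (meson holo_def)
    show "\<exists>h. ((\<lambda>x. f x + g x) has_derivative h) (at x) \<and> (\<forall>a w. h (a *\<^sub>C w) = a * h w)"
      by (rule exI[of _ "\<lambda>w. f' w + g' w"])
        (use * in \<open>auto simp: algebra_simps intro!: has_derivative_add\<close>)
  qed
  show "holo (\<lambda>x. f x * g x) S" unfolding holo_def
  proof
    fix x assume "x \<in> S"
    then obtain f' g' where *: "(f has_derivative f') (at x)" "\<forall>a w. f' (a *\<^sub>C w) = a * f' w"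
      "(g has_derivative g') (at x)" "\<forall>a w. g' (a *\<^sub>C w) = a * g' w"
      using fg by (meson holo_def)
    show "\<exists>h. ((\<lambda>x. f x * g x) has_derivative h) (at x) \<and> (\<forall>a w. h (a *\<^sub>C w) = a * h w)"
      by (rule exI[of _ "\<lambda>w. f x * g' w + f' w * g x"])
        (use * in \<open>auto simp: algebra_simps intro!: has_derivative_mult\<close>)
  qed
qed

lemma dd_plus: "holo f S \<Longrightarrow> holo g S \<Longrightarrow> x \<in> S \<Longrightarrow>
    dd w (\<lambda>x. f x + g x) x = dd w f x + dd w g x"
  and dd_times: "holo f S \<Longrightarrow> holo g S \<Longrightarrow> x \<in> S \<Longrightarrow>
    dd w (\<lambda>x. f x * g x) x = dd w f x * g x + f x * dd w g x"
  using holo_field_derivative[of f S x 0 w] holo_field_derivative[of g S x 0 w]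
  by (auto intro!: dd_unique derivative_eq_intros)

lemma holo_cmult: "holo f S \<Longrightarrow> holo (\<lambda>x. k * f x) S"
  by (rule holo_mult) auto

lemma dd_cmult: "holo f S \<Longrightarrow> x \<in> S \<Longrightarrow> dd w (\<lambda>x. k * f x) x = k * dd w f x"
  by (subst dd_times[where S = S]) auto

lemma holo_diff: "holo f S \<Longrightarrow> holo g S \<Longrightarrow> holo (\<lambda>x. f x - g x) S"
  using holo_add[of f S "\<lambda>x. - 1 * g x"] holo_cmult[of g S "-1"] by simp

lemma dd_diff: "holo f S \<Longrightarrow> holo g S \<Longrightarrow> x \<in> S \<Longrightarrow>
    dd w (\<lambda>x. f x - g x) x = dd w f x - dd w g x"
  using dd_plus[of f S "\<lambda>x. - 1 * g x" x w] holo_cmult[of g S "-1"] dd_cmult[of g S x w "-1"] by simp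

lemma holo_sum: "(\<And>i. i \<in> A \<Longrightarrow> holo (f i) S) \<Longrightarrow> holo (\<lambda>x. \<Sum>i\<in>A. f i x) S"
  by (induction A rule: infinite_finite_induct) (auto intro!: holo_add)

lemma dd_sum_fun: "(\<And>i. i \<in> A \<Longrightarrow> holo (f i) S) \<Longrightarrow> x \<in> S \<Longrightarrow>
    dd w (\<lambda>x. \<Sum>i\<in>A. f i x) x = (\<Sum>i\<in>A. dd w (f i) x)"
  by (induction A rule: infinite_finite_induct) (auto simp: dd_plus[where S = S] holo_sum)

lemma holo_exp: assumes "holo f S" shows "holo (\<lambda>x. exp (f x)) S"
  unfolding holo_def
proof
  fix x assume "x \<in> S"
  then obtain f' where *: "(f has_derivative f') (at x)" "\<forall>a w. f' (a *\<^sub>C w) = a * f' w"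
    using assms by (meson holo_def)
  have "(exp has_derivative (\<lambda>z. exp (f x) * z)) (at (f x))"
    using DERIV_exp[of "f x"] by (simp add: has_field_derivative_def)
  then have "((\<lambda>x. exp (f x)) has_derivative (\<lambda>w. exp (f x) * f' w)) (at x)"
    by (rule has_derivative_compose[OF *(1)])
  then show "\<exists>h. ((\<lambda>x. exp (f x)) has_derivative h) (at x) \<and> (\<forall>a w. h (a *\<^sub>C w) = a * h w)"
    using *(2) by (auto intro!: exI[of _ "\<lambda>w. exp (f x) * f' w"])
qed

lemma dd_exp: "holo f S \<Longrightarrow> x \<in> S \<Longrightarrow> dd w (\<lambda>x. exp (f x)) x = dd w f x * exp (f x)"
  using holo_field_derivative[of f S x 0 w] by (auto intro!: dd_unique derivative_eq_intros)

lemma holo_affine: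
  assumes f: "holo f S" and L: "bounded_linear L" "\<And>a w. L (a *\<^sub>C w) = a *\<^sub>C L w"
    and sub: "\<And>x. x \<in> T \<Longrightarrow> p + L x \<in> S"
  shows "holo (\<lambda>x. f (p + L x)) T"
  unfolding holo_def
proof
  fix x assume "x \<in> T"
  then obtain f' where *: "(f has_derivative f') (at (p + L x))" "\<forall>a w. f' (a *\<^sub>C w) = a * f' w"
    using f sub by (meson holo_def)
  have "((\<lambda>x. p + L x) has_derivative L) (at x)"
    using bounded_linear_imp_has_derivative[OF L(1)] by (auto intro!: derivative_eq_intros)
  from has_derivative_compose[OF this *(1)]
  show "\<exists>h. ((\<lambda>x. f (p + L x)) has_derivative h) (at x) \<and> (\<forall>a w. h (a *\<^sub>C w) = a * h w)"
    using * L(2) by (auto intro!: exI[of _ "\<lambda>w. f' (L w)"])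
qed

lemma dd_affine:
  assumes L: "bounded_linear L" "\<And>a w. L (a *\<^sub>C w) = a *\<^sub>C L w"
  shows "dd w (\<lambda>x. f (p + L x)) x = dd (L w) f (p + L x)"
proof -
  interpret bounded_linear L by (rule L(1))
  show ?thesis by (simp add: dd_def add L(2) add.assoc)
qed

subsection \<open>Cauchy estimates along complex lines\<close>

text \<open>Cauchy's inequality is applied on the smaller circle of radius \<open>s\<close>, because
  nothing is known on the boundary of the ball.\<close>

lemma holomorphic_ball_deriv_bound:
  fixes g :: "complex \<Rightarrow> complex"
  assumes g: "g holomorphic_on ball u r" and M: "\<And>z. z \<in> ball u r \<Longrightarrow> cmod (g z) \<le> M"
    and s: "0 < s" "s < r"
  shows "cmod ((deriv ^^ n) g u) \<le> fact n * M / s ^ n"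
proof (rule Cauchy_inequality[OF _ _ s(1)])
  have sub: "cball u s \<subseteq> ball u r" using s by auto
  show "g holomorphic_on ball u s"
    by (rule holomorphic_on_subset[OF g]) (use s in auto)
  show "continuous_on (cball u s) g"
    using continuous_on_subset[OF holomorphic_on_imp_continuous_on[OF g] sub] .
  show "cmod (g x) \<le> M" if "cmod (u - x) = s" for x
    using M[of x] that s by (simp add: dist_norm)
qed

text \<open>The constant is Cauchy's bound \<open>2 * M / (r/4)^2\<close> for the second derivative
  at points of the half ball: a ball of radius \<open>r/2\<close> around such a point stays in the
  given ball, and the circle of radius \<open>r/4\<close> lies inside it.\<close>

lemma holomorphic_quadratic_remainder:
  fixes g :: "complex \<Rightarrow> complex"
  assumes g: "g holomorphic_on ball 0 r" and M: "\<And>z. z \<in> ball 0 r \<Longrightarrow> cmod (g z) \<le> M"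
    and z: "cmod z < r / 2"
  shows "cmod (g z - g 0 - z * deriv g 0) \<le> 32 * M / r\<^sup>2 * (cmod z)\<^sup>2"
proof -
  have r: "r > 0" using z norm_ge_zero[of z] by linarith
  have bd: "cmod (deriv (deriv g) u) \<le> 32 * M / r\<^sup>2" if u: "u \<in> ball 0 (r/2)" for u
  proof -
    have sub: "ball u (r/2) \<subseteq> ball 0 r"
    proof
      fix x assume "x \<in> ball u (r/2)"
      then have "cmod (u - x) < r/2" "cmod u < r/2" using u by (auto simp: dist_norm)
      moreover have "cmod x \<le> cmod u + cmod (u - x)"
        using norm_triangle_ineq4[of u "u - x"] by simp
      ultimately show "x \<in> ball 0 r" by (simp add: dist_norm)
    qed
    have "cmod ((deriv ^^ 2) g u) \<le> fact 2 * M / (r/4) ^ 2"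
      by (rule holomorphic_ball_deriv_bound[where r = "r/2"])
        (use r sub M in \<open>auto intro!: holomorphic_on_subset[OF g]\<close>)
    then show ?thesis by (simp add: numeral_2_eq_2 power2_eq_square field_simps)
  qed
  define F where "F = (\<lambda>i::nat. (deriv ^^ i) g)"
  have sub: "ball 0 (r/2) \<subseteq> ball (0::complex) r" using r by auto
  have "cmod (F 0 z - (\<Sum>i\<le>1. F i 0 * (z - 0) ^ i / fact i)) \<le>
      (32 * M / r\<^sup>2) * cmod (z - 0) ^ Suc 1 / fact 1"
  proof (rule complex_Taylor[where S = "ball 0 (r/2)"])
    fix i :: nat and x :: complex assume "x \<in> ball 0 (r/2)" "i \<le> 1"
    then have "F i field_differentiable (at x)"
      unfolding F_def using sub
      by (intro holomorphic_on_imp_differentiable_at[OF holomorphic_higher_deriv[OF g]]) auto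
    then show "(F i has_field_derivative F (Suc i) x) (at x within ball 0 (r/2))"
      unfolding F_def using DERIV_deriv_iff_field_differentiable has_field_derivative_at_within
      by (metis comp_apply funpow.simps(2))
  qed (use bd z r in \<open>auto simp: F_def\<close>)
  then show ?thesis by (simp add: F_def power2_eq_square algebra_simps)
qed

lemma line_in_ball:
  fixes x w :: "'a::cspace"
  assumes "cmod z * norm w < r"
  shows "x + z *\<^sub>C w \<in> ball x r"
  using assms by (simp add: dist_norm)

lemma dd_zero_dir: "dd 0 f x = 0"
  by (simp add: dd_def)

text \<open>Any point further along the line can be taken as the base point, so that
  differentiability at the parameter 0 spreads over the line.\<close>

lemma line_holomorphic:
  assumes "open S" and G: "\<And>x w. x \<in> S \<Longrightarrow> (\<lambda>z. f (x + z *\<^sub>C w)) field_differentiable at 0"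
    and T: "\<And>z. z \<in> T \<Longrightarrow> p + z *\<^sub>C w \<in> S"
  shows "(\<lambda>z. f (p + z *\<^sub>C w)) holomorphic_on T"
proof (rule holomorphic_onI)
  fix z assume "z \<in> T"
  from G[OF T[OF this]] obtain D where
    "((\<lambda>h. f ((p + z *\<^sub>C w) + h *\<^sub>C w)) has_field_derivative D) (at 0)"
    by (auto simp: field_differentiable_def)
  then have "((\<lambda>h. f (p + h *\<^sub>C w)) has_field_derivative D) (at (0 + z))"
    unfolding DERIV_shift by (simp add: cscale_add_left algebra_simps)
  then show "(\<lambda>z. f (p + z *\<^sub>C w)) field_differentiable at z within T"
    using field_differentiable_at_within field_differentiable_def by (metis add_0)
qed

text \<open>A locally bounded function that is holomorphic on complex lines is totally differentiable,
  since the remainder of its first-order expansion is quadratic by Cauchy's estimates.\<close>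

lemma gateaux_quadratic_remainder:
  fixes f :: "'a::cspace \<Rightarrow> complex"
  assumes "open S" and G: "\<And>x w. x \<in> S \<Longrightarrow> (\<lambda>z. f (x + z *\<^sub>C w)) field_differentiable at 0"
    and b: "ball x r \<subseteq> S" and M: "\<And>y. y \<in> ball x r \<Longrightarrow> cmod (f y) \<le> M"
    and h: "cmod h * norm w < r / 2"
  shows "cmod (f (x + h *\<^sub>C w) - f x - h * dd w f x) \<le> 32 * M / r\<^sup>2 * (cmod h * norm w)\<^sup>2"
proof (cases "w = 0")
  case True
  then show ?thesis by (simp add: dd_zero_dir)
next
  case False
  define r' where "r' = r / norm w"
  have in_ball: "x + z *\<^sub>C w \<in> ball x r" if "z \<in> ball 0 r'" for z
    using that False by (intro line_in_ball) (simp add: r'_def field_simps dist_norm)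
  have "cmod (f (x + h *\<^sub>C w) - f (x + 0 *\<^sub>C w) - h * deriv (\<lambda>z. f (x + z *\<^sub>C w)) 0)
      \<le> 32 * M / r'\<^sup>2 * (cmod h)\<^sup>2"
    by (rule holomorphic_quadratic_remainder[where g = "\<lambda>z. f (x + z *\<^sub>C w)"])
      (use in_ball b M h False in \<open>auto intro!: line_holomorphic[OF assms(1) G] simp: r'_def field_simps\<close>)
  then show ?thesis
    by (simp add: dd_def r'_def power_divide power_mult_distrib algebra_simps)
qed

text \<open>Cauchy's estimate on the line, which stays in the ball for parameters of modulus below
  \<open>r / norm w\<close>; the factor 2 comes from using half of this radius.\<close>

lemma gateaux_dd_bound:
  fixes f :: "'a::cspace \<Rightarrow> complex"
  assumes "open S" and G: "\<And>x w. x \<in> S \<Longrightarrow> (\<lambda>z. f (x + z *\<^sub>C w)) field_differentiable at 0"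
    and b: "ball x r \<subseteq> S" and M: "\<And>y. y \<in> ball x r \<Longrightarrow> cmod (f y) \<le> M" and r: "0 < r"
  shows "cmod (dd w f x) \<le> 2 * M / r * norm w"
proof (cases "w = 0")
  case True
  then show ?thesis by (simp add: dd_zero_dir)
next
  case False
  define r' where "r' = r / norm w"
  have r': "r' > 0" using False r by (simp add: r'_def)
  have in_ball: "x + z *\<^sub>C w \<in> ball x r" if "z \<in> ball 0 r'" for z
    using that False by (intro line_in_ball) (simp add: r'_def field_simps dist_norm)
  have "cmod ((deriv ^^ 1) (\<lambda>z. f (x + z *\<^sub>C w)) 0) \<le> fact 1 * M / (r'/2) ^ 1"
    by (rule holomorphic_ball_deriv_bound[where r = r'])
      (use in_ball b M r' False in \<open>auto intro!: line_holomorphic[OF assms(1) G] simp: field_simps\<close>)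
  then show ?thesis by (simp add: dd_def r'_def field_simps)
qed

lemma holo_gateaux:
  assumes "holo f S" "x \<in> S"
  shows "(\<lambda>z. f (x + z *\<^sub>C w)) field_differentiable at 0"
  using holo_field_derivative[of f S x 0 w] assms by (auto simp: field_differentiable_def)

text \<open>The criterion is made for limits and integrals, which inherit the additivity of the
  derivative in its direction. Complex homogeneity follows by reparametrising the line, and the
  quadratic remainder gives total differentiability.\<close>

lemma holoI_gateaux:
  fixes f :: "'a::cspace \<Rightarrow> complex"
  assumes S: "open S" and G: "\<And>x w. x \<in> S \<Longrightarrow> (\<lambda>z. f (x + z *\<^sub>C w)) field_differentiable at 0"
    and bd: "\<And>x. x \<in> S \<Longrightarrow> \<exists>r>0. \<exists>M. ball x r \<subseteq> S \<and> (\<forall>y\<in>ball x r. cmod (f y) \<le> M)"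
    and add: "\<And>x w w'. x \<in> S \<Longrightarrow> dd (w + w') f x = dd w f x + dd w' f x"
  shows "holo f S"
  unfolding holo_def
proof
  fix x assume x: "x \<in> S"
  have dir: "((\<lambda>z. f (x + z *\<^sub>C w)) has_field_derivative dd w f x) (at 0)" for w
    using G[OF x] dd_unique by (metis field_differentiable_def)
  have scal: "dd (a *\<^sub>C w) f x = a * dd w f x" for a w
  proof (rule dd_unique)
    have "((\<lambda>z. z * a) has_field_derivative a) (at 0)"
      by (auto intro!: derivative_eq_intros)
    then have "((\<lambda>z. f (x + (z * a) *\<^sub>C w)) has_field_derivative (dd w f x * a)) (at 0)"
      using DERIV_chain2[where f = "\<lambda>z. f (x + z *\<^sub>C w)" and g = "\<lambda>z. z * a" and x = 0] dir[of w]
      by simp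
    then show "((\<lambda>z. f (x + z *\<^sub>C (a *\<^sub>C w))) has_field_derivative (a * dd w f x)) (at 0)"
      by (simp add: mult.commute)
  qed
  obtain r M where r: "r > 0" "ball x r \<subseteq> S" "\<And>y. y \<in> ball x r \<Longrightarrow> cmod (f y) \<le> M"
    using bd[OF x] by blast
  have "(f has_derivative (\<lambda>w. dd w f x)) (at x)"
  proof (rule has_derivativeI_sandwich[where e = "r/2" and H = "\<lambda>y. 32 * M / r\<^sup>2 * norm (y - x)"])
    show "bounded_linear (\<lambda>w. dd w f x)"
    proof (rule bounded_linear_intro[where K = "2 * M / r"])
      fix a :: real and w
      show "dd (a *\<^sub>R w) f x = a *\<^sub>R dd w f x"
        using scal[of "of_real a"] by (simp add: cscale_of_real scaleR_conv_of_real)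
      show "cmod (dd w f x) \<le> norm w * (2 * M / r)"
        using gateaux_dd_bound[OF S G r(2,3,1)] by (simp add: mult.commute)
    qed (simp add: add x)
    show "((\<lambda>y. 32 * M / r\<^sup>2 * norm (y - x)) \<longlongrightarrow> 0) (at x)"
      using r(1) by (auto intro!: tendsto_eq_intros)
    fix y assume y: "y \<noteq> x" "dist y x < r/2"
    have "cmod (f y - f x - dd (y - x) f x) \<le> 32 * M / r\<^sup>2 * (norm (y - x))\<^sup>2"
      using gateaux_quadratic_remainder[OF S G r(2,3), of 1 "y - x"] y by (simp add: dist_norm)
    then show "cmod (f y - f x - dd (y - x) f x) / norm (y - x) \<le> 32 * M / r\<^sup>2 * norm (y - x)"
      using y by (simp add: pos_divide_le_eq power2_eq_square mult.assoc)
  qed (use r(1) in auto)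
  then show "\<exists>f'. (f has_derivative f') (at x) \<and> (\<forall>a w. f' (a *\<^sub>C w) = a * f' w)"
    using scal by blast
qed

lemma continuous_locally_bounded:
  fixes f :: "'a::metric_space \<Rightarrow> complex"
  assumes "open S" "continuous_on S f" "x \<in> S"
  obtains r M where "r > 0" "ball x r \<subseteq> S" "\<And>y. y \<in> ball x r \<Longrightarrow> cmod (f y) \<le> M"
proof -
  have "continuous (at x) f"
    using assms continuous_on_eq_continuous_at by blast
  then obtain d where d: "d > 0" "\<And>y. dist y x < d \<Longrightarrow> dist (f y) (f x) < 1"
    unfolding continuous_at_eps_delta using zero_less_one by blast
  obtain e where e: "e > 0" "ball x e \<subseteq> S" using assms open_contains_ball by blast
  show ?thesis
  proof
    show "min d e > 0" "ball x (min d e) \<subseteq> S" using d e by auto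
    show "cmod (f y) \<le> cmod (f x) + 1" if "y \<in> ball x (min d e)" for y
    proof -
      have "dist y x < d" using that by (simp add: dist_commute)
      then have "dist (f y) (f x) < 1" by (rule d)
      then show ?thesis using norm_triangle_sub[of "f y" "f x"] by (simp add: dist_norm)
    qed
  qed
qed

lemma holo_locally_bounded:
  assumes "open S" "holo f S" "x \<in> S"
  obtains r M where "r > 0" "ball x r \<subseteq> S" "\<And>y. y \<in> ball x r \<Longrightarrow> cmod (f y) \<le> M"
  by (rule continuous_locally_bounded[OF assms(1) holo_continuous_on[OF assms(2)] assms(3)]) (rule that)

subsection \<open>Locally uniform limits\<close>

text \<open>An arbitrary filter covers partial sums of a series, sums over finite sets of lattice
  points, and difference quotients with step tending to 0.\<close>

definition loc_uniform_limit ::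
    "'a::cspace set \<Rightarrow> ('i \<Rightarrow> 'a \<Rightarrow> complex) \<Rightarrow> ('a \<Rightarrow> complex) \<Rightarrow> 'i filter \<Rightarrow> bool" where
  "loc_uniform_limit S f g F \<longleftrightarrow> (\<forall>x\<in>S. \<exists>r>0. ball x r \<subseteq> S \<and> uniform_limit (ball x r) f g F)"

lemma loc_uniform_limit_tendsto:
  assumes "loc_uniform_limit S f g F" "x \<in> S"
  shows "((\<lambda>i. f i x) \<longlongrightarrow> g x) F"
proof -
  obtain r where "r > 0" "uniform_limit (ball x r) f g F"
    using assms by (auto simp: loc_uniform_limit_def)
  then show ?thesis by (simp add: tendsto_uniform_limitI)
qed

text \<open>On a disc in a complex line this is the one-variable theorem of Weierstrass.\<close>

lemma loc_uniform_limit_line: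
  assumes hol: "\<forall>\<^sub>F i in F. holo (f i) S" and F: "F \<noteq> bot"
    and lim: "loc_uniform_limit S f g F" and x: "x \<in> S"
  obtains D where "((\<lambda>z. g (x + z *\<^sub>C w)) has_field_derivative D) (at 0)"
    "((\<lambda>i. dd w (f i) x) \<longlongrightarrow> D) F"
proof -
  obtain r where r: "r > 0" "ball x r \<subseteq> S" and ul: "uniform_limit (ball x r) f g F"
    using lim x by (auto simp: loc_uniform_limit_def)
  \<comment> \<open>Adding 1 in the denominator covers the zero direction and keeps the closed disc
    strictly inside the ball.\<close>
  define s where "s = r / (norm w + 1)"
  have pos: "norm w + 1 > 0" using norm_ge_zero[of w] by linarith
  have s: "s > 0" using r pos by (simp add: s_def)
  have inb: "x + z *\<^sub>C w \<in> ball x r" if "z \<in> cball 0 s" for z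
  proof (rule line_in_ball)
    have "cmod z * norm w \<le> s * norm w" using that by (intro mult_right_mono) auto
    also have "\<dots> < r" using r pos by (simp add: s_def field_simps)
    finally show "cmod z * norm w < r" .
  qed
  have 1: "\<forall>\<^sub>F i in F. continuous_on (cball 0 s) (\<lambda>z. f i (x + z *\<^sub>C w)) \<and>
     (\<forall>z\<in>ball 0 s. ((\<lambda>z. f i (x + z *\<^sub>C w)) has_field_derivative dd w (f i) (x + z *\<^sub>C w)) (at z))"
    using hol
  proof eventually_elim
    case (elim i)
    have "(\<lambda>z. f i (x + z *\<^sub>C w)) holomorphic_on cball 0 s"
      using inb r by (intro holo_holomorphic_line[OF elim]) auto
    then show ?case using inb r
      by (auto intro!: holomorphic_on_imp_continuous_on holo_field_derivative[OF elim])
  qed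
  have 2: "uniform_limit (cball 0 s) (\<lambda>i z. f i (x + z *\<^sub>C w)) (\<lambda>z. g (x + z *\<^sub>C w)) F"
    using ul inb unfolding uniform_limit_iff by (fast elim: eventually_mono)
  from has_complex_derivative_uniform_limit[OF 1 2 F s]
  obtain g' where "\<And>z. z \<in> ball 0 s \<Longrightarrow>
      ((\<lambda>z. g (x + z *\<^sub>C w)) has_field_derivative g' z) (at z) \<and>
      ((\<lambda>i. dd w (f i) (x + z *\<^sub>C w)) \<longlongrightarrow> g' z) F" by blast
  from this[of 0] s show ?thesis by (intro that[of "g' 0"]) auto
qed

lemma dd_loc_uniform_limit:
  assumes "\<forall>\<^sub>F i in F. holo (f i) S" "F \<noteq> bot" "loc_uniform_limit S f g F" "x \<in> S"
  shows "((\<lambda>i. dd w (f i) x) \<longlongrightarrow> dd w g x) F"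
  using loc_uniform_limit_line[OF assms, of w] dd_unique by metis

text \<open>Additivity of the derivative passes to the limit along lines, and local boundedness
  comes from a single approximating function at distance less than 1.\<close>

lemma holo_loc_uniform_limit:
  assumes S: "open S" and hol: "\<forall>\<^sub>F i in F. holo (f i) S" and F: "F \<noteq> bot"
    and lim: "loc_uniform_limit S f g F"
  shows "holo g S"
proof (rule holoI_gateaux[OF S])
  fix x assume x: "x \<in> S"
  show "(\<lambda>z. g (x + z *\<^sub>C w)) field_differentiable at 0" for w
    using loc_uniform_limit_line[OF hol F lim x, of w] by (metis field_differentiable_def)
  show "dd (w + w') g x = dd w g x + dd w' g x" for w w'
  proof (rule tendsto_unique[OF F])
    show "((\<lambda>i. dd (w + w') (f i) x) \<longlongrightarrow> dd (w + w') g x) F"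
      by (rule dd_loc_uniform_limit[OF hol F lim x])
    have "((\<lambda>i. dd w (f i) x + dd w' (f i) x) \<longlongrightarrow> dd w g x + dd w' g x) F"
      by (intro tendsto_add dd_loc_uniform_limit[OF hol F lim x])
    moreover have "\<forall>\<^sub>F i in F. dd w (f i) x + dd w' (f i) x = dd (w + w') (f i) x"
      using hol by eventually_elim (simp add: dd_add[OF _ x])
    ultimately show "((\<lambda>i. dd (w + w') (f i) x) \<longlongrightarrow> dd w g x + dd w' g x) F"
      by (rule Lim_transform_eventually)
  qed
  obtain r where r: "r > 0" "ball x r \<subseteq> S" and ul: "uniform_limit (ball x r) f g F"
    using lim x by (auto simp: loc_uniform_limit_def)
  have "\<forall>\<^sub>F i in F. \<forall>y\<in>ball x r. dist (f i y) (g y) < 1"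
    using ul by (auto simp: uniform_limit_iff)
  with hol have "\<forall>\<^sub>F i in F. holo (f i) S \<and> (\<forall>y\<in>ball x r. dist (f i y) (g y) < 1)"
    by (rule eventually_conj)
  then obtain i where i: "holo (f i) S" "\<forall>y\<in>ball x r. dist (f i y) (g y) < 1"
    using F eventually_happens by blast
  obtain r' M where r': "r' > 0" "ball x r' \<subseteq> S" "\<And>y. y \<in> ball x r' \<Longrightarrow> cmod (f i y) \<le> M"
    using holo_locally_bounded[OF S i(1) x] by metis
  have "cmod (g y) \<le> M + 1" if "y \<in> ball x (min r r')" for y
  proof -
    have "cmod (f i y) \<le> M" "dist (f i y) (g y) < 1" using r'(3)[of y] i(2) that by auto
    then show ?thesis using norm_triangle_sub[of "g y" "f i y"] by (simp add: dist_norm norm_minus_commute)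
  qed
  then show "\<exists>r>0. \<exists>M. ball x r \<subseteq> S \<and> (\<forall>y\<in>ball x r. cmod (g y) \<le> M)"
    using r r' by (intro exI[of _ "min r r'"] conjI exI[of _ "M + 1"]) auto
qed

lemma loc_uniform_limit_dd:
  assumes S: "open S" and hol: "\<forall>\<^sub>F i in F. holo (f i) S" and F: "F \<noteq> bot"
    and lim: "loc_uniform_limit S f g F"
  shows "loc_uniform_limit S (\<lambda>i. dd w (f i)) (dd w g) F"
  unfolding loc_uniform_limit_def
proof
  fix x assume x: "x \<in> S"
  obtain r where r: "r > 0" "ball x r \<subseteq> S" and ul: "uniform_limit (ball x r) f g F"
    using lim x by (auto simp: loc_uniform_limit_def)
  have g: "holo g S" by (rule holo_loc_uniform_limit[OF assms])
  have "uniform_limit (ball x (r/2)) (\<lambda>i. dd w (f i)) (dd w g) F"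
  proof (rule uniform_limitI)
    fix e :: real assume e: "e > 0"
    \<comment> \<open>With this choice Cauchy's estimate on balls of radius \<open>r/2\<close> gives
      \<open>e * (norm w / (norm w + 1))\<close>, which is below \<open>e\<close>.\<close>
    define d where "d = e * r / (4 * (norm w + 1))"
    have pos: "norm w + 1 > 0" using norm_ge_zero[of w] by linarith
    have d: "d > 0" using e r pos by (simp add: d_def)
    have "\<forall>\<^sub>F i in F. \<forall>y\<in>ball x r. dist (f i y) (g y) < d"
      using ul d by (auto simp: uniform_limit_iff)
    with hol show "\<forall>\<^sub>F i in F. \<forall>y\<in>ball x (r/2). dist (dd w (f i) y) (dd w g y) < e"
    proof eventually_elim
      case (elim i)
      show ?case
      proof
        fix y assume y: "y \<in> ball x (r/2)"
        have sub: "ball y (r/2) \<subseteq> ball x r"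
        proof
          fix z assume "z \<in> ball y (r/2)"
          with y show "z \<in> ball x r" using dist_triangle[of x z y] by simp
        qed
        have "y \<in> ball y (r/2)" using r by simp
        then have yS: "y \<in> S" using sub r by blast
        have fg: "holo (\<lambda>y. f i y - g y) S" by (rule holo_diff[OF elim(1) g])
        have "cmod (dd w (\<lambda>y. f i y - g y) y) \<le> 2 * d / (r/2) * norm w"
        proof (rule gateaux_dd_bound[OF S holo_gateaux[OF fg]])
          show "ball y (r / 2) \<subseteq> S" using sub r by auto
          show "cmod (f i z - g z) \<le> d" if "z \<in> ball y (r/2)" for z
            using elim(2) that sub by (force simp: dist_norm)
        qed (use r in auto)
        also have "\<dots> = e * (norm w / (norm w + 1))"
        proof -
          have "2 * (e * r / (4 * q)) / (r/2) * n = e * (n / q)" if "q \<noteq> 0" for n q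
            using that r by (simp add: field_simps)
          then show ?thesis using pos unfolding d_def by (metis less_irrefl)
        qed
        also have "\<dots> < e * 1" using e pos by (intro mult_strict_left_mono) auto
        finally show "dist (dd w (f i) y) (dd w g y) < e"
          by (simp add: dist_norm dd_diff[OF elim(1) g yS])
      qed
    qed
  qed
  then show "\<exists>r>0. ball x r \<subseteq> S \<and> uniform_limit (ball x r) (\<lambda>i. dd w (f i)) (dd w g) F"
    using r by (intro exI[of _ "r/2"]) auto
qed

lemma dd_dd_loc_uniform_limit:
  assumes S: "open S" and hol: "\<forall>\<^sub>F i in F. holo (f i) S" and F: "F \<noteq> bot"
    and lim: "loc_uniform_limit S f g F" and x: "x \<in> S"
    and hol': "\<forall>\<^sub>F i in F. holo (dd w (f i)) S"
  shows "((\<lambda>i. dd w' (dd w (f i)) x) \<longlongrightarrow> dd w' (dd w g) x) F"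
  by (rule dd_loc_uniform_limit[OF hol' F loc_uniform_limit_dd[OF S hol F lim] x])

subsection \<open>Higher directional derivatives\<close>

text \<open>The quadratic remainder, divided by the step, tends to 0 uniformly near x. Presenting
  \<open>dd w f\<close> as such a limit makes the theorem of Weierstrass applicable to it. The set
  shrinks to \<open>V\<close> so that small translates remain in \<open>S\<close>.\<close>

lemma difference_quotient_limit:
  fixes f :: "'a::cspace \<Rightarrow> complex"
  assumes S: "open S" and f: "holo f S" and x: "x \<in> S"
  obtains V where "open V" "x \<in> V" "V \<subseteq> S"
    "\<forall>\<^sub>F h in at 0. holo (\<lambda>y. f (y + h *\<^sub>C w)) V"
    "loc_uniform_limit V (\<lambda>h y. (f (y + h *\<^sub>C w) - f y) / h) (dd w f) (at 0)"
proof -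
  obtain r M where r: "r > 0" "ball x r \<subseteq> S" "\<And>y. y \<in> ball x r \<Longrightarrow> cmod (f y) \<le> M"
    using holo_locally_bounded[OF S f x] by metis
  define V where "V = ball x (r/2)"
  have sub: "ball y (r/2) \<subseteq> ball x r" if "y \<in> V" for y
  proof
    fix z assume "z \<in> ball y (r/2)"
    with that show "z \<in> ball x r" unfolding V_def using dist_triangle[of x z y] by simp
  qed
  have pos: "norm w + 1 > 0" using norm_ge_zero[of w] by linarith
  have small: "\<forall>\<^sub>F h::complex in at 0. h \<noteq> 0 \<and> cmod h * norm w < r/4"
  proof -
    have "((\<lambda>h::complex. cmod h * norm w) \<longlongrightarrow> 0) (at 0)" by (auto intro!: tendsto_eq_intros)
    then have "\<forall>\<^sub>F h::complex in at 0. cmod h * norm w < r/4"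
      using r by (intro order_tendstoD(2)[of _ 0]) auto
    moreover have "\<forall>\<^sub>F h::complex in at 0. h \<noteq> 0" by (simp add: eventually_at_filter)
    ultimately show ?thesis by eventually_elim auto
  qed
  have M: "M \<ge> 0" using r(3)[of x] r(1) norm_ge_zero[of "f x"] by (simp del: norm_ge_zero)
  have "uniform_limit V (\<lambda>h y. (f (y + h *\<^sub>C w) - f y) / h) (dd w f) (at 0)"
  proof (rule uniform_limitI)
    fix e :: real assume e: "e > 0"
    define K where "K = 32 * M / (r/2)\<^sup>2 * (norm w)\<^sup>2"
    have "((\<lambda>h::complex. K * cmod h) \<longlongrightarrow> 0) (at 0)" by (auto intro!: tendsto_eq_intros)
    then have "\<forall>\<^sub>F h::complex in at 0. K * cmod h < e"
      using e by (intro order_tendstoD(2)[of _ 0]) auto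
    with small show "\<forall>\<^sub>F h in at 0. \<forall>y\<in>V. dist ((f (y + h *\<^sub>C w) - f y) / h) (dd w f y) < e"
    proof eventually_elim
      case (elim h)
      show ?case
      proof
        fix y assume y: "y \<in> V"
        have "cmod (f (y + h *\<^sub>C w) - f y - h * dd w f y) \<le>
            32 * M / (r/2)\<^sup>2 * (cmod h * norm w)\<^sup>2"
          by (rule gateaux_quadratic_remainder[OF S holo_gateaux[OF f]])
            (use sub[OF y] r elim in auto)
        also have "\<dots> = K * cmod h * cmod h" by (simp add: K_def power2_eq_square)
        also have "\<dots> < e * cmod h" using elim by (intro mult_strict_right_mono) auto
        finally have "cmod (f (y + h *\<^sub>C w) - f y - h * dd w f y) / cmod h < e"
          using elim by (simp add: pos_divide_less_eq)
        moreover have "(f (y + h *\<^sub>C w) - f y) / h - dd w f y = (f (y + h *\<^sub>C w) - f y - h * dd w f y) / h"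
          using elim by (simp add: field_simps)
        ultimately show "dist ((f (y + h *\<^sub>C w) - f y) / h) (dd w f y) < e"
          by (simp add: dist_norm norm_divide)
      qed
    qed
  qed
  note ul = this
  have lul: "loc_uniform_limit V (\<lambda>h y. (f (y + h *\<^sub>C w) - f y) / h) (dd w f) (at 0)"
    unfolding loc_uniform_limit_def
  proof (intro ballI)
    fix y assume "y \<in> V"
    then obtain e where "e > 0" "ball y e \<subseteq> V"
      by (metis V_def open_ball open_contains_ball)
    then show "\<exists>r>0. ball y r \<subseteq> V \<and>
        uniform_limit (ball y r) (\<lambda>h y. (f (y + h *\<^sub>C w) - f y) / h) (dd w f) (at 0)"
      using uniform_limit_on_subset[OF ul] by blast
  qed
  have hol: "\<forall>\<^sub>F h in at 0. holo (\<lambda>y. f (y + h *\<^sub>C w)) V"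
    using small
  proof eventually_elim
    case (elim h)
    have "holo (\<lambda>y. f (h *\<^sub>C w + id y)) V"
    proof (rule holo_affine[OF f])
      fix y assume y: "y \<in> V"
      have "y + h *\<^sub>C w \<in> ball y (r/2)" using elim r by (intro line_in_ball) auto
      then show "h *\<^sub>C w + id y \<in> S" using sub[OF y] r by (auto simp: add.commute)
    qed (auto simp: bounded_linear_ident id_def)
    then show ?case by (simp add: add.commute)
  qed
  show ?thesis
    by (rule that[OF _ _ _ hol lul]) (use r in \<open>auto simp: V_def\<close>)
qed

lemma holo_dd:
  assumes S: "open S" and f: "holo f S" shows "holo (dd w f) S"
proof (rule holo_local)
  fix x assume "x \<in> S"
  then obtain V where V: "open V" "x \<in> V" "V \<subseteq> S"
    "\<forall>\<^sub>F h in at 0. holo (\<lambda>y. f (y + h *\<^sub>C w)) V"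
    "loc_uniform_limit V (\<lambda>h y. (f (y + h *\<^sub>C w) - f y) / h) (dd w f) (at 0)" by (rule difference_quotient_limit[OF S f])
  have "\<forall>\<^sub>F h in at 0. holo (\<lambda>y. (f (y + h *\<^sub>C w) - f y) / h) V"
    using V(4)
  proof eventually_elim
    case (elim h)
    have "holo (\<lambda>y. 1 / h * (f (y + h *\<^sub>C w) - f y)) V"
      by (intro holo_cmult holo_diff elim holo_subset[OF f V(3)])
    then show ?case by simp
  qed
  from holo_loc_uniform_limit[OF V(1) this _ V(5)] V show "\<exists>T. x \<in> T \<and> holo (dd w f) T"
    by (auto intro!: exI[of _ V])
qed

text \<open>By Weierstrass, \<open>dd w'\<close> may be applied to the difference quotients in the
  direction \<open>w\<close> before passing to the limit; the result is a difference quotient of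
  \<open>dd w' f\<close>.\<close>

lemma dd_commute:
  assumes S: "open S" and f: "holo f S" and x: "x \<in> S"
  shows "dd w (dd w' f) x = dd w' (dd w f) x"
proof -
  obtain V where V: "open V" "x \<in> V" "V \<subseteq> S"
    "\<forall>\<^sub>F h in at 0. holo (\<lambda>y. f (y + h *\<^sub>C w)) V"
    "loc_uniform_limit V (\<lambda>h y. (f (y + h *\<^sub>C w) - f y) / h) (dd w f) (at 0)" by (rule difference_quotient_limit[OF S f x])
  have fV: "holo f V" by (rule holo_subset[OF f V(3)])
  have 1: "\<forall>\<^sub>F h in at 0. holo (\<lambda>y. (f (y + h *\<^sub>C w) - f y) / h) V \<and>
      dd w' (\<lambda>y. (f (y + h *\<^sub>C w) - f y) / h) x = (dd w' f (x + h *\<^sub>C w) - dd w' f x) / h"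
    using V(4)
  proof eventually_elim
    case (elim h)
    have d: "holo (\<lambda>y. f (y + h *\<^sub>C w) - f y) V" by (intro holo_diff elim fV)
    have "holo (\<lambda>y. 1 / h * (f (y + h *\<^sub>C w) - f y)) V" by (rule holo_cmult[OF d])
    moreover have "dd w' (\<lambda>y. 1 / h * (f (y + h *\<^sub>C w) - f y)) x =
        1 / h * (dd w' (\<lambda>y. f (y + h *\<^sub>C w)) x - dd w' f x)"
      by (simp only: dd_cmult[OF d V(2)] dd_diff[OF elim fV V(2)])
    moreover have "dd w' (\<lambda>y. f (y + h *\<^sub>C w)) x = dd w' f (x + h *\<^sub>C w)"
      by (simp add: dd_def algebra_simps)
    ultimately show ?case by simp
  qed
  then have h1: "\<forall>\<^sub>F h in at 0. holo (\<lambda>y. (f (y + h *\<^sub>C w) - f y) / h) V"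
    by eventually_elim auto
  have "((\<lambda>h. dd w' (\<lambda>y. (f (y + h *\<^sub>C w) - f y) / h) x) \<longlongrightarrow> dd w' (dd w f) x) (at 0)"
    by (rule dd_loc_uniform_limit[OF h1 _ V(5,2)]) simp
  then have "((\<lambda>h. (dd w' f (x + h *\<^sub>C w) - dd w' f x) / h) \<longlongrightarrow> dd w' (dd w f) x) (at 0)"
    by (rule Lim_transform_eventually) (use 1 in \<open>eventually_elim, auto\<close>)
  moreover have "((\<lambda>h. (dd w' f (x + h *\<^sub>C w) - dd w' f x) / h) \<longlongrightarrow> dd w (dd w' f) x) (at 0)"
    using holo_field_derivative[OF holo_dd[OF S f], of x 0 w] x by (simp add: DERIV_def)
  ultimately show ?thesis using tendsto_unique[OF at_neq_bot] by blast
qed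

lemma holo_dd_funpow: "open S \<Longrightarrow> holo f S \<Longrightarrow> holo ((dd w ^^ k) f) S"
  by (induction k) (auto intro: holo_dd)

lemma dd_funpow_cong:
  assumes "open S" "\<And>x. x \<in> S \<Longrightarrow> f x = g x" "x \<in> S"
  shows "(dd w ^^ k) f x = (dd w ^^ k) g x"
  using assms(3)
proof (induction k arbitrary: x)
  case (Suc k)
  then show ?case using dd_cong_open[OF assms(1) Suc.prems, of "(dd w ^^ k) f" "(dd w ^^ k) g"] by auto
qed (use assms in auto)

lemma dd_funpow_commute:
  assumes S: "open S" and f: "holo f S" and "x \<in> S"
  shows "(dd w ^^ k) (dd w' f) x = dd w' ((dd w ^^ k) f) x"
  using assms(3)
proof (induction k arbitrary: x)
  case (Suc k)
  have "(dd w ^^ Suc k) (dd w' f) x = dd w ((dd w ^^ k) (dd w' f)) x" by simp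
  also have "\<dots> = dd w (dd w' ((dd w ^^ k) f)) x"
    by (rule dd_cong_open[OF S Suc.prems Suc.IH])
  also have "\<dots> = dd w' (dd w ((dd w ^^ k) f)) x"
    by (rule dd_commute[OF S holo_dd_funpow[OF S f] Suc.prems])
  finally show ?case by simp
qed simp

lemma deriv_funpow_line:
  assumes S: "open S" and f: "holo f S" and "p + z *\<^sub>C w \<in> S"
  shows "(deriv ^^ k) (\<lambda>z. f (p + z *\<^sub>C w)) z = (dd w ^^ k) f (p + z *\<^sub>C w)"
  using assms(3)
proof (induction k arbitrary: z)
  case (Suc k)
  let ?T = "{z. p + z *\<^sub>C w \<in> S}"
  have "\<forall>\<^sub>F z in nhds z. z \<in> ?T"
    by (rule eventually_nhds_in_open[OF open_line[OF S]]) (use Suc.prems in simp)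
  then have "\<forall>\<^sub>F z in nhds z. (deriv ^^ k) (\<lambda>z. f (p + z *\<^sub>C w)) z = (dd w ^^ k) f (p + z *\<^sub>C w)"
    by eventually_elim (use Suc.IH in auto)
  then have "deriv ((deriv ^^ k) (\<lambda>z. f (p + z *\<^sub>C w))) z = deriv (\<lambda>z. (dd w ^^ k) f (p + z *\<^sub>C w)) z"
    by (rule deriv_cong_ev) simp
  also have "\<dots> = dd w ((dd w ^^ k) f) (p + z *\<^sub>C w)"
    by (intro DERIV_imp_deriv holo_field_derivative[OF holo_dd_funpow[OF S f] Suc.prems])
  finally show ?case by simp
qed simp

section \<open>Taylor series on complex lines and uniqueness for the heat equation\<close>

lemma holo_taylor:
  assumes S: "open S" and f: "holo f S" and line: "\<And>z. p + z *\<^sub>C w \<in> S"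
  shows "(\<lambda>k. (dd w ^^ k) f p / fact k * z ^ k) sums f (p + z *\<^sub>C w)"
proof -
  have "(\<lambda>n. (deriv ^^ n) (\<lambda>z. f (p + z *\<^sub>C w)) 0 / fact n * (z - 0) ^ n) sums f (p + z *\<^sub>C w)"
    by (rule holomorphic_power_series[where r = "cmod z + 1"])
      (auto intro!: holo_holomorphic_line[OF f line] simp: dist_norm)
  then show ?thesis using deriv_funpow_line[OF S f line, of _ 0] line[of 0] by simp
qed

text \<open>Uniqueness for the Cauchy problem of the heat equation \<open>\<partial>\<^sub>a\<^sup>2 H = k \<partial>\<^sub>b H\<close>: the equation trades
  two \<open>a\<close>-derivatives for a \<open>b\<close>-derivative, so that all \<open>a\<close>-derivatives vanish on \<open>N\<close>.\<close>

lemma heat_unique: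
  assumes S: "open S" and H: "holo H S" and N: "N \<subseteq> S"
    and heat: "\<And>x. x \<in> S \<Longrightarrow> dd a (dd a H) x = k * dd b H x"
    and bN: "\<And>x. x \<in> N \<Longrightarrow> \<forall>\<^sub>F z in nhds 0. x + z *\<^sub>C b \<in> N"
    and zero: "\<And>x. x \<in> N \<Longrightarrow> H x = 0" and first: "\<And>x. x \<in> N \<Longrightarrow> dd a H x = 0"
    and x: "x \<in> N" and line: "\<And>z. x + z *\<^sub>C a \<in> S"
  shows "H (x + z *\<^sub>C a) = 0"
proof -
  have van: "\<forall>x\<in>N. (dd a ^^ j) H x = 0" for j
  proof (induction j rule: less_induct)
    case (less j)
    consider "j = 0" | "j = 1" | i where "j = Suc (Suc i)"
      by (metis One_nat_def old.nat.exhaust)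
    then show ?case
    proof cases
      case 3
      show ?thesis
      proof
        fix x assume x: "x \<in> N"
        then have xS: "x \<in> S" using N by auto
        have "(dd a ^^ j) H x = (dd a ^^ i) (dd a (dd a H)) x"
          by (simp add: 3 funpow_Suc_right del: funpow.simps)
        also have "\<dots> = (dd a ^^ i) (\<lambda>x. k * dd b H x) x"
          by (rule dd_funpow_cong[OF S heat xS])
        also have "\<dots> = (dd a ^^ i) (dd b (\<lambda>x. k * H x)) x"
          by (rule dd_funpow_cong[OF S _ xS]) (simp add: dd_cmult[OF H])
        also have "\<dots> = dd b ((dd a ^^ i) (\<lambda>x. k * H x)) x"
          by (rule dd_funpow_commute[OF S holo_cmult[OF H] xS])
        also have "\<dots> = dd b (\<lambda>x. k * (dd a ^^ i) H x) x"
        proof (rule dd_cong_open[OF S xS])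
          show "(dd a ^^ i) (\<lambda>x. k * H x) y = k * (dd a ^^ i) H y" if "y \<in> S" for y
            using that
          proof (induction i arbitrary: y)
            case (Suc i)
            then show ?case
              using dd_cong_open[OF S Suc.prems Suc.IH] dd_cmult[OF holo_dd_funpow[OF S H] Suc.prems]
              by simp
          qed simp
        qed
        also have "\<dots> = k * dd b ((dd a ^^ i) H) x"
          by (rule dd_cmult[OF holo_dd_funpow[OF S H] xS])
        also have "dd b ((dd a ^^ i) H) x = deriv (\<lambda>z. (dd a ^^ i) H (x + z *\<^sub>C b)) 0"
          by (rule dd_def)
        \<comment> \<open>By \<open>bN\<close> a short piece of the b-line through x lies in
          \<open>N\<close>, where the derivative of order \<open>i\<close> vanishes by
          induction.\<close>
        also have "\<dots> = deriv (\<lambda>_. 0) 0"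
        proof (rule deriv_cong_ev)
          show "\<forall>\<^sub>F z in nhds 0. (dd a ^^ i) H (x + z *\<^sub>C b) = 0"
            using bN[OF x] by eventually_elim (use less 3 in auto)
        qed simp
        finally show "(dd a ^^ j) H x = 0" by simp
      qed
    next
      case 1
      then show ?thesis using zero by simp
    next
      case 2
      then show ?thesis using first by simp
    qed
  qed
  have "(\<lambda>k. (dd a ^^ k) H x / fact k * z ^ k) sums H (x + z *\<^sub>C a)"
    by (rule holo_taylor[OF S H line])
  then have "(\<lambda>k. 0) sums H (x + z *\<^sub>C a)" using van x by simp
  then show ?thesis using sums_unique2 sums_zero by metis
qed

subsection \<open>Averaging over a period\<close>

text \<open>For a function with period \<open>e\<close> this is the zeroth Fourier coefficient in
  that direction. It remains a function of the base point, so that it can be differentiated and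
  averaged again.\<close>

definition avg :: "'a::cspace \<Rightarrow> ('a \<Rightarrow> complex) \<Rightarrow> 'a \<Rightarrow> complex" where
  "avg e f x = integral (cbox 0 1) (\<lambda>s::real. f (x + of_real s *\<^sub>C e))"

text \<open>Whole complex lines, not just the real period segment, are included, so that the path of
  integration can be moved in the imaginary direction.\<close>

definition cyl :: "'a::cspace \<Rightarrow> 'a set \<Rightarrow> bool" where
  "cyl e S \<longleftrightarrow> open S \<and> (\<forall>x\<in>S. \<forall>z. x + z *\<^sub>C e \<in> S)"

lemma cyl_open: "cyl e S \<Longrightarrow> open S"
  and cyl_line: "cyl e S \<Longrightarrow> x \<in> S \<Longrightarrow> x + z *\<^sub>C e \<in> S"
  by (auto simp: cyl_def)

lemma avg_cong:
  assumes "cyl e S" "x \<in> S" "\<And>y. y \<in> S \<Longrightarrow> f y = g y"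
  shows "avg e f x = avg e g x"
  unfolding avg_def by (rule integral_cong) (use assms cyl_line in blast)

lemma avg_mult_inv:
  assumes "\<And>s. g (x + s *\<^sub>C e) = g x"
  shows "avg e (\<lambda>x. g x * f x) x = g x * avg e f x"
  using assms by (simp add: avg_def)

lemma avg_shift: "avg e (\<lambda>x. f (x + p)) x = avg e f (x + p)"
  by (simp add: avg_def add_ac)

lemma continuous_on_avg_integrand:
  assumes "cyl e S" "continuous_on S f"
  shows "continuous_on (S \<times> cbox 0 1) (\<lambda>(x, t::real). f (x + of_real t *\<^sub>C e))"
  unfolding split_beta
  by (rule continuous_on_compose2[OF assms(2)])
    (use cyl_line[OF assms(1)] in \<open>auto intro!: continuous_intros\<close>)

lemma continuous_on_avg:
  assumes "cyl e S" "continuous_on S f"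
  shows "continuous_on S (avg e f)"
  unfolding avg_def[abs_def] by (rule integral_continuous_on_param[OF continuous_on_avg_integrand[OF assms]])

lemma avg_integrable:
  fixes f :: "'a::cspace \<Rightarrow> complex"
  assumes "cyl e S" "continuous_on S f" "x \<in> S"
  shows "(\<lambda>s::real. f (x + of_real s *\<^sub>C e)) integrable_on cbox 0 1"
  unfolding cbox_interval
proof (rule integrable_continuous_real)
  show "continuous_on {0..1} (\<lambda>s::real. f (x + of_real s *\<^sub>C e))"
    by (rule continuous_on_compose2[OF assms(2)])
      (use cyl_line[OF assms(1,3)] in \<open>auto intro!: continuous_intros\<close>)
qed

lemma avg_diff:
  assumes "cyl e S" "continuous_on S f" "continuous_on S g" "x \<in> S"
  shows "avg e (\<lambda>x. f x - g x) x = avg e f x - avg e g x"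
  unfolding avg_def using assms by (intro integral_diff avg_integrable)

lemma avg_dd_line:
  assumes cyl: "cyl e S" and f: "holo f S" and x: "x \<in> S"
  shows "((\<lambda>z. avg e f (x + z *\<^sub>C w)) has_field_derivative avg e (dd w f) x) (at 0)"
proof -
  note S = cyl_open[OF cyl]
  have "open {z. x + z *\<^sub>C w \<in> S}" "0 \<in> {z. x + z *\<^sub>C w \<in> S}" using open_line[OF S] x by auto
  then obtain d where d: "d > 0" "ball 0 d \<subseteq> {z. x + z *\<^sub>C w \<in> S}"
    using open_contains_ball by blast
  have inS: "x + z *\<^sub>C w + of_real t *\<^sub>C e \<in> S" if "z \<in> ball 0 d" for z :: complex and t :: real
    using cyl_line[OF cyl, of "x + z *\<^sub>C w" "of_real t"] d that by auto
  have "((\<lambda>z::complex. integral (cbox 0 1) (\<lambda>t::real. f (x + z *\<^sub>C w + of_real t *\<^sub>C e))) has_field_derivative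
      integral (cbox 0 1) (\<lambda>t::real. dd w f (x + 0 *\<^sub>C w + of_real t *\<^sub>C e))) (at 0 within ball (0::complex) d)"
  proof (rule leibniz_rule_field_derivative)
    fix z :: complex and t :: real assume z: "z \<in> ball 0 d"
    have "((\<lambda>z. f (x + of_real t *\<^sub>C e + z *\<^sub>C w)) has_field_derivative
        dd w f (x + of_real t *\<^sub>C e + z *\<^sub>C w)) (at z)"
      using inS[OF z, of t] by (intro holo_field_derivative[OF f]) (simp add: add_ac)
    then show "((\<lambda>z. f (x + z *\<^sub>C w + of_real t *\<^sub>C e)) has_field_derivative
        dd w f (x + z *\<^sub>C w + of_real t *\<^sub>C e)) (at z within ball 0 d)"
      by (subst (1 2) add.assoc, subst (1 2) add.commute[of "_ *\<^sub>C w"], subst (1 2) add.assoc[symmetric])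
        (rule has_field_derivative_at_within)
  next
    fix z :: complex assume z: "z \<in> ball 0 d"
    then have "x + z *\<^sub>C w \<in> S" using d by auto
    then show "(\<lambda>t::real. f (x + z *\<^sub>C w + of_real t *\<^sub>C e)) integrable_on cbox 0 1"
      by (rule avg_integrable[OF cyl holo_continuous_on[OF f]])
  next
    show "continuous_on (ball 0 d \<times> cbox 0 1) (\<lambda>(z::complex, t::real). dd w f (x + z *\<^sub>C w + of_real t *\<^sub>C e))"
      unfolding split_beta
    proof (rule continuous_on_compose2[OF holo_continuous_on[OF holo_dd[OF S f]]])
      show "continuous_on (ball 0 d \<times> cbox 0 1)
          (\<lambda>p::complex \<times> real. x + fst p *\<^sub>C w + of_real (snd p) *\<^sub>C e)"
        by (intro continuous_intros)
    qed (use inS in force)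
  qed (use d in auto)
  then show ?thesis using d by (simp add: avg_def at_within_open[of 0 "ball 0 d"])
qed

lemma dd_avg:
  assumes "cyl e S" "holo f S" "x \<in> S"
  shows "dd w (avg e f) x = avg e (dd w f) x"
  by (rule dd_unique[OF avg_dd_line[OF assms]])

text \<open>Differentiation under the integral gives holomorphy on lines; additivity in the
  direction is inherited from the integrand.\<close>

lemma holo_avg:
  assumes cyl: "cyl e S" and f: "holo f S"
  shows "holo (avg e f) S"
proof (rule holoI_gateaux)
  note S = cyl_open[OF cyl]
  show "open S" by (rule S)
  fix x assume x: "x \<in> S"
  show "(\<lambda>z. avg e f (x + z *\<^sub>C w)) field_differentiable at 0" for w
    using avg_dd_line[OF cyl f x] by (auto simp: field_differentiable_def)
  show "\<exists>r>0. \<exists>M. ball x r \<subseteq> S \<and> (\<forall>y\<in>ball x r. cmod (avg e f y) \<le> M)"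
    using continuous_locally_bounded[OF S continuous_on_avg[OF cyl holo_continuous_on[OF f]] x] by metis
  fix w w'
  have "avg e (dd (w + w') f) x = avg e (\<lambda>x. dd w f x + dd w' f x) x"
    by (rule avg_cong[OF cyl x]) (rule dd_add[OF f])
  also have "\<dots> = avg e (dd w f) x + avg e (dd w' f) x"
    unfolding avg_def
    by (intro integral_add avg_integrable[OF cyl _ x] holo_continuous_on holo_dd S f)
  finally show "dd (w + w') (avg e f) x = dd w (avg e f) x + dd w' (avg e f) x"
    by (simp add: dd_avg[OF cyl f x])
qed

lemma avg_dd_self:
  assumes cyl: "cyl e S" and f: "holo f S" and x: "x \<in> S"
  shows "avg e (dd e f) x = f (x + e) - f x"
proof -
  have "((\<lambda>s::real. dd e f (x + of_real s *\<^sub>C e)) has_integral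
      f (x + of_real 1 *\<^sub>C e) - f (x + of_real 0 *\<^sub>C e)) {0..1}"
  proof (rule fundamental_theorem_of_calculus)
    fix s :: real
    have "((\<lambda>z. f (x + z *\<^sub>C e)) has_field_derivative dd e f (x + of_real s *\<^sub>C e)) (at (of_real s))"
      by (rule holo_field_derivative[OF f cyl_line[OF cyl x]])
    from has_vector_derivative_real_field[OF this]
    show "((\<lambda>s. f (x + of_real s *\<^sub>C e)) has_vector_derivative dd e f (x + of_real s *\<^sub>C e))
        (at s within {0..1})"
      by simp
  qed simp
  then show ?thesis by (simp add: avg_def integral_unique)
qed

lemma line_constant:
  assumes cyl: "cyl e S" and f: "holo f S" and 0: "\<And>x. x \<in> S \<Longrightarrow> dd e f x = 0" and x: "x \<in> S"
  shows "f (x + z *\<^sub>C e) = f x"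
proof -
  have "((\<lambda>z. f (x + z *\<^sub>C e)) has_field_derivative 0) (at z)" for z
    using holo_field_derivative[OF f cyl_line[OF cyl x], of z] 0[OF cyl_line[OF cyl x]] by simp
  then have "(\<lambda>z. f (x + z *\<^sub>C e)) constant_on UNIV"
    by (intro DERIV_zero_connected_constant_on[of UNIV "{}"] DERIV_continuous_on)
      (auto simp: has_field_derivative_at_within)
  then obtain y where y: "\<And>z. f (x + z *\<^sub>C e) = y" by (auto simp: constant_on_def)
  show ?thesis using y[of z] y[of 0] by simp
qed

text \<open>This is the contour shift: the derivative of the average along \<open>e\<close> is the
  increment of \<open>f\<close> over one period, which is zero.\<close>

lemma avg_invariant:
  assumes cyl: "cyl e S" and f: "holo f S" and per: "\<And>x. x \<in> S \<Longrightarrow> f (x + e) = f x" and x: "x \<in> S"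
  shows "avg e f (x + z *\<^sub>C e) = avg e f x"
proof (rule line_constant[OF cyl holo_avg[OF cyl f] _ x])
  show "dd e (avg e f) x = 0" if "x \<in> S" for x
    using that by (simp add: dd_avg[OF cyl f] avg_dd_self[OF cyl f] per)
qed

subsection \<open>Uniqueness of Fourier coefficients\<close>

text \<open>With this sign the average of \<open>ch m\<close> times a function is its Fourier
  coefficient of index \<open>m\<close>.\<close>

definition ch :: "int \<Rightarrow> complex \<Rightarrow> complex" where
  "ch m z = exp (- (2 * of_real pi * \<i> * of_int m * z))"

lemma ch_add: "ch m (z + w) = ch m z * ch m w"
  by (simp add: ch_def ring_distribs exp_add[symmetric])

lemma ch_add_int: "ch (k + m) z = ch k z * ch m z"
  by (simp add: ch_def ring_distribs exp_add[symmetric])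

lemma ch_0 [simp]: "ch 0 z = 1" "ch m 0 = 1"
  by (simp_all add: ch_def)

lemma ch_1 [simp]: "ch m 1 = 1"
proof -
  have "exp (complex_of_real (2 * real_of_int (- m) * pi) * \<i>) = 1"
    by (rule exp_integer_2pi) (rule Ints_of_int)
  then show ?thesis by (simp add: ch_def algebra_simps)
qed

lemma ch_nonzero [simp]: "ch m z \<noteq> 0"
  by (simp add: ch_def)

lemma holomorphic_ch: "ch m holomorphic_on A"
  unfolding ch_def[abs_def] by (intro holomorphic_intros)

lemma norm_ch: "cmod (ch m z) = exp (2 * pi * of_int m * Im z)"
  by (simp add: ch_def norm_exp_eq_Re)

lemma has_field_derivative_ch:
  "(ch m has_field_derivative (- (2 * of_real pi * \<i> * of_int m)) * ch m z) (at z)"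
  unfolding ch_def[abs_def] by (auto intro!: derivative_eq_intros)

lemma holomorphic_imp_holo:
  assumes "g holomorphic_on S" "open S"
  shows "holo g S"
  unfolding holo_def
proof
  fix x assume "x \<in> S"
  then have "(g has_field_derivative deriv g x) (at x)"
    using assms by (metis holomorphic_derivI)
  then show "\<exists>f'. (g has_derivative f') (at x) \<and> (\<forall>a w. f' (a *\<^sub>C w) = a * f' w)"
    unfolding has_field_derivative_def by (auto intro!: exI[of _ "\<lambda>h. deriv g x * h"])
qed

lemma dd_one: "(g has_field_derivative D) (at z) \<Longrightarrow> dd 1 g z = D"
  using DERIV_shift[of g D 0 z] by (intro dd_unique) (simp add: add.commute)

lemma cyl_UNIV [simp]: "cyl e UNIV"
  by (simp add: cyl_def)

lemma avg_ch: "avg 1 (ch m) 0 = (if m = 0 then 1 else 0)"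
proof (cases "m = 0")
  case True
  then show ?thesis by (simp add: avg_def ch_def)
next
  case False
  have "avg 1 (dd 1 (ch m)) 0 = ch m (0 + 1) - ch m 0"
    by (rule avg_dd_self[of 1 UNIV]) (auto intro!: holomorphic_imp_holo holomorphic_ch)
  moreover have "dd 1 (ch m) = (\<lambda>z. (- (2 * of_real pi * \<i> * of_int m)) * ch m z)"
    using dd_one[OF has_field_derivative_ch] by blast
  moreover have "avg 1 (\<lambda>z. (- (2 * of_real pi * \<i> * of_int m)) * ch m z) 0 =
      (- (2 * of_real pi * \<i> * of_int m)) * avg 1 (ch m) 0"
    by (rule avg_mult_inv)  simp
  ultimately show ?thesis using False by simp
qed

lemma ch_minus_one_zero_iff: "ch (-1) z - 1 = 0 \<longleftrightarrow> (\<exists>n::int. z = of_int n)"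
proof -
  have "ch (-1) z - 1 = 0 \<longleftrightarrow> exp (2 * of_real pi * \<i> * z) = 1" by (simp add: ch_def)
  also have "\<dots> \<longleftrightarrow> (\<exists>n::int. 2 * of_real pi * \<i> * z = of_int (2 * n) * pi * \<i>)"
    by (subst exp_eq_1) (auto simp: complex_eq_iff)
  also have "\<dots> \<longleftrightarrow> (\<exists>n::int. z = of_int n)" by (auto simp: algebra_simps)
  finally show ?thesis .
qed

text \<open>By periodicity the path may be moved by one unit up or down, to the side on which the
  character is small.\<close>

lemma avg_exponential_decay:
  assumes k: "k holomorphic_on UNIV" and per: "\<And>z. k (z + 1) = k z"
  obtains M where "\<And>m. cmod (avg 1 (\<lambda>z. ch m z * k z) 0) \<le> M * exp (- (2 * pi * of_int \<bar>m\<bar>))"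
proof -
  have ck: "continuous_on A (\<lambda>s::real. k (of_real s + a))" for A a
    by (rule continuous_on_compose2[OF holomorphic_on_imp_continuous_on[OF k]])
      (auto intro!: continuous_intros)
  have "bounded ((\<lambda>s::real. k (of_real s + a)) ` {0..1})" for a
    using compact_continuous_image[OF ck] compact_imp_bounded by blast
  then have "\<forall>a. \<exists>M. \<forall>s\<in>{0..1::real}. cmod (k (of_real s + a)) \<le> M"
    by (simp add: bounded_iff)
  then obtain M where M: "\<And>a (s::real). s \<in> {0..1} \<Longrightarrow> cmod (k (of_real s + a)) \<le> M a"
    by metis
  define M' where "M' = max (M \<i>) (M (- \<i>))"
  show ?thesis
  proof
    fix m :: int
    \<comment> \<open>On the line through \<open>a\<close> the character \<open>ch m\<close> has
      modulus \<open>exp (- 2 * pi * \<bar>m\<bar>)\<close>.\<close>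
    define a where "a = (if m \<ge> 0 then - \<i> else \<i>)"
    have hol: "(\<lambda>z. ch m z * k z) holomorphic_on UNIV"
      by (intro holomorphic_intros holomorphic_ch k)
    have "avg 1 (\<lambda>z. ch m z * k z) 0 = avg 1 (\<lambda>z. ch m z * k z) (0 + a *\<^sub>C 1)"
      by (rule avg_invariant[OF cyl_UNIV holomorphic_imp_holo[OF hol], symmetric]) (auto simp: per ch_add)
    also have "\<dots> = integral {0..1} (\<lambda>s::real. ch m (of_real s + a) * k (of_real s + a))"
      by (simp add: avg_def add.commute)
    also have "cmod \<dots> \<le> (exp (- (2 * pi * of_int \<bar>m\<bar>)) * M') * (1 - 0)"
    proof (rule integral_bound)
      show "continuous_on {0..1} (\<lambda>s::real. ch m (of_real s + a) * k (of_real s + a))"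
        by (intro continuous_intros ck continuous_on_compose2[OF holomorphic_on_imp_continuous_on[OF holomorphic_ch]]) auto
      fix s :: real assume "s \<in> {0..1}"
      then have "cmod (k (of_real s + a)) \<le> M'" using M[of s a] by (auto simp: M'_def a_def)
      moreover have "cmod (ch m (of_real s + a)) = exp (- (2 * pi * of_int \<bar>m\<bar>))"
        by (auto simp: norm_ch a_def)
      ultimately show "cmod (ch m (of_real s + a) * k (of_real s + a)) \<le>
          exp (- (2 * pi * of_int \<bar>m\<bar>)) * M'"
        by (simp add: norm_mult)
    qed simp
    finally show "cmod (avg 1 (\<lambda>z. ch m z * k z) 0) \<le> M' * exp (- (2 * pi * of_int \<bar>m\<bar>))"
      by (simp add: mult.commute)
  qed
qed

lemma field_differentiable_transform_within_open:
  assumes "f field_differentiable at a" "open S" "a \<in> S" "\<And>x. x \<in> S \<Longrightarrow> f x = g x"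
  shows "g field_differentiable at a"
  using assms has_field_derivative_transform_within_open unfolding field_differentiable_def by blast

text \<open>Chernoff's argument: \<open>g - g(0) = k \<cdot> (e\<^bsup>2\<pi>iz\<^esup> - 1)\<close> turns the vanishing of the coefficients of
  \<open>g\<close> into a telescoping relation for those of \<open>k\<close>.\<close>

lemma fourier_unique_at_0:
  assumes g: "g holomorphic_on UNIV" and per: "\<And>z. g (z + 1) = g z"
    and coeff: "\<And>m. avg 1 (\<lambda>z. ch m z * g z) 0 = 0"
  shows "g 0 = 0"
proof -
  define h where "h = (\<lambda>z. g z - g 0)"
  define e where "e = (\<lambda>z. ch (-1) z - 1)"
  \<comment> \<open>At the zeros of \<open>e\<close>, which are simple, the quotient takes its limit
    value.\<close>
  define k where "k = (\<lambda>z. if e z = 0 then deriv h z / deriv e z else h z / e z)"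
  have h: "h holomorphic_on A" for A
    unfolding h_def by (intro holomorphic_intros holomorphic_on_subset[OF g]) auto
  have e: "e holomorphic_on A" for A
    unfolding e_def by (intro holomorphic_intros holomorphic_ch)
  have e0: "e z = 0 \<longleftrightarrow> (\<exists>n::int. z = of_int n)" for z
    unfolding e_def by (rule ch_minus_one_zero_iff)
  have de: "deriv e z = 2 * of_real pi * \<i> * ch (-1) z" for z
    unfolding e_def by (rule DERIV_imp_deriv) (auto intro!: derivative_eq_intros has_field_derivative_ch)
  have gint: "g (z + of_nat n) = g z" for n z
    by (induction n) (simp_all add: per add.assoc[symmetric] add.commute[of 1])
  have gint': "g (of_int n) = g 0" for n
  proof (cases "n \<ge> 0")
    case True
    then show ?thesis using gint[of 0 "nat n"] by simp
  next
    case False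
    then show ?thesis using gint[of "of_int n" "nat (- n)"] by simp
  qed
  have h0: "h z = 0" if "e z = 0" for z using that gint' by (auto simp: e0 h_def)
  have k: "k holomorphic_on UNIV"
  proof (rule holomorphic_onI)
    fix a :: complex
    show "k field_differentiable at a within UNIV"
    proof (cases "e a = 0")
      case False
      have op: "open {z. e z \<noteq> 0}"
        by (intro open_Collect_neq continuous_intros holomorphic_on_imp_continuous_on e)
      have "(\<lambda>z. h z / e z) field_differentiable at a"
        using False holomorphic_on_imp_differentiable_at[OF h[of UNIV]]
          holomorphic_on_imp_differentiable_at[OF e[of UNIV]]
        by (intro field_differentiable_divide) auto
      then show ?thesis
        by (rule field_differentiable_transform_within_open[OF _ op]) (use False in \<open>auto simp: k_def\<close>)
    next
      case True
      \<comment> \<open>Dividing numerator and denominator by \<open>z - a\<close> removes their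
        common zero at \<open>a\<close>. Both new functions are entire, and where \<open>e1\<close>
        does not vanish their quotient is \<open>k\<close>.\<close>
      define h1 where "h1 = (\<lambda>z. if z = a then deriv h a else (h z - h a) / (z - a))"
      define e1 where "e1 = (\<lambda>z. if z = a then deriv e a else (e z - e a) / (z - a))"
      have h1: "h1 holomorphic_on UNIV" unfolding h1_def by (rule pole_lemma_open[OF h]) simp
      have e1: "e1 holomorphic_on UNIV" unfolding e1_def by (rule pole_lemma_open[OF e]) simp
      have op: "open {z. e1 z \<noteq> 0}"
        by (intro open_Collect_neq continuous_intros holomorphic_on_imp_continuous_on e1)
      have e1a: "e1 a \<noteq> 0" by (simp add: e1_def de)
      have "(\<lambda>z. h1 z / e1 z) field_differentiable at a"
        using e1a holomorphic_on_imp_differentiable_at[OF h1]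
          holomorphic_on_imp_differentiable_at[OF e1]
        by (intro field_differentiable_divide) auto
      then show ?thesis
      proof (rule field_differentiable_transform_within_open[OF _ op])
        show "h1 z / e1 z = k z" if "z \<in> {z. e1 z \<noteq> 0}" for z
          using that True h0[OF True] by (auto simp: k_def h1_def e1_def split: if_splits)
      qed (use e1a in auto)
    qed
  qed
  have eper: "e (z + 1) = e z" for z by (simp add: e_def ch_add)
  have hper: "h (z + 1) = h z" for z by (simp add: h_def per)
  have dhper: "deriv h (z + 1) = deriv h z" for z
  proof -
    have "(h has_field_derivative deriv h (z + 1)) (at (z + 1))"
      using h[of UNIV] holomorphic_derivI by blast
    then have "((\<lambda>w. h (w + 1)) has_field_derivative deriv h (z + 1)) (at z)"
      by (simp add: DERIV_shift)
    then show ?thesis using hper DERIV_imp_deriv by fastforce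
  qed
  have kper: "k (z + 1) = k z" for z
    by (simp add: k_def eper hper dhper de ch_add)
  define K where "K = (\<lambda>m. avg 1 (\<lambda>z. ch m z * k z) 0)"
  have kh: "k z * e z = h z" for z using h0[of z] by (auto simp: k_def)
  have cont: "continuous_on UNIV (\<lambda>z. ch m z * k z)" "continuous_on UNIV (\<lambda>z. ch m z * g z)"
    "continuous_on UNIV (\<lambda>z. ch m z * g 0)" for m
    by (intro continuous_intros holomorphic_on_imp_continuous_on holomorphic_ch k g)+
  \<comment> \<open>Multiplication by \<open>ch (-1) - 1\<close> turns coefficients into
    differences, and the coefficients of \<open>g - g 0\<close> all vanish except the one of index
    0, which is \<open>- g 0\<close>.\<close>
  have tele: "K (m - 1) - K m = (if m = 0 then - g 0 else 0)" for m
  proof -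
    have "K (m - 1) - K m = avg 1 (\<lambda>z. ch (m - 1) z * k z - ch m z * k z) 0"
      unfolding K_def by (rule avg_diff[OF cyl_UNIV cont(1) cont(1), symmetric]) simp
    also have "(\<lambda>z. ch (m - 1) z * k z - ch m z * k z) = (\<lambda>z. ch m z * g z - ch m z * g 0)"
    proof
      fix z
      have "ch (m - 1) z * k z - ch m z * k z = ch m z * (k z * e z)"
        using ch_add_int[of m "-1" z] by (simp add: e_def algebra_simps)
      then show "ch (m - 1) z * k z - ch m z * k z = ch m z * g z - ch m z * g 0"
        unfolding kh by (simp add: h_def algebra_simps)
    qed
    also have "avg 1 \<dots> 0 = 0 - avg 1 (\<lambda>z. g 0 * ch m z) 0"
      using avg_diff[OF cyl_UNIV cont(2,3), of 0 1 m m] coeff[of m] by (simp add: mult.commute)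
    also have "avg 1 (\<lambda>z. g 0 * ch m z) 0 = g 0 * avg 1 (ch m) 0"
      by (rule avg_mult_inv) simp
    finally show ?thesis by (simp add: avg_ch)
  qed
  obtain M where M: "\<And>m. cmod (K m) \<le> M * exp (- (2 * pi * of_int \<bar>m\<bar>))"
    using avg_exponential_decay[OF k kper] unfolding K_def by metis
  have lim: "(\<lambda>n. M * exp (- (2 * pi * (real n + 1)))) \<longlonglongrightarrow> 0"
  proof -
    have "(\<lambda>n. M * exp (- (2 * pi)) * exp (- (2 * pi)) ^ n) \<longlonglongrightarrow> M * exp (- (2 * pi)) * 0"
      by (intro tendsto_mult tendsto_const LIMSEQ_realpow_zero) auto
    then show ?thesis
      by (simp add: exp_of_nat_mult[symmetric] exp_add[symmetric] algebra_simps mult_exp_exp)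
  qed
  \<comment> \<open>The coefficients of \<open>k\<close> are constant on the indices from 0 upwards
    and on those from -1 downwards. Decay makes both constants 0, and the jump between them is
    \<open>g 0\<close>.\<close>
  have up: "K (int n) = K 0" for n
  proof (induction n)
    case (Suc n)
    then show ?case using tele[of "int (Suc n)"] by simp
  qed simp
  have down: "K (- 1 - int n) = K (-1)" for n
  proof (induction n)
    case (Suc n)
    then show ?case using tele[of "- 1 - int n"] by (simp add: algebra_simps)
  qed simp
  have "cmod (K 0) \<le> 0"
  proof (rule LIMSEQ_le_const[OF lim], intro exI allI impI)
    fix n show "cmod (K 0) \<le> M * exp (- (2 * pi * (real n + 1)))"
      using M[of "int (Suc n)"] unfolding up by (simp add: add.commute)
  qed
  moreover have "cmod (K (-1)) \<le> 0"
  proof (rule LIMSEQ_le_const[OF lim], intro exI allI impI)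
    fix n show "cmod (K (-1)) \<le> M * exp (- (2 * pi * (real n + 1)))"
      using M[of "- 1 - int n"] unfolding down by (simp add: add.commute)
  qed
  ultimately show ?thesis using tele[of 0] by simp
qed

subsection \<open>Averaging over several periods\<close>

text \<open>The list fixes the order of the iterated integrals; a distinct list of all indices gives
  the mean over a full period cell.\<close>

primrec avgs :: "('i \<Rightarrow> 'a::cspace) \<Rightarrow> 'i list \<Rightarrow> ('a \<Rightarrow> complex) \<Rightarrow> 'a \<Rightarrow> complex" where
  "avgs E [] f = f"
| "avgs E (i # is) f = avg (E i) (avgs E is f)"

lemma avgs_cong:
  assumes "\<And>i. cyl (E i) S" "x \<in> S" "\<And>y. y \<in> S \<Longrightarrow> f y = g y"
  shows "avgs E is f x = avgs E is g x"
  using assms(2)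
proof (induction "is" arbitrary: x)
  case (Cons i "is")
  show ?case unfolding avgs.simps by (rule avg_cong[OF assms(1) Cons.prems Cons.IH])
qed (use assms(3) in auto)

lemma holo_avgs:
  assumes "\<And>i. cyl (E i) S" "holo f S"
  shows "holo (avgs E is f) S"
  using assms by (induction "is") (auto intro: holo_avg)

lemma dd_avgs:
  assumes cyl: "\<And>i. cyl (E i) S" and f: "holo f S" and "x \<in> S"
  shows "dd w (avgs E is f) x = avgs E is (dd w f) x"
  using assms(3)
proof (induction "is" arbitrary: x)
  case (Cons i "is")
  have "dd w (avgs E (i # is) f) x = avg (E i) (dd w (avgs E is f)) x"
    by (simp add: dd_avg[OF cyl holo_avgs[OF cyl f] Cons.prems])
  also have "\<dots> = avg (E i) (avgs E is (dd w f)) x"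
    by (rule avg_cong[OF cyl Cons.prems Cons.IH])
  finally show ?case by simp
qed simp

lemma avgs_shift: "avgs E is (\<lambda>x. f (x + p)) x = avgs E is f (x + p)"
proof (induction "is" arbitrary: x)
  case (Cons i "is")
  then have "avgs E is (\<lambda>x. f (x + p)) = (\<lambda>x. avgs E is f (x + p))" by auto
  then show ?case by (simp add: avg_shift)
qed simp

lemma avgs_mult_inv:
  assumes "\<And>x i s. i \<in> set is \<Longrightarrow> g (x + s *\<^sub>C E i) = g x"
  shows "avgs E is (\<lambda>x. g x * f x) x = g x * avgs E is f x"
  using assms
proof (induction "is" arbitrary: x)
  case (Cons i "is")
  then have "avgs E is (\<lambda>x. g x * f x) = (\<lambda>x. g x * avgs E is f x)" by auto
  then show ?case using Cons.prems by (simp add: avg_mult_inv)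
qed simp

lemma avgs_periodic:
  assumes cyl: "\<And>i. cyl (E i) S" and per: "\<And>x i. x \<in> S \<Longrightarrow> f (x + E i) = f x" and "x \<in> S"
  shows "avgs E is f (x + E j) = avgs E is f x"
proof -
  have "avgs E is f (x + E j) = avgs E is (\<lambda>x. f (x + E j)) x" by (simp add: avgs_shift)
  also have "\<dots> = avgs E is f x" by (rule avgs_cong[OF cyl assms(3) per])
  finally show ?thesis .
qed

text \<open>If \<open>j\<close> occurs in the tail, the inner average is already invariant;
  otherwise \<open>j\<close> is the head, and the contour shift applies to the inner average, which
  is still periodic.\<close>

lemma avgs_invariant:
  assumes cyl: "\<And>i. cyl (E i) S" and f: "holo f S"
    and per: "\<And>x i. x \<in> S \<Longrightarrow> f (x + E i) = f x" and "x \<in> S" "j \<in> set is"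
  shows "avgs E is f (x + z *\<^sub>C E j) = avgs E is f x"
  using assms(4,5)
proof (induction "is" arbitrary: x)
  case (Cons i "is")
  show ?case
  proof (cases "j \<in> set is")
    case True
    have "avgs E (i # is) f (x + z *\<^sub>C E j) = avg (E i) (\<lambda>x. avgs E is f (x + z *\<^sub>C E j)) x"
      by (simp add: avg_shift)
    also have "\<dots> = avg (E i) (avgs E is f) x"
      by (rule avg_cong[OF cyl Cons.prems(1)]) (use Cons.IH True in auto)
    finally show ?thesis by simp
  next
    case False
    then have "j = i" using Cons.prems by simp
    have "avgs E is f (y + E j) = avgs E is f y" if "y \<in> S" for y
      by (rule avgs_periodic[where S = S]) (use cyl per that in auto)
    then have "avg (E j) (avgs E is f) (x + z *\<^sub>C E j) = avg (E j) (avgs E is f) x"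
      by (rule avg_invariant[OF cyl holo_avgs[OF cyl f] _ Cons.prems(1)])
    then show ?thesis using \<open>j = i\<close> by simp
  qed
qed simp

section \<open>Fourier coefficients in several variables\<close>

definition chr :: "(int, 'n::finite) vec \<Rightarrow> (complex, 'n) vec \<Rightarrow> complex" where
  "chr m y = (\<Prod>j\<in>UNIV. ch (m $ j) (y $ j))"

abbreviation ax :: "'n::finite \<Rightarrow> (complex, 'n) vec" where "ax i \<equiv> axis i 1"

lemma chr_add: "chr m (x + y) = chr m x * chr m y"
  by (simp add: chr_def ch_add prod.distrib)

lemma chr_nonzero [simp]: "chr m y \<noteq> 0"
  by (simp add: chr_def)

lemma chr_axis [simp]: "chr m (axis i z) = ch (m $ i) z"
proof -
  have "chr m (axis i z) = (\<Prod>j\<in>UNIV. if j = i then ch (m $ i) z else 1)"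
    unfolding chr_def by (rule prod.cong) (auto simp: axis_def)
  then show ?thesis by (simp add: prod.delta)
qed

lemma cscale_axis: "z *\<^sub>C axis i w = axis i (z * w :: complex)"
  by (auto simp: vec_eq_iff axis_def)

lemma sum_axis: "(\<Sum>j\<in>UNIV. axis j (m $ j)) = m" for m :: "('a::comm_monoid_add, 'n::finite) vec"
  by (simp add: vec_eq_iff axis_def sum.delta)

lemma chr_add_axis: "chr (m + axis i k) y = ch k (y $ i) * chr m y"
proof -
  have "chr (m + axis i k) y = (\<Prod>j\<in>UNIV. (if j = i then ch k (y $ i) else 1) * ch (m $ j) (y $ j))"
    unfolding chr_def by (rule prod.cong) (auto simp: axis_def ch_add_int mult.commute)
  then show ?thesis by (simp add: prod.distrib prod.delta chr_def)
qed

lemma holo_nth: "holo (\<lambda>y::(complex, 'n::finite) vec. y $ i) S"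
  by (rule holo_linear) (auto intro: bounded_linear_vec_nth)

lemma holo_compose_ch:
  assumes "holo f S" shows "holo (\<lambda>x. ch m (f x)) S"
proof -
  have "holo (\<lambda>x. exp (- (2 * of_real pi * \<i> * of_int m) * f x)) S"
    by (intro holo_exp holo_cmult assms)
  then show ?thesis by (simp add: ch_def)
qed

lemma holo_prod: "(\<And>i. i \<in> A \<Longrightarrow> holo (f i) S) \<Longrightarrow> holo (\<lambda>x. \<Prod>i\<in>A. f i x) S"
  by (induction A rule: infinite_finite_induct) (auto intro!: holo_mult)

lemma holo_chr: "holo (chr m) S"
  unfolding chr_def[abs_def] by (intro holo_prod holo_compose_ch holo_nth)

text \<open>One variable is removed at a time: the average over the remaining variables is a
  periodic function of this one, and the one-variable uniqueness theorem applies to it. The support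
  condition on \<open>m\<close> keeps the characters to the variables averaged so far.\<close>

lemma avgs_unique:
  fixes f :: "(complex, 'n::finite) vec \<Rightarrow> complex"
  assumes f: "holo f UNIV" and per: "\<And>y i. f (y + ax i) = f y"
    and "distinct is"
    and "\<And>m y. (\<And>j. j \<notin> set is \<Longrightarrow> m $ j = 0) \<Longrightarrow> avgs ax is (\<lambda>y. chr m y * f y) y = 0"
  shows "f y = 0"
  using assms(3,4)
proof (induction "is")
  case Nil
  from Nil.prems(2)[of 0 y] show ?case by (simp add: chr_def)
next
  case (Cons i "is")
  show ?case
  proof (rule Cons.IH)
    show "distinct is" using Cons.prems by simp
    fix m :: "(int, 'n) vec" and y :: "(complex, 'n) vec"
    assume m: "\<And>j. j \<notin> set is \<Longrightarrow> m $ j = 0"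
    define K where "K = avgs ax is (\<lambda>y. chr m y * f y)"
    have hK: "holo (\<lambda>y. chr m y * f y) UNIV" by (intro holo_mult holo_chr f)
    have holoK: "holo K UNIV" unfolding K_def by (rule holo_avgs[OF _ hK]) simp
    have perK: "K (y + ax i) = K y" for y
      unfolding K_def by (rule avgs_periodic[of ax UNIV]) (auto simp: per chr_add)
    have z: "avg (ax i) (\<lambda>y. ch k (y $ i) * K y) y = 0" for k y
    proof -
      have "avgs ax is (\<lambda>y. ch k (y $ i) * (chr m y * f y)) = (\<lambda>y. ch k (y $ i) * K y)"
        unfolding K_def
      proof
        fix y
        show "avgs ax is (\<lambda>y. ch k (y $ i) * (chr m y * f y)) y =
            ch k (y $ i) * avgs ax is (\<lambda>y. chr m y * f y) y"
          by (rule avgs_mult_inv) (use Cons.prems(1) in \<open>auto simp: axis_def\<close>)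
      qed
      then have "avg (ax i) (\<lambda>y. ch k (y $ i) * K y) y =
          avgs ax (i # is) (\<lambda>y. chr (m + axis i k) y * f y) y"
        by (simp add: chr_add_axis mult.assoc)
      also have "\<dots> = 0" by (rule Cons.prems(2)) (use m in \<open>auto simp: axis_def\<close>)
      finally show ?thesis .
    qed
    have "(\<lambda>z. K (y + z *\<^sub>C ax i)) 0 = 0"
    proof (rule fourier_unique_at_0)
      show "(\<lambda>z. K (y + z *\<^sub>C ax i)) holomorphic_on UNIV"
        by (rule holo_holomorphic_line[OF holoK]) simp
      show "K (y + (z + 1) *\<^sub>C ax i) = K (y + z *\<^sub>C ax i)" for z
        using perK[of "y + z *\<^sub>C ax i"] by (simp add: cscale_add_left add.assoc)
      fix k
      have "0 = avg (ax i) (\<lambda>y. ch k (y $ i) * K y) y" by (simp add: z)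
      \<comment> \<open>Moving the base point from y to the origin of the line only produces a
        nonzero factor.\<close>
      also have "\<dots> = ch k (y $ i) * avg 1 (\<lambda>z. ch k z * K (y + z *\<^sub>C ax i)) 0"
        by (simp add: avg_def ch_add mult.assoc)
      finally show "avg 1 (\<lambda>z. ch k z * K (y + z *\<^sub>C ax i)) 0 = 0" by simp
    qed
    then show "avgs ax is (\<lambda>y. chr m y * f y) y = 0" unfolding K_def by simp
  qed
qed

text \<open>A quasi-periodic function is determined by its zeroth Fourier coefficient: a shift by a column
  of \<open>T\<close> leaves the averages unchanged but multiplies the function by the next character.\<close>

lemma quasi_periodic_zero:
  fixes f :: "(complex, 'n::finite) vec \<Rightarrow> complex"
  assumes f: "holo f UNIV" and per: "\<And>y i. f (y + ax i) = f y"
    and quasi: "\<And>y i. exp (b i + 2 * of_real pi * \<i> * y $ i) * f (y + t i) = f y"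
    and "is": "distinct is" "set is = UNIV" and 0: "avgs ax is f 0 = 0"
  shows "f y = 0"
proof -
  define C where "C = (\<lambda>m. avgs ax is (\<lambda>y. chr m y * f y) 0)"
  have inv: "avgs ax is (\<lambda>y. chr m y * f y) y = C m" for m y
  proof -
    have h: "holo (\<lambda>y. chr m y * f y) UNIV" by (intro holo_mult holo_chr f)
    have "avgs ax is (\<lambda>y. chr m y * f y) (x + z *\<^sub>C ax j) = avgs ax is (\<lambda>y. chr m y * f y) x" for x z j
      by (rule avgs_invariant[OF _ h]) (auto simp: per chr_add "is")
    note step = this
    have "avgs ax is (\<lambda>y. chr m y * f y) (0 + (\<Sum>j\<in>A. (y $ j) *\<^sub>C ax j)) = C m" if "finite A" for A
      using that
    proof (induction A)
      case (insert j A)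
      have eq: "0 + (\<Sum>j\<in>insert j A. (y $ j) *\<^sub>C ax j) = (0 + (\<Sum>j\<in>A. (y $ j) *\<^sub>C ax j)) + (y $ j) *\<^sub>C ax j"
        using insert by (simp add: add.commute)
      show ?case unfolding eq step by (rule insert.IH)
    qed (simp add: C_def)
    note sum = this
    show ?thesis
    proof -
      have "(\<Sum>j\<in>UNIV. (y $ j) *\<^sub>C ax j) = y"
        by (simp add: cscale_axis sum_axis)
      then show ?thesis using sum[OF finite_class.finite_UNIV] by (simp only: add_0_left)
    qed
  qed
  have shift: "C m = 0 \<longleftrightarrow> C (m + axis i 1) = 0" for m i
  proof -
    \<comment> \<open>The character \<open>ch 1\<close> cancels the linear part of the automorphy
      factor, so that a shift of the argument by \<open>t i\<close> becomes a shift of the index by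
      one.\<close>
    have eq: "chr (m + axis i 1) y * f y = (exp (b i) * inverse (chr m (t i))) * (chr m (y + t i) * f (y + t i))" for y
    proof -
      have "ch 1 (y $ i) * exp (b i + 2 * of_real pi * \<i> * y $ i) = exp (b i)"
        by (simp add: ch_def exp_add[symmetric])
      then have "ch 1 (y $ i) * f y = exp (b i) * f (y + t i)"
        using quasi[of i y] by (metis mult.assoc)
      then show ?thesis by (simp add: chr_add_axis chr_add field_simps)
    qed
    have "C (m + axis i 1) = avgs ax is (\<lambda>y. (exp (b i) * inverse (chr m (t i))) * (chr m (y + t i) * f (y + t i))) 0"
      by (simp add: C_def eq)
    also have "\<dots> = (exp (b i) * inverse (chr m (t i))) * avgs ax is (\<lambda>y. chr m (y + t i) * f (y + t i)) 0"
      by (rule avgs_mult_inv) simp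
    also have "avgs ax is (\<lambda>y. chr m (y + t i) * f (y + t i)) 0 = C m"
      using avgs_shift[of ax "is" "\<lambda>y. chr m y * f y" "t i" 0] inv by simp
    finally show ?thesis by simp
  qed
  \<comment> \<open>Only vanishing is transported, and in both directions, so that negative steps
    reduce to positive ones.\<close>
  have shiftn: "C m = 0 \<longleftrightarrow> C (m + axis i (int n)) = 0" for m i n
  proof (induction n)
    case (Suc n)
    have "m + axis i (int (Suc n)) = (m + axis i (int n)) + axis i 1"
      by (auto simp: vec_eq_iff axis_def)
    then show ?case using Suc shift by metis
  next
    case 0
    have "m + axis i 0 = m" by (auto simp: vec_eq_iff axis_def)
    then show ?case by (simp only: of_nat_0)
  qed
  have shiftz: "C m = 0 \<longleftrightarrow> C (m + axis i k) = 0" for m i k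
  proof (cases "k \<ge> 0")
    case True
    then show ?thesis using shiftn[of m i "nat k"] by simp
  next
    case False
    have "m + axis i k + axis i (int (nat (- k))) = m"
      using False by (auto simp: vec_eq_iff axis_def)
    then show ?thesis using shiftn[of "m + axis i k" i "nat (- k)"] by (simp only:)
  qed
  have "C (\<Sum>j\<in>A. axis j (m $ j)) = 0" if "finite A" for A m
    using that
  proof (induction A)
    case empty
    have "chr (0::(int, 'n) vec) y = 1" for y by (simp add: chr_def)
    then show ?case using 0 by (simp add: C_def)
  next
    case (insert j A)
    then show ?case using shiftz[of "\<Sum>j\<in>A. axis j (m $ j)" j "m $ j"] by (simp add: add.commute)
  qed
  from this[OF finite_class.finite_UNIV] have C0: "C m = 0" for m by (simp add: sum_axis)
  show ?thesis
    by (rule avgs_unique[OF f per "is"(1)]) (simp add: inv C0)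
qed

subsection \<open>Exterior algebra\<close>

text \<open>\<open>X i\<close> and \<open>del i\<close> are left multiplication by \<open>\<xi>\<^sub>i\<close> and the left derivative \<open>\<partial>/\<partial>\<xi>\<^sub>i\<close> on the families
  of coefficients of elements of the exterior algebra.\<close>

definition sg :: "'n::{finite,linorder} \<Rightarrow> 'n set \<Rightarrow> complex" where
  "sg i I = (-1) ^ card {k\<in>I. k < i}"

definition X :: "'n::{finite,linorder} \<Rightarrow> ('n set \<Rightarrow> complex) \<Rightarrow> 'n set \<Rightarrow> complex" where
  "X i a I = (if i \<in> I then sg i I * a (I - {i}) else 0)"

definition del :: "'n::{finite,linorder} \<Rightarrow> ('n set \<Rightarrow> complex) \<Rightarrow> 'n set \<Rightarrow> complex" where
  "del i a I = (if i \<in> I then 0 else sg i I * a (insert i I))"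

lemma sg_square [simp]: "sg i I * sg i I = 1"
  by (simp add: sg_def power_mult_distrib[symmetric])

lemma sg_empty [simp]: "sg i {} = 1"
  by (simp add: sg_def)

lemma sg_insert: "j \<notin> I \<Longrightarrow> sg i (insert j I) = (if j < i then - sg i I else sg i I)"
proof -
  assume j: "j \<notin> I"
  have "{k \<in> insert j I. k < i} = (if j < i then insert j {k\<in>I. k < i} else {k\<in>I. k < i})"
    by auto
  then show ?thesis using j by (simp add: sg_def)
qed

lemma sg_remove: "j \<in> I \<Longrightarrow> sg i (I - {j}) = (if j < i then - sg i I else sg i I)"
  using sg_insert[of j "I - {j}" i] by (auto simp: insert_absorb split: if_splits)

lemma X_anticommute: "X i (X j a) I = - X j (X i a) I"
proof (cases "i \<in> I \<and> j \<in> I \<and> i \<noteq> j")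
  case True
  then have "X i (X j a) I = sg i I * (sg j (I - {i}) * a (I - {i} - {j}))"
    "X j (X i a) I = sg j I * (sg i (I - {j}) * a (I - {j} - {i}))"
    by (auto simp: X_def)
  moreover have "I - {i} - {j} = I - {j} - {i}" by auto
  moreover have "i < j \<or> j < i" using True by auto
  ultimately show ?thesis using True by (auto simp: sg_remove not_less_iff_gr_or_eq)
qed (auto simp: X_def)

lemma del_anticommute: "del i (del j a) I = - del j (del i a) I"
proof (cases "i \<notin> I \<and> j \<notin> I \<and> i \<noteq> j")
  case True
  then have "del i (del j a) I = sg i I * (sg j (insert i I) * a (insert j (insert i I)))"
    "del j (del i a) I = sg j I * (sg i (insert j I) * a (insert i (insert j I)))"
    by (auto simp: del_def)
  moreover have "insert j (insert i I) = insert i (insert j I)" by auto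
  moreover have "i < j \<or> j < i" using True by auto
  ultimately show ?thesis using True by (auto simp: sg_insert not_less_iff_gr_or_eq)
qed (auto simp: del_def)

lemma del_X: "del i (X j a) I = (if i = j then a I else 0) - X j (del i a) I"
proof (cases "i = j")
  case True
  show ?thesis
  proof (cases "i \<in> I")
    case True
    then have "X i (del i a) I = sg i I * (sg i (I - {i}) * a (insert i (I - {i})))"
      by (simp add: X_def del_def)
    also have "\<dots> = a I" using True by (simp add: sg_remove insert_absorb mult.assoc[symmetric])
    finally show ?thesis using True \<open>i = j\<close> by (simp add: del_def)
  next
    case False
    then have "del i (X i a) I = sg i I * (sg i (insert i I) * a (insert i I - {i}))"
      by (simp add: X_def del_def)
    also have "\<dots> = a I" using False by (simp add: sg_insert mult.assoc[symmetric])
    finally show ?thesis using False \<open>i = j\<close> by (simp add: X_def)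
  qed
next
  case False
  show ?thesis
  proof (cases "i \<notin> I \<and> j \<in> I")
    case True
    then have "del i (X j a) I = sg i I * (sg j (insert i I) * a (insert i I - {j}))"
      "X j (del i a) I = sg j I * (sg i (I - {j}) * a (insert i (I - {j})))"
      using False by (auto simp: X_def del_def)
    moreover have "insert i I - {j} = insert i (I - {j})" using False by auto
    moreover have "i < j \<or> j < i" using False by auto
    ultimately show ?thesis
      using True False by (auto simp: sg_insert sg_remove not_less_iff_gr_or_eq)
  qed (use False in \<open>auto simp: X_def del_def\<close>)
qed

lemma X_zero: "X i (\<lambda>I. 0) I = 0"
  and X_uminus: "X i (\<lambda>I. - a I) I = - X i a I"
  and X_plus: "X i (\<lambda>I. a I + b I) I = X i a I + X i b I"
  and X_minus: "X i (\<lambda>I. a I - b I) I = X i a I - X i b I"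
  and X_cmult: "X i (\<lambda>I. k * a I) I = k * X i a I"
  and X_sum: "X i (\<lambda>I. \<Sum>j\<in>A. f j I) I = (\<Sum>j\<in>A. X i (f j) I)"
  by (auto simp: X_def algebra_simps sum_distrib_left)

lemma del_plus: "del i (\<lambda>I. a I + b I) I = del i a I + del i b I"
  and del_minus: "del i (\<lambda>I. a I - b I) I = del i a I - del i b I"
  and del_cmult: "del i (\<lambda>I. k * a I) I = k * del i a I"
  and del_sum: "del i (\<lambda>I. \<Sum>j\<in>A. f j I) I = (\<Sum>j\<in>A. del i (f j) I)"
  by (auto simp: del_def algebra_simps sum_distrib_left)

subsection \<open>Symmetrised superfunctions\<close>

text \<open>A function on an open set of symmetric matrices is composed with the symmetrisation
  \<open>v \<mapsto> (v + v\<^sup>t)/2\<close>, which makes it a function on an open set of matrices; then \<open>\<partial>\<^sub>i\<^sub>j\<close> is the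
  derivative in the direction of the matrix unit \<open>(i, j)\<close>.\<close>

definition symm :: "'n::finite cmatrix \<Rightarrow> 'n cmatrix" where
  "symm v = (\<chi> i j. (v $ i $ j + v $ j $ i) / 2)"

definition Em :: "'n::finite \<Rightarrow> 'n \<Rightarrow> 'n cmatrix" where
  "Em i j = (\<chi> k l. if k = i \<and> l = j then 1 else 0)"

lemma symm_nth [simp]: "symm v $ i $ j = (v $ i $ j + v $ j $ i) / 2"
  by (simp add: symm_def)

lemma symm_symm [simp]: "symm (symm v) = symm v"
proof -
  have "((a + b) / 2 + (b + a) / 2) / 2 = (a + b) / 2" for a b :: complex
    by (simp add: field_simps)
  then show ?thesis by (simp only: vec_eq_iff symm_nth) simp
qed

lemma symm_add: "symm (v + w) = symm v + symm w"
  by (simp add: vec_eq_iff field_simps)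

lemma symm_cscale: "symm (a *\<^sub>C v) = a *\<^sub>C symm v"
  by (simp add: vec_eq_iff field_simps)

lemma symm_sym: "transpose v = v \<Longrightarrow> symm v = v"
  by (simp add: vec_eq_iff transpose_def)

lemma transpose_symm [simp]: "transpose (symm v) = symm v"
  by (simp add: vec_eq_iff transpose_def)

lemma Em_nth: "Em i j $ k $ l = (if k = i \<and> l = j then 1 else 0)"
  by (simp add: Em_def)

lemma symm_Em: "symm (Em i j) = symm (Em j i)"
proof -
  have "Em i j $ k $ l = Em j i $ l $ k" for k l by (simp add: Em_nth conj_commute)
  then have "symm (Em i j) $ k $ l = symm (Em j i) $ k $ l" for k l
    unfolding symm_nth by (metis add.commute)
  then show ?thesis by (simp add: vec_eq_iff del: symm_nth)
qed

lemma matrix_unit_expansion: "v = (\<Sum>i\<in>UNIV. \<Sum>j\<in>UNIV. (v $ i $ j) *\<^sub>C Em i j)"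
proof -
  have "(\<Sum>i\<in>UNIV. \<Sum>j\<in>UNIV. v $ i $ j * (if k = i \<and> l = j then 1 else 0)) = v $ k $ l" for k l
  proof -
    have "(\<Sum>i\<in>UNIV. \<Sum>j\<in>UNIV. v $ i $ j * (if k = i \<and> l = j then 1 else 0)) =
        (\<Sum>i\<in>UNIV. if i = k then (\<Sum>j\<in>UNIV. if j = l then v $ i $ j else 0) else 0)"
    proof (intro sum.cong refl)
      fix i
      show "(\<Sum>j\<in>UNIV. v $ i $ j * (if k = i \<and> l = j then 1 else 0)) =
          (if i = k then (\<Sum>j\<in>UNIV. if j = l then v $ i $ j else 0) else 0)"
        by (cases "i = k") (auto intro!: sum.cong simp del: sum.delta sum.delta')
    qed
    also have "\<dots> = v $ k $ l" by simp
    finally show ?thesis .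
  qed
  then have "v $ k $ l = (\<Sum>i\<in>UNIV. \<Sum>j\<in>UNIV. (v $ i $ j) *\<^sub>C Em i j) $ k $ l" for k l
    by (simp only: sum_component cscale_nth cscale_mult Em_nth)
  then show ?thesis unfolding vec_eq_iff by blast
qed

lemma bounded_linear_symm: "bounded_linear (symm :: 'n::finite cmatrix \<Rightarrow> _)"
proof -
  have "linear (symm :: 'n cmatrix \<Rightarrow> _)"
    by (rule linearI)
      (auto simp: vec_eq_iff scaleR_conv_of_real[where 'a = complex] add_divide_distrib ring_distribs)
  then show ?thesis by (simp add: linear_conv_bounded_linear)
qed

lemma holo_if:
  "(P \<Longrightarrow> holo f S) \<Longrightarrow> (\<not> P \<Longrightarrow> holo g S) \<Longrightarrow> holo (\<lambda>x. if P then f x else g x) S"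
  by (cases P) simp_all

text \<open>After symmetrisation, \<open>XX i\<close>, \<open>pd i j\<close> and \<open>VV i j\<close> are multiplication by \<open>\<xi>\<^sub>i\<close>, the derivation
  \<open>\<partial>\<^sub>i\<^sub>j\<close> and multiplication by \<open>v\<^sub>i\<^sub>j\<close>, and \<open>Sp i\<close>, \<open>Sq i\<close> are the operators of the odd generators
  \<open>p\<^sub>i\<close>, \<open>q\<^sub>i\<close>.\<close>

definition shol :: "'n::{finite,linorder} cmatrix set \<Rightarrow> 'n superfun \<Rightarrow> bool" where
  "shol W \<Phi> \<longleftrightarrow> (\<forall>I. holo (\<Phi> I) W) \<and> (\<forall>I v. \<Phi> I (symm v) = \<Phi> I v)"

definition XX :: "'n::{finite,linorder} \<Rightarrow> 'n superfun \<Rightarrow> 'n superfun" where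
  "XX i \<Phi> = (\<lambda>I v. X i (\<lambda>I. \<Phi> I v) I)"

definition pd :: "'n::{finite,linorder} \<Rightarrow> 'n \<Rightarrow> 'n superfun \<Rightarrow> 'n superfun" where
  "pd i j \<Phi> = (\<lambda>I. dd (Em i j) (\<Phi> I))"

definition VV :: "'n::{finite,linorder} \<Rightarrow> 'n \<Rightarrow> 'n superfun \<Rightarrow> 'n superfun" where
  "VV i j \<Phi> = (\<lambda>I v. symm v $ i $ j * \<Phi> I v)"

definition Sp :: "'n::{finite,linorder} \<Rightarrow> 'n superfun \<Rightarrow> 'n superfun" where
  "Sp i \<Phi> = (\<lambda>I v. del i (\<lambda>I. \<Phi> I v) I - (\<Sum>j\<in>UNIV. XX j (pd i j \<Phi>) I v))"

definition Sq :: "'n::{finite,linorder} \<Rightarrow> 'n superfun \<Rightarrow> 'n superfun" where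
  "Sq i \<Phi> = (\<lambda>I v. (\<Sum>j\<in>UNIV. VV j i (Sp j \<Phi>) I v - 1 / 2 * XX j (XX i (Sp j \<Phi>)) I v) -
     1 / 2 * XX i \<Phi> I v)"

lemma shol_holo: "shol W \<Phi> \<Longrightarrow> holo (\<Phi> I) W"
  by (simp add: shol_def)

lemma shol_symm: "shol W \<Phi> \<Longrightarrow> \<Phi> I (symm v) = \<Phi> I v"
  by (simp add: shol_def)

lemma dd_symm:
  assumes "\<And>v. f (symm v) = f v"
  shows "dd w f (symm v) = dd w f v"
proof -
  have "f (symm v + z *\<^sub>C w) = f (v + z *\<^sub>C w)" for z
    using assms[of "symm v + z *\<^sub>C w"] assms[of "v + z *\<^sub>C w"] by (simp add: symm_add symm_cscale)
  then show ?thesis by (simp add: dd_def)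
qed

text \<open>Through \<open>symm\<close> the two matrix units become the same direction.\<close>

lemma dd_Em_commute:
  assumes "\<And>v. f (symm v) = f v"
  shows "dd (Em i j) f v = dd (Em j i) f v"
proof -
  have "f (v + z *\<^sub>C Em i j) = f (v + z *\<^sub>C Em j i)" for z
    using assms[of "v + z *\<^sub>C Em i j"] assms[of "v + z *\<^sub>C Em j i"]
    by (simp add: symm_add symm_cscale symm_Em[of i j])
  then show ?thesis by (simp add: dd_def)
qed

lemma pd_swap: "shol W \<Phi> \<Longrightarrow> pd i j \<Phi> I v = pd j i \<Phi> I v"
  by (simp add: pd_def dd_Em_commute shol_symm)

lemma holo_symm_nth: "holo (\<lambda>v::'n::finite cmatrix. symm v $ i $ j) S"
  and dd_symm_nth: "dd w (\<lambda>v::'n::finite cmatrix. symm v $ i $ j) x = symm w $ i $ j"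
proof -
  have bl: "bounded_linear (\<lambda>v::'n cmatrix. symm v $ i $ j)"
    using bounded_linear_compose[OF bounded_linear_vec_nth
        bounded_linear_compose[OF bounded_linear_vec_nth bounded_linear_symm]] .
  show "holo (\<lambda>v::'n cmatrix. symm v $ i $ j) S"
    by (rule holo_linear[OF bl]) (simp add: field_simps)
  show "dd w (\<lambda>v::'n cmatrix. symm v $ i $ j) x = symm w $ i $ j"
    by (rule dd_linear_fun[OF bl]) (simp add: field_simps)
qed

context
  fixes W :: "'n::{finite,linorder} cmatrix set"
  assumes W: "open W"
begin

lemma shol_pd: "shol W \<Phi> \<Longrightarrow> shol W (pd i j \<Phi>)"
  unfolding shol_def pd_def using holo_dd[OF W] dd_symm by blast

lemma shol_XX: "shol W \<Phi> \<Longrightarrow> shol W (XX i \<Phi>)"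
  by (auto simp: shol_def XX_def X_def intro!: holo_if holo_cmult)

lemma shol_del: "shol W \<Phi> \<Longrightarrow> shol W (\<lambda>I v. del i (\<lambda>I. \<Phi> I v) I)"
  by (auto simp: shol_def del_def intro!: holo_if holo_cmult)

lemma shol_VV: "shol W \<Phi> \<Longrightarrow> shol W (VV i j \<Phi>)"
  unfolding shol_def VV_def by (simp only: symm_symm) (auto intro!: holo_mult holo_symm_nth simp del: symm_nth)

lemma shol_diff: "shol W \<Phi> \<Longrightarrow> shol W \<Psi> \<Longrightarrow> shol W (\<lambda>I v. \<Phi> I v - \<Psi> I v)"
  by (auto simp: shol_def intro!: holo_diff)

lemma shol_cmult: "shol W \<Phi> \<Longrightarrow> shol W (\<lambda>I v. k * \<Phi> I v)"
  by (auto simp: shol_def intro!: holo_cmult)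

lemma shol_sum: "(\<And>j. j \<in> A \<Longrightarrow> shol W (f j)) \<Longrightarrow> shol W (\<lambda>I v. \<Sum>j\<in>A. f j I v)"
  by (auto simp: shol_def intro!: holo_sum)

lemma shol_Sp: "shol W \<Phi> \<Longrightarrow> shol W (Sp i \<Phi>)"
  unfolding Sp_def by (intro shol_diff shol_del shol_sum shol_XX shol_pd)

lemma shol_Sq: "shol W \<Phi> \<Longrightarrow> shol W (Sq i \<Phi>)"
  unfolding Sq_def by (intro shol_diff shol_sum shol_VV shol_cmult shol_XX shol_Sp)

text \<open>Derivatives on the open set \<open>W\<close> see only values there, so equality over
  \<open>W\<close> is a congruence for all operators; equality as functions would be too strong,
  since nothing is known outside \<open>W\<close>.\<close>

definition eqW :: "'n superfun \<Rightarrow> 'n superfun \<Rightarrow> bool" where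
  "eqW \<Phi> \<Psi> \<longleftrightarrow> (\<forall>v\<in>W. \<forall>I. \<Phi> I v = \<Psi> I v)"

lemma eqWD: "eqW \<Phi> \<Psi> \<Longrightarrow> v \<in> W \<Longrightarrow> \<Phi> I v = \<Psi> I v"
  by (simp add: eqW_def)

lemma eqW_refl [simp]: "eqW \<Phi> \<Phi>"
  by (simp add: eqW_def)

lemma eqW_sym: "eqW \<Phi> \<Psi> \<Longrightarrow> eqW \<Psi> \<Phi>"
  by (simp add: eqW_def)

lemma eqW_trans: "eqW \<Phi> \<Psi> \<Longrightarrow> eqW \<Psi> \<Xi> \<Longrightarrow> eqW \<Phi> \<Xi>"
  by (simp add: eqW_def)

lemma eqW_pd: "eqW \<Phi> \<Psi> \<Longrightarrow> eqW (pd i j \<Phi>) (pd i j \<Psi>)"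
  unfolding eqW_def pd_def by (auto intro!: dd_cong_open[OF W])

lemma eqW_XX: "eqW \<Phi> \<Psi> \<Longrightarrow> eqW (XX i \<Phi>) (XX i \<Psi>)"
  unfolding eqW_def XX_def by (auto simp: X_def)

lemma eqW_Sp: "eqW \<Phi> \<Psi> \<Longrightarrow> eqW (Sp i \<Phi>) (Sp i \<Psi>)"
  using eqW_XX[OF eqW_pd, of \<Phi> \<Psi>]
  by (auto simp: eqW_def Sp_def del_def intro!: arg_cong2[of _ _ _ _ "(-)"] sum.cong)

lemma eqW_Sq: "eqW \<Phi> \<Psi> \<Longrightarrow> eqW (Sq i \<Phi>) (Sq i \<Psi>)"
  using eqW_Sp[of \<Phi> \<Psi>] eqW_XX[OF eqW_XX[OF eqW_Sp], of \<Phi> \<Psi>] eqW_XX[of \<Phi> \<Psi>]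
  by (auto simp: eqW_def Sq_def VV_def)

lemma pd_XX: "shol W \<Phi> \<Longrightarrow> v \<in> W \<Longrightarrow> pd i j (XX k \<Phi>) I v = XX k (pd i j \<Phi>) I v"
  by (auto simp: pd_def XX_def X_def dd_cmult[OF shol_holo])

lemma pd_del: "shol W \<Phi> \<Longrightarrow> v \<in> W \<Longrightarrow>
    pd i j (\<lambda>I v. del k (\<lambda>I. \<Phi> I v) I) I v = del k (\<lambda>I. pd i j \<Phi> I v) I"
  by (auto simp: pd_def del_def dd_cmult[OF shol_holo])

lemma pd_VV: "shol W \<Phi> \<Longrightarrow> v \<in> W \<Longrightarrow>
    pd i j (VV k l \<Phi>) I v = VV k l (pd i j \<Phi>) I v + symm (Em i j) $ k $ l * \<Phi> I v"
  unfolding pd_def VV_def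
  by (subst dd_times[OF holo_symm_nth shol_holo]) (auto simp: dd_symm_nth simp del: symm_nth)

lemma pd_sum: "(\<And>k. k \<in> A \<Longrightarrow> shol W (f k)) \<Longrightarrow> v \<in> W \<Longrightarrow>
    pd i j (\<lambda>I v. \<Sum>k\<in>A. f k I v) I v = (\<Sum>k\<in>A. pd i j (f k) I v)"
  unfolding pd_def by (rule dd_sum_fun[of _ _ W]) (auto intro: shol_holo)

lemma pd_diff: "shol W \<Phi> \<Longrightarrow> shol W \<Psi> \<Longrightarrow> v \<in> W \<Longrightarrow>
    pd i j (\<lambda>I v. \<Phi> I v - \<Psi> I v) I v = pd i j \<Phi> I v - pd i j \<Psi> I v"
  unfolding pd_def by (rule dd_diff[of _ W]) (auto intro: shol_holo)

lemma pd_cmult: "shol W \<Phi> \<Longrightarrow> v \<in> W \<Longrightarrow>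
    pd i j (\<lambda>I v. k * \<Phi> I v) I v = k * pd i j \<Phi> I v"
  unfolding pd_def by (rule dd_cmult[of _ W]) (auto intro: shol_holo)

lemma pd_pd: "shol W \<Phi> \<Longrightarrow> v \<in> W \<Longrightarrow> pd i j (pd k l \<Phi>) I v = pd k l (pd i j \<Phi>) I v"
  unfolding pd_def by (rule dd_commute[OF W shol_holo])

lemma pd_Sp: assumes "shol W \<Phi>" "v \<in> W"
  shows "pd i j (Sp k \<Phi>) I v = Sp k (pd i j \<Phi>) I v"
proof -
  have "pd i j (Sp k \<Phi>) I v = del k (\<lambda>I. pd i j \<Phi> I v) I - (\<Sum>l\<in>UNIV. XX l (pd i j (pd k l \<Phi>)) I v)"
    unfolding Sp_def using assms
    by (simp add: pd_diff pd_del pd_sum pd_XX shol_del shol_sum shol_XX shol_pd)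
  also have "\<dots> = Sp k (pd i j \<Phi>) I v"
    unfolding Sp_def XX_def using pd_pd[OF assms] by simp
  finally show ?thesis .
qed

lemma Sp_sum:
  assumes "\<And>k. k \<in> A \<Longrightarrow> shol W (f k)" "v \<in> W"
  shows "Sp i (\<lambda>I v. \<Sum>k\<in>A. f k I v) I v = (\<Sum>k\<in>A. Sp i (f k) I v)"
proof -
  have "XX j (pd i j (\<lambda>I v. \<Sum>k\<in>A. f k I v)) I v = (\<Sum>k\<in>A. XX j (pd i j (f k)) I v)" for j
    unfolding XX_def by (simp add: pd_sum[OF assms(1) assms(2), of A] X_sum)
  then show ?thesis
    unfolding Sp_def by (simp add: del_sum sum_subtractf sum.swap[of _ A])
qed

lemma Sp_diff:
  assumes "shol W \<Phi>" "shol W \<Psi>" "v \<in> W"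
  shows "Sp i (\<lambda>I v. \<Phi> I v - \<Psi> I v) I v = Sp i \<Phi> I v - Sp i \<Psi> I v"
  unfolding Sp_def XX_def using pd_diff[OF assms] by (simp add: del_minus X_minus sum_subtractf)

lemma Sp_cmult:
  assumes "shol W \<Phi>" "v \<in> W"
  shows "Sp i (\<lambda>I v. k * \<Phi> I v) I v = k * Sp i \<Phi> I v"
  unfolding Sp_def XX_def using pd_cmult[OF assms]
  by (simp add: del_cmult X_cmult sum_distrib_left algebra_simps)

lemma Sp_XX:
  assumes "shol W \<Phi>" "v \<in> W"
  shows "Sp i (XX k \<Phi>) I v = (if i = k then \<Phi> I v else 0) - XX k (Sp i \<Phi>) I v"
proof -
  have "XX j (pd i j (XX k \<Phi>)) I v = - XX k (XX j (pd i j \<Phi>)) I v" for j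
    unfolding XX_def using pd_XX[OF assms, unfolded XX_def] X_anticommute[of j k] by simp
  then have "Sp i (XX k \<Phi>) I v = del i (\<lambda>I. XX k \<Phi> I v) I + (\<Sum>j\<in>UNIV. XX k (XX j (pd i j \<Phi>)) I v)"
    unfolding Sp_def by (simp add: sum_negf)
  then show ?thesis
    by (simp add: Sp_def XX_def X_minus X_sum del_X)
qed

text \<open>The derivative of the symmetrised coordinate \<open>v k i\<close> in the direction (j,
  l) is half the sum of two Kronecker products; summing over l against the odd variables leaves the
  two half terms.\<close>

lemma Sp_VV:
  assumes "shol W \<Phi>" "v \<in> W"
  shows "Sp j (VV k i \<Phi>) I v = VV k i (Sp j \<Phi>) I v -
    1 / 2 * ((if j = k then XX i \<Phi> I v else 0) + (if j = i then XX k \<Phi> I v else 0))"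
proof -
  have 1: "XX l (pd j l (VV k i \<Phi>)) I v = symm v $ k $ i * XX l (pd j l \<Phi>) I v +
      symm (Em j l) $ k $ i * XX l \<Phi> I v" for l
    unfolding XX_def using pd_VV[OF assms, of j l k i]
    by (simp add: VV_def X_plus X_cmult del: symm_nth)
  have 2: "(\<Sum>l\<in>UNIV. (if k = j \<and> i = l then 1 else 0) * f l) = (if j = k then f i else 0)"
    for j k i :: 'n and f :: "'n \<Rightarrow> complex"
  proof -
    have "(\<Sum>l\<in>UNIV. (if k = j \<and> i = l then 1 else 0) * f l) = (\<Sum>l\<in>UNIV. if l = i then (if j = k then f i else 0) else 0)"
      by (intro sum.cong refl) auto
    then show ?thesis by simp
  qed
  have 3: "(\<Sum>l\<in>UNIV. symm (Em j l) $ k $ i * XX l \<Phi> I v) =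
      1 / 2 * ((if j = k then XX i \<Phi> I v else 0) + (if j = i then XX k \<Phi> I v else 0))"
  proof -
    have "(\<Sum>l\<in>UNIV. symm (Em j l) $ k $ i * XX l \<Phi> I v) =
        (\<Sum>l\<in>UNIV. 1 / 2 * ((if k = j \<and> i = l then 1 else 0) * XX l \<Phi> I v +
          (if i = j \<and> k = l then 1 else 0) * XX l \<Phi> I v))"
    proof (intro sum.cong refl)
      fix l
      have "symm (Em j l) $ k $ i =
          1 / 2 * ((if k = j \<and> i = l then 1 else 0) + (if i = j \<and> k = l then 1 else 0))"
        by (simp only: symm_nth Em_nth) simp
      then show "symm (Em j l) $ k $ i * XX l \<Phi> I v = 1 / 2 * ((if k = j \<and> i = l then 1 else 0) * XX l \<Phi> I v +
          (if i = j \<and> k = l then 1 else 0) * XX l \<Phi> I v)"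
        by (simp only: ring_distribs mult.assoc)
    qed
    then show ?thesis by (simp only: sum_distrib_left[symmetric] sum.distrib 2)
  qed
  have "del j (\<lambda>I. VV k i \<Phi> I v) I = symm v $ k $ i * del j (\<lambda>I. \<Phi> I v) I"
    by (simp add: VV_def del_cmult del: symm_nth)
  moreover have "(\<Sum>l\<in>UNIV. XX l (pd j l (VV k i \<Phi>)) I v) = symm v $ k $ i * (\<Sum>l\<in>UNIV. XX l (pd j l \<Phi>) I v) +
      1 / 2 * ((if j = k then XX i \<Phi> I v else 0) + (if j = i then XX k \<Phi> I v else 0))"
    unfolding 1 sum.distrib 3 by (simp add: sum_distrib_left)
  ultimately show ?thesis
    by (simp add: Sp_def VV_def ring_distribs del: symm_nth)
qed

text \<open>The derivative in one odd variable, meeting the factor of the other operator, gives -2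
  times the even derivative after symmetrising; all other terms cancel by anticommutation and by
  symmetry of the even derivatives.\<close>

lemma Sp_Sp:
  assumes "shol W \<Phi>" "v \<in> W"
  shows "Sp i (Sp j \<Phi>) I v + Sp j (Sp i \<Phi>) I v = - 2 * pd i j \<Phi> I v"
proof -
  have *: "Sp i (Sp j \<Phi>) I v = del i (del j (\<lambda>I. \<Phi> I v)) I - pd j i \<Phi> I v
      + (\<Sum>l\<in>UNIV. X l (del i (\<lambda>I. pd j l \<Phi> I v)) I) - (\<Sum>l\<in>UNIV. X l (del j (\<lambda>I. pd i l \<Phi> I v)) I)
      + (\<Sum>k\<in>UNIV. \<Sum>l\<in>UNIV. X k (X l (\<lambda>I. pd i k (pd j l \<Phi>) I v)) I)" for i j
  proof -
    have 1: "del i (\<lambda>I. Sp j \<Phi> I v) I = del i (del j (\<lambda>I. \<Phi> I v)) I - pd j i \<Phi> I v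
      + (\<Sum>l\<in>UNIV. X l (del i (\<lambda>I. pd j l \<Phi> I v)) I)"
      unfolding Sp_def XX_def
      by (simp add: del_minus del_sum del_X sum_subtractf sum.delta)
    have 2: "XX k (pd i k (Sp j \<Phi>)) I v = X k (del j (\<lambda>I. pd i k \<Phi> I v)) I -
        (\<Sum>l\<in>UNIV. X k (X l (\<lambda>I. pd i k (pd j l \<Phi>) I v)) I)" for k
    proof -
      have "pd i k (Sp j \<Phi>) I v = del j (\<lambda>I. pd i k \<Phi> I v) I - (\<Sum>l\<in>UNIV. X l (\<lambda>I. pd i k (pd j l \<Phi>) I v) I)" for I
        unfolding pd_Sp[OF assms] using pd_pd[OF assms] by (simp add: Sp_def XX_def)
      then show ?thesis unfolding XX_def by (simp add: X_minus X_sum)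
    qed
    show ?thesis
      unfolding Sp_def[of i] 1 using 2 by (simp add: sum_subtractf)
  qed
  \<comment> \<open>Even derivatives commute and odd variables anticommute, so exchanging the
    summation indices changes the sign.\<close>
  have q: "(\<Sum>k\<in>UNIV. \<Sum>l\<in>UNIV. X k (X l (\<lambda>I. pd i k (pd j l \<Phi>) I v)) I) =
      - (\<Sum>k\<in>UNIV. \<Sum>l\<in>UNIV. X k (X l (\<lambda>I. pd j k (pd i l \<Phi>) I v)) I)"
  proof -
    have "(\<Sum>k\<in>UNIV. \<Sum>l\<in>UNIV. X k (X l (\<lambda>I. pd i k (pd j l \<Phi>) I v)) I) =
        (\<Sum>k\<in>UNIV. \<Sum>l\<in>UNIV. - X l (X k (\<lambda>I. pd j l (pd i k \<Phi>) I v)) I)"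
      by (intro sum.cong refl) (subst X_anticommute, simp add: pd_pd[OF assms, of i])
    also have "\<dots> = - (\<Sum>k\<in>UNIV. \<Sum>l\<in>UNIV. X k (X l (\<lambda>I. pd j k (pd i l \<Phi>) I v)) I)"
      by (subst sum.swap) (simp add: sum_negf)
    finally show ?thesis .
  qed
  show ?thesis
    unfolding * q using del_anticommute[of i j] pd_swap[OF assms(1), of i j] by simp
qed

text \<open>Holomorphy together with the equation \<open>DD\<close> for all pairs of indices. By
  \<open>Sp_Sp\<close> it makes products of two odd operators equal to minus an even
  derivative.\<close>

definition comm :: "'n superfun \<Rightarrow> bool" where
  "comm \<Phi> \<longleftrightarrow> shol W \<Phi> \<and> (\<forall>i j. eqW (Sp i (Sp j \<Phi>)) (Sp j (Sp i \<Phi>)))"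

lemma comm_shol: "comm \<Phi> \<Longrightarrow> shol W \<Phi>"
  by (simp add: comm_def)

lemma comm_Sp_Sp: "comm \<Phi> \<Longrightarrow> v \<in> W \<Longrightarrow> Sp i (Sp j \<Phi>) I v = Sp j (Sp i \<Phi>) I v"
  by (simp add: comm_def eqW_def)

lemma comm_Sp_pd:
  assumes "comm \<Phi>" "v \<in> W"
  shows "Sp i (Sp j \<Phi>) I v = - pd i j \<Phi> I v"
proof -
  have "2 * Sp i (Sp j \<Phi>) I v = 2 * (- pd i j \<Phi> I v)"
    using Sp_Sp[OF comm_shol[OF assms(1)] assms(2), of i j I] comm_Sp_Sp[OF assms, of j i I] by simp
  then show ?thesis by (metis mult_left_cancel zero_neq_numeral)
qed

text \<open>With \<open>A\<^sub>i = D\<^sub>iD\<^sub>jD\<^sub>k\<Phi> = D\<^sub>iD\<^sub>kD\<^sub>j\<Phi>\<close> and so on, the anticommutation relations give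
  \<open>A\<^sub>i + A\<^sub>j = 2 A\<^sub>k\<close> and its cyclic permutations, so that \<open>A\<^sub>i = A\<^sub>j = A\<^sub>k\<close>.\<close>

lemma comm_Sp:
  assumes "comm \<Phi>" shows "comm (Sp k \<Phi>)"
  unfolding comm_def
proof (intro conjI allI)
  have \<Phi>: "shol W \<Phi>" by (rule comm_shol[OF assms])
  show sk: "shol W (Sp k \<Phi>)" for k by (rule shol_Sp[OF \<Phi>])
  fix i j
  have sym: "Sp a (Sp b (Sp c \<Phi>)) I v = Sp a (Sp c (Sp b \<Phi>)) I v" if "v \<in> W" for a b c I v
    using eqWD[OF eqW_Sp that] assms unfolding comm_def by blast
  \<comment> \<open>The left side is the anticommutator acting on the third derivative, hence -2
    times an even derivative; that even derivative commutes with \<open>Sp c\<close> and comes from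
    the other two operators.\<close>
  have rel: "Sp a (Sp b (Sp c \<Phi>)) I v + Sp b (Sp a (Sp c \<Phi>)) I v = 2 * Sp c (Sp a (Sp b \<Phi>)) I v"
    if v: "v \<in> W" for a b c I v
  proof -
    have "eqW (Sp a (Sp b \<Phi>)) (\<lambda>I v. - 1 * pd a b \<Phi> I v)"
      using comm_Sp_pd[OF assms] by (simp add: eqW_def)
    then have "Sp c (Sp a (Sp b \<Phi>)) I v = Sp c (\<lambda>I v. - 1 * pd a b \<Phi> I v) I v"
      by (rule eqWD[OF eqW_Sp v])
    also have "\<dots> = - 1 * Sp c (pd a b \<Phi>) I v" by (rule Sp_cmult[OF shol_pd[OF \<Phi>] v])
    also have "\<dots> = - pd a b (Sp c \<Phi>) I v" by (simp add: pd_Sp[OF \<Phi> v])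
    finally show ?thesis using Sp_Sp[OF sk v, of a b c I] by simp
  qed
  show "eqW (Sp i (Sp j (Sp k \<Phi>))) (Sp j (Sp i (Sp k \<Phi>)))"
    unfolding eqW_def
  proof (intro ballI allI)
    fix v I assume v: "v \<in> W"
    define A where "A = Sp i (Sp j (Sp k \<Phi>)) I v"
    define B where "B = Sp j (Sp i (Sp k \<Phi>)) I v"
    define C where "C = Sp k (Sp i (Sp j \<Phi>)) I v"
    have "A + B = 2 * C" using rel[OF v, of i j k I] by (simp add: A_def B_def C_def)
    moreover have "B + C = 2 * A"
      using rel[OF v, of j k i I] sym[OF v] by (simp add: A_def B_def C_def)
    ultimately have "3 * A = 3 * C" by algebra
    then have "A = C" by simp
    with \<open>A + B = 2 * C\<close> have "A = B" by algebra
    then show "Sp i (Sp j (Sp k \<Phi>)) I v = Sp j (Sp i (Sp k \<Phi>)) I v" by (simp add: A_def B_def)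
  qed
qed

lemma Sp_diff_cmult:
  assumes "shol W \<Phi>" "shol W \<Psi>" "v \<in> W"
  shows "Sp j (\<lambda>I v. \<Phi> I v - k * \<Psi> I v) I v = Sp j \<Phi> I v - k * Sp j \<Psi> I v"
  using assms by (simp add: Sp_diff Sp_cmult shol_cmult)

text \<open>This is the Heisenberg relation: on solutions of \<open>DD\<close> it is the commutator
  of the odd operators, and not their anticommutator, that is a scalar.\<close>

lemma Sp_Sq:
  assumes "comm \<Phi>" "v \<in> W"
  shows "Sp j (Sq i \<Phi>) I v = Sq i (Sp j \<Phi>) I v - (if i = j then 1 / 2 * \<Phi> I v else 0)"
proof -
  note v = assms(2)
  have \<Phi>: "shol W \<Phi>" by (rule comm_shol[OF assms(1)])
  have SpX: "Sp j (XX k (XX i \<Psi>)) I v = XX k (XX i (Sp j \<Psi>)) I v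
      - (if j = i then XX k \<Psi> I v else 0) + (if j = k then XX i \<Psi> I v else 0)" if "shol W \<Psi>" for k \<Psi> I
    using Sp_XX[OF shol_XX[OF that] v, of j k i I] Sp_XX[OF that v, of j i]
    by (auto simp: XX_def X_minus X_zero X_uminus)
  have summand: "Sp j (\<lambda>I v. VV k i (Sp k \<Phi>) I v - 1 / 2 * XX k (XX i (Sp k \<Phi>)) I v) I v =
      (VV k i (Sp j (Sp k \<Phi>)) I v - 1 / 2 * XX k (XX i (Sp j (Sp k \<Phi>))) I v)
      - (if k = j then XX i (Sp k \<Phi>) I v else 0)" for k
  proof -
    have e: "Sp j (\<lambda>I v. VV k i (Sp k \<Phi>) I v - 1 / 2 * XX k (XX i (Sp k \<Phi>)) I v) I v =
        Sp j (VV k i (Sp k \<Phi>)) I v - 1 / 2 * Sp j (XX k (XX i (Sp k \<Phi>))) I v"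
      by (rule Sp_diff_cmult) (intro shol_VV shol_XX shol_Sp \<Phi> v)+
    show ?thesis
      unfolding e Sp_VV[OF shol_Sp[OF \<Phi>] v] SpX[OF shol_Sp[OF \<Phi>]]
      by (cases "j = k"; cases "j = i") (simp_all add: ring_distribs)
  qed
  \<comment> \<open>This is where the commutativity of the odd derivatives on \<open>\<Phi>\<close>
    enters.\<close>
  have swap: "VV k i (Sp j (Sp k \<Phi>)) I v - 1 / 2 * XX k (XX i (Sp j (Sp k \<Phi>))) I v =
      VV k i (Sp k (Sp j \<Phi>)) I v - 1 / 2 * XX k (XX i (Sp k (Sp j \<Phi>))) I v" for k
    using comm_Sp_Sp[OF assms, of j k] by (simp add: VV_def XX_def)
  have "Sp j (Sq i \<Phi>) I v = (\<Sum>k\<in>UNIV. Sp j (\<lambda>I v. VV k i (Sp k \<Phi>) I v - 1 / 2 * XX k (XX i (Sp k \<Phi>)) I v) I v)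
      - 1 / 2 * Sp j (XX i \<Phi>) I v"
    unfolding Sq_def[of i \<Phi>]
    by (subst Sp_diff_cmult, (intro shol_sum shol_diff shol_cmult shol_VV shol_XX shol_Sp \<Phi> v)+)
      (subst Sp_sum, (intro shol_sum shol_diff shol_cmult shol_VV shol_XX shol_Sp \<Phi> v refl)+)
  also have "\<dots> = (\<Sum>k\<in>UNIV. VV k i (Sp k (Sp j \<Phi>)) I v - 1 / 2 * XX k (XX i (Sp k (Sp j \<Phi>))) I v)
      - XX i (Sp j \<Phi>) I v - 1 / 2 * Sp j (XX i \<Phi>) I v"
    unfolding summand swap by (simp add: sum_subtractf sum.delta)
  also have "\<dots> = Sq i (Sp j \<Phi>) I v - (if i = j then 1 / 2 * \<Phi> I v else 0)"
    unfolding Sp_XX[OF \<Phi> v] Sq_def[of i "Sp j \<Phi>"] by (auto simp: algebra_simps)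
  finally show ?thesis .
qed

text \<open>Moving two odd derivatives past \<open>Sq i\<close> produces corrections that are
  symmetric in the two indices, since the commutators are scalars.\<close>

lemma comm_Sq:
  assumes "comm \<Phi>" shows "comm (Sq i \<Phi>)"
  unfolding comm_def
proof (intro conjI allI)
  have \<Phi>: "shol W \<Phi>" by (rule comm_shol[OF assms])
  show "shol W (Sq i \<Phi>)" by (rule shol_Sq[OF \<Phi>])
  fix j k
  have *: "Sp j (Sp k (Sq i \<Phi>)) I v = Sq i (Sp j (Sp k \<Phi>)) I v
      - (if i = j then 1 / 2 * Sp k \<Phi> I v else 0) - (if i = k then 1 / 2 * Sp j \<Phi> I v else 0)"
    if v: "v \<in> W" for j k I v
  proof -
    have "eqW (Sp k (Sq i \<Phi>)) (\<lambda>I v. Sq i (Sp k \<Phi>) I v - (if i = k then 1 / 2 else 0) * \<Phi> I v)"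
      unfolding eqW_def using Sp_Sq[OF assms] by auto
    then have "Sp j (Sp k (Sq i \<Phi>)) I v = Sp j (\<lambda>I v. Sq i (Sp k \<Phi>) I v - (if i = k then 1 / 2 else 0) * \<Phi> I v) I v"
      by (rule eqWD[OF eqW_Sp v])
    also have "\<dots> = Sp j (Sq i (Sp k \<Phi>)) I v - (if i = k then 1 / 2 else 0) * Sp j \<Phi> I v"
      by (rule Sp_diff_cmult[OF shol_Sq[OF shol_Sp[OF \<Phi>]] \<Phi> v])
    finally show ?thesis using Sp_Sq[OF comm_Sp[OF assms] v, of j i k I] by simp
  qed
  have "eqW (Sq i (Sp j (Sp k \<Phi>))) (Sq i (Sp k (Sp j \<Phi>)))"
    by (rule eqW_Sq) (use assms in \<open>simp add: comm_def\<close>)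
  then show "eqW (Sp j (Sp k (Sq i \<Phi>))) (Sp k (Sp j (Sq i \<Phi>)))"
    unfolding eqW_def using * by auto
qed

end

text \<open>Components at single odd variables are bodies of odd derivatives; this turns the odd
  part of an equation into information on first y-derivatives of the generating function.\<close>

lemma Sp_body: "Sp i \<Phi> {} v = \<Phi> {i} v"
  by (simp add: Sp_def del_def XX_def X_def)

lemma Sq_body: "Sq i \<Phi> {} v = (\<Sum>j\<in>UNIV. symm v $ j $ i * Sp j \<Phi> {} v)"
  by (simp add: Sq_def VV_def XX_def X_def)

subsection \<open>The generating function of the bodies\<close>

type_synonym 'n zv = "(complex, 'n) vec \<times> 'n cmatrix"

text \<open>\<open>ak k \<Psi> (y, v)\<close> is the body of \<open>(\<Sum>\<^sub>j y\<^sub>jD\<^sub>j)\<^sup>k \<Psi>\<close> at \<open>v\<close>.\<close>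

primrec ak :: "nat \<Rightarrow> 'n::{finite,linorder} superfun \<Rightarrow> 'n zv \<Rightarrow> complex" where
  "ak 0 \<Psi> = (\<lambda>x. \<Psi> {} (snd x))"
| "ak (Suc k) \<Psi> = (\<lambda>x. \<Sum>j\<in>UNIV. fst x $ j * ak k (Sp j \<Psi>) x)"

text \<open>The matrix y y^t, the direction of the heat flow that belongs to differentiation along
  \<open>y\<close>.\<close>

definition outer :: "(complex, 'n::finite) vec \<Rightarrow> 'n cmatrix" where
  "outer y = (\<chi> i j. y $ i * y $ j)"

lemma outer_nth [simp]: "outer y $ i $ j = y $ i * y $ j"
  by (simp add: outer_def)

lemma outer_expansion: "outer y = (\<Sum>i\<in>UNIV. \<Sum>j\<in>UNIV. (y $ i * y $ j) *\<^sub>C Em i j)"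
  by (subst matrix_unit_expansion) simp

lemma symm_outer [simp]: "symm (outer y) = outer y"
  by (simp add: vec_eq_iff mult.commute)

abbreviation ay :: "'n::finite \<Rightarrow> 'n zv" where "ay j \<equiv> (ax j, 0)"
abbreviation av :: "'n::finite \<Rightarrow> 'n \<Rightarrow> 'n zv" where "av i j \<equiv> (0, Em i j)"

lemma Pair_zero_sum: "(\<Sum>i\<in>A. (0, f i)) = (0, \<Sum>i\<in>A. f i)"
  by (induction A rule: infinite_finite_induct) (auto simp: zero_prod_def)

lemma Pair_sum_zero: "(\<Sum>i\<in>A. (f i, 0)) = (\<Sum>i\<in>A. f i, 0)"
  by (induction A rule: infinite_finite_induct) (auto simp: zero_prod_def)

lemma dir_y: "(y, 0) = (\<Sum>j\<in>UNIV. (y $ j) *\<^sub>C ay j)"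
proof -
  have "(\<Sum>j\<in>UNIV. (y $ j) *\<^sub>C ay j) = (\<Sum>j\<in>UNIV. (axis j (y $ j), 0))"
    by (simp add: cscale_Pair cscale_axis)
  also have "\<dots> = (y, 0)" by (simp add: Pair_sum_zero sum_axis)
  finally show ?thesis by simp
qed

lemma dir_outer: "(0, outer y) = (\<Sum>i\<in>UNIV. \<Sum>j\<in>UNIV. (y $ i * y $ j) *\<^sub>C av i j)"
  by (simp add: outer_expansion Pair_zero_sum cscale_Pair)

lemma norm_outer: "norm (outer y) \<le> (norm y)\<^sup>2 * (\<Sum>i\<in>UNIV. \<Sum>j\<in>UNIV. norm (Em i j :: 'n cmatrix))"
  for y :: "(complex, 'n::finite) vec"
proof -
  have "norm (outer y) \<le> (\<Sum>i\<in>UNIV. \<Sum>j\<in>UNIV. norm ((y $ i * y $ j) *\<^sub>C Em i j :: 'n cmatrix))"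
    unfolding outer_expansion by (intro order.trans[OF norm_sum] sum_mono order.refl)
  also have "\<dots> \<le> (\<Sum>i\<in>UNIV. \<Sum>j\<in>UNIV. (norm y)\<^sup>2 * norm (Em i j :: 'n cmatrix))"
    unfolding norm_cscale norm_mult power2_eq_square
    by (intro sum_mono mult_right_mono mult_mono norm_ge_zero Finite_Cartesian_Product.norm_nth_le) auto
  finally show ?thesis by (simp add: sum_distrib_left)
qed

lemma dd_cong_line:
  assumes "\<forall>\<^sub>F z in nhds 0. f (x + z *\<^sub>C w) = g (x + z *\<^sub>C w)"
  shows "dd w f x = dd w g x"
  unfolding dd_def by (rule deriv_cong_ev[OF assms]) simp

lemma power_div_fact_le_exp:
  fixes x :: real assumes "x \<ge> 0" shows "x ^ m / fact m \<le> exp x"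
proof -
  have s: "(\<lambda>n. x ^ n / fact n) sums exp x"
    using exp_converges[of x] by (simp add: divide_inverse mult.commute)
  have "sum (\<lambda>n. x ^ n / fact n) {m} \<le> suminf (\<lambda>n. x ^ n / fact n)"
    by (rule sum_le_suminf) (use s assms in \<open>auto simp: sums_iff\<close>)
  then show ?thesis using s by (simp add: sums_iff)
qed

lemma fact_square_le: "fact m * fact m \<le> (fact (2 * m) :: real)"
proof -
  have "(fact m * fact m :: nat) dvd fact (m + m)" by (rule fact_fact_dvd_fact)
  then have "(fact m * fact m :: nat) \<le> fact (2 * m)" by (intro dvd_imp_le) (auto simp: mult_2)
  then have "real (fact m * fact m) \<le> real (fact (2 * m))" by (rule of_nat_mono)
  then show ?thesis by simp
qed

text \<open>Since \<open>fact n\<close> dominates \<open>fact m * fact m\<close>, one factorial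
  survives in the denominator. Enlarging the base by 4 bounds the exponential term and leaves
  \<open>(1/4)^m\<close>, hence geometric decay in \<open>n\<close>; the factors 2 and
  \<open>1 + cmod c\<close> pay for odd \<open>n\<close>.\<close>

lemma Cauchy_term_bound:
  fixes c :: complex and a :: complex
  assumes a: "cmod a \<le> M * fact m * q ^ m" and q: "q \<ge> 0" and M: "M \<ge> 0" and n: "n = 2 * m \<or> n = 2 * m + 1"
  shows "cmod (c ^ n / fact n * a) \<le> 2 * (1 + cmod c) * M * exp (4 * (cmod c ^ 2 * q)) * (1 / 2) ^ n"
proof -
  define Q where "Q = cmod c ^ 2 * q"
  have Q: "Q \<ge> 0" using q by (simp add: Q_def)
  have f: "fact m * fact m \<le> (fact n :: real)"
  proof -
    have "2 * m \<le> n" using n by auto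
    then have "fact (2 * m) \<le> (fact n :: real)" by (rule fact_mono)
    then show ?thesis using fact_square_le[of m] by linarith
  qed
  have cn: "cmod c ^ n \<le> (1 + cmod c) * (cmod c ^ 2) ^ m"
    using n by (auto simp: power_mult[symmetric] algebra_simps)
  have "cmod (c ^ n / fact n * a) = cmod c ^ n * cmod a / fact n"
    by (simp add: norm_mult norm_divide norm_power)
  also have "\<dots> \<le> ((1 + cmod c) * (cmod c ^ 2) ^ m) * (M * fact m * q ^ m) / (fact m * fact m)"
    using cn a f M q by (intro frac_le mult_mono) (auto intro!: mult_nonneg_nonneg)
  also have "\<dots> = (1 + cmod c) * M * (Q ^ m / fact m)"
    by (simp add: Q_def power_mult_distrib)
  also have "Q ^ m / fact m = (4 * Q) ^ m / fact m * (1 / 4) ^ m"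
    by (simp add: power_mult_distrib power_divide)
  also have "(1 + cmod c) * M * ((4 * Q) ^ m / fact m * (1 / 4) ^ m) \<le>
      (1 + cmod c) * M * (exp (4 * Q) * (2 * (1 / 2) ^ n))"
  proof (intro mult_left_mono mult_mono)
    show "(4 * Q) ^ m / fact m \<le> exp (4 * Q)" using Q by (intro power_div_fact_le_exp) simp
    show "(1 / 4) ^ m \<le> 2 * (1 / 2 :: real) ^ n"
      using n by (auto simp: power_mult power_add power2_eq_square)
  qed (use M in auto)
  finally show ?thesis by (simp add: Q_def algebra_simps)
qed

text \<open>The function F of the overview: the body of the exponential of c times the sum of the
  y_j D_j, applied to \<open>\<Psi>\<close>.\<close>

definition Fgen :: "complex \<Rightarrow> 'n::{finite,linorder} superfun \<Rightarrow> 'n zv \<Rightarrow> complex" where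
  "Fgen c \<Psi> x = (\<Sum>k. c ^ k / fact k * ak k \<Psi> x)"

context
  fixes W :: "'n::{finite,linorder} cmatrix set"
  assumes W: "open W"
begin

lemma open_S: "open (UNIV \<times> W :: 'n zv set)"
  by (intro open_Times W open_UNIV)

lemma cyl_S: "cyl (ay j) (UNIV \<times> W)"
  unfolding cyl_def using open_S by (auto simp: cscale_Pair)

lemma holo_fst_nth: "holo (\<lambda>x::'n zv. fst x $ j) S"
  by (rule holo_linear) (auto intro: bounded_linear_compose[OF bounded_linear_vec_nth bounded_linear_fst])

lemma dd_fst_nth: "dd w (\<lambda>x::'n zv. fst x $ j) x = fst w $ j"
  by (rule dd_linear_fun) (auto intro: bounded_linear_compose[OF bounded_linear_vec_nth bounded_linear_fst])

lemma holo_ak: "shol W \<Psi> \<Longrightarrow> holo (ak k \<Psi>) (UNIV \<times> W)"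
proof (induction k arbitrary: \<Psi>)
  case 0
  have "holo (\<lambda>x::'n zv. \<Psi> {} (0 + snd x)) (UNIV \<times> W)"
    by (rule holo_affine[OF shol_holo[OF 0] bounded_linear_snd]) auto
  then show ?case by simp
next
  case (Suc k)
  show ?case unfolding ak.simps
    by (intro holo_sum holo_mult holo_fst_nth Suc.IH shol_Sp[OF W] Suc.prems)
qed

lemma ak_cong: "eqW W \<Psi> \<Psi>' \<Longrightarrow> snd x \<in> W \<Longrightarrow> ak k \<Psi> x = ak k \<Psi>' x"
proof (induction k arbitrary: \<Psi> \<Psi>')
  case 0
  then show ?case by (simp add: eqW_def[OF W])
next
  case (Suc k)
  have "ak k (Sp j \<Psi>) x = ak k (Sp j \<Psi>') x" for j
    by (rule Suc.IH[OF eqW_Sp[OF W Suc.prems(1)] Suc.prems(2)])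
  then show ?case by simp
qed

lemma ak_symm: "shol W \<Psi> \<Longrightarrow> ak k \<Psi> (y, symm v) = ak k \<Psi> (y, v)"
  by (induction k arbitrary: \<Psi>) (simp_all add: shol_symm shol_Sp[OF W])

lemma ak_diff_cmult:
  assumes "shol W \<Phi>" "shol W \<Psi>" "snd x \<in> W"
  shows "ak k (\<lambda>I v. \<Phi> I v - a * \<Psi> I v) x = ak k \<Phi> x - a * ak k \<Psi> x"
  using assms(1,2)
proof (induction k arbitrary: \<Phi> \<Psi>)
  case (Suc k)
  have "ak k (Sp j (\<lambda>I v. \<Phi> I v - a * \<Psi> I v)) x = ak k (Sp j \<Phi>) x - a * ak k (Sp j \<Psi>) x" for j
  proof -
    have "eqW W (Sp j (\<lambda>I v. \<Phi> I v - a * \<Psi> I v)) (\<lambda>I v. Sp j \<Phi> I v - a * Sp j \<Psi> I v)"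
      unfolding eqW_def[OF W] using Sp_diff_cmult[OF W Suc.prems] by blast
    from ak_cong[OF this assms(3)] show ?thesis
      using Suc.IH[of "Sp j \<Phi>" "Sp j \<Psi>"] shol_Sp[OF W] Suc.prems by simp
  qed
  then show ?case by (simp add: right_diff_distrib sum_subtractf sum_distrib_left mult.left_commute)
qed simp

text \<open>As the odd derivatives commute, the power rule of a commutative algebra holds.\<close>

lemma dd_ak_y:
  assumes "comm W \<Psi>" "x \<in> UNIV \<times> W"
  shows "dd (ay j) (ak 0 \<Psi>) x = 0"
    and "dd (ay j) (ak (Suc k) \<Psi>) x = of_nat (Suc k) * ak k (Sp j \<Psi>) x"
proof -
  show 0: "dd (ay j) (ak 0 \<Psi>) x = 0" for \<Psi>
    by (simp add: dd_def cscale_Pair)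
  have sw: "snd x \<in> W" using assms(2) by auto
  have step: "dd (ay j) (ak (Suc k) \<Psi>) x = ak k (Sp j \<Psi>) x +
      (\<Sum>l\<in>UNIV. fst x $ l * dd (ay j) (ak k (Sp l \<Psi>)) x)" if "comm W \<Psi>" for k \<Psi>
  proof -
    have h: "holo (ak k (Sp l \<Psi>)) (UNIV \<times> W)" for l
      by (rule holo_ak[OF shol_Sp[OF W comm_shol[OF W that]]])
    have "dd (ay j) (ak (Suc k) \<Psi>) x = (\<Sum>l\<in>UNIV. ax j $ l * ak k (Sp l \<Psi>) x + fst x $ l * dd (ay j) (ak k (Sp l \<Psi>)) x)"
      unfolding ak.simps
      by (simp add: dd_sum_fun[OF holo_mult[OF holo_fst_nth h] assms(2)]
          dd_times[OF holo_fst_nth h assms(2)] dd_fst_nth)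
    also have "(\<Sum>l\<in>UNIV. ax j $ l * ak k (Sp l \<Psi>) x + fst x $ l * dd (ay j) (ak k (Sp l \<Psi>)) x) =
        (\<Sum>l\<in>UNIV. if l = j then ak k (Sp l \<Psi>) x else 0) + (\<Sum>l\<in>UNIV. fst x $ l * dd (ay j) (ak k (Sp l \<Psi>)) x)"
      unfolding sum.distrib by (intro arg_cong2[of _ _ _ _ "(+)"] sum.cong refl) (auto simp: axis_def)
    finally show ?thesis by simp
  qed
  show "dd (ay j) (ak (Suc k) \<Psi>) x = of_nat (Suc k) * ak k (Sp j \<Psi>) x"
    using assms(1)
  proof (induction k arbitrary: \<Psi>)
    case 0
    then show ?case using step[OF 0, of 0] dd_def by (simp add: dd_def cscale_Pair)
  next
    case (Suc k)
    have "ak k (Sp j (Sp l \<Psi>)) x = ak k (Sp l (Sp j \<Psi>)) x" for l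
      by (rule ak_cong[OF _ sw]) (use Suc.prems in \<open>simp add: comm_def[OF W]\<close>)
    then have "(\<Sum>l\<in>UNIV. fst x $ l * dd (ay j) (ak (Suc k) (Sp l \<Psi>)) x) =
        of_nat (Suc k) * ak (Suc k) (Sp j \<Psi>) x"
      using Suc.IH[OF comm_Sp[OF W Suc.prems]] by (simp add: sum_distrib_left algebra_simps)
    then show ?case unfolding step[OF Suc.prems, of "Suc k"] by (simp add: algebra_simps)
  qed
qed

lemma dd_ak_v:
  assumes "comm W \<Psi>" "x \<in> UNIV \<times> W"
  shows "dd (av i j) (ak k \<Psi>) x = - ak k (Sp i (Sp j \<Psi>)) x"
  using assms(1)
proof (induction k arbitrary: \<Psi>)
  case 0
  have "dd (av i j) (ak 0 \<Psi>) x = pd i j \<Psi> {} (snd x)"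
    by (simp add: dd_def pd_def cscale_Pair)
  then show ?case using comm_Sp_pd[OF W 0, of "snd x" i j "{}"] assms(2) by auto
next
  case (Suc k)
  have sw: "snd x \<in> W" using assms(2) by auto
  note c = Suc.prems
  have h: "holo (ak k (Sp l \<Psi>)) (UNIV \<times> W)" for l
    by (rule holo_ak[OF shol_Sp[OF W comm_shol[OF W c]]])
  have e: "ak k (Sp i (Sp j (Sp l \<Psi>))) x = ak k (Sp l (Sp i (Sp j \<Psi>))) x" for l
  proof (rule ak_cong[OF _ sw])
    have "eqW W (Sp i (Sp j (Sp l \<Psi>))) (Sp i (Sp l (Sp j \<Psi>)))"
      by (rule eqW_Sp[OF W]) (use c in \<open>simp add: comm_def[OF W]\<close>)
    moreover have "eqW W (Sp i (Sp l (Sp j \<Psi>))) (Sp l (Sp i (Sp j \<Psi>)))"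
      using comm_Sp[OF W c] by (simp add: comm_def[OF W])
    ultimately show "eqW W (Sp i (Sp j (Sp l \<Psi>))) (Sp l (Sp i (Sp j \<Psi>)))"
      by (rule eqW_trans[OF W])
  qed
  have "dd (av i j) (ak (Suc k) \<Psi>) x = (\<Sum>l\<in>UNIV. fst x $ l * dd (av i j) (ak k (Sp l \<Psi>)) x)"
    unfolding ak.simps
    by (simp add: dd_sum_fun[OF holo_mult[OF holo_fst_nth h] assms(2)]
        dd_times[OF holo_fst_nth h assms(2)] dd_fst_nth)
  then show ?case using Suc.IH[OF comm_Sp[OF W c]] e by (simp add: sum_negf)
qed

lemma dd_ak_outer:
  assumes "comm W \<Psi>" "x \<in> UNIV \<times> W"
  shows "dd (0, outer (fst x)) (ak k \<Psi>) x = - ak (Suc (Suc k)) \<Psi> x"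
proof -
  have h: "holo (ak k \<Psi>) (UNIV \<times> W)" by (rule holo_ak[OF comm_shol[OF W assms(1)]])
  have "dd (0, outer (fst x)) (ak k \<Psi>) x =
      (\<Sum>i\<in>UNIV. \<Sum>j\<in>UNIV. (fst x $ i * fst x $ j) * dd (av i j) (ak k \<Psi>) x)"
    unfolding dir_outer by (simp add: dd_sum[OF h assms(2)] dd_cscale[OF h assms(2)])
  also have "\<dots> = - (\<Sum>i\<in>UNIV. \<Sum>j\<in>UNIV. fst x $ j * (fst x $ i * ak k (Sp i (Sp j \<Psi>)) x))"
    by (simp add: dd_ak_v[OF assms] sum_negf algebra_simps)
  also have "\<dots> = - ak (Suc (Suc k)) \<Psi> x"
    by (subst sum.swap) (simp add: sum_distrib_left)
  finally show ?thesis .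
qed

text \<open>Even terms of the series are pure derivatives in \<open>v\<close> of the body, in the
  direction y y^t, and thus accessible to Cauchy's estimates.\<close>

lemma dd_funpow_ak:
  assumes "comm W \<Psi>" "(y, v) \<in> UNIV \<times> W"
  shows "(dd (0, outer y) ^^ k) (ak 0 \<Psi>) (y, v) = (-1) ^ k * ak (2 * k) \<Psi> (y, v)"
  using assms(2)
proof (induction k arbitrary: v)
  case (Suc k)
  let ?w = "(0, outer y) :: 'n zv"
  have h: "holo (ak (2 * k) \<Psi>) (UNIV \<times> W)" by (rule holo_ak[OF comm_shol[OF W assms(1)]])
  have "\<forall>\<^sub>F z in nhds 0. z \<in> {z. (y, v) + z *\<^sub>C ?w \<in> UNIV \<times> W}"
    by (rule eventually_nhds_in_open[OF open_line[OF open_S]]) (use Suc.prems in \<open>simp add: zero_prod_def[symmetric]\<close>)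
  then have "\<forall>\<^sub>F z in nhds 0. (dd ?w ^^ k) (ak 0 \<Psi>) ((y, v) + z *\<^sub>C ?w) =
      (-1) ^ k * ak (2 * k) \<Psi> ((y, v) + z *\<^sub>C ?w)"
    by eventually_elim (use Suc.IH in \<open>auto simp: cscale_Pair\<close>)
  then have "dd ?w ((dd ?w ^^ k) (ak 0 \<Psi>)) (y, v) = dd ?w (\<lambda>x. (-1) ^ k * ak (2 * k) \<Psi> x) (y, v)"
    by (rule dd_cong_line)
  also have "\<dots> = (-1) ^ k * dd ?w (ak (2 * k) \<Psi>) (y, v)"
    by (rule dd_cmult[OF h Suc.prems])
  also have "dd ?w (ak (2 * k) \<Psi>) (y, v) = - ak (Suc (Suc (2 * k))) \<Psi> (y, v)"
    using dd_ak_outer[OF assms(1) Suc.prems] by (simp del: ak.simps)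
  finally show ?case by (simp del: ak.simps)
qed simp

text \<open>Cauchy's estimate for the derivative of order m on the line through v in the direction y
  y^t gives one factorial \<open>fact m\<close>, with constants uniform near the given
  point.\<close>

lemma ak_even_bound:
  assumes "comm W \<Psi>" "x0 \<in> UNIV \<times> W"
  obtains M q where "M \<ge> 0" "q \<ge> 0"
    "\<forall>\<^sub>F x in nhds x0. \<forall>m. cmod (ak (2 * m) \<Psi> x) \<le> M * fact m * q ^ m"
proof -
  obtain y0 v0 where x0: "x0 = (y0, v0)" "v0 \<in> W" using assms(2) by auto
  have \<Psi>: "shol W \<Psi>" by (rule comm_shol[OF W assms(1)])
  obtain r M where r: "r > 0" "ball v0 r \<subseteq> W" "\<And>v. v \<in> ball v0 r \<Longrightarrow> cmod (\<Psi> {} v) \<le> M"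
    by (rule holo_locally_bounded[OF W shol_holo[OF \<Psi>, of "{}"] x0(2)]) blast
  have M: "M \<ge> 0" using order.trans[OF norm_ge_zero r(3)[of v0]] r(1) by simp
  define E where "E = (\<Sum>i\<in>UNIV. \<Sum>j\<in>UNIV. norm (Em i j :: 'n cmatrix))"
  define Y where "Y = (norm y0 + 1)\<^sup>2 * E + 1"
  have E: "E \<ge> 0" unfolding E_def by (intro sum_nonneg) auto
  have Y: "Y > 0" using E unfolding Y_def by (intro add_nonneg_pos) auto
  \<comment> \<open>\<open>Y\<close> exceeds the norm of \<open>outer y\<close> for all y within
    distance 1 of \<open>y0\<close>, so parameters below this radius move v by at most
    \<open>r / 2\<close>.\<close>
  define \<rho> where "\<rho> = r / 2 / Y"
  have \<rho>: "\<rho> > 0" using r Y by (simp add: \<rho>_def)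
  have bd: "cmod (ak (2 * m) \<Psi> (y, v)) \<le> fact m * M / (\<rho> / 2) ^ m"
    if y: "dist y0 y < 1" and v: "dist v0 v < r / 2" for y v m
  proof -
    have inb: "v + z *\<^sub>C outer y \<in> ball v0 r" if "z \<in> ball 0 \<rho>" for z
    proof -
      have "norm y \<le> norm y0 + 1" using y norm_triangle_sub[of y y0] by (simp add: dist_norm norm_minus_commute)
      then have "norm (outer y) \<le> (norm y0 + 1)\<^sup>2 * E"
        unfolding E_def by (intro order.trans[OF norm_outer] mult_right_mono power_mono sum_nonneg) auto
      then have "cmod z * norm (outer y) \<le> \<rho> * Y"
        using that \<rho> unfolding Y_def by (intro mult_mono) auto
      then have "norm (z *\<^sub>C outer y) \<le> r / 2" using Y by (simp add: \<rho>_def)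
      then show ?thesis using v norm_triangle_ineq4[of "v0 - v" "z *\<^sub>C outer y"]
        by (simp add: dist_norm algebra_simps)
    qed
    define g where "g = (\<lambda>z. ak 0 \<Psi> ((y, v) + z *\<^sub>C (0, outer y)))"
    have inS: "(y, v) + z *\<^sub>C (0, outer y) \<in> UNIV \<times> W" if "z \<in> ball 0 \<rho>" for z
      using inb[OF that] r(2) by (auto simp: cscale_Pair)
    have "cmod ((deriv ^^ m) g 0) \<le> fact m * M / (\<rho> / 2) ^ m"
    proof (rule holomorphic_ball_deriv_bound[where r = \<rho>])
      show "g holomorphic_on ball 0 \<rho>"
        unfolding g_def by (rule holo_holomorphic_line[OF holo_ak[OF \<Psi>] inS])
      show "cmod (g z) \<le> M" if "z \<in> ball 0 \<rho>" for z
        using r(3)[OF inb[OF that]] by (simp add: g_def cscale_Pair)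
    qed (use \<rho> in auto)
    moreover have "(y, v) + 0 *\<^sub>C (0, outer y) \<in> UNIV \<times> W" using inS[of 0] \<rho> by simp
    from deriv_funpow_line[OF open_S holo_ak[OF \<Psi>] this, of m 0]
    have "(deriv ^^ m) g 0 = (dd (0, outer y) ^^ m) (ak 0 \<Psi>) (y, v)"
      unfolding g_def by (simp del: ak.simps)
    moreover have "(y, v) \<in> UNIV \<times> W" using inS[of 0] \<rho> by simp
    ultimately show ?thesis
      using dd_funpow_ak[OF assms(1), of y v m] by (simp add: norm_mult norm_power)
  qed
  show ?thesis
  proof
    show "M \<ge> 0" "2 / \<rho> \<ge> 0" using M \<rho> by auto
    have "\<forall>\<^sub>F x in nhds x0. x \<in> ball y0 1 \<times> ball v0 (r / 2)"
      by (rule eventually_nhds_in_open) (use x0 r in \<open>auto intro!: open_Times\<close>)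
    then show "\<forall>\<^sub>F x in nhds x0. \<forall>m. cmod (ak (2 * m) \<Psi> x) \<le> M * fact m * (2 / \<rho>) ^ m"
    proof eventually_elim
      case (elim x)
      then show ?case using bd[of "fst x" "snd x"] by (auto simp: power_divide field_simps)
    qed
  qed
qed

text \<open>An odd term is a sum over j of y_j times an even term for \<open>Sp j\<close>, so that
  the even estimate applies to finitely many superfunctions at once.\<close>

lemma ak_bound:
  assumes "comm W \<Psi>" "x0 \<in> UNIV \<times> W"
  obtains B where "\<forall>\<^sub>F x in nhds x0. \<forall>k. cmod (c ^ k / fact k * ak k \<Psi> x) \<le> B * (1 / 2) ^ k"
proof -
  obtain M q where Mq: "M \<ge> 0" "q \<ge> 0"
    "\<forall>\<^sub>F x in nhds x0. \<forall>m. cmod (ak (2 * m) \<Psi> x) \<le> M * fact m * q ^ m"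
    by (rule ak_even_bound[OF assms])
  have "\<forall>j. \<exists>M q. M \<ge> 0 \<and> q \<ge> 0 \<and>
      (\<forall>\<^sub>F x in nhds x0. \<forall>m. cmod (ak (2 * m) (Sp j \<Psi>) x) \<le> M * fact m * q ^ m)"
  proof
    fix j
    show "\<exists>M q. M \<ge> 0 \<and> q \<ge> 0 \<and>
        (\<forall>\<^sub>F x in nhds x0. \<forall>m. cmod (ak (2 * m) (Sp j \<Psi>) x) \<le> M * fact m * q ^ m)"
      by (rule ak_even_bound[OF comm_Sp[OF W assms(1)] assms(2), of j]) blast
  qed
  then obtain M' q' where M'q': "\<And>j. M' j \<ge> 0" "\<And>j. q' j \<ge> 0"
    "\<And>j. \<forall>\<^sub>F x in nhds x0. \<forall>m. cmod (ak (2 * m) (Sp j \<Psi>) x) \<le> M' j * fact m * q' j ^ m"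
    unfolding choice_iff by blast
  define R where "R = norm (fst x0) + 1"
  define N where "N = M + (\<Sum>j\<in>UNIV. R * M' j)"
  define p where "p = q + (\<Sum>j\<in>UNIV. q' j)"
  have R: "R \<ge> 0" by (simp add: R_def)
  have N: "N \<ge> 0" "M \<le> N" "(\<Sum>j\<in>UNIV. R * M' j) \<le> N"
    using Mq(1) M'q'(1) R by (auto simp: N_def intro!: add_nonneg_nonneg sum_nonneg)
  have p: "p \<ge> 0" "q \<le> p" "q' j \<le> p" for j
    using Mq(2) M'q'(2) member_le_sum[of j UNIV q'] by (auto simp: p_def intro!: add_nonneg_nonneg sum_nonneg add_increasing)
  have "\<forall>\<^sub>F x in nhds x0. x \<in> ball x0 1" by (rule eventually_nhds_in_open) auto
  moreover have "\<forall>\<^sub>F x in nhds x0. \<forall>j. \<forall>m. cmod (ak (2 * m) (Sp j \<Psi>) x) \<le> M' j * fact m * q' j ^ m"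
    using M'q'(3) by (simp add: eventually_all_finite)
  ultimately have "\<forall>\<^sub>F x in nhds x0. \<forall>k. cmod (c ^ k / fact k * ak k \<Psi> x) \<le>
      (2 * (1 + cmod c) * N * exp (4 * (cmod c ^ 2 * p))) * (1 / 2) ^ k"
    using Mq(3)
  proof eventually_elim
    case (elim x)
    show ?case
    proof
      fix k :: nat
      define m where "m = k div 2"
      have "cmod (ak k \<Psi> x) \<le> N * fact m * p ^ m"
      proof (cases "even k")
        case True
        then have "cmod (ak k \<Psi> x) \<le> M * fact m * q ^ m" using elim(3) by (auto simp: m_def)
        also have "\<dots> \<le> N * fact m * p ^ m"
          using N p Mq by (intro mult_mono power_mono) auto
        finally show ?thesis .
      next
        case False
        then have k: "k = Suc (2 * m)" by (auto simp: m_def elim: oddE)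
        have "norm (fst x) \<le> R"
        proof -
          have "norm (fst x - fst x0) \<le> norm (x - x0)" using norm_fst_le[of "fst (x - x0)" "snd (x - x0)"] by (simp del: fst_diff snd_diff add: fst_diff[symmetric])
          then show ?thesis using elim(1) norm_triangle_sub[of "fst x" "fst x0"]
            by (simp add: R_def dist_norm norm_minus_commute)
        qed
        then have yj: "cmod (fst x $ j) \<le> R" for j
          using Finite_Cartesian_Product.norm_nth_le[of "fst x" j] by linarith
        have "cmod (ak k \<Psi> x) \<le> (\<Sum>j\<in>UNIV. cmod (fst x $ j * ak (2 * m) (Sp j \<Psi>) x))"
          unfolding k ak.simps by (rule norm_sum)
        also have "\<dots> \<le> (\<Sum>j\<in>UNIV. R * (M' j * fact m * p ^ m))"
          unfolding norm_mult
        proof (intro sum_mono mult_mono yj)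
          fix j
          have "cmod (ak (2 * m) (Sp j \<Psi>) x) \<le> M' j * fact m * q' j ^ m" using elim(2) by blast
          also have "\<dots> \<le> M' j * fact m * p ^ m"
            using M'q' p by (intro mult_left_mono power_mono mult_nonneg_nonneg) auto
          finally show "cmod (ak (2 * m) (Sp j \<Psi>) x) \<le> M' j * fact m * p ^ m" .
        qed (use R in auto)
        also have "\<dots> = (\<Sum>j\<in>UNIV. R * M' j) * (fact m * p ^ m)"
          by (simp add: sum_distrib_right mult.assoc)
        also have "\<dots> \<le> N * (fact m * p ^ m)"
          using N p by (intro mult_right_mono) auto
        finally show ?thesis by (simp add: mult.assoc)
      qed
      then show "cmod (c ^ k / fact k * ak k \<Psi> x) \<le>
          (2 * (1 + cmod c) * N * exp (4 * (cmod c ^ 2 * p))) * (1 / 2) ^ k"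
        by (rule Cauchy_term_bound) (use p N in \<open>auto simp: m_def\<close>)
    qed
  qed
  then show ?thesis by (rule that)
qed

lemma ak_summable:
  assumes "comm W \<Psi>" "x \<in> UNIV \<times> W"
  shows "summable (\<lambda>k. norm (c ^ k / fact k * ak k \<Psi> x))"
proof -
  obtain B where "\<forall>\<^sub>F x in nhds x. \<forall>k. cmod (c ^ k / fact k * ak k \<Psi> x) \<le> B * (1 / 2) ^ k"
    by (rule ak_bound[OF assms])
  from eventually_nhds_x_imp_x[OF this]
  have *: "\<And>k. cmod (c ^ k / fact k * ak k \<Psi> x) \<le> B * (1 / 2) ^ k"
    by (rule spec)
  show ?thesis
  proof (rule summable_comparison_test'[where N = 0])
    show "summable (\<lambda>k. B * (1 / 2 :: real) ^ k)" by (intro summable_mult summable_geometric) simp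
    show "norm (norm (c ^ k / fact k * ak k \<Psi> x)) \<le> B * (1 / 2) ^ k" for k
      unfolding real_norm_def abs_norm_cancel by (rule *)
  qed
qed

lemma Fgen_sums:
  assumes "comm W \<Psi>" "x \<in> UNIV \<times> W"
  shows "(\<lambda>k. c ^ k / fact k * ak k \<Psi> x) sums Fgen c \<Psi> x"
  unfolding Fgen_def by (intro summable_sums summable_norm_cancel[OF ak_summable[OF assms]])

lemma Fgen_limit:
  assumes "comm W \<Psi>"
  shows "loc_uniform_limit (UNIV \<times> W) (\<lambda>n x. \<Sum>k<n. c ^ k / fact k * ak k \<Psi> x) (Fgen c \<Psi>) sequentially"
  unfolding loc_uniform_limit_def
proof
  fix x0 :: "'n zv" assume x0: "x0 \<in> UNIV \<times> W"
  obtain B where "\<forall>\<^sub>F x in nhds x0. \<forall>k. cmod (c ^ k / fact k * ak k \<Psi> x) \<le> B * (1 / 2) ^ k"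
    by (rule ak_bound[OF assms x0])
  moreover have "\<forall>\<^sub>F x in nhds x0. x \<in> UNIV \<times> W"
    by (rule eventually_nhds_in_open[OF open_S x0])
  ultimately have "\<forall>\<^sub>F x in nhds x0. x \<in> UNIV \<times> W \<and> (\<forall>k. cmod (c ^ k / fact k * ak k \<Psi> x) \<le> B * (1 / 2) ^ k)"
    by eventually_elim auto
  then obtain r where r: "r > 0"
    "\<And>x. dist x x0 < r \<Longrightarrow> x \<in> UNIV \<times> W \<and> (\<forall>k. cmod (c ^ k / fact k * ak k \<Psi> x) \<le> B * (1 / 2) ^ k)"
    unfolding eventually_nhds_metric by metis
  have "uniform_limit (ball x0 r) (\<lambda>n x. \<Sum>k<n. c ^ k / fact k * ak k \<Psi> x) (Fgen c \<Psi>) sequentially"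
    unfolding Fgen_def[abs_def]
  proof (rule Weierstrass_m_test)
    show "norm (c ^ k / fact k * ak k \<Psi> x) \<le> B * (1 / 2) ^ k" if "x \<in> ball x0 r" for k x
      using r(2)[of x] that by (simp add: dist_commute)
    show "summable (\<lambda>k. B * (1 / 2 :: real) ^ k)" by (intro summable_mult summable_geometric) simp
  qed
  moreover have "ball x0 r \<subseteq> UNIV \<times> W" using r(2) by (auto simp: dist_commute)
  ultimately show "\<exists>r>0. ball x0 r \<subseteq> UNIV \<times> W \<and>
      uniform_limit (ball x0 r) (\<lambda>n x. \<Sum>k<n. c ^ k / fact k * ak k \<Psi> x) (Fgen c \<Psi>) sequentially"
    using r(1) by blast
qed

lemma holo_term: "comm W \<Psi> \<Longrightarrow> holo (\<lambda>x. c ^ k / fact k * ak k \<Psi> x) (UNIV \<times> W)"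
  by (intro holo_cmult holo_ak comm_shol[OF W])

lemma holo_partial: "comm W \<Psi> \<Longrightarrow> \<forall>\<^sub>F n in sequentially. holo (\<lambda>x. \<Sum>k<n. c ^ k / fact k * ak k \<Psi> x) (UNIV \<times> W)"
  by (intro always_eventually allI holo_sum holo_term)

lemma holo_Fgen: "comm W \<Psi> \<Longrightarrow> holo (Fgen c \<Psi>) (UNIV \<times> W)"
  by (rule holo_loc_uniform_limit[OF open_S holo_partial _ Fgen_limit]) auto

lemma dd_Fgen_limit:
  assumes "comm W \<Psi>" "x \<in> UNIV \<times> W"
  shows "(\<lambda>n. \<Sum>k<n. c ^ k / fact k * dd w (ak k \<Psi>) x) \<longlonglongrightarrow> dd w (Fgen c \<Psi>) x"
proof -
  have "(\<lambda>n. dd w (\<lambda>x. \<Sum>k<n. c ^ k / fact k * ak k \<Psi> x) x) \<longlonglongrightarrow> dd w (Fgen c \<Psi>) x"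
    by (rule dd_loc_uniform_limit[OF holo_partial _ Fgen_limit]) (use assms in auto)
  then show ?thesis
    by (simp only: dd_sum_fun[OF holo_term[OF assms(1)] assms(2)]
        dd_cmult[OF holo_ak[OF comm_shol[OF W assms(1)]] assms(2)])
qed

lemma dd_Fgen_y:
  assumes "comm W \<Psi>" "x \<in> UNIV \<times> W"
  shows "dd (ay j) (Fgen c \<Psi>) x = c * Fgen c (Sp j \<Psi>) x"
proof -
  \<comment> \<open>The constant term drops out under differentiation, so one more summand is taken
    to match \<open>n\<close> terms on the right.\<close>
  have "(\<lambda>n. \<Sum>k<Suc n. c ^ k / fact k * dd (ay j) (ak k \<Psi>) x) \<longlonglongrightarrow> dd (ay j) (Fgen c \<Psi>) x"
    by (rule LIMSEQ_Suc[OF dd_Fgen_limit[OF assms]])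
  moreover have "(\<Sum>k<Suc n. c ^ k / fact k * dd (ay j) (ak k \<Psi>) x) =
      c * (\<Sum>k<n. c ^ k / fact k * ak k (Sp j \<Psi>) x)" for n
  proof -
    have "c ^ Suc k / fact (Suc k) * dd (ay j) (ak (Suc k) \<Psi>) x = c * (c ^ k / fact k * ak k (Sp j \<Psi>) x)" for k
      unfolding dd_ak_y(2)[OF assms] by (simp add: field_simps del: of_nat_Suc)
    then show ?thesis unfolding sum.lessThan_Suc_shift dd_ak_y(1)[OF assms]
      by (simp add: sum_distrib_left del: ak.simps)
  qed
  ultimately have "(\<lambda>n. c * (\<Sum>k<n. c ^ k / fact k * ak k (Sp j \<Psi>) x)) \<longlonglongrightarrow> dd (ay j) (Fgen c \<Psi>) x"
    by simp
  moreover have "(\<lambda>n. c * (\<Sum>k<n. c ^ k / fact k * ak k (Sp j \<Psi>) x)) \<longlonglongrightarrow> c * Fgen c (Sp j \<Psi>) x"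
    using Fgen_sums[OF comm_Sp[OF W assms(1)] assms(2)] unfolding sums_def by (intro tendsto_mult tendsto_const)
  ultimately show ?thesis by (rule LIMSEQ_unique)
qed

lemma dd_Fgen_v:
  assumes "comm W \<Psi>" "x \<in> UNIV \<times> W"
  shows "dd (av i j) (Fgen c \<Psi>) x = - Fgen c (Sp i (Sp j \<Psi>)) x"
proof -
  have "(\<lambda>n. - (\<Sum>k<n. c ^ k / fact k * ak k (Sp i (Sp j \<Psi>)) x)) \<longlonglongrightarrow> dd (av i j) (Fgen c \<Psi>) x"
    using dd_Fgen_limit[OF assms, of c "av i j"] by (simp add: dd_ak_v[OF assms] sum_negf)
  moreover have "(\<lambda>n. - (\<Sum>k<n. c ^ k / fact k * ak k (Sp i (Sp j \<Psi>)) x)) \<longlonglongrightarrow> - Fgen c (Sp i (Sp j \<Psi>)) x"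
    using Fgen_sums[OF comm_Sp[OF W comm_Sp[OF W assms(1)]] assms(2)] unfolding sums_def by (rule tendsto_minus)
  ultimately show ?thesis by (rule LIMSEQ_unique)
qed

lemma Fgen_0: "Fgen c \<Psi> (0, v) = \<Psi> {} v"
proof -
  have "c ^ k / fact k * ak k \<Psi> (0, v) = (if k = 0 then \<Psi> {} v else 0)" for k
    by (cases k) auto
  then have "(\<lambda>k. c ^ k / fact k * ak k \<Psi> (0, v)) sums \<Psi> {} v"
    using sums_single[of 0 "\<lambda>_. \<Psi> {} v"] by simp
  then show ?thesis by (simp add: Fgen_def sums_iff)
qed

lemma Fgen_symm: "shol W \<Psi> \<Longrightarrow> Fgen c \<Psi> (y, symm v) = Fgen c \<Psi> (y, v)"
  by (simp add: Fgen_def ak_symm)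

lemma Fgen_diff_cmult:
  assumes "comm W \<Phi>" "comm W \<Psi>" "x \<in> UNIV \<times> W"
  shows "Fgen c (\<lambda>I v. \<Phi> I v - a * \<Psi> I v) x = Fgen c \<Phi> x - a * Fgen c \<Psi> x"
proof -
  have "(\<lambda>k. c ^ k / fact k * ak k \<Phi> x - a * (c ^ k / fact k * ak k \<Psi> x)) sums (Fgen c \<Phi> x - a * Fgen c \<Psi> x)"
    by (intro sums_diff sums_mult Fgen_sums assms)
  moreover have "c ^ k / fact k * ak k \<Phi> x - a * (c ^ k / fact k * ak k \<Psi> x) =
      c ^ k / fact k * ak k (\<lambda>I v. \<Phi> I v - a * \<Psi> I v) x" for k
  proof -
    have "snd x \<in> W" using assms(3) by auto
    from ak_diff_cmult[OF comm_shol[OF W assms(1)] comm_shol[OF W assms(2)] this]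
    show ?thesis by (simp only: right_diff_distrib mult.left_commute)
  qed
  ultimately show ?thesis by (simp only: Fgen_def sums_iff)
qed

end

subsection \<open>Heat equation and quasi-periodicity\<close>

definition col :: "'n::finite cmatrix \<Rightarrow> 'n \<Rightarrow> (complex, 'n) vec" where
  "col v i = (\<chi> j. symm v $ j $ i)"

text \<open>The exponent of the automorphy factor. Like the shift \<open>lshift\<close> it is linear
  in (y, v) jointly, so its derivative in a direction is its value at that direction.\<close>

definition lphase :: "'n::finite \<Rightarrow> 'n zv \<Rightarrow> complex" where
  "lphase i x = of_real pi * \<i> * symm (snd x) $ i $ i + 2 * of_real pi * \<i> * fst x $ i"

definition lshift :: "'n::finite \<Rightarrow> 'n zv \<Rightarrow> 'n zv" where
  "lshift i x = (fst x + col (snd x) i, snd x)"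

lemma bounded_linear_symm_nth: "bounded_linear (\<lambda>v::'n::finite cmatrix. symm v $ i $ j)"
  using bounded_linear_compose[OF bounded_linear_vec_nth
      bounded_linear_compose[OF bounded_linear_vec_nth bounded_linear_symm]] .

lemma symm_nth_cscale: "symm (a *\<^sub>C v) $ i $ j = a * symm v $ i $ j"
  by (simp only: symm_cscale cscale_nth cscale_mult)

lemma bounded_linear_lphase: "bounded_linear (lphase i)"
  unfolding lphase_def[abs_def]
  by (intro bounded_linear_add bounded_linear_const_mult
      bounded_linear_compose[OF bounded_linear_symm_nth bounded_linear_snd]
      bounded_linear_compose[OF bounded_linear_vec_nth bounded_linear_fst])

lemma lphase_cscale: "lphase i (a *\<^sub>C x) = a * lphase i x"
  by (simp add: lphase_def symm_nth_cscale ring_distribs del: symm_nth)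

lemma bounded_linear_lshift: "bounded_linear (lshift i :: 'n::finite zv \<Rightarrow> _)"
proof -
  have "linear (lshift i :: 'n zv \<Rightarrow> _)"
    by (rule linearI)
      (auto simp: lshift_def col_def vec_eq_iff scaleR_conv_of_real[where 'a = complex] add_divide_distrib ring_distribs)
  then show ?thesis by (simp add: linear_conv_bounded_linear)
qed

lemma lshift_cscale: "lshift i (a *\<^sub>C x) = a *\<^sub>C lshift i x"
proof -
  have "col (a *\<^sub>C v) i = a *\<^sub>C col v i" for v :: "'a cmatrix"
    by (simp add: col_def vec_eq_iff symm_nth_cscale del: symm_nth)
  then show ?thesis by (simp add: lshift_def cscale_prod_def cscale_add_right)
qed

lemma dd_lphase: "dd w (lphase i) x = lphase i w"
  by (rule dd_linear_fun[OF bounded_linear_lphase lphase_cscale])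

lemma holo_lphase: "holo (lphase i) S"
  by (rule holo_linear[OF bounded_linear_lphase lphase_cscale])

text \<open>The Taylor coefficients of \<open>exp (-st\<^sup>2/4)\<close>, which is \<open>exp (\<pi>is)\<close> at \<open>t = c\<close>.\<close>

definition gauss_coeff :: "complex \<Rightarrow> nat \<Rightarrow> complex" where
  "gauss_coeff s n = (if even n then (- s / 4) ^ (n div 2) / fact (n div 2) else 0)"

lemma gauss_coeff_sums:
  fixes c s :: complex
  assumes c: "c\<^sup>2 = - (4 * of_real pi * \<i>)"
  shows "(\<lambda>k. c ^ k * gauss_coeff s k) sums exp (of_real pi * \<i> * s)"
    and "summable (\<lambda>k. norm (c ^ k * gauss_coeff s k))"
proof -
  have sm: "strict_mono (\<lambda>m::nat. 2 * m)" by (simp add: strict_mono_def)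
  have van: "gauss_coeff s n = 0" if "n \<notin> range (\<lambda>m::nat. 2 * m)" for n
    using that by (auto simp: gauss_coeff_def elim!: evenE)
  have e: "c ^ (2 * m) * gauss_coeff s (2 * m) = (of_real pi * \<i> * s) ^ m /\<^sub>R fact m" for m
  proof -
    have "c ^ (2 * m) * (- s / 4) ^ m = (c\<^sup>2 * (- s / 4)) ^ m"
      by (simp only: power_mult power_mult_distrib)
    also have "c\<^sup>2 * (- s / 4) = of_real pi * \<i> * s" by (simp add: c)
    finally have eq: "c ^ (2 * m) * (- s / 4) ^ m = (of_real pi * \<i> * s) ^ m" .
    have "c ^ (2 * m) * gauss_coeff s (2 * m) = (c ^ (2 * m) * (- s / 4) ^ m) / fact m"
      by (simp add: gauss_coeff_def)
    also have "\<dots> = (of_real pi * \<i> * s) ^ m /\<^sub>R fact m"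
      unfolding eq by (simp only: scaleR_conv_of_real divide_inverse mult.commute of_real_inverse of_real_fact)
    finally show ?thesis .
  qed
  have "(\<lambda>m. c ^ (2 * m) * gauss_coeff s (2 * m)) sums exp (of_real pi * \<i> * s)"
    unfolding e by (rule exp_converges)
  then show "(\<lambda>k. c ^ k * gauss_coeff s k) sums exp (of_real pi * \<i> * s)"
    by (subst sums_mono_reindex[OF sm, symmetric]) (auto simp: van)
  have "summable (\<lambda>m. norm (c ^ (2 * m) * gauss_coeff s (2 * m)))"
    unfolding e by (rule summable_norm_exp)
  then show "summable (\<lambda>k. norm (c ^ k * gauss_coeff s k))"
    by (subst summable_mono_reindex[OF sm, symmetric]) (auto simp: van)
qed

text \<open>The differential equation g' = -(s/2) t g of \<open>exp (- s * t^2 / 4)\<close>, in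
  formal power series.\<close>

lemma gauss_coeff_rec:
  "fps_deriv (Abs_fps (gauss_coeff s)) = fps_const (- s / 2) * (fps_X * Abs_fps (gauss_coeff s))"
proof (rule fps_ext)
  fix n
  show "fps_deriv (Abs_fps (gauss_coeff s)) $ n = (fps_const (- s / 2) * (fps_X * Abs_fps (gauss_coeff s))) $ n"
  proof (cases "odd n")
    case True
    then obtain m where n: "n = 2 * m + 1" by (auto elim: oddE)
    have "of_nat (2 * m + 2) * ((- s / 4) ^ Suc m / fact (Suc m)) = - s / 2 * ((- s / 4) ^ m / fact m :: complex)"
    proof -
      have "of_nat (2 * m + 2) = (2 * of_nat (Suc m) :: complex)" by simp
      moreover have "(fact (Suc m) :: complex) = of_nat (Suc m) * fact m" by simp
      moreover have "of_nat (Suc m) \<noteq> (0 :: complex)" by (rule of_nat_neq_0)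
      ultimately show ?thesis by (simp add: field_simps del: of_nat_Suc fact_Suc)
    qed
    then show ?thesis by (simp add: n gauss_coeff_def)
  next
    case False
    then show ?thesis by (auto simp: gauss_coeff_def)
  qed
qed

text \<open>The system of the theorem after symmetrisation, with the equation \<open>DD\<close> and
  holomorphy contained in \<open>comm\<close>.\<close>

definition sol :: "'n::{finite,linorder} cmatrix set \<Rightarrow> complex \<Rightarrow> 'n superfun \<Rightarrow> bool" where
  "sol W c \<Phi> \<longleftrightarrow> comm W \<Phi> \<and>
    (\<forall>i. \<forall>v\<in>W. \<forall>I. (\<lambda>k. c ^ k * (Sp i ^^ k) \<Phi> I v / fact k) sums \<Phi> I v) \<and>
    (\<forall>i. \<forall>v\<in>W. \<forall>I. (\<lambda>k. c ^ k * (Sq i ^^ k) \<Phi> I v / fact k) sums \<Phi> I v)"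

text \<open>The zeroth Fourier coefficient in y of the generating function at
  \<open>v\<close>.\<close>

definition C0 :: "complex \<Rightarrow> 'n list \<Rightarrow> 'n::{finite,linorder} superfun \<Rightarrow> 'n cmatrix \<Rightarrow> complex" where
  "C0 c is \<Phi> v = avgs ay is (Fgen c \<Phi>) (0, v)"

context
  fixes W :: "'n::{finite,linorder} cmatrix set" and c :: complex
  assumes W: "open W" and c: "c\<^sup>2 = - (4 * of_real pi * \<i>)"
begin

lemma c_nonzero: "c \<noteq> 0"
  using c by auto

lemma dd_Fgen_dir:
  assumes "comm W \<Psi>" "x \<in> UNIV \<times> W"
  shows "dd (y, 0) (Fgen c \<Psi>) x = (\<Sum>j\<in>UNIV. (c * y $ j) * Fgen c (Sp j \<Psi>) x)"
  unfolding dir_y[of y]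
  by (simp add: dd_sum[OF holo_Fgen[OF W assms(1)] assms(2)] dd_cscale[OF holo_Fgen[OF W assms(1)] assms(2)]
      dd_Fgen_y[OF W assms] mult_ac)

text \<open>Two y-derivatives bring down c^2 and two odd operators, and these are minus an even
  derivative. Contracting with y y^t leaves an equation in two directions, as
  \<open>heat_unique\<close> requires.\<close>

lemma Fgen_heat:
  assumes "comm W \<Psi>" "x \<in> UNIV \<times> W"
  shows "dd (y, 0) (dd (y, 0) (Fgen c \<Psi>)) x = (4 * of_real pi * \<i>) * dd (0, outer y) (Fgen c \<Psi>) x"
proof -
  note S = open_S[OF W]
  have h: "holo (Fgen c (Sp j \<Psi>)) (UNIV \<times> W)" for j
    by (rule holo_Fgen[OF W comm_Sp[OF W assms(1)]])
  have "dd (y, 0) (dd (y, 0) (Fgen c \<Psi>)) x = dd (y, 0) (\<lambda>x. \<Sum>j\<in>UNIV. (c * y $ j) * Fgen c (Sp j \<Psi>) x) x"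
    by (rule dd_cong_open[OF S assms(2)]) (rule dd_Fgen_dir[OF assms(1)])
  also have "\<dots> = (\<Sum>j\<in>UNIV. (c * y $ j) * dd (y, 0) (Fgen c (Sp j \<Psi>)) x)"
    by (simp only: dd_sum_fun[OF holo_cmult[OF h] assms(2)] dd_cmult[OF h assms(2)])
  also have "\<dots> = (\<Sum>j\<in>UNIV. \<Sum>i\<in>UNIV. (c * y $ j) * ((c * y $ i) * Fgen c (Sp i (Sp j \<Psi>)) x))"
    by (simp only: dd_Fgen_dir[OF comm_Sp[OF W assms(1)] assms(2)] sum_distrib_left)
  also have "\<dots> = c\<^sup>2 * (\<Sum>i\<in>UNIV. \<Sum>j\<in>UNIV. (y $ i * y $ j) * Fgen c (Sp i (Sp j \<Psi>)) x)"
    by (subst sum.swap) (simp add: sum_distrib_left power2_eq_square mult_ac)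
  also have "(\<Sum>i\<in>UNIV. \<Sum>j\<in>UNIV. (y $ i * y $ j) * Fgen c (Sp i (Sp j \<Psi>)) x) = - dd (0, outer y) (Fgen c \<Psi>) x"
    unfolding dir_outer
    by (simp add: dd_sum[OF holo_Fgen[OF W assms(1)] assms(2)] dd_cscale[OF holo_Fgen[OF W assms(1)] assms(2)]
        dd_Fgen_v[OF W assms] sum_negf)
  finally show ?thesis by (simp add: c)
qed

text \<open>The initial set is y = 0: moving v along y y^t stays inside it, and moving y reaches
  every point in one step.\<close>

lemma heat_unique_zv:
  assumes H: "holo H (UNIV \<times> W)"
    and heat: "\<And>x. x \<in> UNIV \<times> W \<Longrightarrow> dd (y, 0) (dd (y, 0) H) x = (4 * of_real pi * \<i>) * dd (0, outer y) H x"
    and zero: "\<And>v. v \<in> W \<Longrightarrow> H (0, v) = 0" and first: "\<And>v. v \<in> W \<Longrightarrow> dd (y, 0) H (0, v) = 0"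
    and v: "v \<in> W"
  shows "H (y, v) = 0"
proof -
  have "H ((0, v) + 1 *\<^sub>C (y, 0)) = 0"
  proof (rule heat_unique[OF open_S[OF W] H _ heat, where N = "{0} \<times> W"])
    fix x :: "'n zv" assume x: "x \<in> {0} \<times> W"
    have "\<forall>\<^sub>F z in nhds 0. z \<in> {z. x + z *\<^sub>C (0, outer y) \<in> UNIV \<times> W}"
      by (rule eventually_nhds_in_open[OF open_line[OF open_S[OF W]]]) (use x in auto)
    then show "\<forall>\<^sub>F z in nhds 0. x + z *\<^sub>C (0, outer y) \<in> {0} \<times> W"
      by eventually_elim (use x in \<open>auto simp: cscale_Pair\<close>)
  qed (use zero first v in \<open>auto simp: cscale_Pair\<close>)
  then show ?thesis by simp
qed

section \<open>Periodicity of the generating function\<close>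

lemma ak_axis: "ak k \<Psi> (ax i, v) = (Sp i ^^ k) \<Psi> {} v"
proof (induction k arbitrary: \<Psi>)
  case (Suc k)
  have "ak (Suc k) \<Psi> (ax i, v) = (\<Sum>j\<in>UNIV. if j = i then ak k (Sp j \<Psi>) (ax i, v) else 0)"
    unfolding ak.simps by (intro sum.cong refl) (auto simp: axis_def)
  then show ?case using Suc by (simp add: funpow_Suc_right del: funpow.simps)
qed simp

lemma Sp_funpow_commute:
  assumes "comm W \<Psi>" "v \<in> W"
  shows "Sp j ((Sp i ^^ k) \<Psi>) I v = (Sp i ^^ k) (Sp j \<Psi>) I v"
  using assms
proof (induction k arbitrary: \<Psi> I v)
  case (Suc k)
  have "eqW W ((Sp i ^^ k) (Sp j (Sp i \<Psi>))) ((Sp i ^^ k) (Sp i (Sp j \<Psi>)))"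
  proof (induction k)
    case 0
    then show ?case using Suc.prems(1) by (simp add: comm_def[OF W])
  qed (simp add: eqW_Sp[OF W])
  then show ?case
    using Suc.IH[OF comm_Sp[OF W Suc.prems(1), of i] Suc.prems(2)] Suc.prems(2)
    by (simp add: funpow_Suc_right eqW_def[OF W] del: funpow.simps)
qed simp

text \<open>A translate in y solves the same heat equation. Values and first y-derivatives agree at
  y = 0 by the components of the p-equation at the empty set and at single indices.\<close>

lemma Fgen_periodic:
  assumes s: "sol W c \<Phi>" and v: "v \<in> W"
  shows "Fgen c \<Phi> (y + ax i, v) = Fgen c \<Phi> (y, v)"
proof -
  have cm: "comm W \<Phi>" using s by (simp add: sol_def)
  note hF = holo_Fgen[OF W cm, of c]
  have 0: "Fgen c \<Phi> (ax i, v) = Fgen c \<Phi> (0, v)" if v: "v \<in> W" for v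
  proof -
    have "(\<lambda>k. c ^ k * (Sp i ^^ k) \<Phi> {} v / fact k) sums \<Phi> {} v"
      using s v by (auto simp: sol_def)
    then show ?thesis using Fgen_sums[OF W cm, of "(ax i, v)" c] v
      by (simp add: Fgen_0[OF W] ak_axis sums_iff)
  qed
  have 1: "Fgen c (Sp j \<Phi>) (ax i, v) = Fgen c (Sp j \<Phi>) (0, v)" if v: "v \<in> W" for j v
  proof -
    have "(\<lambda>k. c ^ k * (Sp i ^^ k) \<Phi> {j} v / fact k) sums \<Phi> {j} v"
      using s v by (auto simp: sol_def)
    moreover have "(Sp i ^^ k) \<Phi> {j} v = (Sp i ^^ k) (Sp j \<Phi>) {} v" for k
      using Sp_funpow_commute[OF cm v, where j = j and i = i and k = k and I = "{}"] by (simp add: Sp_body)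
    ultimately show ?thesis using Fgen_sums[OF W comm_Sp[OF W cm, of j], of "(ax i, v)" c] v
      by (simp add: Fgen_0[OF W] ak_axis sums_iff Sp_body)
  qed
  let ?G = "\<lambda>x. Fgen c \<Phi> (ay i + x)"
  have inS: "ay i + x \<in> UNIV \<times> W" if "x \<in> UNIV \<times> W" for x :: "'n zv" using that by auto
  have hG: "holo ?G (UNIV \<times> W)"
    by (rule holo_affine[OF hF bounded_linear_ident]) auto
  have dG: "dd w (\<lambda>x. f (ay i + x)) x = dd w f (ay i + x)" for w f and x :: "'n zv"
    by (rule dd_affine[OF bounded_linear_ident]) simp
  have ddG: "dd w ?G = (\<lambda>x. dd w (Fgen c \<Phi>) (ay i + x))" for w
    by (rule ext) (rule dG)
  note S = open_S[OF W]
  have d1: "dd w (\<lambda>x. ?G x - Fgen c \<Phi> x) x = dd w (Fgen c \<Phi>) (ay i + x) - dd w (Fgen c \<Phi>) x"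
    if "x \<in> UNIV \<times> W" for w x
    using dd_diff[OF hG hF that] by (simp add: ddG)
  have "(\<lambda>x. ?G x - Fgen c \<Phi> x) (y, v) = 0"
  proof (rule heat_unique_zv[OF holo_diff[OF hG hF] _ _ _ v])
    fix x :: "'n zv" assume x: "x \<in> UNIV \<times> W"
    have "dd (y, 0) (dd (y, 0) (\<lambda>x. ?G x - Fgen c \<Phi> x)) x =
        dd (y, 0) (\<lambda>x. dd (y, 0) (Fgen c \<Phi>) (ay i + x) - dd (y, 0) (Fgen c \<Phi>) x) x"
      by (rule dd_cong_open[OF S x]) (rule d1)
    also have "\<dots> = dd (y, 0) (dd (y, 0) (Fgen c \<Phi>)) (ay i + x) - dd (y, 0) (dd (y, 0) (Fgen c \<Phi>)) x"
    proof (subst dd_diff)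
      show "holo (\<lambda>x. dd (y, 0) (Fgen c \<Phi>) (ay i + x)) (UNIV \<times> W)"
        by (rule holo_affine[OF holo_dd[OF S hF] bounded_linear_ident]) auto
      show "holo (dd (y, 0) (Fgen c \<Phi>)) (UNIV \<times> W)" by (rule holo_dd[OF S hF])
      show "x \<in> UNIV \<times> W" by (rule x)
    qed (simp add: dG)
    also have "\<dots> = (4 * of_real pi * \<i>) * dd (0, outer y) (\<lambda>x. ?G x - Fgen c \<Phi> x) x"
      unfolding Fgen_heat[OF cm inS[OF x]] Fgen_heat[OF cm x] d1[OF x] by (simp add: right_diff_distrib)
    finally show "dd (y, 0) (dd (y, 0) (\<lambda>x. ?G x - Fgen c \<Phi> x)) x =
        (4 * of_real pi * \<i>) * dd (0, outer y) (\<lambda>x. ?G x - Fgen c \<Phi> x) x" .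
  next
    fix v assume v: "v \<in> W"
    show "?G (0, v) - Fgen c \<Phi> (0, v) = 0" using 0[OF v] by simp
    have "(0, v) \<in> UNIV \<times> W" "(ax i, v) \<in> UNIV \<times> W" using v by auto
    then show "dd (y, 0) (\<lambda>x. ?G x - Fgen c \<Phi> x) (0, v) = 0"
      using d1[of "(0, v)" "(y, 0)"] by (simp add: dd_Fgen_dir[OF cm] 1[OF v])
  qed
  then show ?thesis by (simp add: add.commute)
qed

section \<open>Powers of the q-operators and quasi-periodicity\<close>

lemma Sq_diff_cmult:
  assumes "shol W \<Phi>" "shol W \<Psi>" "v \<in> W"
  shows "Sq i (\<lambda>I v. \<Phi> I v - a * \<Psi> I v) I v = Sq i \<Phi> I v - a * Sq i \<Psi> I v"
proof -
  have X: "X i (\<lambda>I. f I - a * g I) = (\<lambda>I. X i f I - a * X i g I)" for i :: 'n and f g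
    by (rule ext) (simp add: X_minus X_cmult)
  have "VV j i (Sp j (\<lambda>I v. \<Phi> I v - a * \<Psi> I v)) I v -
      1 / 2 * XX j (XX i (Sp j (\<lambda>I v. \<Phi> I v - a * \<Psi> I v))) I v =
      (VV j i (Sp j \<Phi>) I v - 1 / 2 * XX j (XX i (Sp j \<Phi>)) I v) -
      a * (VV j i (Sp j \<Psi>) I v - 1 / 2 * XX j (XX i (Sp j \<Psi>)) I v)" for j
    unfolding VV_def XX_def Sp_diff_cmult[OF W assms] X by (simp add: algebra_simps del: symm_nth)
  moreover have "XX i (\<lambda>I v. \<Phi> I v - a * \<Psi> I v) I v = XX i \<Phi> I v - a * XX i \<Psi> I v"
    unfolding XX_def X ..
  ultimately show ?thesis
    unfolding Sq_def by (simp only: sum_subtractf sum_distrib_left[symmetric]) (simp add: algebra_simps)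
qed

lemma comm_Sq_funpow: "comm W \<Phi> \<Longrightarrow> comm W ((Sq i ^^ k) \<Phi>)"
  by (induction k) (auto intro: comm_Sq[OF W])

text \<open>A scalar commutator acts on powers as a derivation. At \<open>k = 0\<close> the
  truncated \<open>k - 1\<close> is multiplied by zero.\<close>

lemma Sp_Sq_funpow:
  assumes cm: "comm W \<Phi>" and "v \<in> W"
  shows "Sp j ((Sq i ^^ k) \<Phi>) I v = (Sq i ^^ k) (Sp j \<Phi>) I v -
    (if i = j then of_nat k / 2 else 0) * (Sq i ^^ (k - 1)) \<Phi> I v"
  using assms(2)
proof (induction k arbitrary: I v)
  case (Suc k)
  note v = Suc.prems
  have "eqW W (Sp j ((Sq i ^^ k) \<Phi>)) (\<lambda>I v. (Sq i ^^ k) (Sp j \<Phi>) I v -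
    (if i = j then of_nat k / 2 else 0) * (Sq i ^^ (k - 1)) \<Phi> I v)"
    unfolding eqW_def[OF W] using Suc.IH by blast
  from eqWD[OF W eqW_Sq[OF W this] v]
  have "Sq i (Sp j ((Sq i ^^ k) \<Phi>)) I v = Sq i (\<lambda>I v. (Sq i ^^ k) (Sp j \<Phi>) I v -
    (if i = j then of_nat k / 2 else 0) * (Sq i ^^ (k - 1)) \<Phi> I v) I v" .
  also have "\<dots> = Sq i ((Sq i ^^ k) (Sp j \<Phi>)) I v -
      (if i = j then of_nat k / 2 else 0) * Sq i ((Sq i ^^ (k - 1)) \<Phi>) I v"
    by (rule Sq_diff_cmult) (intro comm_shol[OF W] comm_Sq_funpow comm_Sp[OF W] cm v)+
  finally have *: "Sq i (Sp j ((Sq i ^^ k) \<Phi>)) I v = (Sq i ^^ Suc k) (Sp j \<Phi>) I v -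
      (if i = j then of_nat k / 2 else 0) * (Sq i ^^ Suc (k - 1)) \<Phi> I v"
    by simp
  have "Sp j ((Sq i ^^ Suc k) \<Phi>) I v = Sq i (Sp j ((Sq i ^^ k) \<Phi>)) I v -
      (if i = j then 1 / 2 * (Sq i ^^ k) \<Phi> I v else 0)"
    using Sp_Sq[OF W comm_Sq_funpow[OF cm, of k i] v, of j i I] by simp
  also have "\<dots> = (Sq i ^^ Suc k) (Sp j \<Phi>) I v - (if i = j then of_nat (Suc k) / 2 else 0) * (Sq i ^^ k) \<Phi> I v"
    unfolding * by (cases k) (auto simp: field_simps)
  finally show ?case by simp
qed simp

text \<open>This is a Baker-Campbell-Hausdorff formula on bodies: the exponential of t q_i is
  \<open>exp (- s * t^2 / 4)\<close>, with s the diagonal entry of v, times the exponential of t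
  times the sum of the v_ji D_j. Both sides obey the same recursion in the degree of t.\<close>

lemma Sq_funpow_body:
  assumes "v \<in> W" "comm W \<Psi>"
  shows "(Sq i ^^ k) \<Psi> {} v / fact k =
    (\<Sum>l=0..k. gauss_coeff (symm v $ i $ i) l * (ak (k - l) \<Psi> (col v i, v) / fact (k - l)))"
proof -
  define s where "s = symm v $ i $ i"
  define A where "A = (\<lambda>\<Psi>. Abs_fps (\<lambda>k. ak k \<Psi> (col v i, v) / fact k))"
  define E where "E = Abs_fps (gauss_coeff s)"
  have dA: "fps_deriv (A \<Psi>) = (\<Sum>j\<in>UNIV. fps_const (col v i $ j) * A (Sp j \<Psi>))" for \<Psi>
  proof (rule fps_ext)
    fix n
    have f: "of_nat (Suc n) * (a / fact (Suc n)) = a / fact n" for a :: complex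
      by (simp add: divide_simps del: of_nat_Suc)
    have "fps_deriv (A \<Psi>) $ n = of_nat (Suc n) * (ak (Suc n) \<Psi> (col v i, v) / fact (Suc n))"
      by (simp add: A_def del: of_nat_Suc fact_Suc ak.simps)
    also have "\<dots> = ak (Suc n) \<Psi> (col v i, v) / fact n" by (rule f)
    finally show "fps_deriv (A \<Psi>) $ n = (\<Sum>j\<in>UNIV. fps_const (col v i $ j) * A (Sp j \<Psi>)) $ n"
      by (simp add: A_def fps_sum_nth sum_divide_distrib)
  qed
  \<comment> \<open>Differentiating the product in t: the second factor brings down one odd
    operator, the Gaussian factor lowers the degree by one.\<close>
  have dEA: "of_nat (Suc n) * (E * A \<Psi>) $ Suc n = (\<Sum>j\<in>UNIV. col v i $ j * (E * A (Sp j \<Psi>)) $ n) +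
      (- s / 2) * (if n = 0 then 0 else (E * A \<Psi>) $ (n - 1))" for n \<Psi>
  proof -
    have "of_nat (Suc n) * (E * A \<Psi>) $ Suc n = fps_deriv (E * A \<Psi>) $ n"
      by (simp only: fps_deriv_nth Suc_eq_plus1)
    also have "fps_deriv (E * A \<Psi>) = (\<Sum>j\<in>UNIV. fps_const (col v i $ j) * (E * A (Sp j \<Psi>))) +
        fps_const (- s / 2) * (fps_X * (E * A \<Psi>))"
      unfolding fps_deriv_mult dA using gauss_coeff_rec[of s, folded E_def]
      by (simp add: sum_distrib_left algebra_simps)
    finally show ?thesis by (simp add: fps_sum_nth)
  qed
  have "(Sq i ^^ k) \<Psi> {} v / fact k = (E * A \<Psi>) $ k" if "comm W \<Psi>"
    using that
  proof (induction k arbitrary: \<Psi> rule: less_induct)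
    case (less k)
    show ?case
    proof (cases k)
      case 0
      then show ?thesis by (simp add: E_def A_def gauss_coeff_def)
    next
      case (Suc n)
      \<comment> \<open>Moving \<open>Sp j\<close> inside leaves the induction hypothesis for
        \<open>Sp j \<Psi>\<close> at degree n and, from the commutator, for \<open>\<Psi>\<close>
        at degree n - 1.\<close>
      have 1: "Sp j ((Sq i ^^ n) \<Psi>) {} v / fact n = (E * A (Sp j \<Psi>)) $ n -
          (if j = i then 1 / 2 * (if n = 0 then 0 else (E * A \<Psi>) $ (n - 1)) else 0)" for j
      proof -
        have a: "(Sq i ^^ n) (Sp j \<Psi>) {} v / fact n = (E * A (Sp j \<Psi>)) $ n"
          by (rule less.IH) (use Suc less.prems in \<open>auto intro: comm_Sp[OF W]\<close>)
        have b: "of_nat n * (Sq i ^^ (n - 1)) \<Psi> {} v / fact n = (if n = 0 then 0 else (E * A \<Psi>) $ (n - 1))"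
        proof (cases n)
          case (Suc m)
          have "(Sq i ^^ m) \<Psi> {} v / fact m = (E * A \<Psi>) $ m"
            by (rule less.IH) (use \<open>k = Suc n\<close> Suc less.prems in auto)
          moreover have "of_nat (Suc m) * a / fact (Suc m) = a / fact m" for a :: complex
            by (simp add: divide_simps del: of_nat_Suc)
          ultimately show ?thesis by (simp add: Suc del: of_nat_Suc fact_Suc)
        qed simp
        show ?thesis
          unfolding Sp_Sq_funpow[OF less.prems assms(1)] diff_divide_distrib a b[symmetric] by simp
      qed
      have "(Sq i ^^ Suc n) \<Psi> {} v / fact n = (\<Sum>j\<in>UNIV. col v i $ j * (Sp j ((Sq i ^^ n) \<Psi>) {} v / fact n))"
        by (simp add: Sq_body col_def sum_divide_distrib del: symm_nth)
      also have "\<dots> = (\<Sum>j\<in>UNIV. col v i $ j * (E * A (Sp j \<Psi>)) $ n) -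
          (\<Sum>j\<in>UNIV. if j = i then col v i $ j * (1 / 2 * (if n = 0 then 0 else (E * A \<Psi>) $ (n - 1))) else 0)"
        unfolding 1 right_diff_distrib sum_subtractf by (intro arg_cong2[of _ _ _ _ "(-)"] sum.cong refl) auto
      also have "\<dots> = of_nat (Suc n) * (E * A \<Psi>) $ Suc n"
        unfolding dEA by (simp add: col_def s_def del: symm_nth)
      finally have "(Sq i ^^ Suc n) \<Psi> {} v / fact n / of_nat (Suc n) = (E * A \<Psi>) $ Suc n"
        by (simp add: field_simps del: of_nat_Suc)
      then show ?thesis unfolding Suc by (simp add: mult.commute del: of_nat_Suc funpow.simps)
    qed
  qed
  then show ?thesis using assms(2) by (simp add: fps_mult_nth E_def A_def s_def)
qed

text \<open>At t = c the convolution is a Cauchy product of absolutely convergent series, and the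
  Gaussian factor becomes the one of the theta function.\<close>

lemma Sq_series_body:
  assumes cm: "comm W \<Psi>" and v: "v \<in> W"
  shows "(\<lambda>k. c ^ k * (Sq i ^^ k) \<Psi> {} v / fact k) sums
    (exp (of_real pi * \<i> * symm v $ i $ i) * Fgen c \<Psi> (col v i, v))"
proof -
  define e where "e = (\<lambda>k. c ^ k * gauss_coeff (symm v $ i $ i) k)"
  define a where "a = (\<lambda>k. c ^ k / fact k * ak k \<Psi> (col v i, v))"
  have x: "(col v i, v) \<in> UNIV \<times> W" using v by auto
  have e: "e sums exp (of_real pi * \<i> * symm v $ i $ i)" "summable (\<lambda>k. norm (e k))"
    unfolding e_def by (rule gauss_coeff_sums[OF c])+
  have a: "a sums Fgen c \<Psi> (col v i, v)" "summable (\<lambda>k. norm (a k))"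
    unfolding a_def by (rule Fgen_sums[OF W cm x], rule ak_summable[OF W cm x])
  have "(\<lambda>k. \<Sum>l\<le>k. e l * a (k - l)) sums ((\<Sum>k. e k) * (\<Sum>k. a k))"
    by (rule Cauchy_product_sums[OF e(2) a(2)])
  moreover have "(\<Sum>l\<le>k. e l * a (k - l)) = c ^ k * (Sq i ^^ k) \<Psi> {} v / fact k" for k
  proof -
    have "(\<Sum>l\<le>k. e l * a (k - l)) = (\<Sum>l=0..k. c ^ k *
        (gauss_coeff (symm v $ i $ i) l * (ak (k - l) \<Psi> (col v i, v) / fact (k - l))))"
    proof (rule sum.cong)
      fix l assume "l \<in> {0..k}"
      then have "c ^ k = c ^ l * c ^ (k - l)" by (simp add: power_add[symmetric])
      then show "e l * a (k - l) = c ^ k *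
        (gauss_coeff (symm v $ i $ i) l * (ak (k - l) \<Psi> (col v i, v) / fact (k - l)))"
        by (simp add: e_def a_def del: symm_nth)
    qed auto
    also have "\<dots> = c ^ k * ((Sq i ^^ k) \<Psi> {} v / fact k)"
      unfolding Sq_funpow_body[OF v cm] by (simp add: sum_distrib_left)
    finally show ?thesis by simp
  qed
  ultimately show ?thesis using e(1) a(1) by (simp add: sums_iff)
qed

text \<open>Shifting y by a column of v and multiplying by the automorphy factor preserves the heat
  equation, so it is enough to compare values and first y-derivatives at y = 0. These come from the
  components of the q-equation at the empty set and at single indices.\<close>

lemma Fgen_quasi:
  assumes s: "sol W c \<Phi>" and v: "v \<in> W"
  shows "exp (lphase i (y, v)) * Fgen c \<Phi> (y + col v i, v) = Fgen c \<Phi> (y, v)"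
proof -
  have cm: "comm W \<Phi>" using s by (simp add: sol_def)
  note hF = holo_Fgen[OF W cm, of c]
  note S = open_S[OF W]
  define e where "e = (\<lambda>v. exp (of_real pi * \<i> * symm v $ i $ i))"
  have 0: "e v * Fgen c \<Phi> (col v i, v) = \<Phi> {} v" if v: "v \<in> W" for v
  proof -
    have "(\<lambda>k. c ^ k * (Sq i ^^ k) \<Phi> {} v / fact k) sums \<Phi> {} v"
      using s v by (auto simp: sol_def)
    from sums_unique2[OF Sq_series_body[OF cm v] this] show ?thesis by (simp add: e_def)
  qed
  have 1: "e v * (c * Fgen c (Sp j \<Phi>) (col v i, v) + (if j = i then 2 * of_real pi * \<i> else 0) * Fgen c \<Phi> (col v i, v)) =
      c * \<Phi> {j} v" if v: "v \<in> W" for j v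
  proof -
    define d :: complex where "d = (if i = j then 1 / 2 else 0)"
    have hyp: "(\<lambda>k. c ^ k * (Sq i ^^ k) \<Phi> {j} v / fact k) sums \<Phi> {j} v"
      using s v by (auto simp: sol_def)
    have A: "(\<lambda>k. c ^ k * (Sq i ^^ k) (Sp j \<Phi>) {} v / fact k) sums (e v * Fgen c (Sp j \<Phi>) (col v i, v))"
      unfolding e_def by (rule Sq_series_body[OF comm_Sp[OF W cm] v])
    \<comment> \<open>The commutator corrections carry a factor k, which cancels against k!; they
      sum to \<open>d * c\<close> times the series for the body, with its index shifted by
      one.\<close>
    have "(\<lambda>k. d * c * (c ^ k * (Sq i ^^ k) \<Phi> {} v / fact k)) sums (d * c * (e v * Fgen c \<Phi> (col v i, v)))"
      unfolding e_def by (intro sums_mult Sq_series_body[OF cm v])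
    also have "(\<lambda>k. d * c * (c ^ k * (Sq i ^^ k) \<Phi> {} v / fact k)) =
        (\<lambda>k. c ^ Suc k * (d * of_nat (Suc k) * (Sq i ^^ (Suc k - 1)) \<Phi> {} v) / fact (Suc k))"
      by (simp add: fun_eq_iff divide_simps del: of_nat_Suc)
    finally have B: "(\<lambda>k. c ^ k * (d * of_nat k * (Sq i ^^ (k - 1)) \<Phi> {} v) / fact k) sums
        (d * c * (e v * Fgen c \<Phi> (col v i, v)))"
      by (subst (asm) sums_Suc_iff) simp
    have "(Sq i ^^ k) \<Phi> {j} v = (Sq i ^^ k) (Sp j \<Phi>) {} v - d * of_nat k * (Sq i ^^ (k - 1)) \<Phi> {} v" for k
      using Sp_Sq_funpow[OF cm v, where j = j and i = i and k = k and I = "{}"] by (auto simp: Sp_body d_def)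
    then have "(\<lambda>k. c ^ k * (Sq i ^^ k) \<Phi> {j} v / fact k) sums
        (e v * Fgen c (Sp j \<Phi>) (col v i, v) - d * c * (e v * Fgen c \<Phi> (col v i, v)))"
      using sums_diff[OF A B] by (simp add: right_diff_distrib diff_divide_distrib)
    from sums_unique2[OF this hyp]
    have *: "c * \<Phi> {j} v = e v * (c * Fgen c (Sp j \<Phi>) (col v i, v)) - d * c\<^sup>2 * (e v * Fgen c \<Phi> (col v i, v))"
      by (simp add: power2_eq_square algebra_simps)
    \<comment> \<open>The commutator scalar 1/2 times c^2 becomes the coefficient 2 pi i of y_i in
      the automorphy factor.\<close>
    have q: "(if j = i then 2 * of_real pi * \<i> else 0) = - (d * c\<^sup>2)"
      by (auto simp: d_def c)
    show ?thesis unfolding q * by (simp only: ring_distribs mult_minus_left mult_minus_right mult_ac diff_conv_add_uminus)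
  qed
  have inS: "lshift i x \<in> UNIV \<times> W" if "x \<in> UNIV \<times> W" for x :: "'n zv" using that by (auto simp: lshift_def)
  have hL: "holo (\<lambda>x. g (lshift i x)) (UNIV \<times> W)" if "holo g (UNIV \<times> W)" for g
    using holo_affine[OF that bounded_linear_lshift lshift_cscale, of "UNIV \<times> W" 0] inS by simp
  have dL: "dd w (\<lambda>x. g (lshift i x)) x = dd (lshift i w) g (lshift i x)" for w g x
    using dd_affine[OF bounded_linear_lshift lshift_cscale, of w g 0] by simp
  have tw: "dd w (\<lambda>x. exp (lphase i x) * g (lshift i x)) x =
      exp (lphase i x) * (lphase i w * g (lshift i x) + dd (lshift i w) g (lshift i x))"
    if "holo g (UNIV \<times> W)" "x \<in> UNIV \<times> W" for g w x
    by (simp add: dd_times[OF holo_exp[OF holo_lphase] hL[OF that(1)] that(2)]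
        dd_exp[OF holo_lphase that(2)] dd_lphase dL algebra_simps)
  let ?F = "Fgen c \<Phi>" and ?a = "(y, 0) :: 'n zv"
  define al where "al = lphase i ?a"
  have al: "al = 2 * of_real pi * \<i> * y $ i" by (simp add: al_def lphase_def)
  have col0: "col 0 i = 0" by (simp add: col_def vec_eq_iff)
  have la: "lshift i ?a = ?a" by (simp add: lshift_def col0)
  define K where "K = (\<lambda>x. exp (lphase i x) * ?F (lshift i x))"
  have hK: "holo K (UNIV \<times> W)" unfolding K_def by (intro holo_mult holo_exp holo_lphase hL hF)
  have K1: "dd ?a K x = exp (lphase i x) * (\<lambda>x. al * ?F x + dd ?a ?F x) (lshift i x)" if "x \<in> UNIV \<times> W" for x
    unfolding K_def tw[OF hF that] la al_def by simp
  have hg: "holo (\<lambda>x. al * ?F x + dd ?a ?F x) (UNIV \<times> W)"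
    by (intro holo_add holo_cmult hF holo_dd[OF S hF])
  have K2: "dd ?a (dd ?a K) x = exp (lphase i x) *
      (al\<^sup>2 * ?F (lshift i x) + 2 * al * dd ?a ?F (lshift i x) + dd ?a (dd ?a ?F) (lshift i x))"
    if x: "x \<in> UNIV \<times> W" for x
  proof -
    have "dd ?a (dd ?a K) x = dd ?a (\<lambda>x. exp (lphase i x) * (\<lambda>x. al * ?F x + dd ?a ?F x) (lshift i x)) x"
      by (rule dd_cong_open[OF S x K1])
    also have "\<dots> = exp (lphase i x) * (al * (al * ?F (lshift i x) + dd ?a ?F (lshift i x)) +
        dd ?a (\<lambda>x. al * ?F x + dd ?a ?F x) (lshift i x))"
      using tw[OF hg x, of ?a] by (simp only: la al_def)
    also have "dd ?a (\<lambda>x. al * ?F x + dd ?a ?F x) (lshift i x) = al * dd ?a ?F (lshift i x) + dd ?a (dd ?a ?F) (lshift i x)"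
      by (simp only: dd_plus[OF holo_cmult[OF hF] holo_dd[OF S hF] inS[OF x]] dd_cmult[OF hF inS[OF x]])
    finally show ?thesis by (simp add: power2_eq_square algebra_simps)
  qed
  \<comment> \<open>The shift depends on v: moving v along y y^t also moves the shifted argument by
    y_i y, which produces the first-order term.\<close>
  have Kb: "dd (0, outer y) K x = exp (lphase i x) * ((of_real pi * \<i> * (y $ i)\<^sup>2) * ?F (lshift i x) +
      (y $ i * dd ?a ?F (lshift i x) + dd (0, outer y) ?F (lshift i x)))" if x: "x \<in> UNIV \<times> W" for x
  proof -
    have "lshift i (0, outer y) = (y $ i) *\<^sub>C ?a + (0, outer y)"
      by (simp add: lshift_def col_def cscale_Pair vec_eq_iff mult.commute)
    then have "dd (lshift i (0, outer y)) ?F (lshift i x) = y $ i * dd ?a ?F (lshift i x) + dd (0, outer y) ?F (lshift i x)"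
      by (simp only: dd_add[OF hF inS[OF x]] dd_cscale[OF hF inS[OF x]])
    moreover have "lphase i (0, outer y) = of_real pi * \<i> * (y $ i)\<^sup>2"
      by (simp add: lphase_def power2_eq_square)
    ultimately show ?thesis unfolding K_def tw[OF hF x] by simp
  qed
  have "(\<lambda>x. K x - ?F x) (y, v) = 0"
  proof (rule heat_unique_zv[OF holo_diff[OF hK hF] _ _ _ v])
    fix x :: "'n zv" assume x: "x \<in> UNIV \<times> W"
    \<comment> \<open>This identity of exponents makes the zeroth-order terms agree; the first-order
      ones agree because \<open>2 * al\<close> is 4 pi i times y_i.\<close>
    have al2: "al\<^sup>2 = (4 * of_real pi * \<i>) * (of_real pi * \<i> * (y $ i)\<^sup>2)"
      by (simp add: al power_mult_distrib power2_eq_square)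
    have "dd ?a (dd ?a (\<lambda>x. K x - ?F x)) x = dd ?a (\<lambda>x. dd ?a K x - dd ?a ?F x) x"
      by (rule dd_cong_open[OF S x]) (rule dd_diff[OF hK hF])
    also have "\<dots> = dd ?a (dd ?a K) x - dd ?a (dd ?a ?F) x"
      by (rule dd_diff[OF holo_dd[OF S hK] holo_dd[OF S hF] x])
    also have "dd ?a (dd ?a K) x = (4 * of_real pi * \<i>) * dd (0, outer y) K x"
      unfolding K2[OF x] Kb[OF x] Fgen_heat[OF cm inS[OF x]] al2 unfolding al by (simp add: algebra_simps)
    also have "dd ?a (dd ?a ?F) x = (4 * of_real pi * \<i>) * dd (0, outer y) ?F x"
      by (rule Fgen_heat[OF cm x])
    finally show "dd ?a (dd ?a (\<lambda>x. K x - ?F x)) x = (4 * of_real pi * \<i>) * dd (0, outer y) (\<lambda>x. K x - ?F x) x"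
      by (simp only: dd_diff[OF hK hF x] right_diff_distrib)
  next
    fix v assume v: "v \<in> W"
    have ex: "exp (lphase i (0, v)) = e v" by (simp add: lphase_def e_def)
    have ls: "lshift i (0, v) = (col v i, v)" by (simp add: lshift_def)
    show "K (0, v) - ?F (0, v) = 0"
      unfolding K_def ex ls 0[OF v] Fgen_0[OF W] by simp
    have x: "(0, v) \<in> UNIV \<times> W" "(col v i, v) \<in> UNIV \<times> W" using v by auto
    have "dd ?a K (0, v) = e v * (al * ?F (col v i, v) + (\<Sum>j\<in>UNIV. (c * y $ j) * Fgen c (Sp j \<Phi>) (col v i, v)))"
      unfolding K1[OF x(1)] ex ls dd_Fgen_dir[OF cm x(2)] ..
    also have "al * ?F (col v i, v) = (\<Sum>j\<in>UNIV. if j = i then y $ j * (2 * of_real pi * \<i>) * ?F (col v i, v) else 0)"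
      by (simp add: al)
    also have "e v * (\<dots> + (\<Sum>j\<in>UNIV. (c * y $ j) * Fgen c (Sp j \<Phi>) (col v i, v))) =
        (\<Sum>j\<in>UNIV. y $ j * (e v * (c * Fgen c (Sp j \<Phi>) (col v i, v) + (if j = i then 2 * of_real pi * \<i> else 0) * ?F (col v i, v))))"
      unfolding sum.distrib[symmetric] sum_distrib_left by (intro sum.cong refl) (auto simp: algebra_simps)
    also have "\<dots> = dd ?a ?F (0, v)"
      unfolding 1[OF v] dd_Fgen_dir[OF cm x(1)] by (simp add: Fgen_0[OF W] Sp_body mult_ac)
    finally show "dd ?a (\<lambda>x. K x - ?F x) (0, v) = 0"
      by (simp add: dd_diff[OF hK hF x(1)])
  qed
  then show ?thesis by (simp add: K_def lshift_def)
qed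

end

subsection \<open>The space of solutions is at most one-dimensional\<close>

lemma avgs_slice: "avgs ay is F (y, v) = avgs ax is (\<lambda>y. F (y, v)) y"
proof (induction "is" arbitrary: y)
  case (Cons i "is")
  then show ?case by (simp add: avg_def cscale_Pair)
qed simp

lemma avgs_diff_cmult:
  assumes cyl: "\<And>i. cyl (E i) S" and f: "holo f S" and g: "holo g S" and "x \<in> S"
  shows "avgs E is (\<lambda>x. f x - a * g x) x = avgs E is f x - a * avgs E is g x"
  using assms(4)
proof (induction "is" arbitrary: x)
  case (Cons i "is")
  have cf: "continuous_on S (avgs E is f)" and cg: "continuous_on S (\<lambda>x. a * avgs E is g x)"
    using holo_continuous_on[OF holo_avgs[OF cyl f]] holo_continuous_on[OF holo_cmult[OF holo_avgs[OF cyl g]]]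
    by auto
  have "avgs E (i # is) (\<lambda>x. f x - a * g x) x = avg (E i) (\<lambda>x. avgs E is f x - a * avgs E is g x) x"
    unfolding avgs.simps by (rule avg_cong[OF cyl Cons.prems Cons.IH])
  also have "\<dots> = avg (E i) (avgs E is f) x - avg (E i) (\<lambda>x. a * avgs E is g x) x"
    by (rule avg_diff[OF cyl cf cg Cons.prems])
  also have "avg (E i) (\<lambda>x. a * avgs E is g x) x = a * avg (E i) (avgs E is g) x"
    by (rule avg_mult_inv) simp
  finally show ?case by simp
qed simp

context
  fixes W :: "'n::{finite,linorder} cmatrix set" and c :: complex
  assumes W: "open W" and c: "c\<^sup>2 = - (4 * of_real pi * \<i>)"
begin

lemma sol_comm: "sol W c \<Phi> \<Longrightarrow> comm W \<Phi>"
  by (simp add: sol_def)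

text \<open>By the heat equation a v-derivative of F is a multiple of the y_i-derivative of a
  periodic function, and the average of the latter function is constant along the y_i-lines.\<close>

lemma dd_C0:
  assumes s: "sol W c \<Phi>" and v: "v \<in> W" and "is": "set is = UNIV"
  shows "dd (0, w) (avgs ay is (Fgen c \<Phi>)) (0, v) = 0"
proof -
  note cm = sol_comm[OF s]
  note S = open_S[OF W] and cyl = cyl_S[OF W] and hF = holo_Fgen[OF W cm, of c]
  have x: "(0, v) \<in> UNIV \<times> W" using v by auto
  have hA: "holo (avgs ay is (Fgen c \<Phi>)) (UNIV \<times> W)" by (rule holo_avgs[OF cyl hF])
  have z: "dd (av i j) (avgs ay is (Fgen c \<Phi>)) (0, v) = 0" for i j
  proof -
    define K where "K = dd (ay j) (Fgen c \<Phi>)"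
    have hK: "holo K (UNIV \<times> W)" unfolding K_def by (rule holo_dd[OF S hF])
    have perK: "K (x + ay l) = K x" if "x \<in> UNIV \<times> W" for x l
    proof -
      have "K (x + ay l) = dd (ay j) (\<lambda>x. Fgen c \<Phi> (x + ay l)) x"
        unfolding K_def by (simp add: dd_def add_ac)
      also have "\<dots> = K x"
        unfolding K_def
      proof (rule dd_cong_open[OF S that])
        show "Fgen c \<Phi> (x + ay l) = Fgen c \<Phi> x" if "x \<in> UNIV \<times> W" for x
          using Fgen_periodic[OF W c s, of "snd x" "fst x" l] that by (cases x) auto
      qed
      finally show ?thesis .
    qed
    have inv: "avgs ay is K (x + z *\<^sub>C ay i) = avgs ay is K x" if "x \<in> UNIV \<times> W" for x z
      by (rule avgs_invariant[OF cyl hK perK that]) (auto simp: "is")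
    have "dd (av i j) (Fgen c \<Phi>) x = - (1 / c\<^sup>2) * dd (ay i) K x" if x: "x \<in> UNIV \<times> W" for x
    proof -
      have "dd (ay i) K x = dd (ay i) (\<lambda>x. c * Fgen c (Sp j \<Phi>) x) x"
        unfolding K_def by (rule dd_cong_open[OF S x dd_Fgen_y[OF W cm]])
      also have "\<dots> = c * (c * Fgen c (Sp i (Sp j \<Phi>)) x)"
        by (simp only: dd_cmult[OF holo_Fgen[OF W comm_Sp[OF W cm]] x] dd_Fgen_y[OF W comm_Sp[OF W cm] x])
      finally show ?thesis using c_nonzero[OF W c]
        by (simp add: dd_Fgen_v[OF W cm x] power2_eq_square)
    qed
    then have "avgs ay is (dd (av i j) (Fgen c \<Phi>)) (0, v) = avgs ay is (\<lambda>x. - (1 / c\<^sup>2) * dd (ay i) K x) (0, v)"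
      by (rule avgs_cong[OF cyl x])
    also have "\<dots> = - (1 / c\<^sup>2) * avgs ay is (dd (ay i) K) (0, v)"
      by (rule avgs_mult_inv) simp
    also have "avgs ay is (dd (ay i) K) (0, v) = dd (ay i) (avgs ay is K) (0, v)"
      by (rule dd_avgs[OF cyl hK x, symmetric])
    also have "\<dots> = 0" unfolding dd_def using inv[OF x] by simp
    finally show ?thesis by (simp add: dd_avgs[OF cyl hF x])
  qed
  have "(0, w) = (\<Sum>i\<in>UNIV. \<Sum>j\<in>UNIV. (w $ i $ j) *\<^sub>C av i j)"
    by (subst (1) matrix_unit_expansion) (simp add: Pair_zero_sum cscale_Pair)
  then show ?thesis by (simp add: dd_sum[OF hA x] dd_cscale[OF hA x] z)
qed

lemma C0_locally_constant:
  assumes s: "sol W c \<Phi>" and "is": "set is = UNIV" and b: "ball v r \<subseteq> W" and u: "u \<in> ball v r"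
  shows "C0 c is \<Phi> u = C0 c is \<Phi> v"
proof (rule has_derivative_zero_unique[where s = "ball v r", OF convex_ball])
  have hA: "holo (avgs ay is (Fgen c \<Phi>)) (UNIV \<times> W)"
    by (rule holo_avgs[OF cyl_S[OF W] holo_Fgen[OF W sol_comm[OF s]]])
  show "(C0 c is \<Phi> has_derivative (\<lambda>h. 0)) (at x within ball v r)" if "x \<in> ball v r" for x
  proof -
    have x: "x \<in> W" using that b by auto
    have "((\<lambda>x. (0, x)) has_derivative (\<lambda>w. (0, w))) (at x)"
      by (intro has_derivative_Pair has_derivative_const has_derivative_ident)
    moreover have "(avgs ay is (Fgen c \<Phi>) has_derivative (\<lambda>w. dd w (avgs ay is (Fgen c \<Phi>)) (0, x))) (at (0, x))"
      by (rule holo_has_derivative[OF hA]) (use x in auto)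
    ultimately have "((\<lambda>x. avgs ay is (Fgen c \<Phi>) (0, x)) has_derivative
        (\<lambda>w. dd (0, w) (avgs ay is (Fgen c \<Phi>)) (0, x))) (at x)"
      by (rule has_derivative_compose)
    then have "(C0 c is \<Phi> has_derivative (\<lambda>h. 0)) (at x)"
      unfolding dd_C0[OF s x "is"] C0_def[abs_def] .
    then show ?thesis by (rule has_derivative_at_withinI)
  qed
  show "v \<in> ball v r" using u by (auto intro: le_less_trans[OF zero_le_dist])
  show "u \<in> ball v r" by (rule u)
qed

lemma C0_zero_Fgen_zero:
  assumes s: "sol W c \<Phi>" and v: "v \<in> W" and "is": "distinct is" "set is = UNIV" and 0: "C0 c is \<Phi> v = 0"
  shows "Fgen c \<Phi> (y, v) = 0"
proof (rule quasi_periodic_zero[where f = "\<lambda>y. Fgen c \<Phi> (y, v)" and t = "col v"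
      and b = "\<lambda>i. of_real pi * \<i> * symm v $ i $ i", OF _ _ _ "is"])
  show "holo (\<lambda>y. Fgen c \<Phi> (y, v)) UNIV"
  proof -
    have "holo (\<lambda>y. Fgen c \<Phi> ((0, v) + (y, 0))) UNIV"
      by (rule holo_affine[OF holo_Fgen[OF W sol_comm[OF s]]])
        (use v in \<open>auto simp: cscale_Pair intro!: bounded_linear_Pair bounded_linear_ident bounded_linear_zero\<close>)
    then show ?thesis by simp
  qed
  show "Fgen c \<Phi> (y + ax i, v) = Fgen c \<Phi> (y, v)" for y i
    by (rule Fgen_periodic[OF W c s v])
  show "exp (of_real pi * \<i> * symm v $ i $ i + 2 * of_real pi * \<i> * y $ i) * Fgen c \<Phi> (y + col v i, v) = Fgen c \<Phi> (y, v)" for y i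
    using Fgen_quasi[OF W c s v, of i y] by (simp add: lphase_def)
  show "avgs ax is (\<lambda>y. Fgen c \<Phi> (y, v)) 0 = 0"
    using 0 by (simp add: C0_def avgs_slice)
qed

text \<open>Induction on the size of \<open>I\<close>, for all superfunctions at once. Up to sign,
  the component at \<open>insert i J\<close> is that of \<open>Sp i \<Psi>\<close> at
  \<open>J\<close> plus derivatives of smaller components, and the generating function of
  \<open>Sp i \<Psi>\<close> vanishes as a y-derivative of zero.\<close>

lemma Fgen_zero_imp_zero:
  assumes "comm W \<Psi>" "\<And>x. x \<in> UNIV \<times> W \<Longrightarrow> Fgen c \<Psi> x = 0" "v \<in> W"
  shows "\<Psi> I v = 0"
  using assms
proof (induction "card I" arbitrary: I \<Psi> v rule: less_induct)
  case less
  show ?case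
  proof (cases "I = {}")
    case True
    then show ?thesis using less.prems(2)[of "(0, v)"] less.prems(3) by (simp add: Fgen_0[OF W])
  next
    case False
    then obtain i where i: "i \<in> I" by auto
    define J where "J = I - {i}"
    have J: "I = insert i J" "i \<notin> J" using i by (auto simp: J_def)
    have cJ: "card J < card I" unfolding J_def using i by (intro psubset_card_mono) auto
    have FSp: "Fgen c (Sp i \<Psi>) x = 0" if x: "x \<in> UNIV \<times> W" for x
    proof -
      have "c * Fgen c (Sp i \<Psi>) x = dd (ay i) (Fgen c \<Psi>) x" by (rule dd_Fgen_y[OF W less.prems(1) x, symmetric])
      also have "\<dots> = dd (ay i) (\<lambda>_. 0) x" by (rule dd_cong_open[OF open_S[OF W] x less.prems(2)])
      finally show ?thesis using c_nonzero[OF W c] by simp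
    qed
    have 1: "Sp i \<Psi> J v = 0" by (rule less.hyps[OF cJ comm_Sp[OF W less.prems(1)] FSp less.prems(3)])
    have 2: "XX j (pd i j \<Psi>) J v = 0" for j
    proof (cases "j \<in> J")
      case True
      have "dd (Em i j) (\<Psi> (J - {j})) v = dd (Em i j) (\<lambda>_. 0) v"
      proof (rule dd_cong_open[OF W less.prems(3)])
        have "card (J - {j}) < card I" using cJ card_Diff1_le[of J j] by linarith
        from less.hyps[OF this less.prems(1,2)]
        show "\<Psi> (J - {j}) u = 0" if "u \<in> W" for u
          using that by simp
      qed
      then show ?thesis by (simp add: XX_def X_def pd_def)
    qed (simp add: XX_def X_def)
    have "sg i J * \<Psi> I v = 0" using 1 J by (simp add: Sp_def del_def 2)
    moreover have "sg i J \<noteq> 0" by (simp add: sg_def)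
    ultimately show ?thesis by simp
  qed
qed

text \<open>Connectedness is used on \<open>U\<close>, inside which the Fourier coefficient is
  locally constant; the other points of \<open>W\<close> are reached through \<open>symm\<close>, on
  which alone F depends.\<close>

lemma sol_zero:
  assumes s: "sol W c \<Phi>" and U: "connected U" "U \<subseteq> W" and v0: "v0 \<in> U"
    and WU: "\<And>v. v \<in> W \<Longrightarrow> symm v \<in> U"
    and "is": "distinct is" "set is = UNIV" and 0: "C0 c is \<Phi> v0 = 0" and v: "v \<in> W"
  shows "\<Phi> I v = 0"
proof -
  have "C0 c is \<Phi> constant_on U"
  proof (rule locally_constant_imp_constant[OF U(1)])
    fix a assume a: "a \<in> U"
    obtain r where r: "r > 0" "ball a r \<subseteq> W" using a U(2) W open_contains_ball by blast
    show "\<exists>T. openin (top_of_set U) T \<and> a \<in> T \<and> (\<forall>x\<in>T. C0 c is \<Phi> x = C0 c is \<Phi> a)"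
    proof (intro exI conjI ballI)
      show "openin (top_of_set U) (U \<inter> ball a r)" by (rule openin_open_Int[OF open_ball])
      show "a \<in> U \<inter> ball a r" using a r(1) by simp
      show "C0 c is \<Phi> x = C0 c is \<Phi> a" if "x \<in> U \<inter> ball a r" for x
        using that by (intro C0_locally_constant[OF s "is"(2) r(2)]) simp
    qed
  qed
  then have C: "C0 c is \<Phi> u = 0" if "u \<in> U" for u
    using that v0 0 by (auto simp: constant_on_def)
  have "Fgen c \<Phi> x = 0" if "x \<in> UNIV \<times> W" for x
  proof -
    define y u where "y = fst x" and "u = snd x"
    then have x: "x = (y, u)" "u \<in> W" using that by auto
    have "Fgen c \<Phi> (y, u) = Fgen c \<Phi> (y, symm u)"
      by (simp only: Fgen_symm[OF W comm_shol[OF W sol_comm[OF s]]])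
    also have "\<dots> = 0"
      using WU[OF x(2)] U(2) by (intro C0_zero_Fgen_zero[OF s _ "is"] C) auto
    finally show ?thesis using x by simp
  qed
  then show ?thesis using Fgen_zero_imp_zero[OF sol_comm[OF s] _ v] by blast
qed

lemma funpow_diff_cmult:
  assumes T: "\<And>\<Phi> \<Psi>. comm W \<Phi> \<Longrightarrow> comm W \<Psi> \<Longrightarrow> eqW W (T (\<lambda>I v. \<Phi> I v - a * \<Psi> I v)) (\<lambda>I v. T \<Phi> I v - a * T \<Psi> I v)"
    and Tc: "\<And>\<Phi>. comm W \<Phi> \<Longrightarrow> comm W (T \<Phi>)" and Te: "\<And>\<Phi> \<Psi>. eqW W \<Phi> \<Psi> \<Longrightarrow> eqW W (T \<Phi>) (T \<Psi>)"
    and "comm W \<Phi>" "comm W \<Psi>"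
  shows "eqW W ((T ^^ k) (\<lambda>I v. \<Phi> I v - a * \<Psi> I v)) (\<lambda>I v. (T ^^ k) \<Phi> I v - a * (T ^^ k) \<Psi> I v)"
proof (induction k)
  case (Suc k)
  have c: "comm W ((T ^^ k) \<Phi>)" if "comm W \<Phi>" for k \<Phi>
    using that by (induction k) (auto intro: Tc)
  have "eqW W ((T ^^ Suc k) (\<lambda>I v. \<Phi> I v - a * \<Psi> I v)) (T (\<lambda>I v. (T ^^ k) \<Phi> I v - a * (T ^^ k) \<Psi> I v))"
    using Te[OF Suc.IH] by simp
  moreover have "eqW W (T (\<lambda>I v. (T ^^ k) \<Phi> I v - a * (T ^^ k) \<Psi> I v)) (\<lambda>I v. (T ^^ Suc k) \<Phi> I v - a * (T ^^ Suc k) \<Psi> I v)"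
    using T[OF c[OF assms(4)] c[OF assms(5)], of k k] by simp
  ultimately show ?case by (rule eqW_trans[OF W])
qed (simp add: eqW_refl[OF W])

lemma comm_diff_cmult:
  assumes "comm W \<Phi>" "comm W \<Psi>"
  shows "comm W (\<lambda>I v. \<Phi> I v - a * \<Psi> I v)"
proof -
  note sh = comm_shol[OF W assms(1)] comm_shol[OF W assms(2)]
  have e: "eqW W (Sp i (Sp j (\<lambda>I v. \<Phi> I v - a * \<Psi> I v))) (\<lambda>I v. Sp i (Sp j \<Phi>) I v - a * Sp i (Sp j \<Psi>) I v)" for i j
  proof -
    have "eqW W (Sp j (\<lambda>I v. \<Phi> I v - a * \<Psi> I v)) (\<lambda>I v. Sp j \<Phi> I v - a * Sp j \<Psi> I v)"
      unfolding eqW_def[OF W] using Sp_diff_cmult[OF W sh] by blast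
    then have "eqW W (Sp i (Sp j (\<lambda>I v. \<Phi> I v - a * \<Psi> I v))) (Sp i (\<lambda>I v. Sp j \<Phi> I v - a * Sp j \<Psi> I v))"
      by (rule eqW_Sp[OF W])
    moreover have "eqW W (Sp i (\<lambda>I v. Sp j \<Phi> I v - a * Sp j \<Psi> I v)) (\<lambda>I v. Sp i (Sp j \<Phi>) I v - a * Sp i (Sp j \<Psi>) I v)"
      unfolding eqW_def[OF W] using Sp_diff_cmult[OF W shol_Sp[OF W sh(1)] shol_Sp[OF W sh(2)]] by blast
    ultimately show ?thesis by (rule eqW_trans[OF W])
  qed
  show ?thesis
    unfolding comm_def[OF W]
  proof (intro conjI allI)
    show "shol W (\<lambda>I v. \<Phi> I v - a * \<Psi> I v)" by (intro shol_diff[OF W] shol_cmult[OF W] sh)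
    show "eqW W (Sp i (Sp j (\<lambda>I v. \<Phi> I v - a * \<Psi> I v))) (Sp j (Sp i (\<lambda>I v. \<Phi> I v - a * \<Psi> I v)))" for i j
      using e[of i j] e[of j i] comm_Sp_Sp[OF W assms(1)] comm_Sp_Sp[OF W assms(2)]
      by (simp add: eqW_def[OF W])
  qed
qed

lemma sol_diff_cmult:
  assumes s: "sol W c \<Phi>" "sol W c \<Psi>"
  shows "sol W c (\<lambda>I v. \<Phi> I v - a * \<Psi> I v)"
proof -
  note cm = sol_comm[OF s(1)] sol_comm[OF s(2)]
  have p: "(Sp i ^^ k) (\<lambda>I v. \<Phi> I v - a * \<Psi> I v) I v = (Sp i ^^ k) \<Phi> I v - a * (Sp i ^^ k) \<Psi> I v"
    if "v \<in> W" for i k I v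
    by (rule eqWD[OF W funpow_diff_cmult that])
      (use cm in \<open>auto simp: eqW_def[OF W] Sp_diff_cmult[OF W comm_shol[OF W] comm_shol[OF W]]
        intro: comm_Sp[OF W] eqWD[OF W eqW_Sp[OF W]]\<close>)
  have q: "(Sq i ^^ k) (\<lambda>I v. \<Phi> I v - a * \<Psi> I v) I v = (Sq i ^^ k) \<Phi> I v - a * (Sq i ^^ k) \<Psi> I v"
    if "v \<in> W" for i k I v
    by (rule eqWD[OF W funpow_diff_cmult that])
      (use cm in \<open>auto simp: eqW_def[OF W] Sq_diff_cmult[OF W c comm_shol[OF W] comm_shol[OF W]]
        intro: comm_Sq[OF W] eqWD[OF W eqW_Sq[OF W]]\<close>)
  have comb: "(\<lambda>k. c ^ k * (f k - a * g k) / fact k) sums (F - a * G)"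
    if "(\<lambda>k. c ^ k * f k / fact k) sums F" "(\<lambda>k. c ^ k * g k / fact k) sums G" for f g :: "nat \<Rightarrow> complex" and F G
  proof -
    have "(\<lambda>k. c ^ k * f k / fact k - a * (c ^ k * g k / fact k)) sums (F - a * G)"
      by (intro sums_diff sums_mult that)
    moreover have "c ^ k * f k / fact k - a * (c ^ k * g k / fact k) = c ^ k * (f k - a * g k) / fact k" for k
      by (simp add: algebra_simps diff_divide_distrib)
    ultimately show ?thesis by simp
  qed
  show ?thesis
    unfolding sol_def
    using comm_diff_cmult[OF cm] s by (auto simp: p q sol_def intro!: comb)
qed

lemma sol_proportional:
  assumes s: "sol W c \<Phi>" "sol W c \<Theta>" and U: "connected U" "U \<subseteq> W" and v0: "v0 \<in> U"
    and WU: "\<And>v. v \<in> W \<Longrightarrow> symm v \<in> U"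
    and "is": "distinct is" "set is = UNIV" and nz: "C0 c is \<Theta> v0 \<noteq> 0"
  obtains a where "\<And>I v. v \<in> W \<Longrightarrow> \<Phi> I v = a * \<Theta> I v"
proof
  \<comment> \<open>The quotient of the zeroth Fourier coefficients at one point, so that the
    difference has coefficient zero there.\<close>
  define a where "a = C0 c is \<Phi> v0 / C0 c is \<Theta> v0"
  note cm = sol_comm[OF s(1)] sol_comm[OF s(2)]
  have x: "(0, v0) \<in> UNIV \<times> W" using v0 U by auto
  have "C0 c is (\<lambda>I v. \<Phi> I v - a * \<Theta> I v) v0 = avgs ay is (\<lambda>x. Fgen c \<Phi> x - a * Fgen c \<Theta> x) (0, v0)"
    unfolding C0_def by (rule avgs_cong[OF cyl_S[OF W] x Fgen_diff_cmult[OF W cm]])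
  also have "\<dots> = C0 c is \<Phi> v0 - a * C0 c is \<Theta> v0"
    unfolding C0_def by (rule avgs_diff_cmult[OF cyl_S[OF W] holo_Fgen[OF W cm(1)] holo_Fgen[OF W cm(2)] x])
  also have "\<dots> = 0" using nz by (simp add: a_def)
  finally have "C0 c is (\<lambda>I v. \<Phi> I v - a * \<Theta> I v) v0 = 0" .
  from sol_zero[OF sol_diff_cmult[OF s] U v0 WU "is" this]
  show "\<Phi> I v = a * \<Theta> I v" if "v \<in> W" for I v using that by simp
qed

end

lemma sol_subset:
  assumes "open W" "open W'" "W' \<subseteq> W" "sol W c \<Phi>"
  shows "sol W' c \<Phi>"
  using assms(3,4) unfolding sol_def comm_def[OF assms(1)] comm_def[OF assms(2)] shol_def
    eqW_def[OF assms(1)] eqW_def[OF assms(2)]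
  by (auto intro: holo_subset)

subsection \<open>Superfunctions over symmetric matrices\<close>

text \<open>The preimage under symmetrisation is open among all matrices when \<open>U\<close> is
  relatively open in the Siegel space.\<close>

definition ext :: "'n::finite cmatrix set \<Rightarrow> 'n cmatrix set" where
  "ext U = {v. symm v \<in> U}"

definition hat :: "'n::finite superfun \<Rightarrow> 'n superfun" where
  "hat \<Phi> = (\<lambda>I v. \<Phi> I (symm v))"

lemma cscale_matrix: "(\<chi> i j. a * w $ i $ j) = a *\<^sub>C (w :: 'n::finite cmatrix)"
  by (simp add: vec_eq_iff)

lemma sym_holomorphic_imp_holo:
  assumes f: "sym_holomorphic_on f U" and W: "open (ext U)"
  shows "holo (\<lambda>v. f (symm v)) (ext U)"
  unfolding holo_def
proof
  fix v assume v: "v \<in> ext U"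
  then have "symm v \<in> U" by (simp add: ext_def)
  then obtain f' where f': "(f has_derivative f') (at (symm v) within U)"
    "\<And>a w. f' (\<chi> i j. a * w $ i $ j) = a * f' w"
    using f unfolding sym_holomorphic_on_def by blast
  have "(f has_derivative f') (at (symm v) within symm ` ext U)"
    by (rule has_derivative_subset[OF f'(1)]) (auto simp: ext_def)
  with bounded_linear_imp_has_derivative[OF bounded_linear_symm]
  have "((\<lambda>v. f (symm v)) has_derivative (\<lambda>w. f' (symm w))) (at v within ext U)"
    by (rule has_derivative_in_compose)
  then have "((\<lambda>v. f (symm v)) has_derivative (\<lambda>w. f' (symm w))) (at v)"
    using at_within_open[OF v W] by simp
  moreover have "f' (symm (a *\<^sub>C w)) = a * f' (symm w)" for a w
    using f'(2)[of a "symm w"] by (simp only: cscale_matrix symm_cscale)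
  ultimately show "\<exists>h. ((\<lambda>v. f (symm v)) has_derivative h) (at v) \<and> (\<forall>a w. h (a *\<^sub>C w) = a * h w)"
    by blast
qed

lemma holo_imp_sym_holomorphic:
  assumes h: "holo (\<lambda>v. f (symm v)) (ext U)" and sym: "\<And>v. v \<in> U \<Longrightarrow> symm v = v"
  shows "sym_holomorphic_on f U"
  unfolding sym_holomorphic_on_def
proof
  fix v assume v: "v \<in> U"
  then have "v \<in> ext U" by (simp add: ext_def sym)
  then obtain f' where f': "((\<lambda>v. f (symm v)) has_derivative f') (at v)" "\<And>a w. f' (a *\<^sub>C w) = a * f' w"
    using h unfolding holo_def by blast
  have "(f has_derivative f') (at v within U)"
    by (rule has_derivative_transform[OF v _ has_derivative_at_withinI[OF f'(1)]]) (simp add: sym)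
  then show "\<exists>f'. (f has_derivative f') (at v within U) \<and> (\<forall>a w. f' (\<chi> i j. a * w $ i $ j) = a * f' w)"
    using f'(2) unfolding cscale_matrix by blast
qed

text \<open>Off the diagonal the coordinate direction is the sum of two matrix units, along which
  the symmetrised function has equal derivatives; the factor 1/2 leaves one of them.\<close>

lemma sym_deriv_eq_dd:
  fixes f :: "'n::{finite,linorder} cmatrix \<Rightarrow> complex"
  assumes h: "holo (\<lambda>v. f (symm v)) W" and v: "v \<in> W"
  shows "sym_deriv i j f (symm v) = dd (Em i j) (\<lambda>v. f (symm v)) v"
proof -
  let ?g = "\<lambda>v. f (symm v)"
  define P :: "'n cmatrix" where "P = (\<chi> k l. if {k, l} = {i, j} then 1 else 0)"
  have Psym: "symm P = P"
  proof -
    have "P $ k $ l = P $ l $ k" for k l by (simp add: P_def insert_commute)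
    then show ?thesis by (simp add: vec_eq_iff)
  qed
  have "(\<chi> k l. symm v $ k $ l + (if {k, l} = {i, j} then z else 0)) = symm (v + z *\<^sub>C P)" for z
  proof -
    have "(\<chi> k l. symm v $ k $ l + (if {k, l} = {i, j} then z else 0)) = symm v + z *\<^sub>C P"
      by (auto simp: vec_eq_iff P_def simp del: symm_nth)
    then show ?thesis by (simp add: symm_add symm_cscale Psym)
  qed
  then have cd: "coord_deriv i j f (symm v) = dd P ?g v"
    by (simp add: coord_deriv_def dd_def)
  show ?thesis
  proof (cases "i = j")
    case True
    have "P $ k $ l = Em i j $ k $ l" for k l
      unfolding P_def Em_def using True by (auto simp: doubleton_eq_iff)
    then have "P = Em i j" by (simp add: vec_eq_iff)
    then show ?thesis using True cd by (simp add: sym_deriv_def)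
  next
    case False
    have "P $ k $ l = Em i j $ k $ l + Em j i $ k $ l" for k l
      unfolding P_def Em_def using False by (auto simp: doubleton_eq_iff)
    then have "P = Em i j + Em j i" by (simp add: vec_eq_iff)
    moreover have "dd (Em j i) ?g v = dd (Em i j) ?g v" by (rule dd_Em_commute) simp
    ultimately show ?thesis using False cd by (simp add: sym_deriv_def dd_add[OF h v])
  qed
qed

section \<open>Products of superfunctions in terms of \<open>X\<close> and
  \<open>del\<close>\<close>

lemma reorder_sign_singleton: "reorder_sign {i} K = sg i K"
proof -
  have "{(j, k). j \<in> {i} \<and> k \<in> K \<and> k < j} = Pair i ` {k \<in> K. k < i}" by auto
  then have "card {(j, k). j \<in> {i} \<and> k \<in> K \<and> k < j} = card {k \<in> K. k < i}"
    by (simp add: card_image inj_on_def)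
  then show ?thesis by (simp add: reorder_sign_def sg_def)
qed

lemma odd_deriv_eq: "odd_deriv i \<Phi> I v = del i (\<lambda>I. \<Phi> I v) I"
  by (simp add: odd_deriv_def del_def reorder_sign_singleton)

lemma sg_Diff_self: "sg j (I - {j}) = sg j I"
proof -
  have "{k \<in> I - {j}. k < j} = {k \<in> I. k < j}" by auto
  then show ?thesis by (simp add: sg_def)
qed

lemma xi_mult: "(xi i \<odot> \<Phi>) I v = X i (\<lambda>I. \<Phi> I v) I"
proof -
  have "(xi i \<odot> \<Phi>) I v = (\<Sum>J\<in>Pow I. if J = {i} then reorder_sign {i} (I - {i}) * \<Phi> (I - {i}) v else 0)"
    unfolding super_mult_def by (intro sum.cong refl) (auto simp: xi_def)
  also have "\<dots> = X i (\<lambda>I. \<Phi> I v) I"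
    by (simp add: sum.delta' sum.delta X_def reorder_sign_singleton sg_Diff_self)
  finally show ?thesis .
qed

lemma super_of_mult: "(super_of f \<odot> \<Phi>) I v = f v * \<Phi> I v"
proof -
  have "(super_of f \<odot> \<Phi>) I v = (\<Sum>J\<in>Pow I. if J = {} then f v * \<Phi> I v else 0)"
    unfolding super_mult_def by (intro sum.cong refl) (auto simp: super_of_def reorder_sign_def)
  then show ?thesis by (simp add: sum.delta)
qed

lemma sg_disjoint_union:
  assumes "A \<inter> B = {}" shows "sg i (A \<union> B) = sg i A * sg i (B :: 'n::{finite,linorder} set)"
proof -
  have "{k \<in> A \<union> B. k < i} = {k \<in> A. k < i} \<union> {k \<in> B. k < i}" by auto
  moreover have "card ({k \<in> A. k < i} \<union> {k \<in> B. k < i}) = card {k \<in> A. k < i} + card {k \<in> B. k < i}"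
    by (rule card_Un_disjoint) (use assms in auto)
  ultimately show ?thesis by (simp add: sg_def power_add)
qed

lemma reorder_sign_doubleton:
  assumes "i \<noteq> j" shows "reorder_sign {i, j} K = sg i K * sg j (K :: 'n::{finite,linorder} set)"
proof -
  have "{(a, k). a \<in> {i, j} \<and> k \<in> K \<and> k < a} = Pair i ` {k \<in> K. k < i} \<union> Pair j ` {k \<in> K. k < j}"
    by auto
  moreover have "card (Pair i ` {k \<in> K. k < i} \<union> Pair j ` {k \<in> K. k < j}) =
      card (Pair i ` {k \<in> K. k < i}) + card (Pair j ` {k \<in> K. k < j})"
    by (rule card_Un_disjoint) (use assms in auto)
  ultimately have "card {(a, k). a \<in> {i, j} \<and> k \<in> K \<and> k < a} = card {k \<in> K. k < i} + card {k \<in> K. k < j}"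
    by (simp add: card_image inj_on_def)
  then show ?thesis by (simp add: reorder_sign_def sg_def power_add)
qed

text \<open>The instance of associativity that identifies the quadratic part of
  \<open>t_coord\<close>; both sides move \<xi>_i and then \<xi>_j past the remaining
  factors.\<close>

lemma xi_xi_mult: "((xi j \<odot> xi i) \<odot> \<Phi>) I v = X j (X i (\<lambda>I. \<Phi> I v)) I"
proof (cases "i \<noteq> j \<and> i \<in> I \<and> j \<in> I")
  case True
  define K where "K = I - {j, i}"
  have K: "I = {j, i} \<union> K" "{j, i} \<inter> K = {}" "I - {j} = {i} \<union> K" "{i} \<inter> K = {}" "I - {j} - {i} = K"
    using True by (auto simp: K_def)
  have xx: "(xi j \<odot> xi i) J v = (if J = {j, i} then sg j {j, i} else 0)" for J
    using True unfolding xi_mult by (auto simp: X_def xi_def)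
  have "((xi j \<odot> xi i) \<odot> \<Phi>) I v = (\<Sum>J\<in>Pow I. if J = {j, i} then reorder_sign {j, i} K * sg j {j, i} * \<Phi> K v else 0)"
    unfolding super_mult_def[of "xi j \<odot> xi i"] xx by (intro sum.cong refl) (auto simp: K_def)
  also have "\<dots> = reorder_sign {j, i} K * sg j {j, i} * \<Phi> K v"
    using True by (subst sum.delta) auto
  also have "\<dots> = sg j K * sg i K * sg j {j, i} * \<Phi> K v"
    using True by (subst reorder_sign_doubleton) auto
  also have "\<dots> = sg j I * (sg i ({i} \<union> K) * \<Phi> K v)"
  proof -
    have "sg j I = sg j {j, i} * sg j K" unfolding K(1) by (rule sg_disjoint_union[OF K(2)])
    moreover have "sg i ({i} \<union> K) = sg i K"
    proof -
      have "{k \<in> {i}. k < i} = {}" by auto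
      then have "sg i {i} = 1" unfolding sg_def by (simp only: card.empty power_0)
      then show ?thesis unfolding sg_disjoint_union[OF K(4)] by simp
    qed
    ultimately show ?thesis by simp
  qed
  also have "\<dots> = X j (X i (\<lambda>I. \<Phi> I v)) I"
    using True K by (simp add: X_def)
  finally show ?thesis .
next
  case False
  have "(xi j \<odot> xi i) J v * \<Phi> (I - J) v = 0" if "J \<in> Pow I" for J
    using False that unfolding xi_mult by (auto simp: X_def xi_def)
  then have "((xi j \<odot> xi i) \<odot> \<Phi>) I v = 0"
    unfolding super_mult_def[of "xi j \<odot> xi i"] by (intro sum.neutral) (auto simp: mult.assoc)
  moreover have "X j (X i (\<lambda>I. \<Phi> I v)) I = 0" using False by (auto simp: X_def)
  ultimately show ?thesis by simp
qed

lemma t_coord_mult: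
  "(t_coord j i \<odot> \<Phi>) I v = v $ j $ i * \<Phi> I v - 1 / 2 * X j (X i (\<lambda>I. \<Phi> I v)) I"
proof -
  have "(t_coord j i \<odot> \<Phi>) I v = (super_of (\<lambda>v. v $ j $ i) \<odot> \<Phi>) I v - 1 / 2 * ((xi j \<odot> xi i) \<odot> \<Phi>) I v"
    unfolding super_mult_def[of _ \<Phi>] t_coord_def
    by (simp add: sum_subtractf[symmetric] sum_distrib_left algebra_simps)
  then show ?thesis by (simp only: super_of_mult xi_xi_mult)
qed

context
  fixes U W :: "'n::{finite,linorder} cmatrix set"
  assumes W: "open W" and W_def: "W = ext U" and sym: "\<And>v. v \<in> U \<Longrightarrow> symm v = v"
begin

lemma U_sub_W: "U \<subseteq> W"
  by (auto simp: W_def ext_def sym)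

lemma symm_W: "v \<in> W \<Longrightarrow> symm v \<in> U"
  by (simp add: W_def ext_def)

lemma shol_hat: "shol W \<Psi> \<Longrightarrow> eqW W (hat \<Phi>) \<Psi> \<Longrightarrow> shol W (hat \<Phi>)"
  unfolding shol_def eqW_def[OF W] by (auto simp: hat_def intro: holo_cong_open[OF W])

lemma hat_spinor_deriv:
  assumes "shol W (hat \<Phi>)"
  shows "eqW W (hat (spinor_deriv i \<Phi>)) (Sp i (hat \<Phi>))"
  unfolding eqW_def[OF W]
proof (intro ballI allI)
  fix v I assume v: "v \<in> W"
  have "sym_deriv i j (\<Phi> I) (symm v) = pd i j (hat \<Phi>) I v" for j I
    using sym_deriv_eq_dd[of "\<Phi> I" W v i j] shol_holo[OF assms, of I] v
    by (simp add: pd_def hat_def)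
  then show "hat (spinor_deriv i \<Phi>) I v = Sp i (hat \<Phi>) I v"
    by (simp add: hat_def spinor_deriv_def Sp_def odd_deriv_eq xi_mult even_deriv_def XX_def)
qed

lemma hat_D_q:
  assumes "shol W (hat \<Phi>)"
  shows "eqW W (hat (D_q i \<Phi>)) (Sq i (hat \<Phi>))"
  unfolding eqW_def[OF W]
proof (intro ballI allI)
  fix v I assume v: "v \<in> W"
  have "spinor_deriv j \<Phi> I (symm v) = Sp j (hat \<Phi>) I v" for j I
    using eqWD[OF W hat_spinor_deriv[OF assms] v] by (simp add: hat_def)
  then show "hat (D_q i \<Phi>) I v = Sq i (hat \<Phi>) I v"
    by (simp add: hat_def D_q_def Sq_def t_coord_mult xi_mult XX_def VV_def del: symm_nth)
qed

lemma hat_cong: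
  assumes "eqW W (hat \<Phi>) \<Psi>" "shol W \<Psi>"
  shows "eqW W (hat (spinor_deriv i \<Phi>)) (Sp i \<Psi>)" "eqW W (hat (D_q i \<Phi>)) (Sq i \<Psi>)"
  using eqW_trans[OF W hat_spinor_deriv eqW_Sp[OF W]] eqW_trans[OF W hat_D_q eqW_Sq[OF W]]
    shol_hat[OF assms(2,1)] assms(1) by blast+

lemma hat_funpow:
  assumes "shol W (hat \<Phi>)"
  shows "eqW W (hat ((D_p i ^^ k) \<Phi>)) ((Sp i ^^ k) (hat \<Phi>)) \<and> shol W ((Sp i ^^ k) (hat \<Phi>))"
    and "eqW W (hat ((D_q i ^^ k) \<Phi>)) ((Sq i ^^ k) (hat \<Phi>)) \<and> shol W ((Sq i ^^ k) (hat \<Phi>))"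
  by (induction k) (auto simp: D_p_def[abs_def] assms eqW_refl[OF W] intro: hat_cong shol_Sp[OF W] shol_Sq[OF W])

text \<open>A statement on \<open>U\<close> is one on \<open>W\<close> about \<open>symm v\<close>,
  and the pairs with \<open>i < j\<close> give all pairs because \<open>DD\<close> is
  antisymmetric.\<close>

lemma theta_system_iff_sol:
  assumes sh: "shol W (hat \<Phi>)"
  shows "theta_system c U \<Phi> \<longleftrightarrow> sol W c (hat \<Phi>)"
proof -
  have p: "(D_p i ^^ k) \<Phi> I (symm v) = (Sp i ^^ k) (hat \<Phi>) I v" if "v \<in> W" for i k I v
    using eqWD[OF W conjunct1[OF hat_funpow(1)[OF sh]] that] by (simp add: hat_def)
  have q: "(D_q i ^^ k) \<Phi> I (symm v) = (Sq i ^^ k) (hat \<Phi>) I v" if "v \<in> W" for i k I v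
    using eqWD[OF W conjunct1[OF hat_funpow(2)[OF sh]] that] by (simp add: hat_def)
  have d: "spinor_deriv i (spinor_deriv j \<Phi>) I (symm v) = Sp i (Sp j (hat \<Phi>)) I v" if "v \<in> W" for i j I v
    using eqWD[OF W hat_cong(1)[OF hat_spinor_deriv[OF sh] shol_Sp[OF W sh]] that] by (simp add: hat_def)
  have all: "(\<forall>v\<in>U. P v) \<longleftrightarrow> (\<forall>v\<in>W. P (symm v))" for P
    using symm_W sym U_sub_W by (metis subsetD)
  have "(\<forall>i j. i < j \<longrightarrow> (\<forall>v\<in>U. \<forall>I. DD i j \<Phi> I v = 0)) \<longleftrightarrow>
      (\<forall>i j. i < j \<longrightarrow> (\<forall>v\<in>W. \<forall>I. Sp i (Sp j (hat \<Phi>)) I v = Sp j (Sp i (hat \<Phi>)) I v))"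
    unfolding all by (simp add: DD_def d)
  also have "\<dots> \<longleftrightarrow> comm W (hat \<Phi>)"
    unfolding comm_def[OF W] eqW_def[OF W] using sh by (metis linorder_cases)
  finally have 1: "(\<forall>i j. i < j \<longrightarrow> (\<forall>v\<in>U. \<forall>I. DD i j \<Phi> I v = 0)) \<longleftrightarrow> comm W (hat \<Phi>)" .
  have 2: "exp_maps_to c (D_p i) \<Phi> \<Phi> U \<longleftrightarrow> (\<forall>v\<in>W. \<forall>I. (\<lambda>k. c ^ k * (Sp i ^^ k) (hat \<Phi>) I v / fact k) sums hat \<Phi> I v)" for i
    unfolding exp_maps_to_def all by (simp add: p hat_def[of \<Phi>] cong: ball_cong)
  have 3: "exp_maps_to c (D_q i) \<Phi> \<Phi> U \<longleftrightarrow> (\<forall>v\<in>W. \<forall>I. (\<lambda>k. c ^ k * (Sq i ^^ k) (hat \<Phi>) I v / fact k) sums hat \<Phi> I v)" for i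
    unfolding exp_maps_to_def all by (simp add: q hat_def[of \<Phi>] cong: ball_cong)
  show ?thesis unfolding theta_system_def sol_def 1 2 3 ..
qed

lemma super_holomorphic_iff_shol: "super_holomorphic_on \<Phi> U \<longleftrightarrow> shol W (hat \<Phi>)"
proof
  assume "super_holomorphic_on \<Phi> U"
  then show "shol W (hat \<Phi>)"
    using sym_holomorphic_imp_holo W unfolding super_holomorphic_on_def shol_def hat_def W_def by auto
next
  assume "shol W (hat \<Phi>)"
  then show "super_holomorphic_on \<Phi> U"
    unfolding super_holomorphic_on_def shol_def hat_def W_def
    by (auto intro: holo_imp_sym_holomorphic sym)
qed

end

subsection \<open>The Siegel upper half space\<close>

definition qform :: "'n::finite cmatrix \<Rightarrow> (real, 'n) vec \<Rightarrow> real" where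
  "qform v x = (\<Sum>i\<in>UNIV. \<Sum>j\<in>UNIV. x $ i * Im (v $ i $ j) * x $ j)"

lemma siegel_space_iff: "v \<in> siegel_space \<longleftrightarrow> transpose v = v \<and> (\<forall>x. x \<noteq> 0 \<longrightarrow> qform v x > 0)"
  by (simp add: siegel_space_def qform_def inner_vec_def matrix_vector_mult_def sum_distrib_left mult.assoc)

lemma qform_scale: "qform v (r *\<^sub>R x) = r\<^sup>2 * qform v x"
  by (simp add: qform_def sum_distrib_left power2_eq_square mult_ac)

text \<open>Compactness of the unit sphere gives a positive minimum, half of which survives a small
  perturbation. The uniform constant serves both the openness of the domain and the convergence of
  theta.\<close>

lemma siegel_locally_coercive:
  fixes v0 :: "'n::finite cmatrix"
  assumes "symm v0 \<in> siegel_space"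
  obtains e r where "e > 0" "r > 0" "\<And>v x. dist v0 v < r \<Longrightarrow> qform (symm v) x \<ge> e * (norm x)\<^sup>2"
proof -
  have cont: "continuous_on (sphere 0 1) (qform (symm v0))"
    unfolding qform_def[abs_def] by (intro continuous_intros)
  have ne: "sphere (0::(real, 'n) vec) 1 \<noteq> {}"
  proof -
    have "axis undefined 1 \<in> sphere (0::(real, 'n) vec) 1" by (simp add: norm_axis_1)
    then show ?thesis by blast
  qed
  obtain x0 where x0: "x0 \<in> sphere 0 1" "\<And>x. x \<in> sphere 0 1 \<Longrightarrow> qform (symm v0) x0 \<le> qform (symm v0) x"
    using continuous_attains_inf[OF compact_sphere ne cont] by blast
  define e where "e = qform (symm v0) x0"
  have "x0 \<noteq> 0" using x0(1) by auto
  then have e: "e > 0" using assms by (simp add: e_def siegel_space_iff)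
  have low: "qform (symm v0) x \<ge> e * (norm x)\<^sup>2" for x
  proof (cases "x = 0")
    case False
    have "e \<le> qform (symm v0) ((1 / norm x) *\<^sub>R x)"
      unfolding e_def by (rule x0(2)) (use False in simp)
    then show ?thesis using False by (simp add: qform_scale power_divide field_simps)
  qed (simp add: qform_def)
  define N where "N = (real CARD('n))\<^sup>2"
  have N: "N > 0" by (simp add: N_def)
  \<comment> \<open>There are \<open>N\<close> entries, each contributing at most \<open>r\<close>
    times the squared norm, so the form changes by at most half of its lower bound.\<close>
  define r where "r = e / (2 * N)"
  have r: "r > 0" using e N by (simp add: r_def)
  have "qform (symm v) x \<ge> (e / 2) * (norm x)\<^sup>2" if v: "dist v0 v < r" for v x
  proof -
    have ent: "\<bar>Im (symm v $ i $ j) - Im (symm v0 $ i $ j)\<bar> \<le> r" for i j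
    proof -
      have "cmod (v $ a $ b - v0 $ a $ b) \<le> r" for a b
      proof -
        have "cmod ((v - v0) $ a $ b) \<le> norm ((v - v0) $ a)" by (rule Finite_Cartesian_Product.norm_nth_le)
        also have "\<dots> \<le> norm (v - v0)" by (rule Finite_Cartesian_Product.norm_nth_le)
        finally show ?thesis using v by (simp add: dist_norm norm_minus_commute)
      qed
      then have "\<bar>Im (v $ a $ b - v0 $ a $ b)\<bar> \<le> r" for a b using abs_Im_le_cmod order.trans by blast
      from this[of i j] this[of j i] show ?thesis
        by (simp add: abs_le_iff add_divide_distrib)
    qed
    have "\<bar>qform (symm v) x - qform (symm v0) x\<bar> =
        \<bar>\<Sum>i\<in>UNIV. \<Sum>j\<in>UNIV. x $ i * (Im (symm v $ i $ j) - Im (symm v0 $ i $ j)) * x $ j\<bar>"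
      unfolding qform_def sum_subtractf[symmetric] by (simp only: left_diff_distrib right_diff_distrib)
    also have "\<dots> \<le> (\<Sum>i\<in>(UNIV::'n set). \<Sum>j\<in>(UNIV::'n set). norm x * r * norm x)"
    proof (rule order.trans[OF sum_abs], rule sum_mono, rule order.trans[OF sum_abs], rule sum_mono)
      fix i j
      show "\<bar>x $ i * (Im (symm v $ i $ j) - Im (symm v0 $ i $ j)) * x $ j\<bar> \<le> norm x * r * norm x"
        unfolding abs_mult
        by (intro mult_mono ent mult_nonneg_nonneg abs_ge_zero norm_ge_zero less_imp_le[OF r] component_le_norm_cart)
    qed
    also have "\<dots> = (e / 2) * (norm x)\<^sup>2"
      using N by (simp add: r_def N_def power2_eq_square field_simps)
    finally have "\<bar>qform (symm v) x - qform (symm v0) x\<bar> \<le> (e / 2) * (norm x)\<^sup>2" .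
    moreover have "(e / 2) * (norm x)\<^sup>2 = e * (norm x)\<^sup>2 / 2" by simp
    ultimately show ?thesis using low[of x] by linarith
  qed
  then show ?thesis using e r by (intro that[of "e / 2" r]) auto
qed

lemma open_ext_siegel: "open (ext (siegel_space :: 'n::finite cmatrix set))"
  unfolding open_contains_ball
proof
  fix v0 :: "'n cmatrix" assume "v0 \<in> ext siegel_space"
  then have "symm v0 \<in> siegel_space" by (simp add: ext_def)
  then obtain e r where er: "e > 0" "r > 0" "\<And>v x. dist v0 v < r \<Longrightarrow> qform (symm v) x \<ge> e * (norm x)\<^sup>2"
    by (rule siegel_locally_coercive) blast
  have "symm v \<in> siegel_space" if v: "dist v0 v < r" for v
  proof -
    have "qform (symm v) x > 0" if "x \<noteq> 0" for x
    proof -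
      have "0 < e * (norm x)\<^sup>2" using er(1) that by simp
      then show ?thesis using er(3)[OF v, of x] by linarith
    qed
    then show ?thesis by (simp add: siegel_space_iff)
  qed
  then have "ball v0 r \<subseteq> ext siegel_space" by (auto simp: ext_def)
  then show "\<exists>e>0. ball v0 e \<subseteq> ext siegel_space" using er(2) by blast
qed

lemma siegel_symm: "v \<in> siegel_space \<Longrightarrow> symm v = v"
  by (simp add: siegel_space_iff symm_sym)

lemma connected_siegel: "connected (siegel_space :: 'n::finite cmatrix set)"
proof (rule convex_connected, rule convexI)
  fix v w :: "'n cmatrix" and a b :: real
  assume v: "v \<in> siegel_space" and w: "w \<in> siegel_space" and ab: "a \<ge> 0" "b \<ge> 0" "a + b = 1"
  have "qform (a *\<^sub>R v + b *\<^sub>R w) x = a * qform v x + b * qform w x" for x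
    unfolding qform_def sum_distrib_left sum.distrib[symmetric]
    by (intro sum.cong refl) (simp add: algebra_simps)
  moreover have "a * qform v x + b * qform w x > 0" if "x \<noteq> 0" for x
  proof -
    have p: "qform v x > 0" "qform w x > 0" using v w that by (auto simp: siegel_space_iff)
    show ?thesis
    proof (cases "a = 0")
      case True
      then show ?thesis using ab p by simp
    next
      case False
      then show ?thesis using ab p by (intro add_pos_nonneg mult_pos_pos mult_nonneg_nonneg) auto
    qed
  qed
  moreover have "transpose (a *\<^sub>R v + b *\<^sub>R w) = a *\<^sub>R v + b *\<^sub>R w"
    using v w by (simp add: siegel_space_iff transpose_def vec_eq_iff)
  ultimately show "a *\<^sub>R v + b *\<^sub>R w \<in> siegel_space" by (simp add: siegel_space_iff)
qed

lemma open_ext: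
  fixes U :: "'n::finite cmatrix set"
  assumes "openin (top_of_set siegel_space) U" shows "open (ext U)"
proof -
  obtain T where T: "open T" "U = siegel_space \<inter> T" using assms by (auto simp: openin_open)
  have "ext U = ext siegel_space \<inter> symm -` T" using T by (auto simp: ext_def)
  moreover have "open (symm -` T)"
    by (rule open_vimage[OF T(1)]) (rule bounded_linear.continuous_on[OF bounded_linear_symm continuous_on_id])
  ultimately show ?thesis using open_ext_siegel by auto
qed

(* fps_syntax makes $ ambiguous. *)
unbundle no fps_syntax

subsection \<open>Theta series with characteristics\<close>

type_synonym 'n tz = "(complex, 'n) vec \<times> (complex, 'n) vec \<times> 'n cmatrix"

text \<open>A point \<open>(\<sigma>, u, v)\<close> consists of the two characteristics and a matrix; \<open>\<sigma>\<close> is added to the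
  summation variable, and \<open>u\<close> enters through the character \<open>exp (-2\<pi>i u\<^sup>t(m + \<sigma>))\<close>.\<close>

definition xv :: "(int, 'n::finite) vec \<Rightarrow> 'n \<Rightarrow> 'n tz \<Rightarrow> complex" where
  "xv m i p = of_int (m $ i) + fst p $ i"

definition tq :: "(int, 'n::finite) vec \<Rightarrow> 'n tz \<Rightarrow> complex" where
  "tq m p = of_real pi * \<i> * (\<Sum>i\<in>UNIV. \<Sum>j\<in>UNIV. xv m i p * (symm (snd (snd p)) $ i $ j * xv m j p)) +
     (- 2 * of_real pi * \<i>) * (\<Sum>i\<in>UNIV. fst (snd p) $ i * xv m i p)"

definition tE :: "(int, 'n::finite) vec \<Rightarrow> 'n tz \<Rightarrow> complex" where
  "tE m p = exp (tq m p)"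

definition th :: "'n::finite tz \<Rightarrow> complex" where
  "th p = (\<Sum>\<^sub>\<infinity>m. tE m p)"

abbreviation Hs :: "'n::finite cmatrix set" where "Hs \<equiv> ext siegel_space"
abbreviation Ts :: "'n::finite tz set" where "Ts \<equiv> UNIV \<times> UNIV \<times> Hs"
abbreviation du :: "'n::finite \<Rightarrow> 'n tz" where "du i \<equiv> (0, ax i, 0)"
abbreviation ds :: "'n::finite \<Rightarrow> 'n tz" where "ds i \<equiv> (ax i, 0, 0)"
abbreviation dv :: "'n::finite \<Rightarrow> 'n \<Rightarrow> 'n tz" where "dv i j \<equiv> (0, 0, Em i j)"

lemma open_Ts: "open (Ts :: 'n::finite tz set)"
  by (intro open_Times open_UNIV open_ext_siegel)

lemma fst_nth_props:
  "holo (\<lambda>p::'n::finite tz. fst p $ i) S" "dd w (\<lambda>p::'n::finite tz. fst p $ i) p = fst w $ i"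
  by (rule holo_linear dd_linear_fun,
      auto intro: bounded_linear_compose[OF bounded_linear_vec_nth bounded_linear_fst])+

lemma snd_nth_props:
  "holo (\<lambda>p::'n::finite tz. fst (snd p) $ i) S" "dd w (\<lambda>p::'n::finite tz. fst (snd p) $ i) p = fst (snd w) $ i"
  by (rule holo_linear dd_linear_fun,
      auto intro: bounded_linear_compose[OF bounded_linear_vec_nth bounded_linear_compose[OF bounded_linear_fst bounded_linear_snd]])+

lemma symm_nth_props:
  "holo (\<lambda>p::'n::finite tz. symm (snd (snd p)) $ i $ j) S"
  "dd w (\<lambda>p::'n::finite tz. symm (snd (snd p)) $ i $ j) p = symm (snd (snd w)) $ i $ j"
  by (rule holo_linear dd_linear_fun,
      auto simp: symm_nth_cscale simp del: symm_nth intro: bounded_linear_compose[OF bounded_linear_symm_nth bounded_linear_compose[OF bounded_linear_snd bounded_linear_snd]])+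

lemma xv_props: "holo (xv m i) S" "dd w (xv m i) p = fst w $ i"
proof -
  show h: "holo (xv m i) S" for S unfolding xv_def[abs_def] by (intro holo_add holo_const fst_nth_props)
  have "dd w (\<lambda>p. of_int (m $ i) + fst p $ i) p = dd w (\<lambda>_. of_int (m $ i)) p + dd w (\<lambda>p. fst p $ i) p"
    by (rule dd_plus[where S = UNIV]) (auto intro: fst_nth_props)
  then show "dd w (xv m i) p = fst w $ i" unfolding xv_def[abs_def] by (simp add: fst_nth_props)
qed

lemma holo_tq: "holo (tq m) S"
  unfolding tq_def[abs_def]
  by (intro holo_add holo_cmult holo_sum holo_mult xv_props symm_nth_props snd_nth_props)

lemma dd_tq: "dd w (tq m) p =
    of_real pi * \<i> * (\<Sum>i\<in>UNIV. \<Sum>j\<in>UNIV. fst w $ i * (symm (snd (snd p)) $ i $ j * xv m j p) +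
      xv m i p * (symm (snd (snd w)) $ i $ j * xv m j p + symm (snd (snd p)) $ i $ j * fst w $ j)) +
    (- 2 * of_real pi * \<i>) * (\<Sum>i\<in>UNIV. fst (snd w) $ i * xv m i p + fst (snd p) $ i * fst w $ i)"
proof -
  note H = xv_props(1)[of m _ UNIV] symm_nth_props(1)[of _ _ UNIV] snd_nth_props(1)[of _ UNIV]
  have 1: "dd w (\<lambda>p. xv m i p * (symm (snd (snd p)) $ i $ j * xv m j p)) p =
      fst w $ i * (symm (snd (snd p)) $ i $ j * xv m j p) +
      xv m i p * (symm (snd (snd w)) $ i $ j * xv m j p + symm (snd (snd p)) $ i $ j * fst w $ j)" for i j
    by (simp only: dd_times[OF H(1) holo_mult[OF H(2) H(1)] UNIV_I] dd_times[OF H(2) H(1) UNIV_I]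
        xv_props(2) symm_nth_props(2))
  have 2: "dd w (\<lambda>p. fst (snd p) $ i * xv m i p) p = fst (snd w) $ i * xv m i p + fst (snd p) $ i * fst w $ i" for i
    by (simp only: dd_times[OF H(3) H(1) UNIV_I] xv_props(2) snd_nth_props(2))
  have h1: "holo (\<lambda>p. \<Sum>j\<in>UNIV. xv m i p * (symm (snd (snd p)) $ i $ j * xv m j p)) UNIV" for i
    by (intro holo_sum holo_mult H)
  have h2: "holo (\<lambda>p. fst (snd p) $ i * xv m i p) UNIV" for i
    by (intro holo_mult H)
  have h3: "holo (\<lambda>p. xv m i p * (symm (snd (snd p)) $ i $ j * xv m j p)) UNIV" for i j
    by (intro holo_mult H)
  show ?thesis
    unfolding tq_def[abs_def]
    by (simp only: dd_plus[OF holo_cmult[OF holo_sum[OF h1]] holo_cmult[OF holo_sum[OF h2]] UNIV_I]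
        dd_cmult[OF holo_sum[OF h1] UNIV_I] dd_cmult[OF holo_sum[OF h2] UNIV_I]
        dd_sum_fun[OF h1 UNIV_I] dd_sum_fun[OF h2 UNIV_I] dd_sum_fun[OF h3 UNIV_I] 1 2)
qed

lemma sum_ax: "(\<Sum>i\<in>UNIV. ax j $ i * f i) = (f j :: complex)"
  "(\<Sum>i\<in>UNIV. f i * ax j $ i) = (f j :: complex)" for j :: "'n::finite"
proof -
  have "(\<Sum>i\<in>UNIV. ax j $ i * f i) = (\<Sum>i\<in>UNIV. if i = j then f i else 0)"
    by (intro sum.cong refl) (auto simp: axis_def)
  then show "(\<Sum>i\<in>UNIV. ax j $ i * f i) = f j" by simp
  then show "(\<Sum>i\<in>UNIV. f i * ax j $ i) = f j" by (simp add: mult.commute)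
qed

lemma symm_zero [simp]: "symm 0 = 0"
  by (simp add: vec_eq_iff)

lemma sum_Em: "(\<Sum>k\<in>UNIV. \<Sum>l\<in>UNIV. f k * (symm (Em i j) $ k $ l * f l)) = f i * (f j :: complex)"
  for i j :: "'n::finite"
proof -
  have e: "(\<Sum>k\<in>UNIV. \<Sum>l\<in>UNIV. f k * (Em a b $ k $ l * f l)) = f a * f b" for a b :: 'n
  proof -
    have "(\<Sum>k\<in>UNIV. \<Sum>l\<in>UNIV. f k * (Em a b $ k $ l * f l)) =
        (\<Sum>k\<in>UNIV. ax a $ k * (\<Sum>l\<in>UNIV. ax b $ l * (f k * f l)))"
      unfolding sum_distrib_left by (intro sum.cong refl) (auto simp: Em_nth axis_def)
    then show ?thesis by (simp only: sum_ax)
  qed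
  have "(\<Sum>k\<in>UNIV. \<Sum>l\<in>UNIV. f k * (symm (Em i j) $ k $ l * f l)) =
      (\<Sum>k\<in>UNIV. \<Sum>l\<in>UNIV. 1 / 2 * (f k * (Em i j $ k $ l * f l)) + 1 / 2 * (f k * (Em j i $ k $ l * f l)))"
  proof (intro sum.cong refl)
    fix k l
    have "Em i j $ l $ k = Em j i $ k $ l" by (simp add: Em_nth conj_commute)
    then show "f k * (symm (Em i j) $ k $ l * f l) =
        1 / 2 * (f k * (Em i j $ k $ l * f l)) + 1 / 2 * (f k * (Em j i $ k $ l * f l))"
      by (simp add: field_simps)
  qed
  moreover have "(\<Sum>k\<in>UNIV. \<Sum>l\<in>UNIV. 1 / 2 * (f k * (Em a b $ k $ l * f l))) = 1 / 2 * (f a * f b)" for a b :: 'n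
    by (subst e[symmetric]) (simp only: sum_distrib_left)
  ultimately show ?thesis by (simp only: sum.distrib) simp
qed

lemma dd_tq_u: "dd (du j) (tq m) p = - 2 * of_real pi * \<i> * xv m j p"
  unfolding dd_tq by (simp add: sum_ax del: symm_nth)

lemma dd_tq_v: "dd (dv i j) (tq m) p = of_real pi * \<i> * (xv m i p * xv m j p)"
  unfolding dd_tq by (simp add: sum_Em del: symm_nth)

lemma dd_tq_s: "dd (ds i) (tq m) p =
    2 * of_real pi * \<i> * (\<Sum>j\<in>UNIV. symm (snd (snd p)) $ i $ j * xv m j p) - 2 * of_real pi * \<i> * fst (snd p) $ i"
proof -
  have sy: "symm (snd (snd p)) $ a $ b = symm (snd (snd p)) $ b $ a" for a b
    by (simp add: add.commute)
  have "(\<Sum>a\<in>UNIV. \<Sum>b\<in>UNIV. ax i $ a * (symm (snd (snd p)) $ a $ b * xv m b p)) =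
      (\<Sum>j\<in>UNIV. symm (snd (snd p)) $ i $ j * xv m j p)"
    by (simp only: sum_distrib_left[symmetric] sum_ax)
  moreover have "(\<Sum>a\<in>UNIV. \<Sum>b\<in>UNIV. xv m a p * (symm (snd (snd p)) $ a $ b * ax i $ b)) =
      (\<Sum>j\<in>UNIV. symm (snd (snd p)) $ i $ j * xv m j p)"
    by (simp only: sum_distrib_left[symmetric] sum_ax sy[of _ i] mult.commute)
  ultimately show ?thesis
    unfolding dd_tq by (simp add: sum.distrib sum_ax algebra_simps del: symm_nth)
qed

lemma holo_tE: "holo (tE m) S"
  unfolding tE_def[abs_def] by (intro holo_exp holo_tq)

lemma dd_tE: "dd w (tE m) p = dd w (tq m) p * tE m p"
  unfolding tE_def[abs_def] by (rule dd_exp[OF holo_tq UNIV_I])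

lemma dd_dd_tE_u: "dd (du i) (dd (du j) (tE m)) p = (- 2 * of_real pi * \<i>)\<^sup>2 * (xv m i p * xv m j p) * tE m p"
proof -
  have e: "dd (du j) (tE m) = (\<lambda>p. (- 2 * of_real pi * \<i>) * (xv m j p * tE m p))"
    by (rule ext) (simp add: dd_tE dd_tq_u)
  have "dd (du i) (dd (du j) (tE m)) p = (- 2 * of_real pi * \<i>) *
      (dd (du i) (xv m j) p * tE m p + xv m j p * dd (du i) (tE m) p)"
    unfolding e by (simp only: dd_cmult[OF holo_mult[OF xv_props(1) holo_tE] UNIV_I]
        dd_times[OF xv_props(1) holo_tE UNIV_I])
  then show ?thesis by (simp add: xv_props(2) dd_tE dd_tq_u power2_eq_square)
qed

subsection \<open>Convergence\<close>

lemma sum_exp_minus_abs_le: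
  assumes "finite B"
  shows "(\<Sum>y\<in>B. exp (- \<bar>real_of_int y\<bar>)) \<le> 2 / (1 - exp (- 1))"
proof -
  have e1: "exp (- 1 :: real) < 1" by simp
  obtain K where K: "\<And>y. y \<in> B \<Longrightarrow> \<bar>y\<bar> \<le> int K"
  proof
    show "\<bar>y\<bar> \<le> int (nat (\<Sum>y\<in>B. \<bar>y\<bar>))" if "y \<in> B" for y
      using member_le_sum[OF that, of abs] assms by simp
  qed
  have geo: "(\<Sum>k<Suc K. exp (- real k)) \<le> 1 / (1 - exp (- 1))"
  proof -
    have "(\<Sum>k<Suc K. exp (- real k)) = (\<Sum>k<Suc K. exp (- 1 :: real) ^ k)"
      by (intro sum.cong refl) (simp add: exp_of_nat_mult[symmetric])
    also have "\<dots> \<le> suminf (\<lambda>k. exp (- 1 :: real) ^ k)"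
      by (rule sum_le_suminf) (use e1 in \<open>auto intro!: summable_geometric\<close>)
    also have "\<dots> = 1 / (1 - exp (- 1))" using e1 by (intro suminf_geometric) simp
    finally show ?thesis .
  qed
  have sub: "B \<subseteq> int ` {..<Suc K} \<union> (\<lambda>k. - int k) ` {..<Suc K}"
  proof
    fix y assume y: "y \<in> B"
    show "y \<in> int ` {..<Suc K} \<union> (\<lambda>k. - int k) ` {..<Suc K}"
    proof (cases "y \<ge> 0")
      case True
      then have "y = int (nat y)" "nat y < Suc K" using K[OF y] by auto
      then show ?thesis by blast
    next
      case False
      then have "y = - int (nat (- y))" "nat (- y) < Suc K" using K[OF y] by auto
      then show ?thesis by blast
    qed
  qed
  have "(\<Sum>y\<in>B. exp (- \<bar>real_of_int y\<bar>)) \<le> (\<Sum>y\<in>int ` {..<Suc K} \<union> (\<lambda>k. - int k) ` {..<Suc K}. exp (- \<bar>real_of_int y\<bar>))"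
    by (rule sum_mono2[OF _ sub]) auto
  also have "\<dots> \<le> (\<Sum>y\<in>int ` {..<Suc K}. exp (- \<bar>real_of_int y\<bar>)) + (\<Sum>y\<in>(\<lambda>k. - int k) ` {..<Suc K}. exp (- \<bar>real_of_int y\<bar>))"
    by (subst sum.union_inter[symmetric]) (auto intro!: sum_nonneg)
  also have "\<dots> = (\<Sum>k<Suc K. exp (- real k)) + (\<Sum>k<Suc K. exp (- real k))"
    by (subst (1 2) sum.reindex) (auto simp: inj_on_def)
  finally show ?thesis using geo by simp
qed

text \<open>A finite set of lattice points lies in a box, over which the sum factors into
  one-dimensional sums bounded by geometric series.\<close>

lemma summable_prod_exp_minus_abs:
  "(\<lambda>m::(int, 'n::finite) vec. \<Prod>i\<in>UNIV. exp (- \<bar>real_of_int (m $ i)\<bar>)) summable_on UNIV"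
proof (rule nonneg_bdd_above_summable_on)
  define G where "G = 2 / (1 - exp (- 1 :: real))"
  show "bdd_above (sum (\<lambda>m::(int, 'n) vec. \<Prod>i\<in>UNIV. exp (- \<bar>real_of_int (m $ i)\<bar>)) ` {F. F \<subseteq> UNIV \<and> finite F})"
  proof (rule bdd_aboveI2)
    fix F :: "(int, 'n) vec set" assume "F \<in> {F. F \<subseteq> UNIV \<and> finite F}"
    then have F: "finite F" by simp
    define B where "B = (\<lambda>i. (\<lambda>m. m $ i) ` F)"
    have B: "finite (B i)" for i using F by (simp add: B_def)
    have "(\<Sum>m\<in>F. \<Prod>i\<in>UNIV. exp (- \<bar>real_of_int (m $ i)\<bar>)) =
        (\<Sum>p\<in>vec_nth ` F. \<Prod>i\<in>UNIV. exp (- \<bar>real_of_int (p i)\<bar>))"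
      by (subst sum.reindex) (auto simp: inj_on_def vec_nth_inject)
    also have "\<dots> \<le> (\<Sum>p\<in>PiE UNIV B. \<Prod>i\<in>UNIV. exp (- \<bar>real_of_int (p i)\<bar>))"
      by (rule sum_mono2) (auto simp: F B_def intro!: finite_PiE prod_nonneg)
    also have "\<dots> = (\<Prod>i\<in>UNIV. \<Sum>y\<in>B i. exp (- \<bar>real_of_int y\<bar>))"
      by (rule prod_sum_PiE[symmetric]) (auto simp: B)
    also have "\<dots> \<le> (\<Prod>i\<in>(UNIV::'n set). G)"
      unfolding G_def by (intro prod_mono conjI sum_nonneg sum_exp_minus_abs_le B) auto
    finally show "(\<Sum>m\<in>F. \<Prod>i\<in>UNIV. exp (- \<bar>real_of_int (m $ i)\<bar>)) \<le> (\<Prod>i\<in>(UNIV::'n set). G)" .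
  qed
qed (auto intro: prod_nonneg)

lemma quadratic_le_minus_abs:
  fixes e C t :: real assumes "e > 0"
  shows "- e * t\<^sup>2 + C * \<bar>t\<bar> \<le> (C + 1)\<^sup>2 / (4 * e) - \<bar>t\<bar>"
proof -
  have "0 \<le> (2 * e * \<bar>t\<bar> - (C + 1))\<^sup>2 / (4 * e)" using assms by simp
  also have "\<dots> = e * t\<^sup>2 - (C + 1) * \<bar>t\<bar> + (C + 1)\<^sup>2 / (4 * e)"
  proof -
    have "(2 * e * \<bar>t\<bar> - (C + 1))\<^sup>2 = 4 * e * (e * t\<^sup>2 - (C + 1) * \<bar>t\<bar>) + (C + 1)\<^sup>2"
      by (simp add: power2_eq_square algebra_simps)
    then show ?thesis using assms by (simp add: add_divide_distrib)
  qed
  finally show ?thesis by (simp add: algebra_simps)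
qed

text \<open>Near \<open>p0\<close> the quadratic form is uniformly coercive and the characteristics
  are bounded, so the quadratic decay in m absorbs all linear terms after completing the
  square.\<close>

lemma tE_dominated:
  fixes p0 :: "'n::finite tz"
  assumes p0: "p0 \<in> Ts"
  obtains r K where "r > 0" "ball p0 r \<subseteq> Ts"
    "\<And>p m. p \<in> ball p0 r \<Longrightarrow> cmod (tE m p) \<le> K * (\<Prod>i\<in>UNIV. exp (- \<bar>real_of_int (m $ i)\<bar>))"
proof -
  have "symm (snd (snd p0)) \<in> siegel_space" using p0 by (auto simp: ext_def)
  then obtain e r0 where er: "e > 0" "r0 > 0"
    "\<And>v x. dist (snd (snd p0)) v < r0 \<Longrightarrow> qform (symm v) x \<ge> e * (norm x)\<^sup>2"
    by (rule siegel_locally_coercive) blast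
  obtain r1 where r1: "r1 > 0" "ball p0 r1 \<subseteq> Ts" using open_Ts p0 open_contains_ball by blast
  define r where "r = min r0 r1"
  define B where "B = norm p0 + r"
  define n where "n = real CARD('n)"
  have r: "r > 0" using er r1 by (simp add: r_def)
  have B: "B \<ge> 0" using r by (simp add: B_def)
  have n: "n \<ge> 0" by (simp add: n_def)
  \<comment> \<open>\<open>C\<close> collects what is linear in m, namely the two cross terms and
    the character, and \<open>C'\<close> what is free of m.\<close>
  define C where "C = pi * (2 * n * B * B) + 2 * pi * B"
  define C' where "C' = pi * (n * n * B * B * B) + 2 * pi * (n * B * B)"
  define K where "K = exp (C' + n * ((C + 1)\<^sup>2 / (4 * (pi * e))))"
  have bound: "cmod (tE m p) \<le> K * (\<Prod>i\<in>UNIV. exp (- \<bar>real_of_int (m $ i)\<bar>))" if p: "p \<in> ball p0 r" for m p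
  proof -
    obtain s u v where pp: "p = (s, u, v)" by (cases p)
    have nb: "norm p \<le> B" using p norm_triangle_sub[of p p0] by (simp add: B_def dist_norm norm_minus_commute)
    have "norm s \<le> norm p" "norm (u, v) \<le> norm p" unfolding pp by (rule norm_fst_le norm_snd_le)+
    moreover have "norm u \<le> norm (u, v)" "norm v \<le> norm (u, v)" by (rule norm_fst_le norm_snd_le)+
    ultimately have N: "norm s \<le> B" "norm u \<le> B" "norm v \<le> B" using nb by linarith+
    have si: "cmod (s $ i) \<le> B" and ui: "cmod (u $ i) \<le> B" for i
      using N Finite_Cartesian_Product.norm_nth_le[of s i] Finite_Cartesian_Product.norm_nth_le[of u i] by linarith+
    have vij: "cmod (v $ i $ j) \<le> B" for i j
      using N Finite_Cartesian_Product.norm_nth_le[of v i] Finite_Cartesian_Product.norm_nth_le[of "v $ i" j] by linarith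
    have wij: "cmod (symm v $ i $ j) \<le> B" for i j
      using norm_triangle_ineq[of "v $ i $ j" "v $ j $ i"] vij[of i j] vij[of j i] by simp
    define M where "M = (\<Sum>i\<in>UNIV. \<bar>real_of_int (m $ i)\<bar>)"
    have Mn: "M \<ge> 0" by (simp add: M_def sum_nonneg)
    define mv where "mv = (\<chi> i. real_of_int (m $ i))"
    define mz where "mz = (\<lambda>i. complex_of_int (m $ i))"
    define w where "w = (\<lambda>i j. symm v $ i $ j)"
    define sv where "sv = (\<lambda>i. s $ i)"
    have svb: "cmod (sv i) \<le> B" and wb: "cmod (w i j) \<le> B" and wsym: "w i j = w j i" for i j
      using si wij by (simp_all only: sv_def w_def symm_nth add.commute)
    have mzn: "cmod (mz i) = \<bar>real_of_int (m $ i)\<bar>" for i by (simp add: mz_def)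
    have xvp: "xv m i p = mz i + sv i" for i by (simp add: xv_def pp mz_def sv_def)
    have dsum: "(\<Sum>i\<in>UNIV. \<Sum>j\<in>UNIV. xv m i p * (w i j * xv m j p)) =
        (\<Sum>i\<in>UNIV. \<Sum>j\<in>UNIV. mz i * (w i j * mz j)) +
        ((\<Sum>i\<in>UNIV. \<Sum>j\<in>UNIV. mz i * (w i j * sv j)) +
         (\<Sum>i\<in>UNIV. \<Sum>j\<in>UNIV. sv i * (w i j * mz j)) +
         (\<Sum>i\<in>UNIV. \<Sum>j\<in>UNIV. sv i * (w i j * sv j)))"
      unfolding sum.distrib[symmetric] by (intro sum.cong refl) (simp add: xvp algebra_simps)
    have t1: "cmod (\<Sum>i\<in>UNIV. \<Sum>j\<in>UNIV. mz i * (w i j * sv j)) \<le> n * B * B * M"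
    proof -
      have "cmod (\<Sum>i\<in>UNIV. \<Sum>j\<in>UNIV. mz i * (w i j * sv j)) \<le>
          (\<Sum>i\<in>(UNIV::'n set). \<Sum>j\<in>(UNIV::'n set). \<bar>real_of_int (m $ i)\<bar> * (B * B))"
        by (intro order.trans[OF norm_sum] sum_mono)
          (simp add: norm_mult mzn mult_left_mono mult_mono wb svb B)
      then show ?thesis by (simp add: M_def n_def sum_distrib_left sum_distrib_right mult_ac)
    qed
    have t2: "cmod (\<Sum>i\<in>UNIV. \<Sum>j\<in>UNIV. sv i * (w i j * mz j)) \<le> n * B * B * M"
    proof -
      have "(\<Sum>i\<in>UNIV. \<Sum>j\<in>UNIV. sv i * (w i j * mz j)) =
          (\<Sum>j\<in>UNIV. \<Sum>i\<in>UNIV. mz j * (w j i * sv i))"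
        by (subst sum.swap) (intro sum.cong refl, simp add: mult_ac wsym)
      then show ?thesis using t1 by simp
    qed
    have t3: "cmod (\<Sum>i\<in>UNIV. \<Sum>j\<in>UNIV. sv i * (w i j * sv j)) \<le> n * n * B * B * B"
    proof -
      have "cmod (\<Sum>i\<in>UNIV. \<Sum>j\<in>UNIV. sv i * (w i j * sv j)) \<le>
          (\<Sum>i\<in>(UNIV::'n set). \<Sum>j\<in>(UNIV::'n set). B * (B * B))"
        by (intro order.trans[OF norm_sum] sum_mono)
          (simp add: norm_mult mult_mono wb svb B)
      then show ?thesis by (simp add: n_def mult_ac)
    qed
    have t4: "cmod (\<Sum>i\<in>UNIV. u $ i * xv m i p) \<le> B * M + n * B * B"
    proof -
      have "cmod (\<Sum>i\<in>UNIV. u $ i * xv m i p) \<le> (\<Sum>i\<in>(UNIV::'n set). B * (\<bar>real_of_int (m $ i)\<bar> + B))"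
      proof (intro order.trans[OF norm_sum] sum_mono)
        fix i
        have "cmod (xv m i p) \<le> \<bar>real_of_int (m $ i)\<bar> + B"
          unfolding xvp using norm_triangle_ineq[of "mz i" "sv i"] svb[of i] mzn[of i] by linarith
        then show "cmod (u $ i * xv m i p) \<le> B * (\<bar>real_of_int (m $ i)\<bar> + B)"
          unfolding norm_mult using ui B by (intro mult_mono) auto
      qed
      then show ?thesis by (simp add: M_def n_def sum.distrib sum_distrib_left algebra_simps)
    qed
    have q: "Im (\<Sum>i\<in>UNIV. \<Sum>j\<in>UNIV. mz i * (w i j * mz j)) \<ge> e * (\<Sum>i\<in>UNIV. (real_of_int (m $ i))\<^sup>2)"
    proof -
      have "Im (of_int k * (z * of_int l)) = real_of_int k * Im z * real_of_int l" for k l and z :: complex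
        by (simp add: mult.assoc)
      then have "Im (\<Sum>i\<in>UNIV. \<Sum>j\<in>UNIV. mz i * (w i j * mz j)) = qform (symm v) mv"
        by (simp only: qform_def mv_def Im_sum vec_lambda_beta mz_def w_def)
      moreover have "dist (snd (snd p0)) v < r0"
      proof -
        have "norm (snd (snd (p0 - p))) \<le> norm (p0 - p)"
          by (metis norm_snd_le order.trans prod.collapse)
        then show ?thesis using p by (simp add: r_def pp dist_norm)
      qed
      moreover have "(norm mv)\<^sup>2 = (\<Sum>i\<in>UNIV. (real_of_int (m $ i))\<^sup>2)"
        by (simp add: mv_def norm_vec_def L2_set_def sum_nonneg)
      ultimately show ?thesis using er(3) by metis
    qed
    define z1 where "z1 = (\<Sum>i\<in>UNIV. \<Sum>j\<in>UNIV. mz i * (w i j * mz j))"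
    define z2 where "z2 = (\<Sum>i\<in>UNIV. \<Sum>j\<in>UNIV. mz i * (w i j * sv j)) +
         (\<Sum>i\<in>UNIV. \<Sum>j\<in>UNIV. sv i * (w i j * mz j)) +
         (\<Sum>i\<in>UNIV. \<Sum>j\<in>UNIV. sv i * (w i j * sv j))"
    define z3 where "z3 = (\<Sum>i\<in>UNIV. u $ i * xv m i p)"
    have z2: "cmod z2 \<le> 2 * n * B * B * M + n * n * B * B * B"
      unfolding z2_def using t1 t2 t3 by (intro norm_triangle_le) (auto intro!: add_mono norm_triangle_le)
    have tq: "tq m p = of_real pi * \<i> * (z1 + z2) + (- 2 * of_real pi * \<i>) * z3"
      unfolding tq_def z1_def z2_def z3_def dsum[symmetric] by (simp only: pp fst_conv snd_conv w_def)
    have "Re (tq m p) = - pi * Im z1 - pi * Im z2 + 2 * pi * Im z3"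
      unfolding tq by (simp add: algebra_simps)
    also have "\<dots> \<le> - pi * (e * (\<Sum>i\<in>UNIV. (real_of_int (m $ i))\<^sup>2)) + pi * (2 * n * B * B * M + n * n * B * B * B) +
        2 * pi * (B * M + n * B * B)"
    proof -
      have "pi * (e * (\<Sum>i\<in>UNIV. (real_of_int (m $ i))\<^sup>2)) \<le> pi * Im z1"
        unfolding z1_def by (intro mult_left_mono q) simp
      moreover have "pi * (- Im z2) \<le> pi * (2 * n * B * B * M + n * n * B * B * B)"
        using abs_Im_le_cmod[of z2] z2 by (intro mult_left_mono) auto
      moreover have "2 * pi * Im z3 \<le> 2 * pi * (B * M + n * B * B)"
        using abs_Im_le_cmod[of z3] t4 unfolding z3_def[symmetric] by (intro mult_left_mono) auto
      ultimately show ?thesis by linarith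
    qed
    also have "\<dots> = C' + (- (pi * e) * (\<Sum>i\<in>UNIV. (real_of_int (m $ i))\<^sup>2) + C * M)"
      by (simp add: C_def C'_def algebra_simps)
    also have "- (pi * e) * (\<Sum>i\<in>UNIV. (real_of_int (m $ i))\<^sup>2) + C * M =
        (\<Sum>i\<in>UNIV. - (pi * e) * (real_of_int (m $ i))\<^sup>2 + C * \<bar>real_of_int (m $ i)\<bar>)"
      by (simp only: M_def sum.distrib sum_distrib_left)
    also have "\<dots> \<le> (\<Sum>i\<in>(UNIV::'n set). (C + 1)\<^sup>2 / (4 * (pi * e)) - \<bar>real_of_int (m $ i)\<bar>)"
      by (intro sum_mono quadratic_le_minus_abs mult_pos_pos er) simp
    also have "\<dots> = n * ((C + 1)\<^sup>2 / (4 * (pi * e))) - M"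
      by (simp add: sum_subtractf n_def M_def)
    finally have "Re (tq m p) \<le> (C' + n * ((C + 1)\<^sup>2 / (4 * (pi * e)))) + - M" by simp
    then have "cmod (tE m p) \<le> exp ((C' + n * ((C + 1)\<^sup>2 / (4 * (pi * e)))) + - M)"
      unfolding tE_def norm_exp_eq_Re by simp
    also have "\<dots> = K * (\<Prod>i\<in>UNIV. exp (- \<bar>real_of_int (m $ i)\<bar>))"
      unfolding exp_add K_def M_def by (simp add: exp_sum sum_negf[symmetric])
    finally show ?thesis .
  qed
  show ?thesis
    by (rule that[OF r _ bound]) (use r1 in \<open>auto simp: r_def\<close>)
qed

lemma th_limit:
  "loc_uniform_limit Ts (\<lambda>F p. \<Sum>m\<in>F. tE m p) (th :: 'n::finite tz \<Rightarrow> complex) (finite_subsets_at_top UNIV)"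
  unfolding loc_uniform_limit_def
proof
  fix p0 :: "'n tz" assume "p0 \<in> Ts"
  then obtain r K where r: "r > 0" "ball p0 r \<subseteq> Ts"
    and K: "\<And>p m. p \<in> ball p0 r \<Longrightarrow> cmod (tE m p) \<le> K * (\<Prod>i\<in>UNIV. exp (- \<bar>real_of_int (m $ i)\<bar>))"
    by (rule tE_dominated) blast
  have "uniform_limit (ball p0 r) (\<lambda>F p. \<Sum>m\<in>F. tE m p) (\<lambda>p. \<Sum>\<^sub>\<infinity>m. tE m p) (finite_subsets_at_top UNIV)"
  proof (rule Weierstrass_m_test_general)
    show "cmod (tE m p) \<le> K * (\<Prod>i\<in>UNIV. exp (- \<bar>real_of_int (m $ i)\<bar>))" if "p \<in> ball p0 r" for m p
      by (rule K[OF that])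
    show "(\<lambda>m::(int, 'n) vec. K * (\<Prod>i\<in>UNIV. exp (- \<bar>real_of_int (m $ i)\<bar>))) summable_on UNIV"
      by (rule summable_on_cmult_right[OF summable_prod_exp_minus_abs])
  qed
  then show "\<exists>r>0. ball p0 r \<subseteq> Ts \<and> uniform_limit (ball p0 r) (\<lambda>F p. \<Sum>m\<in>F. tE m p) th (finite_subsets_at_top UNIV)"
    using r unfolding th_def[abs_def] by blast
qed

lemma tE_summable:
  fixes p :: "'n::finite tz"
  assumes "p \<in> Ts" shows "(\<lambda>m. tE m p) summable_on UNIV"
  unfolding summable_on_def has_sum_def
  using loc_uniform_limit_tendsto[OF th_limit assms] by blast

lemma holo_partial_th: "\<forall>\<^sub>F F in finite_subsets_at_top UNIV. holo (\<lambda>p. \<Sum>m\<in>F. tE m p) Ts"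
  by (intro always_eventually allI holo_sum holo_tE)

lemma holo_th: "holo th (Ts :: 'n::finite tz set)"
  by (rule holo_loc_uniform_limit[OF open_Ts holo_partial_th _ th_limit]) simp

lemma dd_th_limit:
  fixes p :: "'n::finite tz"
  assumes "p \<in> Ts"
  shows "((\<lambda>F. \<Sum>m\<in>F. dd w (tE m) p) \<longlongrightarrow> dd w th p) (finite_subsets_at_top UNIV)"
proof -
  have "((\<lambda>F. dd w (\<lambda>p. \<Sum>m\<in>F. tE m p) p) \<longlongrightarrow> dd w th p) (finite_subsets_at_top UNIV)"
    by (rule dd_loc_uniform_limit[OF holo_partial_th _ th_limit assms]) simp
  then show ?thesis by (simp only: dd_sum_fun[OF holo_tE UNIV_I])
qed

lemma dd_dd_th_limit:
  fixes p :: "'n::finite tz"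
  assumes "p \<in> Ts"
  shows "((\<lambda>F. \<Sum>m\<in>F. dd w' (dd w (tE m)) p) \<longlongrightarrow> dd w' (dd w th) p) (finite_subsets_at_top UNIV)"
proof -
  have e: "dd w (\<lambda>p. \<Sum>m\<in>F. tE m p) = (\<lambda>p. \<Sum>m\<in>F. dd w (tE m) p)" for F :: "(int, 'n) vec set" and w
    by (rule ext) (rule dd_sum_fun[OF holo_tE UNIV_I])
  have "((\<lambda>F. dd w' (dd w (\<lambda>p. \<Sum>m\<in>F. tE m p)) p) \<longlongrightarrow> dd w' (dd w th) p) (finite_subsets_at_top UNIV)"
    by (rule dd_dd_loc_uniform_limit[OF open_Ts holo_partial_th _ th_limit assms])
      (auto intro!: always_eventually holo_dd[OF open_Ts] holo_sum holo_tE)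
  then show ?thesis
    unfolding e by (simp only: dd_sum_fun[OF holo_dd[OF open_UNIV holo_tE] UNIV_I])
qed

section \<open>Differential equations and symmetries of the theta series\<close>

lemma th_heat:
  fixes p :: "'n::finite tz"
  assumes p: "p \<in> Ts" and c: "c\<^sup>2 = - (4 * of_real pi * \<i>)"
  shows "dd (dv i j) th p = - (1 / c\<^sup>2) * dd (du i) (dd (du j) th) p"
proof (rule tendsto_unique[OF _ dd_th_limit[OF p]])
  have "dd (dv i j) (tE m) p = - (1 / c\<^sup>2) * dd (du i) (dd (du j) (tE m)) p" for m
    unfolding dd_tE[of "dv i j"] dd_tq_v dd_dd_tE_u c by (simp add: power2_eq_square field_simps)
  then show "((\<lambda>F. \<Sum>m\<in>F. dd (dv i j) (tE m) p) \<longlongrightarrow> - (1 / c\<^sup>2) * dd (du i) (dd (du j) th) p) (finite_subsets_at_top UNIV)"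
    unfolding sum_distrib_left[symmetric] using tendsto_mult[OF tendsto_const dd_dd_th_limit[OF p]]
    by (simp only: sum_distrib_left[symmetric])
qed simp

text \<open>Differentiating the exponent in the first characteristic gives a linear form in the
  summation variable, which differentiation in u also produces.\<close>

lemma th_shift_eq:
  fixes p :: "'n::finite tz"
  assumes p: "p \<in> Ts"
  shows "dd (ds i) th p = - (\<Sum>j\<in>UNIV. symm (snd (snd p)) $ i $ j * dd (du j) th p) - 2 * of_real pi * \<i> * fst (snd p) $ i * th p"
proof (rule tendsto_unique[OF _ dd_th_limit[OF p]])
  have eq: "dd (ds i) (tE m) p = - (\<Sum>j\<in>UNIV. symm (snd (snd p)) $ i $ j * dd (du j) (tE m) p) - 2 * of_real pi * \<i> * fst (snd p) $ i * tE m p" for m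
    unfolding dd_tE dd_tq_s dd_tq_u
    by (simp add: sum_distrib_left sum_distrib_right sum_negf algebra_simps del: symm_nth)
  have "(\<Sum>m\<in>F. dd (ds i) (tE m) p) = - (\<Sum>j\<in>UNIV. symm (snd (snd p)) $ i $ j * (\<Sum>m\<in>F. dd (du j) (tE m) p)) -
      2 * of_real pi * \<i> * fst (snd p) $ i * (\<Sum>m\<in>F. tE m p)" for F
    unfolding eq sum_subtractf sum_negf sum_distrib_left by (subst sum.swap) (rule refl)
  moreover have "((\<lambda>F. - (\<Sum>j\<in>UNIV. symm (snd (snd p)) $ i $ j * (\<Sum>m\<in>F. dd (du j) (tE m) p)) -
      2 * of_real pi * \<i> * fst (snd p) $ i * (\<Sum>m\<in>F. tE m p)) \<longlongrightarrow>
      - (\<Sum>j\<in>UNIV. symm (snd (snd p)) $ i $ j * dd (du j) th p) - 2 * of_real pi * \<i> * fst (snd p) $ i * th p) (finite_subsets_at_top UNIV)"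
    by (intro tendsto_diff tendsto_minus tendsto_sum tendsto_mult tendsto_const dd_th_limit[OF p]
        loc_uniform_limit_tendsto[OF th_limit p])
  ultimately show "((\<lambda>F. \<Sum>m\<in>F. dd (ds i) (tE m) p) \<longlongrightarrow>
      - (\<Sum>j\<in>UNIV. symm (snd (snd p)) $ i $ j * dd (du j) th p) - 2 * of_real pi * \<i> * fst (snd p) $ i * th p) (finite_subsets_at_top UNIV)"
    by simp
qed simp

text \<open>At zero first characteristic the extra character value is that of an integer, hence
  1.\<close>

lemma th_periodic_u: "th (0, u + ax j, v) = th (0, u, v)"
proof -
  have "tE m (0, u + ax j, v) = tE m (0, u, v)" for m
  proof -
    have "tq m (0, u + ax j, v) = tq m (0, u, v) + (- 2 * of_real pi * \<i>) * of_int (m $ j)"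
      unfolding tq_def by (simp add: xv_def ring_distribs sum.distrib sum_ax del: symm_nth)
    then have "tE m (0, u + ax j, v) = tE m (0, u, v) * ch (m $ j) 1"
      by (simp add: tE_def ch_def exp_add[symmetric])
    then show ?thesis by simp
  qed
  then show ?thesis by (simp add: th_def)
qed

text \<open>The first characteristic always appears added to the summation variable, so that an
  integral shift is a reindexing, for every u.\<close>

lemma th_periodic_s: "th (s + ax j, u, v) = th (s, u, v)"
proof -
  have "tE m (s + ax j, u, v) = tE (m + axis j 1) (s, u, v)" for m
  proof -
    have "xv m i (s + ax j, u, v) = xv (m + axis j 1) i (s, u, v)" for i
      by (simp add: xv_def axis_def)
    then show ?thesis by (simp add: tE_def tq_def)
  qed
  moreover have "bij (\<lambda>m::(int, 'a) vec. m + axis j 1)"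
    by (rule bij_betw_byWitness[where f' = "\<lambda>m. m - axis j 1"]) auto
  ultimately show ?thesis
    unfolding th_def using infsum_reindex_bij_betw[of "\<lambda>m. m + axis j 1" UNIV UNIV "\<lambda>m. tE m (s, u, v)"] by simp
qed

lemma th_even: "th (0, - u, v) = th (0, u, v)"
proof -
  have "tE m (0, - u, v) = tE (- m) (0, u, v)" for m
    by (simp add: tE_def tq_def xv_def del: symm_nth)
  moreover have "bij (uminus :: (int, 'a) vec \<Rightarrow> _)"
    by (rule bij_betw_byWitness[where f' = uminus]) auto
  ultimately show ?thesis
    unfolding th_def using infsum_reindex_bij_betw[of uminus UNIV UNIV "\<lambda>m. tE m (0, u, v)"] by simp
qed

lemma th_symm: "th (s, u, symm v) = th (s, u, v)"
  unfolding th_def tE_def tq_def by (simp only: snd_conv fst_conv symm_symm xv_def)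

lemma th_riemann: "th (0, 0, v) = riemann_theta (symm v)"
  unfolding th_def riemann_theta_def tE_def tq_def by (simp add: xv_def mult.assoc del: symm_nth)

text \<open>Theta is even in u, so its odd derivatives vanish at 0; thus the degree-one part of the
  family \<open>TH\<close> disappears at the theta constant.\<close>

lemma dd_th_u_zero:
  fixes v :: "'n::finite cmatrix"
  assumes "v \<in> Hs" shows "dd (du j) th (0, 0, v) = 0"
proof -
  define D where "D = dd (du j) th (0, 0, v)"
  have "((\<lambda>z. th ((0, 0, v) + z *\<^sub>C du j)) has_field_derivative dd (du j) th ((0, 0, v) + 0 *\<^sub>C du j)) (at 0)"
    by (rule holo_field_derivative[OF holo_th]) (use assms in \<open>auto simp: zero_prod_def[symmetric]\<close>)
  then have 1: "((\<lambda>z. th (0, z *\<^sub>C ax j, v)) has_field_derivative D) (at 0)"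
    by (simp add: cscale_Pair D_def)
  have "((\<lambda>z. th (0, (- z) *\<^sub>C ax j, v)) has_field_derivative D * (- 1)) (at 0)"
    by (rule DERIV_chain2[where f = "\<lambda>z. th (0, z *\<^sub>C ax j, v)" and g = uminus])
      (use 1 in \<open>auto intro!: derivative_eq_intros\<close>)
  moreover have "th (0, (- z) *\<^sub>C ax j, v) = th (0, z *\<^sub>C ax j, v)" for z
  proof -
    have "(- z) *\<^sub>C ax j = - (z *\<^sub>C ax j)" by (simp add: vec_eq_iff axis_def)
    then show ?thesis by (simp add: th_even)
  qed
  ultimately have "((\<lambda>z. th (0, z *\<^sub>C ax j, v)) has_field_derivative - D) (at 0)" by simp
  from DERIV_unique[OF 1 this] show ?thesis by (simp add: D_def)
qed

subsection \<open>The theta superfunction and its flows\<close>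

definition one :: "'n set \<Rightarrow> complex" where
  "one I = (if I = {} then 1 else 0)"

text \<open>The elements a + sum of b_j \<xi>_j of degree at most one, in which the theta family
  lives.\<close>

definition comb :: "complex \<Rightarrow> ('n::{finite,linorder} \<Rightarrow> complex) \<Rightarrow> 'n set \<Rightarrow> complex" where
  "comb a b = (\<lambda>I. a * one I + (\<Sum>j\<in>UNIV. b j * X j one I))"

lemma del_one: "del i one = (\<lambda>I. 0)"
  by (auto simp: del_def one_def)

lemma del_comb: "del i (comb a b) I = b i * one I"
proof -
  have "del i (X j one) I = (if j = i then one I else 0)" for j
    by (auto simp: del_X del_one X_zero)
  then have "(\<Sum>j\<in>UNIV. b j * del i (X j one) I) = (\<Sum>j\<in>UNIV. if j = i then b j * one I else 0)"
    by (intro sum.cong refl) auto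
  then show ?thesis
    unfolding comb_def by (simp add: del_plus del_sum del_cmult del_one)
qed

lemma X_comb: "X l (comb a b) I = a * X l one I + (\<Sum>j\<in>UNIV. b j * X l (X j one) I)"
  unfolding comb_def by (simp add: X_plus X_sum X_cmult)

lemma X_X_symmetric_sum:
  fixes b :: "'n::{finite,linorder} \<Rightarrow> 'n \<Rightarrow> complex"
  assumes "\<And>l j. b l j = b j l"
  shows "(\<Sum>l\<in>UNIV. \<Sum>j\<in>UNIV. b l j * X l (X j a) I) = 0"
proof -
  have "(\<Sum>l\<in>UNIV. \<Sum>j\<in>UNIV. b l j * X l (X j a) I) = (\<Sum>l\<in>UNIV. \<Sum>j\<in>UNIV. - (b j l * X j (X l a) I))"
  proof (intro sum.cong refl)
    fix l j
    show "b l j * X l (X j a) I = - (b j l * X j (X l a) I)"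
      using X_anticommute[of l j a I] assms[of l j] by simp
  qed
  also have "\<dots> = - (\<Sum>l\<in>UNIV. \<Sum>j\<in>UNIV. b l j * X l (X j a) I)"
    by (subst sum.swap) (simp add: sum_negf)
  finally show ?thesis by simp
qed

lemma sum_X_comb:
  assumes "\<And>l j. b l j = b j l"
  shows "(\<Sum>l\<in>UNIV. X l (comb (a l) (b l)) I) = (\<Sum>l\<in>UNIV. a l * X l one I)"
  by (simp add: X_comb sum.distrib X_X_symmetric_sum[OF assms])

text \<open>The part of degree one is chosen so that \<open>c\<partial>/\<partial>\<xi>\<^sub>j\<close> reproduces \<open>\<partial>/\<partial>u\<^sub>j\<close> on the body.\<close>

definition TH :: "complex \<Rightarrow> 'n::{finite,linorder} set \<Rightarrow> 'n tz \<Rightarrow> complex" where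
  "TH c I p = comb (th p) (\<lambda>j. dd (du j) th p / c) I"

lemma TH_alt: "TH c I = (\<lambda>p. one I * th p + (\<Sum>j\<in>UNIV. (X j one I / c) * dd (du j) th p))"
  by (rule ext) (simp add: TH_def comb_def mult.commute)

lemma holo_thu: "holo (dd (du j) th) (Ts :: 'n::finite tz set)"
  by (rule holo_dd[OF open_Ts holo_th])

lemma holo_TH: "holo (TH c I) (Ts :: 'n::{finite,linorder} tz set)"
  unfolding TH_alt by (intro holo_add holo_cmult holo_sum holo_th holo_thu)

lemma dd_TH:
  fixes p :: "'n::{finite,linorder} tz"
  assumes p: "p \<in> Ts"
  shows "dd w (TH c I) p = comb (dd w th p) (\<lambda>j. dd w (dd (du j) th) p / c) I"
proof -
  have "dd w (TH c I) p = one I * dd w th p + (\<Sum>j\<in>UNIV. (X j one I / c) * dd w (dd (du j) th) p)"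
    unfolding TH_alt
    by (simp only: dd_plus[OF holo_cmult[OF holo_th] holo_sum[OF holo_cmult[OF holo_thu]] p]
        dd_cmult[OF holo_th p] dd_sum_fun[OF holo_cmult[OF holo_thu] p] dd_cmult[OF holo_thu p])
  then show ?thesis by (simp add: comb_def mult.commute)
qed

lemma TH_symm: "TH c I (s, u, symm v) = TH c I (s, u, v)"
proof -
  have "dd (du j) th (s, u, symm v) = dd (du j) th (s, u, v)" for j
    by (simp add: dd_def cscale_Pair th_symm)
  then show ?thesis by (simp add: TH_def th_symm)
qed

text \<open>By the heat equation both sides are the same multiple of a third derivative in
  u.\<close>

lemma th_dv_du_symmetric:
  fixes p :: "'n::finite tz"
  assumes p: "p \<in> Ts" and c: "c\<^sup>2 = - (4 * of_real pi * \<i>)"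
  shows "dd (dv i l) (dd (du j) th) p = dd (dv i j) (dd (du l) th) p"
proof -
  have e: "dd (dv i l) (dd (du j) th) p = - (1 / c\<^sup>2) * dd (du j) (dd (du i) (dd (du l) th)) p" for l j
  proof -
    have "dd (dv i l) (dd (du j) th) p = dd (du j) (dd (dv i l) th) p"
      by (rule dd_commute[OF open_Ts holo_th p])
    also have "\<dots> = dd (du j) (\<lambda>p. - (1 / c\<^sup>2) * dd (du i) (dd (du l) th) p) p"
      by (rule dd_cong_open[OF open_Ts p th_heat[OF _ c]])
    also have "\<dots> = - (1 / c\<^sup>2) * dd (du j) (dd (du i) (dd (du l) th)) p"
      by (rule dd_cmult[OF holo_dd[OF open_Ts holo_thu] p])
    finally show ?thesis .
  qed
  have "dd (du j) (dd (du i) (dd (du l) th)) p = dd (du i) (dd (du j) (dd (du l) th)) p" for j l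
    by (rule dd_commute[OF open_Ts holo_thu p])
  moreover have "dd (du i) (dd (du j) (dd (du l) th)) p = dd (du i) (dd (du l) (dd (du j) th)) p"
    by (rule dd_cong_open[OF open_Ts p dd_commute[OF open_Ts holo_th]])
  ultimately show ?thesis unfolding e by simp
qed

lemma dd_snd_slice: "dd (Em i l) (\<lambda>v. G (y, v)) v = dd (av i l) G (y, v)"
  by (simp add: dd_def cscale_Pair)

text \<open>The operator of p_i on families in (y, v), with y a mere parameter; in this form its
  commutation with y-derivatives can be stated.\<close>

definition SpT :: "'n::{finite,linorder} \<Rightarrow> ('n set \<Rightarrow> 'n zv \<Rightarrow> complex) \<Rightarrow> 'n set \<Rightarrow> 'n zv \<Rightarrow> complex" where
  "SpT i G I x = del i (\<lambda>I. G I x) I - (\<Sum>l\<in>UNIV. X l (\<lambda>I. dd (av i l) (G I) x) I)"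

definition SqT :: "'n::{finite,linorder} \<Rightarrow> ('n set \<Rightarrow> 'n zv \<Rightarrow> complex) \<Rightarrow> 'n set \<Rightarrow> 'n zv \<Rightarrow> complex" where
  "SqT i G I x = (\<Sum>j\<in>UNIV. symm (snd x) $ j $ i * SpT j G I x - 1 / 2 * X j (X i (\<lambda>I. SpT j G I x)) I)
     - 1 / 2 * X i (\<lambda>I. G I x) I"

lemma Sp_slice: "Sp i (\<lambda>I v. G I (y, v)) I v = SpT i G I (y, v)"
  unfolding Sp_def SpT_def XX_def pd_def dd_snd_slice ..

lemma Sq_slice: "Sq i (\<lambda>I v. G I (y, v)) I v = SqT i G I (y, v)"
  unfolding Sq_def SqT_def XX_def VV_def Sp_slice by simp

lemma X_dd:
  assumes "\<And>I. holo (H I) S" "x \<in> S"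
  shows "holo (\<lambda>x. X l (\<lambda>I. H I x) I) S" "dd w (\<lambda>x. X l (\<lambda>I. H I x) I) x = X l (\<lambda>I. dd w (H I) x) I"
  by (auto simp: X_def dd_cmult[OF assms] intro!: holo_if holo_cmult assms(1))

lemma del_dd:
  assumes "\<And>I. holo (H I) S" "x \<in> S"
  shows "holo (\<lambda>x. del l (\<lambda>I. H I x) I) S" "dd w (\<lambda>x. del l (\<lambda>I. H I x) I) x = del l (\<lambda>I. dd w (H I) x) I"
  by (auto simp: del_def dd_cmult[OF assms] intro!: holo_if holo_cmult assms(1))

context
  fixes W :: "'n::{finite,linorder} cmatrix set"
  assumes W: "open W"
begin

lemma SpT_dd:
  assumes G: "\<And>I. holo (G I) (UNIV \<times> W)" and x: "x \<in> UNIV \<times> W"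
  shows "holo (SpT i G I) (UNIV \<times> W)" "dd w (SpT i G I) x = SpT i (\<lambda>I. dd w (G I)) I x"
proof -
  note S = open_S[OF W]
  have h: "holo (dd (av i l) (G I)) (UNIV \<times> W)" for l I by (rule holo_dd[OF S G])
  note hd = del_dd[where H = G, OF G x]
  have hx: "holo (\<lambda>x. X l (\<lambda>I. dd (av i l) (G I) x) I) (UNIV \<times> W)"
    "dd w (\<lambda>x. X l (\<lambda>I. dd (av i l) (G I) x) I) x = X l (\<lambda>I. dd w (dd (av i l) (G I)) x) I" for l I
    by (rule X_dd(1)[OF h x], rule X_dd(2)[OF h x])
  show "holo (SpT i G I) (UNIV \<times> W)"
    unfolding SpT_def[abs_def] by (intro holo_diff holo_sum hd(1) hx(1))
  have "dd w (SpT i G I) x = del i (\<lambda>I. dd w (G I) x) I - (\<Sum>l\<in>UNIV. X l (\<lambda>I. dd w (dd (av i l) (G I)) x) I)"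
    unfolding SpT_def[abs_def]
    by (simp only: dd_diff[OF hd(1) holo_sum[OF hx(1)] x] hd(2) dd_sum_fun[OF hx(1) x] hx(2))
  then show "dd w (SpT i G I) x = SpT i (\<lambda>I. dd w (G I)) I x"
    unfolding SpT_def dd_commute[OF S G x, of w] .
qed

lemma SpT_cmult:
  assumes "\<And>I. holo (G I) (UNIV \<times> W)" "x \<in> UNIV \<times> W"
  shows "SpT i (\<lambda>I x. a * G I x) I x = a * SpT i G I x"
  unfolding SpT_def
  by (simp add: dd_cmult[OF assms] del_cmult X_cmult sum_distrib_left right_diff_distrib)

lemma SqT_dd:
  assumes G: "\<And>I. holo (G I) (UNIV \<times> W)" and x: "x \<in> UNIV \<times> W"
  shows "dd (y, 0) (SqT i G I) x = SqT i (\<lambda>I. dd (y, 0) (G I)) I x"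
proof -
  have bl: "bounded_linear (\<lambda>x::'n zv. symm (snd x) $ j $ i)" for j
    by (rule bounded_linear_compose[OF bounded_linear_symm_nth bounded_linear_snd])
  have sy: "holo (\<lambda>x::'n zv. symm (snd x) $ j $ i) (UNIV \<times> W)" "dd (y, 0) (\<lambda>x::'n zv. symm (snd x) $ j $ i) x = 0" for j
  proof -
    show "holo (\<lambda>x::'n zv. symm (snd x) $ j $ i) (UNIV \<times> W)"
      by (rule holo_linear[OF bl]) (simp add: symm_nth_cscale del: symm_nth)
    have "dd (y, 0) (\<lambda>x::'n zv. symm (snd x) $ j $ i) x = symm (snd (y, 0 :: 'n cmatrix)) $ j $ i"
      by (rule dd_linear_fun[OF bl]) (simp add: symm_nth_cscale del: symm_nth)
    then show "dd (y, 0) (\<lambda>x::'n zv. symm (snd x) $ j $ i) x = 0" by simp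
  qed
  have hS: "holo (SpT j G I) (UNIV \<times> W)" for j I by (rule SpT_dd(1)[OF G x])
  have h2: "holo (\<lambda>x. X i (\<lambda>I. SpT j G I x) I) (UNIV \<times> W)" for j I by (rule X_dd(1)[OF hS x])
  have h3: "holo (\<lambda>x. X j (X i (\<lambda>I. SpT j G I x)) I) (UNIV \<times> W)" for j I by (rule X_dd(1)[OF h2 x])
  have d3: "dd (y, 0) (\<lambda>x. X j (X i (\<lambda>I. SpT j G I x)) I) x = X j (X i (\<lambda>I. dd (y, 0) (SpT j G I) x)) I" for j I
    by (simp only: X_dd(2)[where H = "\<lambda>I x. X i (\<lambda>I. SpT j G I x) I", OF h2 x]
        X_dd(2)[where H = "SpT j G", OF hS x])
  have hA: "holo (\<lambda>x. symm (snd x) $ j $ i * SpT j G I x - 1 / 2 * X j (X i (\<lambda>I. SpT j G I x)) I) (UNIV \<times> W)" for j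
    by (intro holo_diff holo_mult holo_cmult sy hS h3)
  have dA: "dd (y, 0) (\<lambda>x. symm (snd x) $ j $ i * SpT j G I x - 1 / 2 * X j (X i (\<lambda>I. SpT j G I x)) I) x =
      symm (snd x) $ j $ i * dd (y, 0) (SpT j G I) x - 1 / 2 * X j (X i (\<lambda>I. dd (y, 0) (SpT j G I) x)) I" for j
    by (simp only: dd_diff[OF holo_mult[OF sy(1) hS] holo_cmult[OF h3] x] dd_times[OF sy(1) hS x] sy(2)
        dd_cmult[OF h3 x] d3 mult_zero_left add_0_left)
  have hX: "holo (\<lambda>x. X i (\<lambda>I. G I x) I) (UNIV \<times> W)" by (rule X_dd(1)[OF G x])
  show ?thesis
    unfolding SqT_def[abs_def]
    by (simp only: dd_diff[OF holo_sum[OF hA] holo_cmult[OF hX] x] dd_sum_fun[OF hA x] dA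
        dd_cmult[OF hX x] X_dd(2)[OF G x] SpT_dd(2)[OF G x])
qed

lemma SqT_cmult:
  assumes "\<And>I. holo (G I) (UNIV \<times> W)" "x \<in> UNIV \<times> W"
  shows "SqT i (\<lambda>I x. a * G I x) I x = a * SqT i G I x"
proof -
  have X: "X i (\<lambda>I. a * f I) = (\<lambda>I. a * X i f I)" for i :: 'n and f
    by (rule ext) (rule X_cmult)
  show ?thesis
    unfolding SqT_def SpT_cmult[OF assms] X
    by (simp add: sum_distrib_left right_diff_distrib mult_ac del: symm_nth)
qed

text \<open>If \<open>O\<close> acts on a holomorphic family as \<open>\<kappa>\<close> times the derivative in the parameter, then
  \<open>e\<^bsup>cO\<^esup>\<close> acts as translation by \<open>c\<kappa>\<close>, by Taylor's theorem.\<close>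

lemma exp_flow:
  assumes G: "\<And>I. holo (G I) (UNIV \<times> W)"
    and slice: "\<And>G I y v. Op (\<lambda>I v. G I (y, v)) I v = OT G I (y, v)"
    and cong: "\<And>\<Phi> \<Psi>. eqW W \<Phi> \<Psi> \<Longrightarrow> eqW W (Op \<Phi>) (Op \<Psi>)"
    and OTdd: "\<And>G I x. (\<And>I. holo (G I) (UNIV \<times> W)) \<Longrightarrow> x \<in> UNIV \<times> W \<Longrightarrow> dd (ay i) (OT G I) x = OT (\<lambda>I. dd (ay i) (G I)) I x"
    and OTc: "\<And>G I x a. (\<And>I. holo (G I) (UNIV \<times> W)) \<Longrightarrow> x \<in> UNIV \<times> W \<Longrightarrow> OT (\<lambda>I x. a * G I x) I x = a * OT G I x"
    and flow: "\<And>I x. x \<in> UNIV \<times> W \<Longrightarrow> OT G I x = \<kappa> * dd (ay i) (G I) x"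
    and v: "v \<in> W"
  shows "(\<lambda>k. c ^ k * (Op ^^ k) (\<lambda>I v. G I (y, v)) I v / fact k) sums G I ((y, v) + (c * \<kappa>) *\<^sub>C ay i)"
proof -
  note S = open_S[OF W]
  have hG: "holo ((dd (ay i) ^^ k) (G I)) (UNIV \<times> W)" for k I by (rule holo_dd_funpow[OF S G])
  have OTk: "OT (\<lambda>I. (dd (ay i) ^^ k) (G I)) I x = \<kappa> * dd (ay i) ((dd (ay i) ^^ k) (G I)) x" if "x \<in> UNIV \<times> W" for k I x
    using that
  proof (induction k arbitrary: x I)
    case (Suc k)
    have "OT (\<lambda>I. (dd (ay i) ^^ Suc k) (G I)) I x = dd (ay i) (OT (\<lambda>I. (dd (ay i) ^^ k) (G I)) I) x"
      using OTdd[of "\<lambda>I. (dd (ay i) ^^ k) (G I)", OF hG Suc.prems] by simp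
    also have "\<dots> = dd (ay i) (\<lambda>x. \<kappa> * dd (ay i) ((dd (ay i) ^^ k) (G I)) x) x"
      by (rule dd_cong_open[OF S Suc.prems Suc.IH])
    also have "\<dots> = \<kappa> * dd (ay i) (dd (ay i) ((dd (ay i) ^^ k) (G I))) x"
      by (rule dd_cmult[OF holo_dd[OF S hG] Suc.prems])
    finally show ?case by simp
  qed (simp add: flow)
  have it: "eqW W ((Op ^^ k) (\<lambda>I v. G I (y, v))) (\<lambda>I v. (\<lambda>I x. \<kappa> ^ k * (dd (ay i) ^^ k) (G I) x) I (y, v))" for k
  proof (induction k)
    case (Suc k)
    have "eqW W (Op (\<lambda>I v. (\<lambda>I x. \<kappa> ^ k * (dd (ay i) ^^ k) (G I) x) I (y, v)))
      (\<lambda>I v. (\<lambda>I x. \<kappa> ^ Suc k * (dd (ay i) ^^ Suc k) (G I) x) I (y, v))"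
      unfolding eqW_def[OF W]
    proof (intro ballI allI)
      fix v I assume "v \<in> W"
      then have x: "(y, v) \<in> UNIV \<times> W" by simp
      have "Op (\<lambda>I v. (\<lambda>I x. \<kappa> ^ k * (dd (ay i) ^^ k) (G I) x) I (y, v)) I v =
          OT (\<lambda>I x. \<kappa> ^ k * (dd (ay i) ^^ k) (G I) x) I (y, v)"
        by (rule slice)
      also have "\<dots> = \<kappa> ^ Suc k * (dd (ay i) ^^ Suc k) (G I) (y, v)"
        unfolding OTc[of "\<lambda>I. (dd (ay i) ^^ k) (G I)", OF hG x] OTk[OF x] by simp
      finally show "Op (\<lambda>I v. (\<lambda>I x. \<kappa> ^ k * (dd (ay i) ^^ k) (G I) x) I (y, v)) I v =
          (\<lambda>I x. \<kappa> ^ Suc k * (dd (ay i) ^^ Suc k) (G I) x) I (y, v)" .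
    qed
    with cong[OF Suc.IH] show ?case unfolding funpow.simps comp_apply by (rule eqW_trans[OF W])
  qed (simp add: eqW_refl[OF W])
  have "(\<lambda>k. (dd (ay i) ^^ k) (G I) (y, v) / fact k * (c * \<kappa>) ^ k) sums G I ((y, v) + (c * \<kappa>) *\<^sub>C ay i)"
    by (rule holo_taylor[OF S G cyl_line[OF cyl_S[OF W]]]) (use v in auto)
  moreover have "(dd (ay i) ^^ k) (G I) (y, v) / fact k * (c * \<kappa>) ^ k = c ^ k * (Op ^^ k) (\<lambda>I v. G I (y, v)) I v / fact k" for k
    using eqWD[OF W it v, of k I] by (simp add: power_mult_distrib mult_ac)
  ultimately show ?thesis by simp
qed

end

lemma open_Hs: "open Hs" by (rule open_ext_siegel)

text \<open>The theta family at zero first characteristic, with u as the flow parameter;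
  \<open>Gq\<close> is its counterpart at u = 0.\<close>

definition Gp :: "complex \<Rightarrow> 'n::{finite,linorder} set \<Rightarrow> 'n zv \<Rightarrow> complex" where
  "Gp c I x = TH c I (0, x)"

definition Gq :: "complex \<Rightarrow> 'n::{finite,linorder} set \<Rightarrow> 'n zv \<Rightarrow> complex" where
  "Gq c I x = TH c I (fst x, 0, snd x)"

lemma Gp_props: "holo (Gp c I) (UNIV \<times> Hs)" "dd w (Gp c I) x = dd (0, w) (TH c I) (0, x)"
proof -
  have bl: "bounded_linear (\<lambda>x::'a zv. (0, x) :: 'a tz)"
    by (intro bounded_linear_Pair bounded_linear_zero bounded_linear_ident)
  have cs: "(0, a *\<^sub>C x) = a *\<^sub>C (0, x)" for a and x :: "'a zv" by (simp add: cscale_Pair)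
  have e: "Gp c I = (\<lambda>x. TH c I (0 + (0, x)))" by (rule ext) (simp add: Gp_def)
  show "holo (Gp c I) (UNIV \<times> Hs)" unfolding e by (rule holo_affine[OF holo_TH bl cs]) auto
  show "dd w (Gp c I) x = dd (0, w) (TH c I) (0, x)" unfolding e by (subst dd_affine[OF bl cs]) simp
qed

lemma Gq_props: "holo (Gq c I) (UNIV \<times> Hs)"
  "dd w (Gq c I) x = dd (fst w, 0, snd w) (TH c I) (fst x, 0, snd x)"
proof -
  have bl: "bounded_linear (\<lambda>x::'a zv. (fst x, 0, snd x) :: 'a tz)"
    by (intro bounded_linear_Pair bounded_linear_zero bounded_linear_fst bounded_linear_snd)
  have cs: "(fst (a *\<^sub>C x), 0, snd (a *\<^sub>C x)) = a *\<^sub>C (fst x, 0, snd x)" for a and x :: "'a zv"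
    by (simp add: cscale_Pair)
  have e: "Gq c I = (\<lambda>x. TH c I (0 + (fst x, 0, snd x)))" by (rule ext) (simp add: Gq_def)
  show "holo (Gq c I) (UNIV \<times> Hs)" unfolding e by (rule holo_affine[OF holo_TH bl cs]) auto
  show "dd w (Gq c I) x = dd (fst w, 0, snd w) (TH c I) (fst x, 0, snd x)"
    unfolding e by (subst dd_affine[OF bl cs]) simp
qed

text \<open>\<open>D\<^sub>i\<close> acts on the theta family as \<open>\<partial>/\<partial>u\<^sub>i\<close>, up to the factor \<open>1/c\<close>; only the body and the
  linear part of the family are nonzero, and the quadratic part of the result vanishes because
  \<open>\<partial>\<^sub>i\<^sub>l\<partial>\<^sub>u\<^sub>j\<theta>\<close> is symmetric in \<open>l\<close> and \<open>j\<close>.\<close>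

lemma TH_Sp:
  fixes p :: "'n::{finite,linorder} tz"
  assumes p: "p \<in> Ts" and c: "c\<^sup>2 = - (4 * of_real pi * \<i>)"
  shows "del i (\<lambda>I. TH c I p) I - (\<Sum>l\<in>UNIV. X l (\<lambda>I. dd (dv i l) (TH c I) p) I) = 1 / c * dd (du i) (TH c I) p"
proof -
  have "(\<Sum>l\<in>UNIV. X l (\<lambda>I. dd (dv i l) (TH c I) p) I) = (\<Sum>l\<in>UNIV. dd (dv i l) th p * X l one I)"
    unfolding dd_TH[OF p] by (rule sum_X_comb) (simp add: th_dv_du_symmetric[OF p c, of i])
  moreover have "del i (\<lambda>I. TH c I p) I = dd (du i) th p / c * one I"
    unfolding TH_def by (rule del_comb)
  ultimately show ?thesis
    unfolding dd_TH[OF p] th_heat[OF p c] comb_def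
    by (simp add: sum_distrib_left sum_negf power2_eq_square ring_distribs mult_ac)
qed

lemma Gp_flow:
  assumes "x \<in> UNIV \<times> Hs" and c: "c\<^sup>2 = - (4 * of_real pi * \<i>)"
  shows "SpT i (Gp c) I x = 1 / c * dd (ay i) (Gp c I) x"
proof -
  have p: "(0, x) \<in> Ts" using assms(1) by auto
  show ?thesis unfolding SpT_def Gp_props(2) Gp_def by (rule TH_Sp[OF p c])
qed

text \<open>The odd derivatives act as u-derivatives, and their combination with a column of v is,
  by \<open>th_shift_eq\<close>, minus a derivative in the first characteristic. It remains to match
  the terms of first and second degree.\<close>

lemma Gq_flow:
  fixes x :: "'n::{finite,linorder} zv"
  assumes x: "x \<in> UNIV \<times> Hs" and c: "c\<^sup>2 = - (4 * of_real pi * \<i>)"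
  shows "SqT i (Gq c) I x = - (1 / c) * dd (ay i) (Gq c I) x"
proof -
  define p :: "'n tz" where "p = (fst x, 0, snd x)"
  have p: "p \<in> Ts" using x by (auto simp: p_def)
  have c0: "c \<noteq> 0" using c by auto
  define w where "w = (\<lambda>i j. symm (snd x) $ i $ j)"
  have wp: "symm (snd (snd p)) $ a $ b = w a b" for a b by (simp add: p_def w_def)
  have wsym: "w a b = w b a" for a b by (simp add: w_def add.commute)
  define A where "A = (\<lambda>j. dd (du j) th p)"
  define B where "B = (\<lambda>j l. dd (du j) (dd (du l) th) p)"
  have Bsym: "B j l = B l j" for j l unfolding B_def by (rule dd_commute[OF open_Ts holo_th p])
  have Sp: "SpT j (Gq c) I x = 1 / c * comb (A j) (\<lambda>l. B j l / c) I" for j I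
    using TH_Sp[OF p c, of j I] unfolding SpT_def Gq_props(2) Gq_def
    by (simp add: p_def[symmetric] dd_TH[OF p] A_def B_def)
  have G: "Gq c I x = comb (th p) (\<lambda>j. A j / c) I" for I
    by (simp add: Gq_def TH_def p_def[symmetric] A_def)
  have ds_th: "dd (ds i) th p = - (\<Sum>j\<in>UNIV. w i j * A j)"
    unfolding th_shift_eq[OF p] wp A_def by (simp add: p_def)
  \<comment> \<open>The factor u_i in \<open>th_shift_eq\<close> vanishes at u = 0 but must be
    differentiated first; this leaves the extra multiple of theta.\<close>
  have ds_thu: "dd (ds i) (dd (du l) th) p = - (\<Sum>j\<in>UNIV. w i j * B j l) - (if l = i then 2 * of_real pi * \<i> * th p else 0)" for l
  proof -
    have hw: "holo (\<lambda>p::'n tz. symm (snd (snd p)) $ i $ j) Ts" for j by (rule symm_nth_props)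
    have hs: "holo (\<lambda>p::'n tz. fst (snd p) $ i) Ts" by (rule snd_nth_props)
    have h1: "holo (\<lambda>p. symm (snd (snd p)) $ i $ j * dd (du j) th p) Ts" for j
      by (intro holo_mult hw holo_thu)
    have h2: "holo (\<lambda>p::'n tz. fst (snd p) $ i * th p) Ts" by (intro holo_mult hs holo_th)
    have "dd (ds i) (dd (du l) th) p = dd (du l) (dd (ds i) th) p"
      by (rule dd_commute[OF open_Ts holo_th p])
    also have "\<dots> = dd (du l) (\<lambda>p. (- 1) * (\<Sum>j\<in>UNIV. symm (snd (snd p)) $ i $ j * dd (du j) th p) -
        (2 * of_real pi * \<i>) * (fst (snd p) $ i * th p)) p"
      by (rule dd_cong_open[OF open_Ts p]) (simp add: th_shift_eq mult.assoc del: symm_nth)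
    also have "\<dots> = (- 1) * (\<Sum>j\<in>UNIV. dd (du l) (\<lambda>p. symm (snd (snd p)) $ i $ j * dd (du j) th p) p) -
        (2 * of_real pi * \<i>) * dd (du l) (\<lambda>p. fst (snd p) $ i * th p) p"
      by (simp only: dd_diff[OF holo_cmult[OF holo_sum[OF h1]] holo_cmult[OF h2] p]
          dd_cmult[OF holo_sum[OF h1] p] dd_cmult[OF h2 p] dd_sum_fun[OF h1 p])
    also have "(\<lambda>j. dd (du l) (\<lambda>p. symm (snd (snd p)) $ i $ j * dd (du j) th p) p) = (\<lambda>j. w i j * B j l)"
    proof
      fix j
      have "dd (du l) (\<lambda>p. symm (snd (snd p)) $ i $ j * dd (du j) th p) p = w i j * B l j"
        unfolding dd_times[OF hw holo_thu p] symm_nth_props(2) wp B_def by simp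
      then show "dd (du l) (\<lambda>p. symm (snd (snd p)) $ i $ j * dd (du j) th p) p = w i j * B j l"
        by (simp only: Bsym[of l j])
    qed
    also have "dd (du l) (\<lambda>p. fst (snd p) $ i * th p) p = (if l = i then th p else 0)"
      unfolding dd_times[OF hs holo_th p] snd_nth_props(2) by (auto simp: p_def axis_def)
    finally show ?thesis by simp
  qed
  \<comment> \<open>The second u-derivatives are symmetric and drop out; what remains cancels
    against the quadratic part of \<open>X2\<close>.\<close>
  have X1: "(\<Sum>j\<in>UNIV. X j (X i (\<lambda>I. SpT j (Gq c) I x)) I) = - (1 / c) * (\<Sum>j\<in>UNIV. A j * X i (X j one) I)"
  proof -
    have Xc: "X i (\<lambda>I. k * f I) = (\<lambda>I. k * X i f I)" for i :: 'n and k f by (rule ext) (rule X_cmult)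
    have "X j (X i (\<lambda>I. SpT j (Gq c) I x)) I = - (1 / c) * X i (X j (comb (A j) (\<lambda>l. B j l / c))) I" for j
      by (simp only: Sp Xc X_anticommute[of j i] mult_minus_left mult_minus_right)
    then have "(\<Sum>j\<in>UNIV. X j (X i (\<lambda>I. SpT j (Gq c) I x)) I) =
        - (1 / c) * X i (\<lambda>I. \<Sum>j\<in>UNIV. X j (comb (A j) (\<lambda>l. B j l / c)) I) I"
      by (simp only: sum_distrib_left X_sum)
    also have "(\<lambda>I. \<Sum>j\<in>UNIV. X j (comb (A j) (\<lambda>l. B j l / c)) I) = (\<lambda>I. \<Sum>j\<in>UNIV. A j * X j one I)"
      by (rule ext) (rule sum_X_comb, simp add: Bsym)
    finally show ?thesis by (simp add: X_sum X_cmult)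
  qed
  have X2: "X i (\<lambda>I. Gq c I x) I = th p * X i one I + 1 / c * (\<Sum>j\<in>UNIV. A j * X i (X j one) I)"
    unfolding G X_comb by (simp add: sum_distrib_left)
  have "SqT i (Gq c) I x = (\<Sum>j\<in>UNIV. w j i * SpT j (Gq c) I x) - 1 / 2 * th p * X i one I"
    unfolding SqT_def sum_subtractf sum_distrib_left[symmetric] X1 X2 w_def by (simp add: algebra_simps del: symm_nth)
  also have "(\<Sum>j\<in>UNIV. w j i * SpT j (Gq c) I x) = 1 / c * ((\<Sum>j\<in>UNIV. w i j * A j) * one I +
      (\<Sum>l\<in>UNIV. (1 / c * (\<Sum>j\<in>UNIV. w i j * B j l)) * X l one I))"
  proof -
    have "(\<Sum>j\<in>UNIV. w i j * (\<Sum>l\<in>UNIV. B j l / c * X l one I)) =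
        (\<Sum>l\<in>UNIV. (1 / c * (\<Sum>j\<in>UNIV. w i j * B j l)) * X l one I)"
      unfolding sum_distrib_left sum_distrib_right by (subst sum.swap) (simp add: mult_ac)
    note swap = this
    have "(\<Sum>j\<in>UNIV. w j i * SpT j (Gq c) I x) =
        (\<Sum>j\<in>UNIV. 1 / c * (w i j * A j * one I + w i j * (\<Sum>l\<in>UNIV. B j l / c * X l one I)))"
    proof (intro sum.cong refl)
      fix j
      have "a * (k * (b * d + e)) = k * (a * b * d + a * e)" for a b d e k :: complex
        by (simp add: algebra_simps)
      then show "w j i * SpT j (Gq c) I x = 1 / c * (w i j * A j * one I + w i j * (\<Sum>l\<in>UNIV. B j l / c * X l one I))"
        unfolding Sp comb_def wsym[of j i] by blast
    qed
    also have "\<dots> = 1 / c * ((\<Sum>j\<in>UNIV. w i j * A j) * one I + (\<Sum>j\<in>UNIV. w i j * (\<Sum>l\<in>UNIV. B j l / c * X l one I)))"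
      unfolding sum_distrib_left[symmetric] sum.distrib sum_distrib_right[symmetric] ..
    finally show ?thesis unfolding swap .
  qed
  \<comment> \<open>Since 2 pi i / c^2 is -1/2, the term -1/2 \<xi>_i of q_i supplies exactly the
    multiple of theta in \<open>ds_thu\<close>.\<close>
  also have "1 / 2 * th p * X i one I = - (1 / c) * (\<Sum>l\<in>UNIV. (if l = i then 2 * of_real pi * \<i> * th p else 0) / c * X l one I)"
  proof -
    have "(\<Sum>l\<in>UNIV. (if l = i then 2 * of_real pi * \<i> * th p else 0) / c * X l one I) =
        (\<Sum>l\<in>UNIV. if l = i then 2 * of_real pi * \<i> * th p / c * X l one I else 0)"
      by (intro sum.cong refl) auto
    also have "\<dots> = 2 * of_real pi * \<i> * th p / c * X i one I" by simp
    finally have "- (1 / c) * (\<Sum>l\<in>UNIV. (if l = i then 2 * of_real pi * \<i> * th p else 0) / c * X l one I) =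
        - (2 * of_real pi * \<i> / c\<^sup>2) * (th p * X i one I)"
      by (simp add: power2_eq_square)
    also have "2 * of_real pi * \<i> / c\<^sup>2 = - (1 / 2)" unfolding c by (simp add: field_simps)
    finally show ?thesis by simp
  qed
  finally have "SqT i (Gq c) I x = 1 / c * ((\<Sum>j\<in>UNIV. w i j * A j) * one I +
      (\<Sum>l\<in>UNIV. (1 / c * (\<Sum>j\<in>UNIV. w i j * B j l)) * X l one I) +
      (\<Sum>l\<in>UNIV. (if l = i then 2 * of_real pi * \<i> * th p else 0) / c * X l one I))"
    by (simp only: ring_distribs mult_minus_left diff_minus_eq_add)
  also have "\<dots> = - (1 / c) * comb (dd (ds i) th p) (\<lambda>l. dd (ds i) (dd (du l) th) p / c) I"
  proof -
    have "(\<Sum>l\<in>UNIV. (1 / c * (\<Sum>j\<in>UNIV. w i j * B j l)) * X l one I) +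
      (\<Sum>l\<in>UNIV. (if l = i then 2 * of_real pi * \<i> * th p else 0) / c * X l one I) =
      - (\<Sum>l\<in>UNIV. dd (ds i) (dd (du l) th) p / c * X l one I)"
    proof -
      have "1 / c * P * Z + Q / c * Z = - ((- P - Q) / c * Z)" for P Q Z
        by (simp add: ring_distribs diff_divide_distrib add_divide_distrib)
      then have "1 / c * (\<Sum>j\<in>UNIV. w i j * B j l) * X l one I + (if l = i then 2 * of_real pi * \<i> * th p else 0) / c * X l one I =
          - (dd (ds i) (dd (du l) th) p / c * X l one I)" for l
        unfolding ds_thu by blast
      then show ?thesis by (simp only: sum.distrib[symmetric] sum_negf[symmetric])
    qed
    then show ?thesis
      unfolding comb_def ds_th add.assoc by (simp only: mult_minus_left minus_add_distrib[symmetric] mult_minus_right[symmetric]) (simp add: ring_distribs)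
  qed
  also have "\<dots> = - (1 / c) * dd (ay i) (Gq c I) x"
    unfolding Gq_props(2) p_def[symmetric] by (simp add: dd_TH[OF p])
  finally show ?thesis .
qed

lemma TH_periodic_u: "TH c I (0, u + ax i, v) = TH c I (0, u, v)"
proof -
  have "dd (du j) th (0, u + ax i, v) = dd (du j) th (0, u, v)" for j
  proof -
    have "th (0, u + ax i + z *\<^sub>C ax j, v) = th (0, u + z *\<^sub>C ax j, v)" for z
      using th_periodic_u[of "u + z *\<^sub>C ax j" i v] by (simp add: add_ac)
    then show ?thesis by (simp add: dd_def cscale_Pair)
  qed
  then show ?thesis by (simp add: TH_def th_periodic_u)
qed

lemma TH_periodic_s: "TH c I (s + ax i, u, v) = TH c I (s, u, v)"
proof -
  have "dd (du j) th (s + ax i, u, v) = dd (du j) th (s, u, v)" for j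
    by (simp add: dd_def cscale_Pair th_periodic_s)
  then show ?thesis by (simp add: TH_def th_periodic_s)
qed

lemma TH_zero:
  assumes "v \<in> Hs" shows "TH c I (0, 0, v) = hat (super_of riemann_theta) I v"
  by (simp add: TH_def comb_def dd_th_u_zero[OF assms] th_riemann hat_def super_of_def one_def)

lemma funpow_eqW:
  assumes "open W" "\<And>\<Phi> \<Psi>. eqW W \<Phi> \<Psi> \<Longrightarrow> eqW W (T \<Phi>) (T \<Psi>)" "eqW W \<Phi> \<Psi>"
  shows "eqW W ((T ^^ k) \<Phi>) ((T ^^ k) \<Psi>)"
  using assms(3) by (induction k) (auto intro: assms(2))

text \<open>Both flows start at theta. They translate u_i by 1 and the first characteristic by -1,
  which are periods. Commutativity of the odd derivatives is that of the u-derivatives.\<close>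

lemma sol_riemann_theta:
  assumes c: "c\<^sup>2 = - (4 * of_real pi * \<i>)"
  shows "shol Hs (hat (super_of riemann_theta) :: 'n::{finite,linorder} superfun)"
    and "sol Hs c (hat (super_of riemann_theta) :: 'n::{finite,linorder} superfun)"
proof -
  let ?\<theta> = "hat (super_of riemann_theta) :: 'n superfun"
  note W = open_Hs
  have c0: "c \<noteq> 0" using c by auto
  have ep: "eqW Hs ?\<theta> (\<lambda>I v. Gp c I (0, v))" and eq: "eqW Hs ?\<theta> (\<lambda>I v. Gq c I (0, v))"
    unfolding eqW_def[OF W] by (auto simp: Gp_def Gq_def TH_zero)
  have hs: "holo (\<lambda>v. Gp c I (y, v)) Hs" for I y
  proof -
    have "holo (\<lambda>v. Gp c I ((y, 0) + (0, v))) Hs"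
      by (rule holo_affine[OF Gp_props(1)])
        (auto simp: cscale_Pair intro!: bounded_linear_Pair bounded_linear_zero bounded_linear_ident)
    then show ?thesis by simp
  qed
  have "shol Hs (\<lambda>I v. Gp c I (0, v))"
    unfolding shol_def by (intro conjI allI hs) (simp add: Gp_def TH_symm)
  then show sh: "shol Hs ?\<theta>"
    unfolding shol_def
  proof (intro conjI allI)
    show "holo (?\<theta> I) Hs" for I
      by (rule holo_cong_open[OF W _ hs[of I 0]]) (rule eqWD[OF W eqW_sym[OF W ep]])
    show "?\<theta> I (symm v) = ?\<theta> I v" for I v by (simp add: hat_def)
  qed
  have cm: "comm Hs ?\<theta>"
    unfolding comm_def[OF W]
  proof (intro conjI allI)
    show "shol Hs ?\<theta>" by (rule sh)
    fix i j
    have two: "eqW Hs (Sp i (Sp j ?\<theta>)) (\<lambda>I v. 1 / c * (1 / c * dd (ay j) (dd (ay i) (Gp c I)) (0, v)))" for i j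
    proof -
      have "eqW Hs (Sp j ?\<theta>) (\<lambda>I v. (\<lambda>I x. 1 / c * dd (ay j) (Gp c I) x) I (0, v))"
        by (rule eqW_trans[OF W eqW_Sp[OF W ep]])
          (use Gp_flow[OF _ c] in \<open>auto simp: eqW_def[OF W] Sp_slice\<close>)
      then have "eqW Hs (Sp i (Sp j ?\<theta>)) (Sp i (\<lambda>I v. (\<lambda>I x. 1 / c * dd (ay j) (Gp c I) x) I (0, v)))"
        by (rule eqW_Sp[OF W])
      moreover have "eqW Hs (Sp i (\<lambda>I v. (\<lambda>I x. 1 / c * dd (ay j) (Gp c I) x) I (0, v)))
          (\<lambda>I v. 1 / c * (1 / c * dd (ay j) (dd (ay i) (Gp c I)) (0, v)))"
        unfolding eqW_def[OF W]
      proof (intro ballI allI)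
        fix v I assume "v \<in> (Hs :: 'n cmatrix set)"
        then have x: "(0, v) \<in> UNIV \<times> Hs" by simp
        note S = open_S[OF W]
        have "Sp i (\<lambda>I v. (\<lambda>I x. 1 / c * dd (ay j) (Gp c I) x) I (0, v)) I v =
            SpT i (\<lambda>I x. 1 / c * dd (ay j) (Gp c I) x) I (0, v)"
          by (rule Sp_slice)
        also have "\<dots> = 1 / c * SpT i (\<lambda>I. dd (ay j) (Gp c I)) I (0, v)"
          by (rule SpT_cmult[OF W holo_dd[OF S Gp_props(1)] x])
        also have "SpT i (\<lambda>I. dd (ay j) (Gp c I)) I (0, v) = dd (ay j) (SpT i (Gp c) I) (0, v)"
          by (rule SpT_dd(2)[OF W Gp_props(1) x, symmetric])
        also have "\<dots> = dd (ay j) (\<lambda>x. 1 / c * dd (ay i) (Gp c I) x) (0, v)"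
          by (rule dd_cong_open[OF S x Gp_flow[OF _ c]])
        also have "\<dots> = 1 / c * dd (ay j) (dd (ay i) (Gp c I)) (0, v)"
          by (rule dd_cmult[OF holo_dd[OF S Gp_props(1)] x])
        finally show "Sp i (\<lambda>I v. (\<lambda>I x. 1 / c * dd (ay j) (Gp c I) x) I (0, v)) I v = 1 / c * (1 / c * dd (ay j) (dd (ay i) (Gp c I)) (0, v))" .
      qed
      ultimately show ?thesis by (rule eqW_trans[OF W])
    qed
    show "eqW Hs (Sp i (Sp j ?\<theta>)) (Sp j (Sp i ?\<theta>))"
      unfolding eqW_def[OF W]
    proof (intro ballI allI)
      fix v I assume v: "v \<in> (Hs :: 'n cmatrix set)"
      have "dd (ay j) (dd (ay i) (Gp c I)) (0, v) = dd (ay i) (dd (ay j) (Gp c I)) (0, v)"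
        by (rule dd_commute[OF open_S[OF W] Gp_props(1)]) (use v in auto)
      then show "Sp i (Sp j ?\<theta>) I v = Sp j (Sp i ?\<theta>) I v"
        unfolding eqWD[OF W two v] by simp
    qed
  qed
  have p: "(\<lambda>k. c ^ k * (Sp i ^^ k) ?\<theta> I v / fact k) sums ?\<theta> I v" if v: "v \<in> Hs" for i I v
  proof -
    have "(\<lambda>k. c ^ k * (Sp i ^^ k) (\<lambda>I v. Gp c I (0, v)) I v / fact k) sums Gp c I ((0, v) + (c * (1 / c)) *\<^sub>C ay i)"
      by (rule exp_flow[OF W Gp_props(1) Sp_slice eqW_Sp[OF W] SpT_dd(2)[OF W] SpT_cmult[OF W] Gp_flow[OF _ c] v])
    moreover have "Gp c I ((0, v) + (c * (1 / c)) *\<^sub>C ay i) = ?\<theta> I v"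
      using TH_periodic_u[of c I 0 i v] c0 by (simp add: Gp_def TH_zero[OF v])
    moreover have "(Sp i ^^ k) (\<lambda>I v. Gp c I (0, v)) I v = (Sp i ^^ k) ?\<theta> I v" for k
      by (rule eqWD[OF W funpow_eqW[OF W eqW_Sp[OF W] eqW_sym[OF W ep]] v])
    ultimately show ?thesis by simp
  qed
  have q: "(\<lambda>k. c ^ k * (Sq i ^^ k) ?\<theta> I v / fact k) sums ?\<theta> I v" if v: "v \<in> Hs" for i I v
  proof -
    have "(\<lambda>k. c ^ k * (Sq i ^^ k) (\<lambda>I v. Gq c I (0, v)) I v / fact k) sums Gq c I ((0, v) + (c * (- (1 / c))) *\<^sub>C ay i)"
      by (rule exp_flow[OF W Gq_props(1) Sq_slice eqW_Sq[OF W] SqT_dd[OF W] SqT_cmult[OF W] Gq_flow[OF _ c] v])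
    moreover have "Gq c I ((0, v) + (c * (- (1 / c))) *\<^sub>C ay i) = ?\<theta> I v"
    proof -
      have "(c * (- (1 / c))) *\<^sub>C ay i = (- ax i, 0)" using c0 by (simp add: cscale_Pair vec_eq_iff)
      then show ?thesis
        using TH_periodic_s[of c I "- ax i" i 0 v] by (simp add: Gq_def TH_zero[OF v])
    qed
    moreover have "(Sq i ^^ k) (\<lambda>I v. Gq c I (0, v)) I v = (Sq i ^^ k) ?\<theta> I v" for k
      by (rule eqWD[OF W funpow_eqW[OF W eqW_Sq[OF W] eqW_sym[OF W eq]] v])
    ultimately show ?thesis by simp
  qed
  show "sol Hs c ?\<theta>" unfolding sol_def using cm p q by blast
qed

text \<open>At i times the unit matrix all terms are positive reals, and the one at m = 0 is
  1.\<close>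

lemma riemann_theta_nonzero:
  obtains v :: "'n::finite cmatrix" where "v \<in> siegel_space" "riemann_theta v \<noteq> 0"
proof
  define v :: "'n cmatrix" where "v = (\<chi> i j. if i = j then \<i> else 0)"
  have vt: "transpose v = v" by (auto simp: v_def transpose_def vec_eq_iff)
  have "qform v x = (\<Sum>i\<in>UNIV. (x $ i)\<^sup>2)" for x
  proof -
    have "(\<Sum>j\<in>UNIV. x $ i * Im (v $ i $ j) * x $ j) = (\<Sum>j\<in>UNIV. if j = i then x $ i * x $ j else 0)" for i
      by (intro sum.cong refl) (auto simp: v_def)
    then show ?thesis by (simp add: qform_def power2_eq_square)
  qed
  moreover have "(\<Sum>i\<in>UNIV. (x $ i)\<^sup>2) > 0" if "x \<noteq> 0" for x :: "(real, 'n) vec"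
  proof -
    have "0 < x \<bullet> x" using that by simp
    then show ?thesis by (simp add: inner_vec_def power2_eq_square)
  qed
  ultimately show vs: "v \<in> siegel_space" using vt by (simp add: siegel_space_iff)
  have sv: "symm v = v" by (rule symm_sym[OF vt])
  have tE: "tE m (0, 0, v) = of_real (exp (- pi * (\<Sum>i\<in>UNIV. (real_of_int (m $ i))\<^sup>2)))" for m
  proof -
    have "(\<Sum>i\<in>UNIV. \<Sum>j\<in>UNIV. xv m i (0, 0, v) * (symm v $ i $ j * xv m j (0, 0, v))) =
        (\<Sum>i\<in>UNIV. \<Sum>j\<in>UNIV. if j = i then of_int (m $ i) * (\<i> * of_int (m $ j)) else 0)"
      unfolding sv by (intro sum.cong refl) (auto simp: v_def xv_def)
    also have "\<dots> = \<i> * of_real (\<Sum>i\<in>UNIV. (real_of_int (m $ i))\<^sup>2)"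
      by (simp add: sum_distrib_left power2_eq_square mult.left_commute)
    finally have "tq m (0, 0, v) = of_real (- pi * (\<Sum>i\<in>UNIV. (real_of_int (m $ i))\<^sup>2))"
      unfolding tq_def fst_conv snd_conv by (simp del: symm_nth add: algebra_simps)
    then show ?thesis unfolding tE_def by (simp only: exp_of_real)
  qed
  have "(0, 0, v) \<in> Ts" using vs by (simp add: ext_def sv)
  note s = tE_summable[OF this]
  have Re: "Re (th (0, 0, v)) = (\<Sum>\<^sub>\<infinity>m. Re (tE m (0, 0, v)))"
    unfolding th_def by (rule infsum_Re[OF s, symmetric])
  have "(\<Sum>m\<in>{0}. Re (tE m (0, 0, v))) \<le> (\<Sum>\<^sub>\<infinity>m. Re (tE m (0, 0, v)))"
    by (rule finite_sum_le_infsum[OF summable_on_Re[OF s]]) (auto simp: tE)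
  moreover have "(\<Sum>m\<in>{0::(int, 'n) vec}. Re (tE m (0, 0, v))) = 1" by (simp add: tE)
  ultimately have "Re (th (0, 0, v)) \<ge> 1" unfolding Re by simp
  then show "riemann_theta v \<noteq> 0" using th_riemann[of v] sv by auto
qed

theorem theorem4p4p5:
  fixes c :: complex
  assumes "c\<^sup>2 = - (4 * of_real pi * \<i>)"
  shows
    "(super_holomorphic_on (super_of riemann_theta :: 'n::{finite,linorder} superfun) siegel_space \<and>
      theta_system c siegel_space (super_of riemann_theta :: 'n superfun)) \<and>
     (\<forall>(U :: 'n cmatrix set) (\<Phi> :: 'n superfun).
        openin (top_of_set siegel_space) U \<and> U \<noteq> {} \<and> connected U \<and>
        super_holomorphic_on \<Phi> U \<and> theta_system c U \<Phi> \<longrightarrow>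
        (\<exists>a. \<forall>v\<in>U. \<forall>I. \<Phi> I v = a * super_of riemann_theta I v))"
proof (intro conjI allI impI)
  let ?\<theta> = "super_of riemann_theta :: 'n superfun"
  note th = sol_riemann_theta[OF assms, where 'n = 'n]
  show "super_holomorphic_on ?\<theta> siegel_space"
    using super_holomorphic_iff_shol[OF open_Hs refl siegel_symm] th(1) by blast
  show "theta_system c siegel_space ?\<theta>"
    using theta_system_iff_sol[OF open_Hs refl siegel_symm th(1)] th(2) by blast
  obtain "is" :: "'n list" where "is": "set is = UNIV" "distinct is"
    using finite_distinct_list[OF finite_class.finite_UNIV] by blast
  fix U :: "'n cmatrix set" and \<Phi> :: "'n superfun"
  assume "openin (top_of_set siegel_space) U \<and> U \<noteq> {} \<and> connected U \<and>
    super_holomorphic_on \<Phi> U \<and> theta_system c U \<Phi>"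
  then have U: "openin (top_of_set siegel_space) U" "U \<noteq> {}" "connected U"
    and \<Phi>: "super_holomorphic_on \<Phi> U" "theta_system c U \<Phi>" by auto
  have Us: "U \<subseteq> siegel_space" using U(1) by (rule openin_imp_subset)
  note W = open_ext[OF U(1)]
  have sym: "symm v = v" if "v \<in> U" for v using that Us siegel_symm by blast
  have sh: "shol (ext U) (hat \<Phi>)" using super_holomorphic_iff_shol[OF W refl sym] \<Phi>(1) by blast
  have s\<Phi>: "sol (ext U) c (hat \<Phi>)" using theta_system_iff_sol[OF W refl sym sh] \<Phi>(2) by blast
  have s\<theta>: "sol (ext U) c (hat ?\<theta>)"
    by (rule sol_subset[OF open_Hs W _ th(2)]) (use Us in \<open>auto simp: ext_def\<close>)
  obtain v0 where v0: "v0 \<in> U" using U(2) by blast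
  \<comment> \<open>Theta solves the system on the whole connected Siegel space, so a zero
    coefficient at this one point would make it vanish everywhere, also outside
    \<open>U\<close>.\<close>
  have nz: "C0 c is (hat ?\<theta>) v0 \<noteq> 0"
  proof
    assume 0: "C0 c is (hat ?\<theta>) v0 = 0"
    obtain v :: "'n cmatrix" where v: "v \<in> siegel_space" "riemann_theta v \<noteq> 0"
      by (rule riemann_theta_nonzero)
    have "hat ?\<theta> {} v = 0"
      by (rule sol_zero[OF open_Hs assms th(2) connected_siegel _ _ _ "is"(2,1) 0])
        (use v v0 Us in \<open>auto simp: ext_def siegel_symm\<close>)
    then show False using v siegel_symm[OF v(1)] by (simp add: hat_def super_of_def)
  qed
  have UW: "U \<subseteq> ext U" using sym by (auto simp: ext_def)
  obtain a where a: "\<And>I v. v \<in> ext U \<Longrightarrow> hat \<Phi> I v = a * hat ?\<theta> I v"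
    by (rule sol_proportional[OF W assms s\<Phi> s\<theta> U(3) UW v0 _ "is"(2,1) nz]) (auto simp: ext_def)
  have "\<Phi> I v = a * ?\<theta> I v" if v: "v \<in> U" for I v
    using a[of v I] UW v sym[OF v] by (auto simp: hat_def)
  then show "\<exists>a. \<forall>v\<in>U. \<forall>I. \<Phi> I v = a * ?\<theta> I v" by blast
qed

end
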